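(* Let $R$ be a unital ring, $N=\{1<2<\dots<n\}$ and $L=R[x_1^{\pm1},\dots,x_n^{\pm1}]$. Let $h_1,\dots,h_n\colon D\to D$ be mutually commuting cochain self-maps of an $R$-module cochain complex $D$. Let $C$ be a cochain complex of $R$-modules, let $\alpha\colon C\to D$ and $\beta\colon D\to C$ be cochain maps, and let $G\colon\mathrm{id}_D\simeq\alpha\circ\beta$ be a homotopy, so that $dG+Gd=\alpha\beta-\mathrm{id}_D$. Put $$Y=\mathcal T\,\mathfrak{Der}(D;\alpha\beta,\mathrm{id}_D,G;h_1,\dots,h_n),\qquad Z=\mathcal T\,\mathfrak{Der}(C;\alpha,\beta,G;h_1,\dots,h_n).$$ Then the (constant) diagonal matrix $J$, indexed by the subsets of $N$, with all diagonal entries equal to $\beta\otimes1\colon D\otimes_RL\to C\otimes_RL$, defines a cochain map $J\colon Y\to Z$. If $\beta$ is a quasi-isomorphism, so is $J$. If in addition $C$ and $D$ are bounded above complexes of projective $R$-modules, then $J$ is a homotopy equivalence of $L$-module complexes $Y\simeq Z$.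
   Context: Subsets $A,B,S\subseteq N$ have cardinalities $a,b,s$. Complexes are cochain complexes. Total incidence numbers: for $B=\{b_1<\dots<b_b\}\subseteq N$ write $d_i(B)=B\setminus\{b_i\}$. For $A\subset B$ write uniquely $A=d_{i_1}d_{i_2}\cdots d_{i_{b-a}}(B)$ with $i_1<\dots<i_{b-a}$; set $[B:A]=(-1)^{b-a}(-1)^{i_1+\dots+i_{b-a}}$, and $[A:A]=1$. A special $N$-cube is given by a cochain complex $C$ with differential $d$, cochain maps $f_k\colon C\to C$ ($k\in N$) and graded maps $H_S\colon C\to C$ of degree $1-s$ ($S\subseteq N$, $s\ge2$) such that the following totalisation is a cochain complex: $\mathrm{Tot}^\ell=\bigoplus_{A\subseteq N}C^{\ell-a}$ with differential the matrix $(D_{B,A})_{A,B\subseteq N}$, $D_{B,A}=(-1)^{ab}[B:A]\cdot H_{B,A}$ for $A\subseteq B$ and $D_{B,A}=0$ otherwise, where $H_{A,A}=d$, $H_{B,A}=f_k$ if $B\setminus A=\{k\}$, and $H_{B,A}=H_{B\setminus A}$ if $b-a\ge2$. Derived cube: given cochain complexes $C,D$, pairwise commuting cochain maps $h_k\colon D\to D$ ($k\in N$), cochain maps $\alpha\colon C\to D$, $\beta\colon D\to C$ and a homotopy $G$ with $dG+Gd=\alpha\beta-\mathrm{id}_D$, $\mathfrak{Der}(C;\alpha,\beta,G;h_1,\dots,h_n)$ denotes the special $N$-cube on $C$ with $f_k=\beta h_k\alpha$ and, for $S=\{z_1<\dots<z_s\}$ with $s\ge2$, $H_S=\beta\circ\sum_{\sigma\in\Sigma(S)}\mathrm{sgn}(\sigma)h_{\sigma(z_1)}Gh_{\sigma(z_2)}G\cdots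 Gh_{\sigma(z_s)}\circ\alpha$ (this is indeed a special $N$-cube). $\mathfrak{Der}(D;\alpha\beta,\mathrm{id}_D,G;h_1,\dots,h_n)$ is the case in which $C,\alpha,\beta$ are replaced by $D,\alpha\beta,\mathrm{id}_D$. Mapping torus: for a special $N$-cube $F$ on $C$ with data $d,f_k,H_S$, the mapping $n$-torus $\mathcal T F$ is the totalisation of the special $N$-cube on the $L$-module complex $C\otimes_RL$ with data $\bar d=d\otimes1$, $\bar f_k=f_k\otimes1-1\otimes x_k$ and $\bar H_S=H_S\otimes1$. *)

theory Defs
  imports "HOL-Algebra.Free_Abelian_Groups" "HOL-Algebra.Module" "HOL-Combinatorics.Permutations"
begin

section \<open>Right modules over a unital ring\<close>

text \<open>
  The library locale \<open>module\<close> requires a commutative ring. Here the ring is arbitrary and modules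
  are right modules, so that \<open>C \<otimes>\<^sub>R L\<close> makes sense; the library record is reused,
  and \<open>a \<odot>\<^bsub>M\<^esub> x\<close> denotes the right action \<open>x \<cdot> a\<close>. The fields
  \<open>mult\<close> and \<open>one\<close> of the record play no role in a module.
\<close>

locale right_module = R?: ring R + M?: abelian_group M
  for R (structure) and M (structure) +
  assumes smult_closed:
      "\<lbrakk>a \<in> carrier R; x \<in> carrier M\<rbrakk> \<Longrightarrow> a \<odot>\<^bsub>M\<^esub> x \<in> carrier M"
    and smult_scalar_distr:
      "\<lbrakk>a \<in> carrier R; b \<in> carrier R; x \<in> carrier M\<rbrakk>
        \<Longrightarrow> (a \<oplus>\<^bsub>R\<^esub> b) \<odot>\<^bsub>M\<^esub> x = a \<odot>\<^bsub>M\<^esub> x \<oplus>\<^bsub>M\<^esub> b \<odot>\<^bsub>M\<^esub> x"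
    and smult_vector_distr:
      "\<lbrakk>a \<in> carrier R; x \<in> carrier M; y \<in> carrier M\<rbrakk>
        \<Longrightarrow> a \<odot>\<^bsub>M\<^esub> (x \<oplus>\<^bsub>M\<^esub> y) = a \<odot>\<^bsub>M\<^esub> x \<oplus>\<^bsub>M\<^esub> a \<odot>\<^bsub>M\<^esub> y"
    and smult_assoc:
      "\<lbrakk>a \<in> carrier R; b \<in> carrier R; x \<in> carrier M\<rbrakk>
        \<Longrightarrow> (a \<otimes>\<^bsub>R\<^esub> b) \<odot>\<^bsub>M\<^esub> x = b \<odot>\<^bsub>M\<^esub> (a \<odot>\<^bsub>M\<^esub> x)"
    and smult_one:
      "x \<in> carrier M \<Longrightarrow> \<one>\<^bsub>R\<^esub> \<odot>\<^bsub>M\<^esub> x = x"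

definition lin_hom ::
  "('r, 'x) ring_scheme \<Rightarrow> ('r, 'm) module \<Rightarrow> ('r, 'k) module \<Rightarrow> ('m \<Rightarrow> 'k) set" where
  "lin_hom R M K = {f. f \<in> carrier M \<rightarrow> carrier K
     \<and> (\<forall>x\<in>carrier M. \<forall>y\<in>carrier M. f (x \<oplus>\<^bsub>M\<^esub> y) = f x \<oplus>\<^bsub>K\<^esub> f y)
     \<and> (\<forall>a\<in>carrier R. \<forall>x\<in>carrier M. f (a \<odot>\<^bsub>M\<^esub> x) = a \<odot>\<^bsub>K\<^esub> f x)}"

definition direct_sum :: "'i set \<Rightarrow> ('i \<Rightarrow> ('r, 'm) module) \<Rightarrow> ('r, 'i \<Rightarrow> 'm) module" where
  "direct_sum I M =
    \<lparr>carrier = {v \<in> (\<Pi>\<^sub>E i\<in>I. carrier (M i)). finite {i\<in>I. v i \<noteq> \<zero>\<^bsub>M i\<^esub>}},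
     monoid.mult = undefined, one = undefined,
     zero = (\<lambda>i\<in>I. \<zero>\<^bsub>M i\<^esub>),
     add = (\<lambda>v w. \<lambda>i\<in>I. v i \<oplus>\<^bsub>M i\<^esub> w i),
     smult = (\<lambda>a v. \<lambda>i\<in>I. a \<odot>\<^bsub>M i\<^esub> v i)\<rparr>"

definition regular_module :: "('r, 'x) ring_scheme \<Rightarrow> ('r, 'r) module" where
  "regular_module R =
    \<lparr>carrier = carrier R, monoid.mult = monoid.mult R, one = one R, zero = zero R, add = add R,
     smult = (\<lambda>a x. x \<otimes>\<^bsub>R\<^esub> a)\<rparr>"

text \<open>
  A module is projective if it is a direct summand of a free module. Indexing the free module by
  elements of the type of \<open>P\<close> is no restriction: if \<open>P\<close> is a summand of any free module, then
  the canonical surjection onto \<open>P\<close> from the free module on \<open>carrier P\<close> splits.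
\<close>

definition projective_module :: "('r, 'x) ring_scheme \<Rightarrow> ('r, 'm) module \<Rightarrow> bool" where
  "projective_module R P \<longleftrightarrow> right_module R P \<and>
    (\<exists>(I :: 'm set) i r.
       i \<in> lin_hom R P (direct_sum I (\<lambda>_. regular_module R))
     \<and> r \<in> lin_hom R (direct_sum I (\<lambda>_. regular_module R)) P
     \<and> (\<forall>x\<in>carrier P. r (i x) = x))"


section \<open>Cochain complexes\<close>

record ('r, 'm) cochain =
  obj :: "int \<Rightarrow> ('r, 'm) module"
  dif :: "int \<Rightarrow> 'm \<Rightarrow> 'm"

definition cochain_complex :: "('r, 'x) ring_scheme \<Rightarrow> ('r, 'm) cochain \<Rightarrow> bool" where
  "cochain_complex R C \<longleftrightarrow> ring R \<and>
    (\<forall>l. right_module R (obj C l)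
       \<and> dif C l \<in> lin_hom R (obj C l) (obj C (l + 1))
       \<and> (\<forall>x\<in>carrier (obj C l). dif C (l + 1) (dif C l x) = \<zero>\<^bsub>obj C (l + 2)\<^esub>))"

definition cochain_map ::
  "('r, 'x) ring_scheme \<Rightarrow> ('r, 'm) cochain \<Rightarrow> ('r, 'k) cochain \<Rightarrow> (int \<Rightarrow> 'm \<Rightarrow> 'k) \<Rightarrow> bool" where
  "cochain_map R C D f \<longleftrightarrow> cochain_complex R C \<and> cochain_complex R D \<and>
    (\<forall>l. f l \<in> lin_hom R (obj C l) (obj D l)
       \<and> (\<forall>x\<in>carrier (obj C l). f (l + 1) (dif C l x) = dif D l (f l x)))"

text \<open>\<open>s\<close> is a homotopy from \<open>f\<close> to \<open>g\<close>, i.e. \<open>d s + s d = g - f\<close>.\<close>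

definition cochain_homotopy ::
  "('r, 'x) ring_scheme \<Rightarrow> ('r, 'm) cochain \<Rightarrow> ('r, 'k) cochain
    \<Rightarrow> (int \<Rightarrow> 'm \<Rightarrow> 'k) \<Rightarrow> (int \<Rightarrow> 'm \<Rightarrow> 'k) \<Rightarrow> (int \<Rightarrow> 'm \<Rightarrow> 'k) \<Rightarrow> bool" where
  "cochain_homotopy R C D s f g \<longleftrightarrow>
    (\<forall>l. s l \<in> lin_hom R (obj C l) (obj D (l - 1))
       \<and> (\<forall>x\<in>carrier (obj C l).
            dif D (l - 1) (s l x) \<oplus>\<^bsub>obj D l\<^esub> s (l + 1) (dif C l x) = g l x \<ominus>\<^bsub>obj D l\<^esub> f l x))"

definition homotopy_equivalence ::
  "('r, 'x) ring_scheme \<Rightarrow> ('r, 'm) cochain \<Rightarrow> ('r, 'k) cochain \<Rightarrow> (int \<Rightarrow> 'm \<Rightarrow> 'k) \<Rightarrow> bool" where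
  "homotopy_equivalence R C D f \<longleftrightarrow> cochain_map R C D f \<and>
    (\<exists>g s t. cochain_map R D C g
       \<and> cochain_homotopy R C C s (\<lambda>l. id) (\<lambda>l. g l \<circ> f l)
       \<and> cochain_homotopy R D D t (\<lambda>l. id) (\<lambda>l. f l \<circ> g l))"

definition cocycles :: "('r, 'm) cochain \<Rightarrow> int \<Rightarrow> 'm set" where
  "cocycles C l = {x \<in> carrier (obj C l). dif C l x = \<zero>\<^bsub>obj C (l + 1)\<^esub>}"

definition coboundaries :: "('r, 'm) cochain \<Rightarrow> int \<Rightarrow> 'm set" where
  "coboundaries C l = dif C (l - 1) ` carrier (obj C (l - 1))"

definition cohomology :: "('r, 'm) cochain \<Rightarrow> int \<Rightarrow> 'm set monoid" where
  "cohomology C l = (add_monoid (obj C l))\<lparr>carrier := cocycles C l\<rparr> Mod coboundaries C l"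

text \<open>The induced map sends the class of \<open>z\<close> to the class of \<open>f z\<close>; classes are cosets.\<close>

definition cohomology_map ::
  "('r, 'k) cochain \<Rightarrow> (int \<Rightarrow> 'm \<Rightarrow> 'k) \<Rightarrow> int \<Rightarrow> 'm set \<Rightarrow> 'k set" where
  "cohomology_map D f l X = coboundaries D l <#>\<^bsub>add_monoid (obj D l)\<^esub> (f l ` X)"

definition quasi_isomorphism ::
  "('r, 'm) cochain \<Rightarrow> ('r, 'k) cochain \<Rightarrow> (int \<Rightarrow> 'm \<Rightarrow> 'k) \<Rightarrow> bool" where
  "quasi_isomorphism C D f \<longleftrightarrow>
    (\<forall>l. cohomology_map D f l \<in> iso (cohomology C l) (cohomology D l))"

definition bounded_above :: "('r, 'm) cochain \<Rightarrow> bool" where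
  "bounded_above C \<longleftrightarrow> (\<exists>m. \<forall>l>m. carrier (obj C l) = {\<zero>\<^bsub>obj C l\<^esub>})"


section \<open>Laurent polynomials and extension of scalars\<close>

text \<open>
  The variables of \<open>laurent R N\<close> are indexed by \<open>N\<close>; an element is the finitely supported
  function assigning to every exponent vector (vanishing outside \<open>N\<close>) its coefficient.
\<close>

definition laurent :: "('r, 'x) ring_scheme \<Rightarrow> nat set \<Rightarrow> ((nat \<Rightarrow> int) \<Rightarrow> 'r) ring" where
  "laurent R N =
    \<lparr>carrier = {p. range p \<subseteq> carrier R \<and> finite {e. p e \<noteq> \<zero>\<^bsub>R\<^esub>}
                 \<and> (\<forall>e. p e \<noteq> \<zero>\<^bsub>R\<^esub> \<longrightarrow> (\<forall>k. k \<notin> N \<longrightarrow> e k = 0))},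
     monoid.mult = (\<lambda>p q e. \<Oplus>\<^bsub>R\<^esub>u\<in>{u. p u \<noteq> \<zero>\<^bsub>R\<^esub>}. p u \<otimes>\<^bsub>R\<^esub> q (\<lambda>k. e k - u k)),
     one = (\<lambda>e. if e = (\<lambda>k. 0) then \<one>\<^bsub>R\<^esub> else \<zero>\<^bsub>R\<^esub>),
     zero = (\<lambda>e. \<zero>\<^bsub>R\<^esub>),
     add = (\<lambda>p q e. p e \<oplus>\<^bsub>R\<^esub> q e)\<rparr>"

definition laurent_const :: "('r, 'x) ring_scheme \<Rightarrow> 'r \<Rightarrow> (nat \<Rightarrow> int) \<Rightarrow> 'r" where
  "laurent_const R a = (\<lambda>e. if e = (\<lambda>k. 0) then a else \<zero>\<^bsub>R\<^esub>)"

definition laurent_var :: "('r, 'x) ring_scheme \<Rightarrow> nat \<Rightarrow> (nat \<Rightarrow> int) \<Rightarrow> 'r" where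
  "laurent_var R k = (\<lambda>e. if e = (\<lambda>i. if i = k then 1 else 0) then \<one>\<^bsub>R\<^esub> else \<zero>\<^bsub>R\<^esub>)"

text \<open>
  For a right \<open>R\<close>-module \<open>M\<close> and a ring homomorphism \<open>\<iota>\<close> from \<open>R\<close> to \<open>L\<close>, the tensor
  product of \<open>M\<close> with \<open>L\<close> over \<open>R\<close> is the free abelian group on \<open>carrier M \<times> carrier L\<close> modulo
  the subgroup generated by the usual relations.
\<close>

definition tensor_free :: "('l, 'y) ring_scheme \<Rightarrow> ('r, 'm) module \<Rightarrow> ('m \<times> 'l \<Rightarrow>\<^sub>0 int) monoid" where
  "tensor_free L M = free_Abelian_group (carrier M \<times> carrier L)"

definition tensor_relations ::
  "('r, 'x) ring_scheme \<Rightarrow> ('l, 'y) ring_scheme \<Rightarrow> ('r \<Rightarrow> 'l) \<Rightarrow> ('r, 'm) module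
    \<Rightarrow> ('m \<times> 'l \<Rightarrow>\<^sub>0 int) set" where
  "tensor_relations R L \<iota> M = generate (tensor_free L M)
    ({frag_of (x \<oplus>\<^bsub>M\<^esub> y, p) - frag_of (x, p) - frag_of (y, p) |x y p.
        x \<in> carrier M \<and> y \<in> carrier M \<and> p \<in> carrier L}
   \<union> {frag_of (x, p \<oplus>\<^bsub>L\<^esub> q) - frag_of (x, p) - frag_of (x, q) |x p q.
        x \<in> carrier M \<and> p \<in> carrier L \<and> q \<in> carrier L}
   \<union> {frag_of (a \<odot>\<^bsub>M\<^esub> x, p) - frag_of (x, \<iota> a \<otimes>\<^bsub>L\<^esub> p) |x a p.
        x \<in> carrier M \<and> a \<in> carrier R \<and> p \<in> carrier L})"

text \<open>
  The map \<open>\<phi> \<otimes> \<psi>\<close> into the tensor product of \<open>M'\<close> with \<open>L\<close>, where \<open>\<phi>\<close> is a linear map into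
  \<open>M'\<close> and \<open>\<psi>\<close> is a left linear self-map of \<open>L\<close>; it sends the coset of \<open>frag_of (x, p)\<close> to that
  of \<open>frag_of (\<phi> x, \<psi> p)\<close>.
\<close>

definition tensor_map ::
  "('r, 'x) ring_scheme \<Rightarrow> ('l, 'y) ring_scheme \<Rightarrow> ('r \<Rightarrow> 'l) \<Rightarrow> ('r, 'k) module
    \<Rightarrow> ('m \<Rightarrow> 'k) \<Rightarrow> ('l \<Rightarrow> 'l) \<Rightarrow> ('m \<times> 'l \<Rightarrow>\<^sub>0 int) set \<Rightarrow> ('k \<times> 'l \<Rightarrow>\<^sub>0 int) set" where
  "tensor_map R L \<iota> M' \<phi> \<psi> X =
    tensor_relations R L \<iota> M' <#>\<^bsub>tensor_free L M'\<^esub>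
      (frag_extend (\<lambda>(x, p). frag_of (\<phi> x, \<psi> p)) ` X)"

definition tensor ::
  "('r, 'x) ring_scheme \<Rightarrow> ('l, 'y) ring_scheme \<Rightarrow> ('r \<Rightarrow> 'l) \<Rightarrow> ('r, 'm) module
    \<Rightarrow> ('l, ('m \<times> 'l \<Rightarrow>\<^sub>0 int) set) module" where
  "tensor R L \<iota> M = (let T = tensor_free L M Mod tensor_relations R L \<iota> M in
    \<lparr>carrier = carrier T, monoid.mult = undefined, one = undefined,
     zero = \<one>\<^bsub>T\<^esub>, add = monoid.mult T,
     smult = (\<lambda>q. tensor_map R L \<iota> M id (\<lambda>p. p \<otimes>\<^bsub>L\<^esub> q))\<rparr>)"

abbreviation laurent_tensor where
  "laurent_tensor R N \<equiv> tensor R (laurent R N) (laurent_const R)"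

abbreviation laurent_tensor_map where
  "laurent_tensor_map R N \<equiv> tensor_map R (laurent R N) (laurent_const R)"


section \<open>Total incidence numbers\<close>

definition face :: "nat \<Rightarrow> nat set \<Rightarrow> nat set" where
  "face i B = B - {sorted_list_of_set B ! (i - 1)}"

definition incidence :: "nat set \<Rightarrow> nat set \<Rightarrow> int" where
  "incidence B A =
    (let js = (THE js. sorted_wrt (<) js \<and> set js \<subseteq> {1..card B}
                 \<and> length js = card B - card A \<and> foldr face js B = A)
     in (-1) ^ (card B - card A) * (-1) ^ sum_list js)"


section \<open>Cubes, totalisation, mapping tori\<close>

text \<open>
  The data of an \<open>N\<close>-cube on a complex: the maps \<open>f\<^sub>k\<close> and the maps \<open>H\<^sub>S\<close>, where
  \<open>higher F S l\<close> goes from degree \<open>l\<close> to degree \<open>l + 1 - card S\<close>. The cube is special if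
  its totalisation is a cochain complex.
\<close>

record ('r, 'm) cube =
  base :: "('r, 'm) cochain"
  edge :: "nat \<Rightarrow> int \<Rightarrow> 'm \<Rightarrow> 'm"
  higher :: "nat set \<Rightarrow> int \<Rightarrow> 'm \<Rightarrow> 'm"

definition cube_entry :: "('r, 'm) cube \<Rightarrow> nat set \<Rightarrow> int \<Rightarrow> 'm \<Rightarrow> 'm" where
  "cube_entry F S =
    (if S = {} then dif (base F) else if card S = 1 then edge F (the_elem S) else higher F S)"

text \<open>
  The map given by a matrix with entries \<open>T B A\<close> (row \<open>B\<close>, column \<open>A\<close>), indexed by the subsets
  of \<open>N\<close>, into the direct sum of the modules \<open>K B\<close>.
\<close>

definition matrix_map ::
  "nat set \<Rightarrow> (nat set \<Rightarrow> ('r, 'k) module) \<Rightarrow> (nat set \<Rightarrow> nat set \<Rightarrow> 'm \<Rightarrow> 'k)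
    \<Rightarrow> (nat set \<Rightarrow> 'm) \<Rightarrow> nat set \<Rightarrow> 'k" where
  "matrix_map N K T v = (\<lambda>B\<in>Pow N. \<Oplus>\<^bsub>K B\<^esub>A\<in>Pow N. T B A (v A))"

definition totalisation :: "nat set \<Rightarrow> ('r, 'm) cube \<Rightarrow> ('r, nat set \<Rightarrow> 'm) cochain" where
  "totalisation N F =
    \<lparr>obj = (\<lambda>l. direct_sum (Pow N) (\<lambda>A. obj (base F) (l - int (card A)))),
     dif = (\<lambda>l. matrix_map N (\<lambda>B. obj (base F) (l + 1 - int (card B)))
       (\<lambda>B A x. if A \<subseteq> B
          then [((-1) ^ (card A * card B) * incidence B A)] \<cdot>\<^bsub>obj (base F) (l + 1 - int (card B))\<^esub>
                 (cube_entry F (B - A) (l - int (card A)) x)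
          else \<zero>\<^bsub>obj (base F) (l + 1 - int (card B))\<^esub>))\<rparr>"

text \<open>
  \<open>zigzag h G [k\<^sub>1, \<dots>, k\<^sub>s] l\<close> is the composite \<open>h\<^bsub>k\<^sub>1\<^esub> G h\<^bsub>k\<^sub>2\<^esub> G \<cdots> G h\<^bsub>k\<^sub>s\<^esub>\<close> on
  degree \<open>l\<close>, with values in degree \<open>l + 1 - s\<close>; the empty list does not occur.
\<close>

fun zigzag ::
  "(nat \<Rightarrow> int \<Rightarrow> 'm \<Rightarrow> 'm) \<Rightarrow> (int \<Rightarrow> 'm \<Rightarrow> 'm) \<Rightarrow> nat list \<Rightarrow> int \<Rightarrow> 'm \<Rightarrow> 'm" where
  "zigzag h G [] l x = x"
| "zigzag h G [k] l x = h k l x"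
| "zigzag h G (k # j # ks) l x =
     h k (l - 1 - int (length ks)) (G (l - int (length ks)) (zigzag h G (j # ks) l x))"

text \<open>
  The derived cube on \<open>C\<close>; the complex \<open>D\<close> on which the maps \<open>h\<^sub>k\<close> and \<open>G\<close> live is an explicit
  argument here.
\<close>

definition derived_cube ::
  "('r, 'c) cochain \<Rightarrow> ('r, 'd) cochain \<Rightarrow> (int \<Rightarrow> 'c \<Rightarrow> 'd) \<Rightarrow> (int \<Rightarrow> 'd \<Rightarrow> 'c)
    \<Rightarrow> (int \<Rightarrow> 'd \<Rightarrow> 'd) \<Rightarrow> (nat \<Rightarrow> int \<Rightarrow> 'd \<Rightarrow> 'd) \<Rightarrow> ('r, 'c) cube" where
  "derived_cube C D \<alpha> \<beta> G h =
    \<lparr>base = C,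
     edge = (\<lambda>k l x. \<beta> l (h k l (\<alpha> l x))),
     higher = (\<lambda>S l x. \<beta> (l + 1 - int (card S))
       (\<Oplus>\<^bsub>obj D (l + 1 - int (card S))\<^esub>\<sigma>\<in>{\<sigma>. \<sigma> permutes S}.
          [(sign \<sigma>)] \<cdot>\<^bsub>obj D (l + 1 - int (card S))\<^esub>
            (zigzag h G (map \<sigma> (sorted_list_of_set S)) l (\<alpha> l x))))\<rparr>"

definition laurent_cube ::
  "('r, 'x) ring_scheme \<Rightarrow> nat set \<Rightarrow> ('r, 'm) cube
    \<Rightarrow> ((nat \<Rightarrow> int) \<Rightarrow> 'r, ('m \<times> ((nat \<Rightarrow> int) \<Rightarrow> 'r) \<Rightarrow>\<^sub>0 int) set) cube" where
  "laurent_cube R N F =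
    \<lparr>base =
       \<lparr>obj = (\<lambda>l. laurent_tensor R N (obj (base F) l)),
        dif = (\<lambda>l. laurent_tensor_map R N (obj (base F) (l + 1)) (dif (base F) l) id)\<rparr>,
     edge = (\<lambda>k l X.
       laurent_tensor_map R N (obj (base F) l) (edge F k l) id X
         \<ominus>\<^bsub>laurent_tensor R N (obj (base F) l)\<^esub>
       laurent_tensor_map R N (obj (base F) l) id (\<lambda>p. laurent_var R k \<otimes>\<^bsub>laurent R N\<^esub> p) X),
     higher = (\<lambda>S l.
       laurent_tensor_map R N (obj (base F) (l + 1 - int (card S))) (higher F S l) id)\<rparr>"

definition mapping_torus ::
  "('r, 'x) ring_scheme \<Rightarrow> nat set \<Rightarrow> ('r, 'm) cube
    \<Rightarrow> ((nat \<Rightarrow> int) \<Rightarrow> 'r, nat set \<Rightarrow> ('m \<times> ((nat \<Rightarrow> int) \<Rightarrow> 'r) \<Rightarrow>\<^sub>0 int) set) cochain" where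
  "mapping_torus R N F = totalisation N (laurent_cube R N F)"

definition diagonal_map ::
  "('r, 'x) ring_scheme \<Rightarrow> nat set \<Rightarrow> ('r, 'c) cochain \<Rightarrow> (int \<Rightarrow> 'd \<Rightarrow> 'c) \<Rightarrow> int
    \<Rightarrow> (nat set \<Rightarrow> ('d \<times> ((nat \<Rightarrow> int) \<Rightarrow> 'r) \<Rightarrow>\<^sub>0 int) set)
    \<Rightarrow> nat set \<Rightarrow> ('c \<times> ((nat \<Rightarrow> int) \<Rightarrow> 'r) \<Rightarrow>\<^sub>0 int) set" where
  "diagonal_map R N C \<beta> l =
    matrix_map N (\<lambda>B. laurent_tensor R N (obj C (l - int (card B))))
      (\<lambda>B A X. if A = B
         then laurent_tensor_map R N (obj C (l - int (card B))) (\<beta> (l - int (card B))) id X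
         else \<zero>\<^bsub>laurent_tensor R N (obj C (l - int (card B)))\<^esub>)"

end

theory Submission
  imports Defs "HOL-Algebra.AbelCoset"
begin

text \<open>
  On families indexed by the subsets of \<open>N\<close>, let \<open>h\<close> be the operator with the \<open>h\<^sub>k\<close> as entries on
  the edges of the cube, and let \<open>x\<close> be the one given by the variables. All composites
  \<open>h\<^sub>i G h\<^sub>j G \<dots>\<close> together form the operator \<open>P\<close> with \<open>P = h (1 + G P)\<close>, and the differential of the
  mapping torus is \<open>d + \<beta> P \<alpha> - x\<close>. It squares to zero because \<open>d P + P d + P \<alpha> \<beta> P\<close> is fixed by the
  nilpotent operator \<open>h G\<close>. The map \<open>J\<close> then commutes with the differentials.
  Since \<open>L\<close> is free over \<open>R\<close>, the map \<open>\<beta> \<otimes> 1\<close> is a quasi-isomorphism if \<open>\<beta>\<close> is one, and \<open>J\<close> inherits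
  this property because its cone is filtered by the cardinality of the index, with the cone of
  \<open>\<beta> \<otimes> 1\<close> as graded pieces. Finally, \<open>Q \<otimes> L\<close> has the lifting property for \<open>L\<close>-linear maps if \<open>Q\<close> is
  projective over \<open>R\<close>, so the cone of \<open>J\<close>, being acyclic and bounded above, is contractible.
\<close>

section \<open>Additive and linear maps\<close>

text \<open>The obstacle is the signs. With the factor (-1)^{ab}[B:A] the differential enters the
  matrix as (-1)^{|B|} d, and an edge with the sign of the position of k in B. Then d anticommutes
  with the edge operators of h and x, and G, given the sign (-1)^{|B|} as well, with that of x;
  \<open>entry_sign_step\<close> is the identity that makes the alternating sums over permutations
  satisfy P = h (1 + G P). Replacing d by d - x is harmless because the variables commute with d, h,
  G, \<alpha> and \<beta>: the relations dh = -hd and dG + Gd = \<alpha>\<beta> - 1 persist. On Y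
  the differential is d - x + P \<alpha>\<beta>, and \<beta> (d - x + P \<alpha>\<beta>) = (d - x +
  \<beta> P \<alpha>) \<beta>, so J is a cochain map without any entries off the diagonal.
  Quasi-isomorphisms are defined through cosets; they are translated into solvability of the
  equations of the cone, where the filtration becomes an induction on cardinality and the freeness
  of L over R a choice of solutions coefficient by coefficient.\<close>

context abelian_group
begin

lemma int_smult_one: "x \<in> carrier G \<Longrightarrow> [(1::int)] \<cdot> x = x"
  by (simp add: add.int_pow_1)

lemma int_smult_neg_one: "x \<in> carrier G \<Longrightarrow> [(-1::int)] \<cdot> x = \<ominus> x"
  using add.int_pow_neg[of x 1] by (simp add: int_smult_one)

lemma int_smult_mult: "x \<in> carrier G \<Longrightarrow> [(j * k :: int)] \<cdot> x = [j] \<cdot> ([k] \<cdot> x)"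
  using add.int_pow_pow[of x j k] by (simp add: mult.commute)

lemma int_smult_add: "x \<in> carrier G \<Longrightarrow> y \<in> carrier G \<Longrightarrow> [(k::int)] \<cdot> (x \<oplus> y) = [k] \<cdot> x \<oplus> [k] \<cdot> y"
  by (simp add: add.int_pow_distrib)

lemma int_smult_zero: "[(k::int)] \<cdot> \<zero> = \<zero>"
  by (simp add: add.int_pow_one)

lemma int_smult_closed: "x \<in> carrier G \<Longrightarrow> [(k::int)] \<cdot> x \<in> carrier G"
  by (simp add: add.int_pow_closed)

lemma int_smult_neg: "x \<in> carrier G \<Longrightarrow> [(- k::int)] \<cdot> x = \<ominus> ([k] \<cdot> x)"
  by (simp add: add.int_pow_neg)

lemma int_smult_a_inv: "x \<in> carrier G \<Longrightarrow> [(k::int)] \<cdot> (\<ominus> x) = \<ominus> ([k] \<cdot> x)"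
  by (metis int_smult_neg_one int_smult_mult mult.commute int_smult_closed)

lemma diff_add_cancel: "x \<in> carrier G \<Longrightarrow> y \<in> carrier G \<Longrightarrow> (x \<ominus> y) \<oplus> y = x"
  by (simp add: a_minus_def a_assoc l_neg)

lemma finsum_zero_eqI: "(\<And>i. i \<in> A \<Longrightarrow> f i = \<zero>) \<Longrightarrow> finsum G f A = \<zero>"
  by (rule add.finprod_one_eqI)

lemma finsum_a_inv:
  assumes "finite A" "f \<in> A \<rightarrow> carrier G"
  shows "(\<Oplus>i\<in>A. \<ominus> f i) = \<ominus> finsum G f A"
  using assms
proof (induction A)
  case empty
  show ?case by (metis finsum_empty l_zero minus_equality zero_closed)
qed (simp add: Pi_def finsum_insert minus_add finsum_closed)

lemma finsum_swap:
  assumes "finite A" "finite B" "\<And>i j. i \<in> A \<Longrightarrow> j \<in> B \<Longrightarrow> f i j \<in> carrier G"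
  shows "(\<Oplus>i\<in>A. \<Oplus>j\<in>B. f i j) = (\<Oplus>j\<in>B. \<Oplus>i\<in>A. f i j)"
  using assms
proof (induction A)
  case (insert a A)
  have "(\<Oplus>i\<in>insert a A. \<Oplus>j\<in>B. f i j) = (\<Oplus>j\<in>B. f a j) \<oplus> (\<Oplus>j\<in>B. \<Oplus>i\<in>A. f i j)"
    using insert by (subst finsum_insert) (auto intro!: finsum_closed simp: Pi_def)
  also have "\<dots> = (\<Oplus>j\<in>B. f a j \<oplus> (\<Oplus>i\<in>A. f i j))"
    using insert by (subst finsum_addf) (auto intro!: finsum_closed simp: Pi_def)
  also have "\<dots> = (\<Oplus>j\<in>B. \<Oplus>i\<in>insert a A. f i j)"
    using insert
    by (intro finsum_cong' refl) (auto intro!: finsum_closed finsum_insert[symmetric] simp: Pi_def)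
  finally show ?case .
qed (simp add: finsum_zero)

text \<open>Both restricted sums are padded with zeros to sums over a full rectangle, where the
  order can be changed. In the recursion for P the relation says that the set A avoids the element
  k.\<close>

lemma finsum_swap_restrict:
  assumes "finite A" "finite B" "\<And>i j. i \<in> A \<Longrightarrow> j \<in> B \<Longrightarrow> Q i j \<Longrightarrow> f i j \<in> carrier G"
  shows "(\<Oplus>i\<in>A. \<Oplus>j\<in>{j \<in> B. Q i j}. f i j) = (\<Oplus>j\<in>B. \<Oplus>i\<in>{i \<in> A. Q i j}. f i j)"
proof -
  have 1: "(\<Oplus>j\<in>{j \<in> B. Q i j}. f i j) = (\<Oplus>j\<in>B. if Q i j then f i j else \<zero>)" if "i \<in> A" for i
    using assms that by (intro add.finprod_mono_neutral_cong_left) (auto split: if_splits)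
  have 2: "(\<Oplus>i\<in>{i \<in> A. Q i j}. f i j) = (\<Oplus>i\<in>A. if Q i j then f i j else \<zero>)" if "j \<in> B" for j
    using assms that by (intro add.finprod_mono_neutral_cong_left) (auto split: if_splits)
  have "(\<Oplus>i\<in>A. \<Oplus>j\<in>{j \<in> B. Q i j}. f i j) = (\<Oplus>i\<in>A. \<Oplus>j\<in>B. if Q i j then f i j else \<zero>)"
    by (rule finsum_cong'[OF refl]) (use assms in \<open>auto simp: 1 intro!: finsum_closed\<close>)
  also have "\<dots> = (\<Oplus>j\<in>B. \<Oplus>i\<in>A. if Q i j then f i j else \<zero>)"
    using assms by (intro finsum_swap) auto
  also have "\<dots> = (\<Oplus>j\<in>B. \<Oplus>i\<in>{i \<in> A. Q i j}. f i j)"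
    by (rule finsum_cong'[OF refl]) (use assms in \<open>auto simp: 2 intro!: finsum_closed\<close>)
  finally show ?thesis .
qed

lemma finsum_delta:
  assumes "finite A" "a \<in> A" "f a \<in> carrier G"
  shows "(\<Oplus>i\<in>A. if i = a then f i else \<zero>) = f a"
proof -
  have "(\<Oplus>i\<in>A. if i = a then f i else \<zero>) = (\<Oplus>i\<in>{a}. f i)"
    using assms by (intro add.finprod_mono_neutral_cong_right) auto
  then show ?thesis using assms by (simp add: finsum_insert)
qed

text \<open>Serves to group a sum over permutations by the value that comes first.\<close>

lemma finsum_Sigma:
  assumes "finite A" "\<And>i. i \<in> A \<Longrightarrow> finite (B i)"
    "\<And>i j. i \<in> A \<Longrightarrow> j \<in> B i \<Longrightarrow> f i j \<in> carrier G"
  shows "(\<Oplus>i\<in>A. \<Oplus>j\<in>B i. f i j) = finsum G (\<lambda>(i, j). f i j) (Sigma A B)"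
proof -
  have "(\<Oplus>p\<in>(\<Union>i\<in>A. Pair i ` B i). case p of (i, j) \<Rightarrow> f i j)
      = (\<Oplus>i\<in>A. \<Oplus>p\<in>Pair i ` B i. case p of (i, j) \<Rightarrow> f i j)"
    using assms by (intro add.finprod_UN_disjoint) (auto simp: pairwise_def disjnt_def)
  also have "\<dots> = (\<Oplus>i\<in>A. \<Oplus>j\<in>B i. f i j)"
  proof (intro finsum_cong' refl)
    show "(\<lambda>i. \<Oplus>j\<in>B i. f i j) \<in> A \<rightarrow> carrier G"
      using assms by (auto intro!: finsum_closed)
    show "(\<Oplus>p\<in>Pair i ` B i. case p of (i, j) \<Rightarrow> f i j) = (\<Oplus>j\<in>B i. f i j)" if "i \<in> A" for i
      using assms that by (subst finsum_reindex) (auto simp: inj_on_def)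
  qed
  moreover have "(\<Union>i\<in>A. Pair i ` B i) = Sigma A B" by auto
  ultimately show ?thesis by simp
qed

end

context abelian_group_hom
begin

lemma hom_minus: "x \<in> carrier G \<Longrightarrow> y \<in> carrier G \<Longrightarrow> h (x \<ominus>\<^bsub>G\<^esub> y) = h x \<ominus>\<^bsub>H\<^esub> h y"
  by (simp add: a_minus_def)

lemma hom_finsum:
  assumes "f \<in> A \<rightarrow> carrier G"
  shows "h (finsum G f A) = (\<Oplus>\<^bsub>H\<^esub>i\<in>A. h (f i))"
  using assms
proof (induction A rule: infinite_finite_induct)
  case (insert a A)
  then show ?case
    by (simp add: G.finsum_insert H.finsum_insert G.finsum_closed Pi_def)
qed (simp_all add: G.finsum_infinite H.finsum_infinite)

lemma hom_int_smult: "x \<in> carrier G \<Longrightarrow> h ([(k::int)] \<cdot>\<^bsub>G\<^esub> x) = [k] \<cdot>\<^bsub>H\<^esub> h x"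
  using group_hom.hom_int_pow[OF a_group_hom, of x k] by (simp add: add_pow_def)

end

lemma abelian_group_homI:
  assumes "abelian_group M" "abelian_group K" "\<And>x. x \<in> carrier M \<Longrightarrow> f x \<in> carrier K"
    "\<And>x y. x \<in> carrier M \<Longrightarrow> y \<in> carrier M \<Longrightarrow> f (x \<oplus>\<^bsub>M\<^esub> y) = f x \<oplus>\<^bsub>K\<^esub> f y"
  shows "abelian_group_hom M K f"
proof -
  interpret M: abelian_group M by fact
  interpret K: abelian_group K by fact
  show ?thesis
    by (rule abelian_group_hom.intro[OF assms(1,2)], rule abelian_group_hom_axioms.intro)
      (auto simp: group_hom_def group_hom_axioms_def hom_def M.a_group K.a_group assms)
qed

lemma abelian_group_hom_compose:
  assumes "abelian_group_hom M K f" "abelian_group_hom K W g"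
  shows "abelian_group_hom M W (\<lambda>x. g (f x))"
proof -
  interpret f: abelian_group_hom M K f by fact
  interpret g: abelian_group_hom K W g by fact
  show ?thesis
    by (rule abelian_group_homI) (auto simp: f.G.abelian_group_axioms g.H.abelian_group_axioms)
qed

text \<open>Membership in \<open>lin_hom\<close> does not say that source and target are modules.
  Bundling this lets a single fact yield additivity, zero and negatives, and keeps composites free
  of side conditions.\<close>

definition linear_map ::
  "('r, 'x) ring_scheme \<Rightarrow> ('r, 'm) module \<Rightarrow> ('r, 'k) module \<Rightarrow> ('m \<Rightarrow> 'k) \<Rightarrow> bool" where
  "linear_map R M K f \<longleftrightarrow> right_module R M \<and> right_module R K \<and> f \<in> lin_hom R M K"

lemma right_moduleD:
  "right_module R M \<Longrightarrow> abelian_group M" "right_module R M \<Longrightarrow> ring R"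
  by (simp_all add: right_module_def)

lemma linear_map_abelian_group_hom: "linear_map R M K f \<Longrightarrow> abelian_group_hom M K f"
  unfolding linear_map_def lin_hom_def
  by (rule abelian_group_homI) (auto simp: right_moduleD)

lemma linear_map_modules:
  assumes "linear_map R M K f"
  shows "right_module R M" "right_module R K" "abelian_group M" "abelian_group K" "ring R"
  using assms by (auto simp: linear_map_def right_moduleD)

lemma linear_mapI:
  assumes "right_module R M" "right_module R K" "\<And>x. x \<in> carrier M \<Longrightarrow> f x \<in> carrier K"
    "\<And>x y. x \<in> carrier M \<Longrightarrow> y \<in> carrier M \<Longrightarrow> f (x \<oplus>\<^bsub>M\<^esub> y) = f x \<oplus>\<^bsub>K\<^esub> f y"
    "\<And>a x. a \<in> carrier R \<Longrightarrow> x \<in> carrier M \<Longrightarrow> f (a \<odot>\<^bsub>M\<^esub> x) = a \<odot>\<^bsub>K\<^esub> f x"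
  shows "linear_map R M K f"
  using assms by (auto simp: linear_map_def lin_hom_def)

lemma linear_map_smult:
  "linear_map R M K f \<Longrightarrow> a \<in> carrier R \<Longrightarrow> x \<in> carrier M \<Longrightarrow> f (a \<odot>\<^bsub>M\<^esub> x) = a \<odot>\<^bsub>K\<^esub> f x"
  by (auto simp: linear_map_def lin_hom_def)

lemma linear_map_closed: "linear_map R M K f \<Longrightarrow> x \<in> carrier M \<Longrightarrow> f x \<in> carrier K"
  by (auto simp: linear_map_def lin_hom_def)

lemmas linear_map_add = abelian_group_hom.hom_add[OF linear_map_abelian_group_hom]
  and linear_map_zero = abelian_group_hom.hom_zero[OF linear_map_abelian_group_hom]
  and linear_map_a_inv = abelian_group_hom.hom_a_inv[OF linear_map_abelian_group_hom]
  and linear_map_minus = abelian_group_hom.hom_minus[OF linear_map_abelian_group_hom]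
  and linear_map_finsum = abelian_group_hom.hom_finsum[OF linear_map_abelian_group_hom]
  and linear_map_int_smult = abelian_group_hom.hom_int_smult[OF linear_map_abelian_group_hom]

text \<open>\<open>lin_hom\<close> tests values on the carrier only. This carries linearity from the
  operators used in the argument over to the matrices of the definitions, with which they agree on
  the carrier.\<close>

lemma linear_map_cong:
  assumes "linear_map R M K f" "\<And>x. x \<in> carrier M \<Longrightarrow> f x = g x"
  shows "linear_map R M K g"
proof -
  interpret M: right_module R M using assms by (simp add: linear_map_def)
  show ?thesis
    using assms unfolding linear_map_def lin_hom_def by (auto simp: M.smult_closed Pi_def)
qed

lemma linear_map_compose:
  assumes "linear_map R M K f" "linear_map R K W g"
  shows "linear_map R M W (\<lambda>x. g (f x))"
  using assms unfolding linear_map_def lin_hom_def by (auto simp: Pi_def)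

lemma linear_map_ident: "right_module R M \<Longrightarrow> linear_map R M M (\<lambda>x. x)"
  by (simp add: linear_map_def lin_hom_def)

lemma (in right_module) smult_hom: "a \<in> carrier R \<Longrightarrow> abelian_group_hom M M (smult M a)"
  by (rule abelian_group_homI) (auto simp: smult_closed smult_vector_distr M.abelian_group_axioms)

lemma (in right_module) scalar_hom: "x \<in> carrier M \<Longrightarrow> abelian_group_hom R M (\<lambda>a. a \<odot>\<^bsub>M\<^esub> x)"
  by (rule abelian_group_homI)
    (auto simp: smult_closed smult_scalar_distr M.abelian_group_axioms R.abelian_group_axioms)

lemma linear_map_const_zero:
  assumes "right_module R M" "right_module R K"
  shows "linear_map R M K (\<lambda>x. \<zero>\<^bsub>K\<^esub>)"
proof -
  interpret K: right_module R K by fact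
  show ?thesis
    using assms abelian_group_hom.hom_zero[OF K.smult_hom]
    by (intro linear_mapI) auto
qed

lemma linear_map_plus:
  assumes "linear_map R M K f" "linear_map R M K g"
  shows "linear_map R M K (\<lambda>x. f x \<oplus>\<^bsub>K\<^esub> g x)"
proof -
  interpret K: right_module R K using assms by (simp add: linear_map_def)
  show ?thesis
    using linear_map_modules[OF assms(1)]
    by (intro linear_mapI)
      (auto simp: linear_map_closed[OF assms(1)] linear_map_add[OF assms(1)]
        linear_map_smult[OF assms(1)] linear_map_closed[OF assms(2)] linear_map_add[OF assms(2)]
        linear_map_smult[OF assms(2)]
        K.smult_vector_distr K.M.a_ac)
qed

lemma linear_map_uminus:
  assumes "linear_map R M K f"
  shows "linear_map R M K (\<lambda>x. \<ominus>\<^bsub>K\<^esub> f x)"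
proof -
  interpret K: right_module R K using assms by (simp add: linear_map_def)
  show ?thesis
    using linear_map_modules[OF assms]
    by (intro linear_mapI)
      (auto simp: linear_map_closed[OF assms] linear_map_add[OF assms] linear_map_smult[OF assms]
        abelian_group_hom.hom_a_inv[OF K.smult_hom] K.M.minus_add)
qed

lemma linear_map_diff:
  assumes "linear_map R M K f" "linear_map R M K g"
  shows "linear_map R M K (\<lambda>x. f x \<ominus>\<^bsub>K\<^esub> g x)"
  unfolding a_minus_def by (intro linear_map_plus linear_map_uminus assms)

lemma linear_map_int_multiple:
  assumes "linear_map R M K f"
  shows "linear_map R M K (\<lambda>x. [(k::int)] \<cdot>\<^bsub>K\<^esub> f x)"
proof -
  interpret K: right_module R K using assms by (simp add: linear_map_def)
  show ?thesis
    using linear_map_modules[OF assms]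
    by (intro linear_mapI)
      (auto simp: linear_map_closed[OF assms] linear_map_add[OF assms] linear_map_smult[OF assms]
        abelian_group_hom.hom_int_smult[OF K.smult_hom] K.M.int_smult_add K.M.int_smult_closed)
qed

lemma linear_map_sum:
  assumes "right_module R M" "right_module R K" "\<And>i. i \<in> I \<Longrightarrow> linear_map R M K (f i)"
  shows "linear_map R M K (\<lambda>x. \<Oplus>\<^bsub>K\<^esub>i\<in>I. f i x)"
proof -
  interpret K: right_module R K by fact
  show ?thesis
    using assms(3)
  proof (induction I rule: infinite_finite_induct)
    case (insert i I)
    have "linear_map R M K (\<lambda>x. f i x \<oplus>\<^bsub>K\<^esub> (\<Oplus>\<^bsub>K\<^esub>i\<in>I. f i x))"
      using insert by (intro linear_map_plus) auto
    then show ?case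
      by (rule linear_map_cong)
        (use insert linear_map_closed[OF insert.prems] in \<open>auto simp: K.M.finsum_insert Pi_def\<close>)
  qed (simp_all add: K.M.finsum_infinite linear_map_const_zero assms)
qed

section \<open>Direct sums\<close>

lemma direct_sum_simps:
  "finite I \<Longrightarrow> carrier (direct_sum I M) = (\<Pi>\<^sub>E i\<in>I. carrier (M i))"
  "\<zero>\<^bsub>direct_sum I M\<^esub> = (\<lambda>i\<in>I. \<zero>\<^bsub>M i\<^esub>)"
  "v \<oplus>\<^bsub>direct_sum I M\<^esub> w = (\<lambda>i\<in>I. v i \<oplus>\<^bsub>M i\<^esub> w i)"
  "a \<odot>\<^bsub>direct_sum I M\<^esub> v = (\<lambda>i\<in>I. a \<odot>\<^bsub>M i\<^esub> v i)"
  by (auto simp: direct_sum_def)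

lemma direct_sum_mem:
  "v \<in> carrier (direct_sum I M) \<Longrightarrow> i \<in> I \<Longrightarrow> v i \<in> carrier (M i)"
  "v \<in> carrier (direct_sum I M) \<Longrightarrow> i \<notin> I \<Longrightarrow> v i = undefined"
  "v \<in> carrier (direct_sum I M) \<Longrightarrow> finite {i \<in> I. v i \<noteq> \<zero>\<^bsub>M i\<^esub>}"
  by (auto simp: direct_sum_def PiE_def extensional_def)

text \<open>The set E bounds the support. It is the union of the supports for a sum, and the whole
  index set when that is finite.\<close>

lemma restrict_in_direct_sum:
  assumes "\<And>i. i \<in> I \<Longrightarrow> v i \<in> carrier (M i)" "finite E" "\<And>i. i \<in> I \<Longrightarrow> i \<notin> E \<Longrightarrow> v i = \<zero>\<^bsub>M i\<^esub>"
  shows "(\<lambda>i\<in>I. v i) \<in> carrier (direct_sum I M)"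
proof -
  have "{i \<in> I. (\<lambda>i\<in>I. v i) i \<noteq> \<zero>\<^bsub>M i\<^esub>} \<subseteq> E" using assms(3) by auto
  then show ?thesis
    using finite_subset[OF _ assms(2)] assms(1) by (auto simp: direct_sum_def simp del: restrict_apply)
qed

lemma right_module_direct_sum:
  assumes "ring R" and M: "\<And>i. i \<in> I \<Longrightarrow> right_module R (M i)"
  shows "right_module R (direct_sum I M)"
proof -
  note M' = right_module.axioms(2)[OF M]
  note g = abelian_groupE[OF M']
  note l0 = abelian_monoid.l_zero[OF abelian_group.axioms(1)[OF M']]
  note mem = direct_sum_mem[of _ I M]
  let ?E = "\<lambda>v. {i \<in> I. v i \<noteq> \<zero>\<^bsub>M i\<^esub>}"
  have "abelian_group (direct_sum I M)"
  proof (rule abelian_groupI)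
    fix v assume v: "v \<in> carrier (direct_sum I M)"
    have inv: "\<ominus>\<^bsub>M i\<^esub> \<zero>\<^bsub>M i\<^esub> = \<zero>\<^bsub>M i\<^esub>" if "i \<in> I" for i
      using abelian_group.minus_equality[OF M'[OF that]] l0 g(2) that by metis
    show "\<exists>w\<in>carrier (direct_sum I M). w \<oplus>\<^bsub>direct_sum I M\<^esub> v = \<zero>\<^bsub>direct_sum I M\<^esub>"
    proof (rule bexI)
      show "(\<lambda>i\<in>I. \<ominus>\<^bsub>M i\<^esub> v i) \<oplus>\<^bsub>direct_sum I M\<^esub> v = \<zero>\<^bsub>direct_sum I M\<^esub>"
        using mem[OF v] abelian_group.l_neg[OF M'] by (auto simp: direct_sum_simps restrict_def)
      show "(\<lambda>i\<in>I. \<ominus>\<^bsub>M i\<^esub> v i) \<in> carrier (direct_sum I M)"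
        using mem[OF v] by (intro restrict_in_direct_sum[where E = "?E v"])
          (auto simp: inv abelian_group.a_inv_closed[OF M'])
    qed
    show "\<zero>\<^bsub>direct_sum I M\<^esub> \<oplus>\<^bsub>direct_sum I M\<^esub> v = v"
      using mem[OF v] l0 by (intro ext) (auto simp: direct_sum_simps restrict_def)
    fix w assume w: "w \<in> carrier (direct_sum I M)"
    show "v \<oplus>\<^bsub>direct_sum I M\<^esub> w \<in> carrier (direct_sum I M)"
      unfolding direct_sum_simps using mem[OF v] mem[OF w]
      by (intro restrict_in_direct_sum[where E = "?E v \<union> ?E w"]) (auto simp: g(1,2) l0)
    show "v \<oplus>\<^bsub>direct_sum I M\<^esub> w = w \<oplus>\<^bsub>direct_sum I M\<^esub> v"
      unfolding direct_sum_simps by (rule restrict_ext, rule g(4)) (auto simp: mem[OF v] mem[OF w])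
    fix u assume u: "u \<in> carrier (direct_sum I M)"
    show "v \<oplus>\<^bsub>direct_sum I M\<^esub> w \<oplus>\<^bsub>direct_sum I M\<^esub> u = v \<oplus>\<^bsub>direct_sum I M\<^esub> (w \<oplus>\<^bsub>direct_sum I M\<^esub> u)"
      unfolding direct_sum_simps
      by (rule restrict_ext) (simp add: g(3) mem[OF v] mem[OF w] mem[OF u])
  next
    show "\<zero>\<^bsub>direct_sum I M\<^esub> \<in> carrier (direct_sum I M)"
      unfolding direct_sum_simps by (rule restrict_in_direct_sum[where E = "{}"]) (auto simp: g(2))
  qed
  moreover have "right_module_axioms R (direct_sum I M)"
  proof
    fix v a assume v: "v \<in> carrier (direct_sum I M)" and a: "a \<in> carrier R"
    show "a \<odot>\<^bsub>direct_sum I M\<^esub> v \<in> carrier (direct_sum I M)"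
      unfolding direct_sum_simps
      using mem[OF v] a abelian_group_hom.hom_zero[OF right_module.smult_hom[OF M]]
      by (intro restrict_in_direct_sum[where E = "?E v"]) (auto simp: right_module.smult_closed[OF M])
    fix b assume b: "b \<in> carrier R"
    show "(a \<oplus>\<^bsub>R\<^esub> b) \<odot>\<^bsub>direct_sum I M\<^esub> v = a \<odot>\<^bsub>direct_sum I M\<^esub> v \<oplus>\<^bsub>direct_sum I M\<^esub> b \<odot>\<^bsub>direct_sum I M\<^esub> v"
      unfolding direct_sum_simps
      by (rule restrict_ext) (simp add: right_module.smult_scalar_distr[OF M] mem[OF v] a b)
    show "(a \<otimes>\<^bsub>R\<^esub> b) \<odot>\<^bsub>direct_sum I M\<^esub> v = b \<odot>\<^bsub>direct_sum I M\<^esub> (a \<odot>\<^bsub>direct_sum I M\<^esub> v)"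
      unfolding direct_sum_simps
      by (rule restrict_ext) (simp add: right_module.smult_assoc[OF M] mem[OF v] a b)
  next
    fix v w a
    assume v: "v \<in> carrier (direct_sum I M)" "w \<in> carrier (direct_sum I M)" and a: "a \<in> carrier R"
    show "a \<odot>\<^bsub>direct_sum I M\<^esub> (v \<oplus>\<^bsub>direct_sum I M\<^esub> w) = a \<odot>\<^bsub>direct_sum I M\<^esub> v \<oplus>\<^bsub>direct_sum I M\<^esub> a \<odot>\<^bsub>direct_sum I M\<^esub> w"
      unfolding direct_sum_simps
      by (rule restrict_ext)
        (simp add: right_module.smult_vector_distr[OF M] mem[OF v(1)] mem[OF v(2)] a)
  next
    fix v assume v: "v \<in> carrier (direct_sum I M)"
    show "\<one>\<^bsub>R\<^esub> \<odot>\<^bsub>direct_sum I M\<^esub> v = v"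
      using mem[OF v] by (intro ext) (auto simp: direct_sum_simps right_module.smult_one[OF M])
  qed
  ultimately show ?thesis using assms(1) by (simp add: right_module_def)
qed

lemma linear_map_direct_sum_proj:
  assumes "ring R" "\<And>i. i \<in> I \<Longrightarrow> right_module R (M i)" "i \<in> I"
  shows "linear_map R (direct_sum I M) (M i) (\<lambda>v. v i)"
  using assms(3) direct_sum_mem(1)[of _ I M i] unfolding direct_sum_simps
  by (intro linear_mapI[OF right_module_direct_sum[OF assms(1,2)] assms(2)])
    (simp_all add: direct_sum_simps)

lemma linear_map_into_direct_sum:
  assumes "finite I" "right_module R W" and f: "\<And>i. i \<in> I \<Longrightarrow> linear_map R W (M i) (\<lambda>w. f w i)"
  shows "linear_map R W (direct_sum I M) (\<lambda>w. \<lambda>i\<in>I. f w i)"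
proof (rule linear_mapI)
  show "right_module R (direct_sum I M)"
    using right_module_direct_sum[OF right_moduleD(2)[OF assms(2)] linear_map_modules(2)[OF f]] .
  fix w assume w: "w \<in> carrier W"
  show "(\<lambda>i\<in>I. f w i) \<in> carrier (direct_sum I M)"
    using linear_map_closed[OF f w] assms(1) by (auto simp: direct_sum_simps)
  show "(\<lambda>i\<in>I. f (a \<odot>\<^bsub>W\<^esub> w) i) = a \<odot>\<^bsub>direct_sum I M\<^esub> (\<lambda>i\<in>I. f w i)" if "a \<in> carrier R" for a
    unfolding direct_sum_simps by (rule restrict_ext) (simp add: linear_map_smult[OF f that w])
  fix w' assume w': "w' \<in> carrier W"
  show "(\<lambda>i\<in>I. f (w \<oplus>\<^bsub>W\<^esub> w') i) = (\<lambda>i\<in>I. f w i) \<oplus>\<^bsub>direct_sum I M\<^esub> (\<lambda>i\<in>I. f w' i)"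
    unfolding direct_sum_simps by (rule restrict_ext) (simp add: linear_map_add[OF f w w'])
qed fact

section \<open>Incidence numbers\<close>

text \<open>Equal to (-1)^{i-1} when k is the i-th element of B: the sign that belongs to the face
  map d_i.\<close>

definition position_sign :: "nat set \<Rightarrow> nat \<Rightarrow> int" where
  "position_sign B k = (-1) ^ card {x \<in> B. x < k}"

lemma sorted_list_of_set_unique_list:
  "sorted_wrt (<) xs \<Longrightarrow> set xs = (A :: nat set) \<Longrightarrow> sorted_list_of_set A = xs"
  using sorted_list_of_set.idem_if_sorted_distinct[of xs] by (auto simp: strict_sorted_iff)

text \<open>\<open>foldr\<close> applies the face with the largest index first. Deleting the
  elements at positions beyond j leaves the first j entries of the increasing list untouched, so
  each face removes the element which had that position in B itself.\<close>

lemma foldr_face: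
  assumes "finite B" "sorted_wrt (<) js" "set js \<subseteq> {1..card B}"
  shows "foldr face js B = B - (\<lambda>j. sorted_list_of_set B ! (j - 1)) ` set js"
  using assms(2,3)
proof (induction js)
  case (Cons j js)
  let ?z = "sorted_list_of_set B"
  let ?B = "B - (\<lambda>j. ?z ! (j - 1)) ` set js"
  have j: "j \<ge> 1" "j \<le> length ?z" "\<And>i. i \<in> set js \<Longrightarrow> j < i \<and> i \<le> length ?z"
    using Cons.prems assms(1) by auto
  have "sorted_list_of_set ?B = filter (\<lambda>x. x \<in> ?B) ?z"
    using assms(1) by (intro sorted_list_of_set_unique_list sorted_wrt_filter) auto
  also have "\<dots> = filter (\<lambda>x. x \<in> ?B) (take j ?z @ drop j ?z)" by simp
  also have "\<dots> = take j ?z @ filter (\<lambda>x. x \<in> ?B) (drop j ?z)"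
  proof -
    have "x \<in> ?B" if "x \<in> set (take j ?z)" for x
    proof -
      obtain i where i: "i < j" "i < length ?z" "x = ?z ! i"
        using \<open>x \<in> set (take j ?z)\<close> by (auto simp: in_set_conv_nth)
      have "x \<noteq> ?z ! (m - 1)" if "m \<in> set js" for m
      proof -
        have "j < m" "m \<le> length ?z" using j(3)[OF that] by auto
        then show ?thesis using i by (auto simp: nth_eq_iff_index_eq)
      qed
      then show ?thesis using i assms(1) nth_mem[of i ?z] by auto
    qed
    then show ?thesis by (simp only: filter_append filter_id_conv) (simp add: filter_id_conv)
  qed
  finally have "sorted_list_of_set ?B ! (j - 1) = ?z ! (j - 1)"
    using j(1,2) by (simp add: nth_append)
  moreover have "foldr face (j # js) B = face j ?B" using Cons by simp
  moreover have "?B - {?z ! (j - 1)} = B - (\<lambda>j. ?z ! (j - 1)) ` set (j # js)" by auto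
  ultimately show ?case by (metis face_def)
qed simp

lemma card_less_nth:
  assumes "finite B" "i < card B"
  shows "card {x \<in> B. x < sorted_list_of_set B ! i} = i"
proof -
  let ?z = "sorted_list_of_set B"
  have s: "sorted_wrt (<) ?z" by simp
  have "{x \<in> B. x < ?z ! i} = (\<lambda>m. ?z ! m) ` {..<i}"
  proof (intro Set.set_eqI iffI)
    fix x assume "x \<in> {x \<in> B. x < ?z ! i}"
    then obtain m where m: "m < length ?z" "x = ?z ! m" "?z ! m < ?z ! i"
      using assms by (metis (no_types, lifting) in_set_conv_nth mem_Collect_eq set_sorted_list_of_set)
    then have "m < i"
      using sorted_wrt_nth_less[OF s, of i m] by (metis less_asym' linorder_neqE_nat)
    then show "x \<in> (\<lambda>m. ?z ! m) ` {..<i}" using m by auto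
  next
    fix x assume "x \<in> (\<lambda>m. ?z ! m) ` {..<i}"
    then obtain m where "m < i" "x = ?z ! m" by auto
    then show "x \<in> {x \<in> B. x < ?z ! i}"
      using sorted_wrt_nth_less[OF s, of m i] nth_mem[of m ?z] assms by auto
  qed
  also have "card \<dots> = i"
    using assms by (subst card_image) (auto simp: inj_on_def nth_eq_iff_index_eq)
  finally show ?thesis .
qed

text \<open>The prefactor (-1)^{b-a} supplies one sign for each removed element, and i + 1 has the
  parity of i - 1. The total incidence number is thus multiplicative over the removed elements, with
  positions counted in B throughout.\<close>

lemma incidence_eq:
  assumes "finite B" "A \<subseteq> B"
  shows "incidence B A = (\<Prod>c\<in>B - A. position_sign B c)"
proof -
  let ?z = "sorted_list_of_set B"
  let ?f = "\<lambda>j. ?z ! (j - 1)"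
  \<comment> \<open>The positions in B of the elements to be removed. The list described in the
    definition has to be J in increasing order.\<close>
  define J where "J = {j \<in> {1..card B}. ?f j \<in> B - A}"
  have inj: "inj_on ?f {1..card B}"
    using assms(1) by (auto simp: inj_on_def nth_eq_iff_index_eq)
  have surj: "?f ` {1..card B} = B"
  proof (intro Set.set_eqI iffI)
    fix x assume "x \<in> B"
    then obtain i where "i < card B" "x = ?z ! i"
      using assms(1) by (metis in_set_conv_nth length_sorted_list_of_set set_sorted_list_of_set)
    then show "x \<in> ?f ` {1..card B}" by (intro image_eqI[of _ _ "Suc i"]) auto
  next
    fix x assume "x \<in> ?f ` {1..card B}"
    then obtain j where "j \<in> {1..card B}" "x = ?f j" by auto
    then show "x \<in> B" using assms(1) nth_mem[of "j - 1" ?z] by auto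
  qed
  have "?f ` J = ?f ` {1..card B} \<inter> (B - A)" unfolding J_def by auto
  then have img: "?f ` J = B - A" unfolding surj by auto
  have injJ: "inj_on ?f J" using inj by (rule inj_on_subset) (auto simp: J_def)
  have finJ: "finite J" by (simp add: J_def)
  have cardJ: "card J = card B - card A"
    using card_image[OF injJ] img assms by (simp add: card_Diff_subset finite_subset)
  have "(THE js. sorted_wrt (<) js \<and> set js \<subseteq> {1..card B}
           \<and> length js = card B - card A \<and> foldr face js B = A) = sorted_list_of_set J"
  proof (rule the_equality)
    have "foldr face (sorted_list_of_set J) B = B - ?f ` J"
      using assms(1) finJ by (subst foldr_face) (auto simp: J_def)
    then show "sorted_wrt (<) (sorted_list_of_set J) \<and> set (sorted_list_of_set J) \<subseteq> {1..card B}
      \<and> length (sorted_list_of_set J) = card B - card A \<and> foldr face (sorted_list_of_set J) B = A"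
      using img assms finJ cardJ by (auto simp: J_def)
  next
    fix js
    assume js: "sorted_wrt (<) js \<and> set js \<subseteq> {1..card B}
      \<and> length js = card B - card A \<and> foldr face js B = A"
    then have eq: "B - ?f ` set js = A" using foldr_face[OF assms(1), of js] by auto
    have sub: "?f ` set js \<subseteq> B" using js surj by blast
    \<comment> \<open>Distinct positions carry distinct elements, so the removed set determines the
      positions.\<close>
    have "set js = J"
    proof (intro Set.set_eqI iffI)
      fix j assume j: "j \<in> set js"
      then have "?f j \<in> B" "?f j \<notin> A" using eq sub by blast+
      then show "j \<in> J" using js j by (auto simp: J_def)
    next
      fix j assume j: "j \<in> J"
      then have "?f j \<in> ?f ` set js" using eq assms(2) by (auto simp: J_def)
      then obtain i where i: "i \<in> set js" "?f j = ?f i" by blast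
      have "i \<in> {1..card B}" "j \<in> {1..card B}" using i(1) j js unfolding J_def by blast+
      then have "j = i" using inj_onD[OF inj i(2)] by blast
      then show "j \<in> set js" using i(1) by simp
    qed
    then show "js = sorted_list_of_set J" using sorted_list_of_set_unique_list js by metis
  qed
  then have "incidence B A = (-1) ^ card J * (-1) ^ sum_list (sorted_list_of_set J)"
    by (simp add: incidence_def cardJ)
  also have "sum_list (sorted_list_of_set J) = (\<Sum>j\<in>J. j)"
    using finJ by (simp add: sum_list_distinct_conv_sum_set[of _ "\<lambda>x. x", simplified])
  also have "(-1 :: int) ^ card J * (-1) ^ (\<Sum>j\<in>J. j) = (\<Prod>j\<in>J. (-1) ^ (j - 1))"
  proof -
    have "(-1 :: int) ^ card J * (-1) ^ (\<Sum>j\<in>J. j) = (\<Prod>j\<in>J. (-1) * (-1) ^ j)"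
      by (simp only: power_sum prod.distrib prod_constant)
    \<comment> \<open>Positions start at 1, so j - 1 is a genuine difference of naturals.\<close>
    also have "\<dots> = (\<Prod>j\<in>J. (-1) ^ (j - 1))"
    proof (rule prod.cong)
      fix j assume "j \<in> J"
      then obtain i where "j = Suc i" by (cases j) (auto simp: J_def)
      then show "(-1 :: int) * (-1) ^ j = (-1) ^ (j - 1)" by simp
    qed simp
    finally show ?thesis .
  qed
  also have "\<dots> = (\<Prod>j\<in>J. position_sign B (?f j))"
    using card_less_nth[OF assms(1)] by (intro prod.cong) (auto simp: J_def position_sign_def)
  also have "\<dots> = (\<Prod>c\<in>B - A. position_sign B c)"
    using prod.reindex[OF injJ, of "position_sign B"] img by simp
  finally show ?thesis .
qed

text \<open>The scalar in front of the entry D_{B,A} of a totalisation.\<close>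

definition entry_sign :: "nat set \<Rightarrow> nat set \<Rightarrow> int" where
  "entry_sign B A = (-1) ^ (card A * card B) * incidence B A"

text \<open>The exponent b^2 has the parity of b.\<close>

lemma entry_sign_refl: "finite B \<Longrightarrow> entry_sign B B = (-1) ^ card B"
  by (simp add: entry_sign_def incidence_eq minus_one_power_iff)

text \<open>The exponent ab is a product of consecutive integers, hence even, and only the sign of
  the position of k survives.\<close>

lemma entry_sign_face:
  assumes "finite B" "k \<in> B"
  shows "entry_sign B (B - {k}) = position_sign B k"
proof -
  obtain n where n: "card B = Suc n" using assms by (metis card_gt_0_iff empty_iff gr0_conv_Suc)
  have "B - (B - {k}) = {k}" using assms by auto
  then show ?thesis
    using assms n by (simp add: entry_sign_def incidence_eq minus_one_power_iff)
qed

lemma position_sign_remove: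
  assumes "finite B" "k \<in> B"
  shows "position_sign (B - {k}) c = (if k < c then - position_sign B c else position_sign B c)"
proof (cases "k < c")
  case True
  then have eq: "{x \<in> B. x < c} = insert k {x \<in> B - {k}. x < c}" using assms by auto
  have "card {x \<in> B. x < c} = Suc (card {x \<in> B - {k}. x < c})"
    unfolding eq using assms by (subst card_insert_disjoint) auto
  then show ?thesis using True by (simp add: position_sign_def)
next
  case False
  then have "{x \<in> B. x < c} = {x \<in> B - {k}. x < c}" by auto
  then show ?thesis using False by (simp add: position_sign_def)
qed

text \<open>The sign bookkeeping behind P = h (1 + G P). On the left stand the sign of the edge from
  B - {k} to B, the sign of G at B - {k} and the matrix sign of the remaining step; on the right the
  matrix sign at (B, A) and the sign of moving k to the front of B - A. Deleting k reverses the
  position signs of exactly those c in B - A that exceed k, and passing from a(b-1) to ab in the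
  exponent contributes (-1)^a. As b - 1 equals a plus the number of elements of B - A other than k,
  what is left over counts the elements of B - A below k.\<close>

lemma entry_sign_step:
  assumes "finite B" "A \<subseteq> B" "k \<in> B - A"
  shows "position_sign B k * ((-1) ^ (card B - 1) * entry_sign (B - {k}) A)
       = entry_sign B A * position_sign (B - A) k"
proof -
  let ?S = "B - A"
  let ?p = "\<Prod>c\<in>?S. position_sign B c"
  let ?lt = "{x \<in> ?S. x < k}" and ?gt = "{x \<in> ?S. k < x}"
  have fin: "finite A" "finite ?S" using assms finite_subset by auto
  obtain n where n: "card B = Suc n"
    using assms by (metis DiffD1 card_gt_0_iff empty_iff gr0_conv_Suc)
  have S: "?S = insert k (?S - {k})" using assms by auto
  have "incidence (B - {k}) A = (\<Prod>c\<in>?S - {k}. position_sign (B - {k}) c)"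
    using assms by (subst incidence_eq) (auto intro!: prod.cong)
  also have "\<dots> = (\<Prod>c\<in>?S - {k}. position_sign B c * (if k < c then -1 else 1))"
    using assms by (intro prod.cong) (auto simp: position_sign_remove)
  also have "\<dots> = (\<Prod>c\<in>?S - {k}. position_sign B c) * (\<Prod>c\<in>?S - {k}. if k < c then -1 else 1)"
    by (rule prod.distrib)
  also have "(\<Prod>c\<in>?S - {k}. if k < c then -1 else 1 :: int) = (-1) ^ card ?gt"
  proof -
    have "(\<Prod>c\<in>?S - {k}. if k < c then -1 else 1 :: int) = (\<Prod>c\<in>?gt. -1)"
      using fin by (intro prod.mono_neutral_cong_right) auto
    then show ?thesis by simp
  qed
  finally have 1: "incidence (B - {k}) A = (\<Prod>c\<in>?S - {k}. position_sign B c) * (-1) ^ card ?gt" .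
  have "?p = position_sign B k * (\<Prod>c\<in>?S - {k}. position_sign B c)"
    using fin assms by (subst prod.remove[of _ k]) auto
  then have 2: "position_sign B k * incidence (B - {k}) A = incidence B A * (-1) ^ card ?gt"
    using assms(1,2) 1 by (simp add: incidence_eq)
  have "card ?S = Suc (card ?lt + card ?gt)"
  proof -
    have "?S = insert k (?lt \<union> ?gt)" using assms by auto
    then have "card ?S = card (insert k (?lt \<union> ?gt))" by (rule arg_cong)
    also have "\<dots> = Suc (card (?lt \<union> ?gt))" using fin by (intro card_insert_disjoint) auto
    also have "card (?lt \<union> ?gt) = card ?lt + card ?gt"
    proof (rule card_Un_disjoint)
      show "?lt \<inter> ?gt = {}" by (rule equals0I) (simp, meson less_asym)
    qed (simp_all add: assms(1))
    finally show ?thesis .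
  qed
  moreover have "card ?S = card B - card A" "card A \<le> card B"
    using assms fin by (auto simp: card_Diff_subset intro: card_mono)
  ultimately have 3: "card A + card ?lt + card ?gt = n" using n by linarith
  have "position_sign B k * ((-1) ^ (card B - 1) * entry_sign (B - {k}) A)
      = (-1) ^ n * (-1) ^ (card A * n) * (position_sign B k * incidence (B - {k}) A)"
    using assms n by (simp add: entry_sign_def mult_ac)
  also have "\<dots> = (-1) ^ n * (-1) ^ (card A * n) * incidence B A * (-1) ^ card ?gt"
    by (simp only: 2 mult_ac)
  also have "\<dots> = ((-1) ^ (card A * Suc n) * incidence B A) * ((-1) ^ n * (-1) ^ card A * (-1) ^ card ?gt)"
    by (simp add: power_add algebra_simps minus_one_power_iff)
  also have "(-1) ^ n * (-1) ^ card A * (-1) ^ card ?gt = (-1 :: int) ^ card ?lt"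
    unfolding 3[symmetric] by (simp add: power_add minus_one_power_iff)
  finally show ?thesis by (simp add: entry_sign_def n position_sign_def)
qed

section \<open>Alternating sums of zigzags\<close>

text \<open>For distinct entries this is the cycle z_1 -> k, z_2 -> z_1, ..., k -> z_r. Written as a
  product of r transpositions, its sign can be read off.\<close>

fun initial_cycle :: "nat list \<Rightarrow> nat \<Rightarrow> nat \<Rightarrow> nat" where
  "initial_cycle [] k = id"
| "initial_cycle (z # zs) k = transpose z k \<circ> initial_cycle zs k"

lemma initial_cycle_permutes: "initial_cycle zs k permutes insert k (set zs)"
proof (induction zs)
  case (Cons z zs)
  then have "initial_cycle zs k permutes insert k (set (z # zs))"
    by (rule permutes_subset) auto
  then show ?case
    unfolding initial_cycle.simps by (rule permutes_compose) (rule permutes_swap_id, auto)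
qed (simp add: permutes_def)

lemma map_initial_cycle:
  "distinct (zs @ k # ws) \<Longrightarrow> map (initial_cycle zs k) (zs @ k # ws) = k # zs @ ws"
proof (induction zs)
  case (Cons z zs)
  have step: "initial_cycle (z # zs) k = transpose z k \<circ> initial_cycle zs k" by auto
  have "initial_cycle zs k z = z"
    using Cons.prems permutes_not_in[OF initial_cycle_permutes] by auto
  moreover have "map (initial_cycle (z # zs) k) ((z # zs) @ k # ws)
      = map (transpose z k) (initial_cycle zs k z # map (initial_cycle zs k) (zs @ k # ws))"
    unfolding step by simp
  moreover have "map (transpose z k) (zs @ ws) = zs @ ws"
    using Cons.prems by (intro map_idI) (auto simp: transpose_def)
  moreover have "map (initial_cycle zs k) (zs @ k # ws) = k # zs @ ws" using Cons by simp
  ultimately show ?case by (simp only: list.map transpose_apply_first transpose_apply_second append_Cons)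
qed simp

lemma sign_initial_cycle: "k \<notin> set zs \<Longrightarrow> sign (initial_cycle zs k) = (-1) ^ length zs"
proof (induction zs)
  case (Cons z zs)
  have step: "initial_cycle (z # zs) k = transpose z k \<circ> initial_cycle zs k" by auto
  have "permutation (initial_cycle zs k)"
    using initial_cycle_permutes permutation_permutes by blast
  then show ?case
    unfolding step using Cons by (simp add: sign_compose permutation_swap_id sign_swap_id del: o_apply)
qed simp

text \<open>Moves k to the front of the increasing enumeration of S and keeps the order of the other
  elements. Its sign counts the elements that k has to pass.\<close>

definition removal_cycle :: "nat set \<Rightarrow> nat \<Rightarrow> nat \<Rightarrow> nat" where
  "removal_cycle S k = initial_cycle (sorted_list_of_set {x \<in> S. x < k}) k"

lemma removal_cycle:
  assumes "finite S" "k \<in> S"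
  shows "removal_cycle S k permutes S"
    "map (removal_cycle S k) (sorted_list_of_set S) = k # sorted_list_of_set (S - {k})"
    "sign (removal_cycle S k) = position_sign S k"
proof -
  let ?lt = "sorted_list_of_set {x \<in> S. x < k}" and ?gt = "sorted_list_of_set {x \<in> S. k < x}"
  show "removal_cycle S k permutes S"
    unfolding removal_cycle_def using assms
    by (intro permutes_subset[OF initial_cycle_permutes]) auto
  have S: "sorted_list_of_set S = ?lt @ k # ?gt"
    using assms by (intro sorted_list_of_set_unique_list) (auto simp: sorted_wrt_append)
  have S': "sorted_list_of_set (S - {k}) = ?lt @ ?gt"
    using assms by (intro sorted_list_of_set_unique_list) (auto simp: sorted_wrt_append)
  have "distinct (?lt @ k # ?gt)"
    unfolding S[symmetric] by simp
  then show "map (removal_cycle S k) (sorted_list_of_set S) = k # sorted_list_of_set (S - {k})"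
    unfolding removal_cycle_def S S' by (rule map_initial_cycle)
  show "sign (removal_cycle S k) = position_sign S k"
    unfolding removal_cycle_def using assms
    by (subst sign_initial_cycle) (auto simp: position_sign_def)
qed

text \<open>Expansion of the symmetric group by the value at the smallest element, as in the Laplace
  expansion of a determinant. The cycle sends the smallest element to k and \<tau> fixes k, so k is
  recovered as the value of the composite there, and then \<tau> by cancelling the cycle.\<close>

lemma bij_betw_removal_cycle:
  assumes "finite S" "S \<noteq> {}"
  shows "bij_betw (\<lambda>(k, \<tau>). \<tau> \<circ> removal_cycle S k) (SIGMA k:S. {\<tau>. \<tau> permutes S - {k}}) {\<sigma>. \<sigma> permutes S}"
proof -
  let ?z = "hd (sorted_list_of_set S)"
  have z: "?z \<in> S" using assms by (metis hd_in_set set_sorted_list_of_set sorted_list_of_set_eq_Nil_iff)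
  have cz: "removal_cycle S k ?z = k" if "k \<in> S" for k
    using removal_cycle(2)[OF assms(1) that] by (metis list.sel(1) list.map_sel(1) list.simps(3) list.map_disc_iff)
  show ?thesis
  proof (rule bij_betwI')
    fix p q assume pq: "p \<in> (SIGMA k:S. {\<tau>. \<tau> permutes S - {k}})" "q \<in> (SIGMA k:S. {\<tau>. \<tau> permutes S - {k}})"
    obtain k \<tau> where p: "p = (k, \<tau>)" by (cases p)
    obtain k' \<tau>' where q: "q = (k', \<tau>')" by (cases q)
    have k: "k \<in> S" "\<tau> permutes S - {k}" "k' \<in> S" "\<tau>' permutes S - {k'}" using pq p q by auto
    show "((case p of (k, \<tau>) \<Rightarrow> \<tau> \<circ> removal_cycle S k) = (case q of (k, \<tau>) \<Rightarrow> \<tau> \<circ> removal_cycle S k)) = (p = q)"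
    proof
      assume "(case p of (k, \<tau>) \<Rightarrow> \<tau> \<circ> removal_cycle S k) = (case q of (k, \<tau>) \<Rightarrow> \<tau> \<circ> removal_cycle S k)"
      then have eq: "\<tau> \<circ> removal_cycle S k = \<tau>' \<circ> removal_cycle S k'" by (simp add: p q)
      then have "\<tau> k = \<tau>' k'" using cz k(1,3) by (metis comp_apply)
      then have kk: "k = k'" using permutes_not_in[OF k(2)] permutes_not_in[OF k(4)] by simp
      have rc: "removal_cycle S k permutes S" using removal_cycle(1)[OF assms(1) k(1)] .
      have "\<tau> \<circ> removal_cycle S k \<circ> inv_into UNIV (removal_cycle S k) = \<tau>' \<circ> removal_cycle S k \<circ> inv_into UNIV (removal_cycle S k)"
        using eq kk by simp
      then have "\<tau> = \<tau>'" using permutes_inv_o(1)[OF rc] by (simp only: comp_assoc comp_id)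
      then show "p = q" using kk p q by simp
    qed simp
  next
    fix p assume "p \<in> (SIGMA k:S. {\<tau>. \<tau> permutes S - {k}})"
    then obtain k \<tau> where p: "p = (k, \<tau>)" "k \<in> S" "\<tau> permutes S - {k}" by auto
    then have "\<tau> permutes S" by (auto intro: permutes_subset)
    then show "(case p of (k, \<tau>) \<Rightarrow> \<tau> \<circ> removal_cycle S k) \<in> {\<sigma>. \<sigma> permutes S}"
      using p removal_cycle(1)[OF assms(1)] by (auto intro: permutes_compose)
  next
    fix \<sigma> assume "\<sigma> \<in> {\<sigma>. \<sigma> permutes S}"
    then have s: "\<sigma> permutes S" by simp
    define k where "k = \<sigma> ?z"
    have k: "k \<in> S" using z s permutes_in_image unfolding k_def by metis
    \<comment> \<open>The only candidate. It fixes k because the inverse cycle takes k back to the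
      smallest element, and hence permutes the smaller set.\<close>
    define \<tau> where "\<tau> = \<sigma> \<circ> inv_into UNIV (removal_cycle S k)"
    note c = removal_cycle(1)[OF assms(1) k]
    have "\<tau> permutes S" unfolding \<tau>_def using c s permutes_compose permutes_inv by metis
    moreover have "inv_into UNIV (removal_cycle S k) k = ?z" using cz[OF k] c by (metis permutes_inverses(2))
    then have "\<tau> k = k" by (simp add: \<tau>_def k_def)
    ultimately have "\<tau> permutes S - {k}" using permutes_superset[of \<tau> S "S - {k}"] by auto
    moreover have "\<sigma> = \<tau> \<circ> removal_cycle S k"
      unfolding \<tau>_def using c by (simp add: comp_assoc permutes_inv_o)
    ultimately show "\<exists>p\<in>(SIGMA k:S. {\<tau>. \<tau> permutes S - {k}}). \<sigma> = (case p of (k, \<tau>) \<Rightarrow> \<tau> \<circ> removal_cycle S k)"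
      using k by force
  qed
qed

text \<open>The sum inside H_S, without the outer maps \<alpha> and \<beta>, so that the cubes on C
  and on D share it. For a singleton it is h_k itself, which puts edges and higher maps on the same
  footing.\<close>

definition alternating_zigzag ::
  "(int \<Rightarrow> ('r, 'm) module) \<Rightarrow> (nat \<Rightarrow> int \<Rightarrow> 'm \<Rightarrow> 'm) \<Rightarrow> (int \<Rightarrow> 'm \<Rightarrow> 'm) \<Rightarrow> nat set \<Rightarrow> int \<Rightarrow> 'm \<Rightarrow> 'm" where
  "alternating_zigzag M h G S l y =
    (\<Oplus>\<^bsub>M (l + 1 - int (card S))\<^esub>\<sigma>\<in>{\<sigma>. \<sigma> permutes S}.
      [(sign \<sigma>)] \<cdot>\<^bsub>M (l + 1 - int (card S))\<^esub> (zigzag h G (map \<sigma> (sorted_list_of_set S)) l y))"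

lemma zigzag_Cons:
  "ks \<noteq> [] \<Longrightarrow> zigzag h G (k # ks) l x
    = h k (l - int (length ks)) (G (l + 1 - int (length ks)) (zigzag h G ks l x))"
  by (cases ks) (simp_all add: algebra_simps)

locale zigzag_data =
  fixes R :: "('r, 'x) ring_scheme" and N :: "nat set" and M :: "int \<Rightarrow> ('r, 'm) module"
    and h :: "nat \<Rightarrow> int \<Rightarrow> 'm \<Rightarrow> 'm" and G :: "int \<Rightarrow> 'm \<Rightarrow> 'm"
  assumes h_linear: "\<And>k l. k \<in> N \<Longrightarrow> linear_map R (M l) (M l) (h k l)"
    and G_linear: "\<And>l. linear_map R (M l) (M (l - 1)) (G l)"
    and finite_N: "finite N"
begin

lemma modules: "right_module R (M l)"
  using G_linear by (rule linear_map_modules)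

lemma zigzag_linear:
  "ks \<noteq> [] \<Longrightarrow> set ks \<subseteq> N \<Longrightarrow> linear_map R (M l) (M (l + 1 - int (length ks))) (zigzag h G ks l)"
proof (induction ks)
  case (Cons k ks)
  show ?case
  proof (cases "ks = []")
    case True
    have "zigzag h G [k] l = h k l" by auto
    then show ?thesis using True Cons h_linear by simp
  next
    case False
    have 1: "linear_map R (M l) (M (l + 1 - int (length ks))) (zigzag h G ks l)"
      using Cons False by simp
    have 2: "linear_map R (M (l + 1 - int (length ks))) (M (l - int (length ks))) (G (l + 1 - int (length ks)))"
      using G_linear[of "l + 1 - int (length ks)"] by simp
    have 3: "linear_map R (M (l - int (length ks))) (M (l - int (length ks))) (h k (l - int (length ks)))"
      using Cons.prems by (intro h_linear) simp
    show ?thesis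
      using linear_map_compose[OF linear_map_compose[OF 1 2] 3] zigzag_Cons[OF False, of h G k l]
      by simp
  qed
qed simp

lemma alternating_zigzag_linear:
  assumes "S \<noteq> {}" "S \<subseteq> N"
  shows "linear_map R (M l) (M (l + 1 - int (card S))) (alternating_zigzag M h G S l)"
proof -
  have fin: "finite S" using assms finite_N finite_subset by blast
  have "linear_map R (M l) (M (l + 1 - int (card S))) (zigzag h G (map \<sigma> (sorted_list_of_set S)) l)"
    if "\<sigma> permutes S" for \<sigma>
    using zigzag_linear[of "map \<sigma> (sorted_list_of_set S)" l] permutes_image[OF that] fin assms by simp
  then show ?thesis
    unfolding alternating_zigzag_def[abs_def]
    by (intro linear_map_sum linear_map_int_multiple modules) auto
qed

text \<open>The matrix entries, up to sign, of 1 + G P: the empty set gives the identity, every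
  other set one more G in front of the alternating sum.\<close>

definition homotopy_zigzag :: "nat set \<Rightarrow> int \<Rightarrow> 'm \<Rightarrow> 'm" where
  "homotopy_zigzag S l y = (if S = {} then y else G (l + 1 - int (card S)) (alternating_zigzag M h G S l y))"

lemma homotopy_zigzag_linear:
  assumes "S \<subseteq> N"
  shows "linear_map R (M l) (M (l - int (card S))) (homotopy_zigzag S l)"
proof (cases "S = {}")
  case True
  then show ?thesis by (simp add: homotopy_zigzag_def[abs_def] linear_map_ident modules)
next
  case False
  from linear_map_compose[OF alternating_zigzag_linear[OF False assms] G_linear]
  show ?thesis using False by (simp add: homotopy_zigzag_def[abs_def])
qed

text \<open>Group the permutations by their first value k. The leading factor is then h_k, the rest
  is an alternating sum over S - {k}, and the sign splits off as that of moving k to the front. This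
  is P = h (1 + G P) for one pair of sets.\<close>

lemma alternating_zigzag_rec:
  assumes "S \<noteq> {}" "S \<subseteq> N" "y \<in> carrier (M l)"
  shows "alternating_zigzag M h G S l y = (\<Oplus>\<^bsub>M (l + 1 - int (card S))\<^esub>k\<in>S.
    [(position_sign S k)] \<cdot>\<^bsub>M (l + 1 - int (card S))\<^esub>
      h k (l + 1 - int (card S)) (homotopy_zigzag (S - {k}) l y))"
proof -
  let ?K = "M (l + 1 - int (card S))"
  interpret K: right_module R ?K by (rule modules)
  have fin: "finite S" using assms finite_N finite_subset by blast
  let ?F = "\<lambda>\<sigma>. [(sign \<sigma>)] \<cdot>\<^bsub>?K\<^esub> (zigzag h G (map \<sigma> (sorted_list_of_set S)) l y)"
  have zcl: "zigzag h G (map \<sigma> (sorted_list_of_set S)) l y \<in> carrier ?K" if "\<sigma> permutes S" for \<sigma>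
    using linear_map_closed[OF zigzag_linear[of "map \<sigma> (sorted_list_of_set S)" l] assms(3)]
      permutes_image[OF that] fin assms by simp
  then have Fcl: "?F \<sigma> \<in> carrier ?K" if "\<sigma> permutes S" for \<sigma>
    using that by (simp add: K.M.int_smult_closed)
  note bij = bij_betw_removal_cycle[OF fin assms(1)]
  have perm: "\<tau> \<circ> removal_cycle S k permutes S" if "k \<in> S" "\<tau> permutes S - {k}" for k \<tau>
    using bij_betw_apply[OF bij, of "(k, \<tau>)"] that by simp
  have "alternating_zigzag M h G S l y
      = (\<Oplus>\<^bsub>?K\<^esub>p\<in>(SIGMA k:S. {\<tau>. \<tau> permutes S - {k}}). ?F (case p of (k, \<tau>) \<Rightarrow> \<tau> \<circ> removal_cycle S k))"
    unfolding alternating_zigzag_def bij_betw_imp_surj_on[OF bij, symmetric]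
    using bij_betw_imp_surj_on[OF bij] Fcl
    by (intro K.M.finsum_reindex bij_betw_imp_inj_on[OF bij]) auto
  also have "\<dots> = (\<Oplus>\<^bsub>?K\<^esub>k\<in>S. \<Oplus>\<^bsub>?K\<^esub>\<tau>\<in>{\<tau>. \<tau> permutes S - {k}}. ?F (\<tau> \<circ> removal_cycle S k))"
    using fin Fcl perm
    by (subst K.M.finsum_Sigma) (auto simp: finite_permutations split_def)
  also have "\<dots> = (\<Oplus>\<^bsub>?K\<^esub>k\<in>S. [(position_sign S k)] \<cdot>\<^bsub>?K\<^esub>
      h k (l + 1 - int (card S)) (homotopy_zigzag (S - {k}) l y))"
  proof (rule K.M.finsum_cong'[OF refl])
    show "(\<lambda>k. [(position_sign S k)] \<cdot>\<^bsub>?K\<^esub> h k (l + 1 - int (card S)) (homotopy_zigzag (S - {k}) l y)) \<in> S \<rightarrow> carrier ?K"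
    proof
      fix k assume k: "k \<in> S"
      have "homotopy_zigzag (S - {k}) l y \<in> carrier ?K"
        using linear_map_closed[OF homotopy_zigzag_linear assms(3), of "S - {k}"] assms k fin
        by (auto simp: of_nat_diff Suc_leI card_gt_0_iff algebra_simps)
      then show "[(position_sign S k)] \<cdot>\<^bsub>?K\<^esub> h k (l + 1 - int (card S)) (homotopy_zigzag (S - {k}) l y) \<in> carrier ?K"
        using k assms linear_map_closed[OF h_linear] by (auto intro!: K.M.int_smult_closed)
    qed
    fix k assume k: "k \<in> S"
    then have kN: "k \<in> N" using assms by auto
    let ?T = "S - {k}"
    let ?g = "\<lambda>\<tau>. zigzag h G (map \<tau> (sorted_list_of_set ?T)) l y"
    have sgn: "sign (\<tau> \<circ> removal_cycle S k) = position_sign S k * sign \<tau>" if "\<tau> permutes ?T" for \<tau>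
      using removal_cycle(1,3)[OF fin k] that fin
      by (subst sign_compose) (auto simp: mult.commute intro!: permutation_permutes[THEN iffD2])
    have map: "map (\<tau> \<circ> removal_cycle S k) (sorted_list_of_set S) = k # map \<tau> (sorted_list_of_set ?T)"
      if "\<tau> permutes ?T" for \<tau>
      using arg_cong[OF removal_cycle(2)[OF fin k], of "map \<tau>"] permutes_not_in[OF that, of k] by simp
    show "(\<Oplus>\<^bsub>?K\<^esub>\<tau>\<in>{\<tau>. \<tau> permutes ?T}. ?F (\<tau> \<circ> removal_cycle S k))
        = [(position_sign S k)] \<cdot>\<^bsub>?K\<^esub> h k (l + 1 - int (card S)) (homotopy_zigzag ?T l y)"
    \<comment> \<open>If k is the only element, no G follows h_k; this is the value of
      \<open>homotopy_zigzag\<close> at the empty set.\<close>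
    proof (cases "?T = {}")
      case True
      then have S: "S = {k}" using k by auto
      have "{\<tau>. \<tau> permutes ?T} = {id}" by (simp add: True)
      moreover have "?F (\<tau> \<circ> removal_cycle S k) = [(position_sign S k)] \<cdot>\<^bsub>?K\<^esub> h k l y" if "\<tau> = id" for \<tau>
        using sgn[of \<tau>] map[of \<tau>] that True by (simp add: permutes_id sign_id)
      moreover have "h k l y \<in> carrier ?K"
        using linear_map_closed[OF h_linear[OF kN] assms(3)] S by simp
      ultimately have "(\<Oplus>\<^bsub>?K\<^esub>\<tau>\<in>{\<tau>. \<tau> permutes ?T}. ?F (\<tau> \<circ> removal_cycle S k))
          = [(position_sign S k)] \<cdot>\<^bsub>?K\<^esub> h k l y"
        using K.M.finsum_insert[of "{}" id "\<lambda>\<tau>. ?F (\<tau> \<circ> removal_cycle S k)"]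
        by (simp only: finite.emptyI empty_iff K.M.finsum_empty) (simp add: K.M.int_smult_closed)
      then show ?thesis by (simp add: homotopy_zigzag_def S)
    next
      case False
      have cardT: "int (card ?T) = int (card S) - 1"
        using k fin by (metis card_Suc_Diff1 of_nat_Suc add_diff_cancel_left')
      \<comment> \<open>The rest of the zigzag has one factor less, hence lives one degree higher; G
        brings it down again.\<close>
      let ?W = "M (l + 2 - int (card S))"
      interpret W: right_module R ?W by (rule modules)
      have TN: "?T \<subseteq> N" using assms by auto
      have gcl: "?g \<tau> \<in> carrier ?W" if "\<tau> permutes ?T" for \<tau>
        using linear_map_closed[OF zigzag_linear[of "map \<tau> (sorted_list_of_set ?T)" l] assms(3)]
          permutes_image[OF that] fin False TN cardT by (simp add: algebra_simps)
      have lin: "linear_map R ?W ?K (\<lambda>x. [(position_sign S k)] \<cdot>\<^bsub>?K\<^esub> h k (l + 1 - int (card S)) (G (l + 2 - int (card S)) x))"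
        using linear_map_int_multiple[OF linear_map_compose[OF G_linear[of "l + 2 - int (card S)"]], of "M (l + 1 - int (card S))"]
          h_linear[OF kN, of "l + 1 - int (card S)"] by (simp add: algebra_simps)
      have "?F (\<tau> \<circ> removal_cycle S k)
          = [(position_sign S k)] \<cdot>\<^bsub>?K\<^esub> h k (l + 1 - int (card S)) (G (l + 2 - int (card S)) ([(sign \<tau>)] \<cdot>\<^bsub>?W\<^esub> ?g \<tau>))"
        if t: "\<tau> permutes ?T" for \<tau>
      proof -
        have "zigzag h G (map (\<tau> \<circ> removal_cycle S k) (sorted_list_of_set S)) l y
            = h k (l + 1 - int (card S)) (G (l + 2 - int (card S)) (?g \<tau>))"
        proof -
          have "l - int (card ?T) = l + 1 - int (card S)" "l + 1 - int (card ?T) = l + 2 - int (card S)"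
            using cardT by auto
          moreover have "map \<tau> (sorted_list_of_set ?T) \<noteq> []" using False fin by auto
          ultimately show ?thesis
            unfolding map[OF t] using zigzag_Cons[of "map \<tau> (sorted_list_of_set ?T)" h G k l y]
            by (simp only: length_map length_sorted_list_of_set not_False_eq_True simp_thms)
        qed
        moreover have "h k (l + 1 - int (card S)) (G (l + 2 - int (card S)) (?g \<tau>)) \<in> carrier ?K"
          using zcl[OF perm[OF k t]] calculation by simp
        ultimately show ?thesis
          using sgn[OF t] linear_map_int_smult[OF lin gcl[OF t]]
          by (simp add: K.M.int_smult_mult mult.commute[of "position_sign S k"])
      qed
      then have "(\<Oplus>\<^bsub>?K\<^esub>\<tau>\<in>{\<tau>. \<tau> permutes ?T}. ?F (\<tau> \<circ> removal_cycle S k))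
          = (\<Oplus>\<^bsub>?K\<^esub>\<tau>\<in>{\<tau>. \<tau> permutes ?T}. [(position_sign S k)] \<cdot>\<^bsub>?K\<^esub> h k (l + 1 - int (card S)) (G (l + 2 - int (card S)) ([(sign \<tau>)] \<cdot>\<^bsub>?W\<^esub> ?g \<tau>)))"
        using linear_map_closed[OF lin] gcl
        by (intro K.M.finsum_cong'[OF refl]) (auto simp: W.M.int_smult_closed)
      also have "\<dots> = [(position_sign S k)] \<cdot>\<^bsub>?K\<^esub> h k (l + 1 - int (card S)) (G (l + 2 - int (card S))
          (\<Oplus>\<^bsub>?W\<^esub>\<tau>\<in>{\<tau>. \<tau> permutes ?T}. [(sign \<tau>)] \<cdot>\<^bsub>?W\<^esub> ?g \<tau>))"
        using gcl by (intro linear_map_finsum[OF lin, symmetric]) (auto simp: W.M.int_smult_closed)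
      also have "(\<Oplus>\<^bsub>?W\<^esub>\<tau>\<in>{\<tau>. \<tau> permutes ?T}. [(sign \<tau>)] \<cdot>\<^bsub>?W\<^esub> ?g \<tau>) = alternating_zigzag M h G ?T l y"
        by (simp only: alternating_zigzag_def cardT) (simp add: algebra_simps)
      also have "G (l + 2 - int (card S)) (alternating_zigzag M h G ?T l y) = homotopy_zigzag ?T l y"
      proof -
        have "l + 1 - int (card ?T) = l + 2 - int (card S)" using cardT by simp
        then show ?thesis using False by (simp only: homotopy_zigzag_def if_False)
      qed
      finally show ?thesis .
    qed
  qed
  finally show ?thesis .
qed

end

section \<open>The perturbation argument\<close>

text \<open>The cancellation in the computation of the defect, with x = d u, y = \<alpha>\<beta> p,
  g = G d p, s = G P d u and t = G P y, where p = P u.\<close>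

lemma (in abelian_group) perturbation_identity:
  assumes [simp]: "x \<in> carrier G" "y \<in> carrier G" "p \<in> carrier G" "g \<in> carrier G" "s \<in> carrier G" "t \<in> carrier G"
  shows "\<ominus> (x \<oplus> (y \<ominus> p \<ominus> g)) \<oplus> (x \<oplus> s) \<oplus> (y \<oplus> t) = p \<oplus> (g \<oplus> s \<oplus> t)"
proof -
  have "x \<oplus> (y \<ominus> p \<ominus> g) = (x \<oplus> y) \<ominus> (p \<oplus> g)"
    by (simp add: a_minus_def minus_add a_ac)
  then have "\<ominus> (x \<oplus> (y \<ominus> p \<ominus> g)) = \<ominus> (x \<oplus> y) \<oplus> (p \<oplus> g)"
    by (simp add: a_minus_def minus_add)
  moreover have "(x \<oplus> s) \<oplus> (y \<oplus> t) = (x \<oplus> y) \<oplus> (s \<oplus> t)" by (simp add: a_ac)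
  ultimately have "\<ominus> (x \<oplus> (y \<ominus> p \<ominus> g)) \<oplus> (x \<oplus> s) \<oplus> (y \<oplus> t)
      = (\<ominus> (x \<oplus> y) \<oplus> (p \<oplus> g)) \<oplus> ((x \<oplus> y) \<oplus> (s \<oplus> t))" by (simp add: a_assoc)
  also have "\<dots> = (\<ominus> (x \<oplus> y) \<oplus> (x \<oplus> y)) \<oplus> ((p \<oplus> g) \<oplus> (s \<oplus> t))" by (simp add: a_ac)
  also have "\<dots> = p \<oplus> (g \<oplus> s \<oplus> t)" by (simp add: l_neg a_assoc)
  finally show ?thesis .
qed

text \<open>
  The defect of the Maurer--Cartan type equation for the solution \<open>P\<close> of \<open>P = h (1 + G P)\<close> is a
  fixed point of the nilpotent operator \<open>h G\<close>, hence vanishes.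
\<close>

lemma perturbation_square_zero:
  fixes T :: "int \<Rightarrow> ('r, 't) module" and T' :: "int \<Rightarrow> ('r, 's) module"
  assumes d: "\<And>l. linear_map R (T l) (T (l + 1)) (d l)"
    and h: "\<And>l. linear_map R (T l) (T (l + 1)) (h l)"
    and P: "\<And>l. linear_map R (T l) (T (l + 1)) (P l)"
    and G: "\<And>l. linear_map R (T l) (T (l - 1)) (G l)"
    and a: "\<And>l. linear_map R (T' l) (T l) (a l)"
    and b: "\<And>l. linear_map R (T l) (T' l) (b l)"
    and d': "\<And>l. linear_map R (T' l) (T' (l + 1)) (d' l)"
    and dd: "\<And>l v. v \<in> carrier (T' l) \<Longrightarrow> d' (l + 1) (d' l v) = \<zero>\<^bsub>T' (l + 2)\<^esub>"
    and dh: "\<And>l v. v \<in> carrier (T l) \<Longrightarrow> d (l + 1) (h l v) = \<ominus>\<^bsub>T (l + 2)\<^esub> h (l + 1) (d l v)"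
    and hh: "\<And>l v. v \<in> carrier (T l) \<Longrightarrow> h (l + 1) (h l v) = \<zero>\<^bsub>T (l + 2)\<^esub>"
    and dG: "\<And>l v. v \<in> carrier (T l) \<Longrightarrow> d (l - 1) (G l v) = b' l v \<ominus>\<^bsub>T l\<^esub> v \<ominus>\<^bsub>T l\<^esub> G (l + 1) (d l v)"
    and b': "\<And>l v. v \<in> carrier (T l) \<Longrightarrow> b' l v = a l (b l v)"
    and da: "\<And>l v. v \<in> carrier (T' l) \<Longrightarrow> a (l + 1) (d' l v) = d l (a l v)"
    and db: "\<And>l v. v \<in> carrier (T l) \<Longrightarrow> b (l + 1) (d l v) = d' l (b l v)"
    and rec: "\<And>l v. v \<in> carrier (T l) \<Longrightarrow> P l v = h l (v \<oplus>\<^bsub>T l\<^esub> G (l + 1) (P l v))"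
    and nilp: "\<And>l q. q \<in> carrier (T l) \<Longrightarrow> q = h (l - 1) (G l q) \<Longrightarrow> q = \<zero>\<^bsub>T l\<^esub>"
    and v: "v \<in> carrier (T' l)"
  shows "d' (l + 1) (d' l v \<oplus>\<^bsub>T' (l + 1)\<^esub> b (l + 1) (P l (a l v)))
      \<oplus>\<^bsub>T' (l + 2)\<^esub> b (l + 2) (P (l + 1) (a (l + 1) (d' l v \<oplus>\<^bsub>T' (l + 1)\<^esub> b (l + 1) (P l (a l v)))))
    = \<zero>\<^bsub>T' (l + 2)\<^esub>"
proof -
  have e: "l + 1 + 1 = l + 2" "l + 2 - 1 = l + 1" "l + 1 - 1 = l" by simp_all
  have d2: "linear_map R (T (l + 1)) (T (l + 2)) (d (l + 1))" using d[of "l + 1"] unfolding e by simp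
  have h2: "linear_map R (T (l + 1)) (T (l + 2)) (h (l + 1))" using h[of "l + 1"] unfolding e by simp
  have P2: "linear_map R (T (l + 1)) (T (l + 2)) (P (l + 1))" using P[of "l + 1"] unfolding e by simp
  have G1: "linear_map R (T (l + 1)) (T l) (G (l + 1))" using G[of "l + 1"] unfolding e by simp
  have G2: "linear_map R (T (l + 2)) (T (l + 1)) (G (l + 2))" using G[of "l + 2"] unfolding e by simp
  have d'2: "linear_map R (T' (l + 1)) (T' (l + 2)) (d' (l + 1))" using d'[of "l + 1"] unfolding e by simp
  interpret T0: right_module R "T l" using d by (rule linear_map_modules)
  interpret T1: right_module R "T (l + 1)" using d2 by (rule linear_map_modules)
  interpret T2: right_module R "T (l + 2)" using d2 by (rule linear_map_modules)
  interpret S1: right_module R "T' (l + 1)" using d'2 by (rule linear_map_modules)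
  interpret S2: right_module R "T' (l + 2)" using d'2 by (rule linear_map_modules)
  let ?u = "a l v"
  let ?p = "P l ?u"
  let ?y = "b' (l + 1) ?p"
  have u[simp]: "?u \<in> carrier (T l)" using linear_map_closed[OF a v] .
  have p[simp]: "?p \<in> carrier (T (l + 1))" using linear_map_closed[OF P u] .
  have du[simp]: "d l ?u \<in> carrier (T (l + 1))" using linear_map_closed[OF d u] .
  have y[simp]: "?y \<in> carrier (T (l + 1))"
    using b'[OF p] linear_map_closed[OF a linear_map_closed[OF b p]] by simp
  have Gp[simp]: "G (l + 1) ?p \<in> carrier (T l)" using linear_map_closed[OF G1 p] .
  have dp[simp]: "d (l + 1) ?p \<in> carrier (T (l + 2))" using linear_map_closed[OF d2 p] .
  have Pdu[simp]: "P (l + 1) (d l ?u) \<in> carrier (T (l + 2))" using linear_map_closed[OF P2 du] .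
  have Py[simp]: "P (l + 1) ?y \<in> carrier (T (l + 2))" using linear_map_closed[OF P2 y] .
  note Gcl[simp] = linear_map_closed[OF G2]
  note hcl[simp] = linear_map_closed[OF h2]
  have dGp: "d l (G (l + 1) ?p) = ?y \<ominus>\<^bsub>T (l + 1)\<^esub> ?p \<ominus>\<^bsub>T (l + 1)\<^esub> G (l + 2) (d (l + 1) ?p)"
    using dG[OF p] by (simp add: algebra_simps)
  \<comment> \<open>The defect d P + P d + P \<alpha>\<beta> P, evaluated at u.\<close>
  define Q where "Q = d (l + 1) ?p \<oplus>\<^bsub>T (l + 2)\<^esub> P (l + 1) (d l ?u) \<oplus>\<^bsub>T (l + 2)\<^esub> P (l + 1) ?y"
  have Qcl: "Q \<in> carrier (T (l + 2))" by (simp add: Q_def)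
  let ?w = "d l ?u \<oplus>\<^bsub>T (l + 1)\<^esub> (?y \<ominus>\<^bsub>T (l + 1)\<^esub> ?p \<ominus>\<^bsub>T (l + 1)\<^esub> G (l + 2) (d (l + 1) ?p))"
  have wcl: "?w \<in> carrier (T (l + 1))" by simp
  \<comment> \<open>Write p as h (u + G p), pull d through h at the cost of a sign, and then through
    G by the homotopy relation.\<close>
  have "d (l + 1) ?p = d (l + 1) (h l (?u \<oplus>\<^bsub>T l\<^esub> G (l + 1) ?p))" using rec[OF u] by simp
  also have "\<dots> = \<ominus>\<^bsub>T (l + 2)\<^esub> h (l + 1) (d l (?u \<oplus>\<^bsub>T l\<^esub> G (l + 1) ?p))" by (rule dh) simp
  also have "d l (?u \<oplus>\<^bsub>T l\<^esub> G (l + 1) ?p) = ?w" unfolding dGp[symmetric] by (rule linear_map_add[OF d]) simp_all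
  also have "\<ominus>\<^bsub>T (l + 2)\<^esub> h (l + 1) ?w = h (l + 1) (\<ominus>\<^bsub>T (l + 1)\<^esub> ?w)"
    by (rule linear_map_a_inv[OF h2 wcl, symmetric])
  finally have 1: "d (l + 1) ?p = h (l + 1) (\<ominus>\<^bsub>T (l + 1)\<^esub> ?w)" .
  have rec2: "P (l + 1) z = h (l + 1) (z \<oplus>\<^bsub>T (l + 1)\<^esub> G (l + 2) (P (l + 1) z))" if "z \<in> carrier (T (l + 1))" for z
    using rec[OF that] by (simp add: algebra_simps)
  have "Q = h (l + 1) (\<ominus>\<^bsub>T (l + 1)\<^esub> ?w
      \<oplus>\<^bsub>T (l + 1)\<^esub> (d l ?u \<oplus>\<^bsub>T (l + 1)\<^esub> G (l + 2) (P (l + 1) (d l ?u)))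
      \<oplus>\<^bsub>T (l + 1)\<^esub> (?y \<oplus>\<^bsub>T (l + 1)\<^esub> G (l + 2) (P (l + 1) ?y)))"
    unfolding Q_def using 1 rec2[OF du] rec2[OF y]
    by (subst linear_map_add[OF h2], simp, simp, subst linear_map_add[OF h2], simp_all)
  also have "\<dots> = h (l + 1) (?p \<oplus>\<^bsub>T (l + 1)\<^esub> (G (l + 2) (d (l + 1) ?p)
      \<oplus>\<^bsub>T (l + 1)\<^esub> G (l + 2) (P (l + 1) (d l ?u)) \<oplus>\<^bsub>T (l + 1)\<^esub> G (l + 2) (P (l + 1) ?y)))"
    by (subst T1.M.perturbation_identity) simp_all
  also have "\<dots> = h (l + 1) (?p \<oplus>\<^bsub>T (l + 1)\<^esub> G (l + 2) Q)"
    unfolding Q_def by (subst linear_map_add[OF G2], simp, simp, subst linear_map_add[OF G2], simp_all)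
  also have "\<dots> = h (l + 1) ?p \<oplus>\<^bsub>T (l + 2)\<^esub> h (l + 1) (G (l + 2) Q)"
    using Qcl by (intro linear_map_add[OF h2]) simp_all
  \<comment> \<open>P takes values in the image of h, and h squares to zero. Only h G Q is
    left.\<close>
  also have "h (l + 1) ?p = \<zero>\<^bsub>T (l + 2)\<^esub>"
    using rec[OF u] hh[of "?u \<oplus>\<^bsub>T l\<^esub> G (l + 1) ?p" l] by simp
  finally have "Q = h (l + 1) (G (l + 2) Q)" using Qcl by simp
  then have Q0: "Q = \<zero>\<^bsub>T (l + 2)\<^esub>" using nilp[OF Qcl] by (simp add: algebra_simps)
  have d'v: "d' l v \<in> carrier (T' (l + 1))" using linear_map_closed[OF d' v] .
  note bcl = linear_map_closed[OF b]
  have bp: "b (l + 1) ?p \<in> carrier (T' (l + 1))" using bcl[OF p] .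
  \<comment> \<open>As a and b commute with the unperturbed differentials and those square to zero,
    the square of d' + b P a is b applied to the defect.\<close>
  have "d' (l + 1) (d' l v \<oplus>\<^bsub>T' (l + 1)\<^esub> b (l + 1) ?p) = b (l + 2) (d (l + 1) ?p)"
    using linear_map_add[OF d'2 d'v bp] dd[OF v] db[OF p] linear_map_closed[OF d'2 bp]
    by (simp add: algebra_simps)
  moreover have "P (l + 1) (a (l + 1) (d' l v \<oplus>\<^bsub>T' (l + 1)\<^esub> b (l + 1) ?p)) = P (l + 1) (d l ?u) \<oplus>\<^bsub>T (l + 2)\<^esub> P (l + 1) ?y"
    using linear_map_add[OF a d'v bp] linear_map_add[OF P2 du y] da[OF v] b'[OF p] by simp
  ultimately have "d' (l + 1) (d' l v \<oplus>\<^bsub>T' (l + 1)\<^esub> b (l + 1) ?p)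
      \<oplus>\<^bsub>T' (l + 2)\<^esub> b (l + 2) (P (l + 1) (a (l + 1) (d' l v \<oplus>\<^bsub>T' (l + 1)\<^esub> b (l + 1) ?p)))
      = b (l + 2) Q"
    unfolding Q_def by (simp add: linear_map_add[OF b] T2.M.a_assoc)
  then show ?thesis using Q0 linear_map_zero[OF b] by simp
qed

section \<open>Operators on families indexed by subsets\<close>

abbreviation total_module where
  "total_module N M l \<equiv> direct_sum (Pow N) (\<lambda>A. M (l - int (card A)))"

text \<open>Here p is the degree of \<phi>. The sign (-1)^{|B|} makes the operator anticommute with
  edge operators, whatever the parity of p.\<close>

definition signed_diagonal ::
  "nat set \<Rightarrow> (int \<Rightarrow> ('r, 'm) module) \<Rightarrow> int \<Rightarrow> (int \<Rightarrow> 'm \<Rightarrow> 'm) \<Rightarrow> int \<Rightarrow> (nat set \<Rightarrow> 'm) \<Rightarrow> nat set \<Rightarrow> 'm" where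
  "signed_diagonal N M p \<phi> l v =
    (\<lambda>B\<in>Pow N. [((-1) ^ card B :: int)] \<cdot>\<^bsub>M (l + p - int (card B))\<^esub> \<phi> (l - int (card B)) (v B))"

definition diagonal :: "nat set \<Rightarrow> (int \<Rightarrow> 'm \<Rightarrow> 'k) \<Rightarrow> int \<Rightarrow> (nat set \<Rightarrow> 'm) \<Rightarrow> nat set \<Rightarrow> 'k" where
  "diagonal N \<phi> l v = (\<lambda>B\<in>Pow N. \<phi> (l - int (card B)) (v B))"

text \<open>A Koszul type operator: the entry from B - {k} to B is \<psi>_k with the sign of the
  position of k in B.\<close>

definition edge_operator ::
  "nat set \<Rightarrow> (int \<Rightarrow> ('r, 'm) module) \<Rightarrow> (nat \<Rightarrow> int \<Rightarrow> 'm \<Rightarrow> 'm) \<Rightarrow> int \<Rightarrow> (nat set \<Rightarrow> 'm) \<Rightarrow> nat set \<Rightarrow> 'm" where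
  "edge_operator N M \<psi> l v = (\<lambda>B\<in>Pow N. \<Oplus>\<^bsub>M (l + 1 - int (card B))\<^esub>k\<in>B.
    [(position_sign B k)] \<cdot>\<^bsub>M (l + 1 - int (card B))\<^esub> \<psi> k (l + 1 - int (card B)) (v (B - {k})))"

text \<open>A map of degree 0 along an edge raises the total degree by one. Rewriting the degree in
  this way lets all summands with target B live in the same module.\<close>

lemma degree_face:
  "finite B \<Longrightarrow> k \<in> B \<Longrightarrow> l - int (card (B - {k})) = l + 1 - int (card B)"
  using card_Suc_Diff1[of B k] by linarith

lemma direct_sum_eqI:
  "v \<in> carrier (direct_sum I M) \<Longrightarrow> w \<in> carrier (direct_sum I M) \<Longrightarrow> (\<And>i. i \<in> I \<Longrightarrow> v i = w i) \<Longrightarrow> v = w"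
  by (rule ext) (metis direct_sum_mem(2))

text \<open>One cannot argue that twice the sum is zero, because 2 may be a zero divisor. Instead a
  new index is added together with all pairs that contain it, and these cancel two by two.\<close>

lemma (in abelian_group) finsum_antisymmetric:
  assumes "finite B" "\<And>j k. j \<in> B \<Longrightarrow> k \<in> B \<Longrightarrow> j \<noteq> k \<Longrightarrow> F j k \<in> carrier G"
    "\<And>j k. j \<in> B \<Longrightarrow> k \<in> B \<Longrightarrow> j \<noteq> k \<Longrightarrow> F j k \<oplus> F k j = \<zero>"
  shows "(\<Oplus>j\<in>B. \<Oplus>k\<in>B - {j}. F j k) = \<zero>"
  using assms
proof (induction B)
  case (insert a B)
  have F: "F j k \<in> carrier G" if "j \<in> insert a B" "k \<in> insert a B" "j \<noteq> k" for j k
    using insert.prems(1) that by blast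
  have neq: "a \<noteq> j" "j \<noteq> a" if "j \<in> B" for j using insert.hyps that by auto
  have cl: "(\<Oplus>k\<in>B - {j}. F j k) \<in> carrier G" if "j \<in> B" for j
    using that F by (intro finsum_closed) blast
  have Fa: "F j a \<in> carrier G" "F a j \<in> carrier G" if "j \<in> B" for j
    using that F neq[OF that] by blast+
  have split: "(\<Oplus>k\<in>insert a B - {j}. F j k) = F j a \<oplus> (\<Oplus>k\<in>B - {j}. F j k)" if "j \<in> B" for j
  proof -
    have "insert a B - {j} = insert a (B - {j})" using neq[OF that] by auto
    moreover have "(\<Oplus>k\<in>insert a (B - {j}). F j k) = F j a \<oplus> (\<Oplus>k\<in>B - {j}. F j k)"
      using insert.hyps that Fa F by (intro finsum_insert) blast+
    ultimately show ?thesis by simp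
  qed
  have "(\<Oplus>j\<in>insert a B. \<Oplus>k\<in>insert a B - {j}. F j k)
      = (\<Oplus>k\<in>insert a B - {a}. F a k) \<oplus> (\<Oplus>j\<in>B. \<Oplus>k\<in>insert a B - {j}. F j k)"
    using insert.hyps F by (intro finsum_insert funcsetI finsum_closed) blast+
  also have "insert a B - {a} = B" using insert.hyps by auto
  also have "(\<Oplus>j\<in>B. \<Oplus>k\<in>insert a B - {j}. F j k) = (\<Oplus>j\<in>B. F j a \<oplus> (\<Oplus>k\<in>B - {j}. F j k))"
    by (rule finsum_cong'[OF refl]) (use split Fa cl in auto)
  also have "\<dots> = (\<Oplus>j\<in>B. F j a) \<oplus> (\<Oplus>j\<in>B. \<Oplus>k\<in>B - {j}. F j k)"
    by (rule finsum_addf) (use Fa cl in auto)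
  also have "(\<Oplus>j\<in>B. \<Oplus>k\<in>B - {j}. F j k) = \<zero>"
    using insert by blast
  also have "(\<Oplus>j\<in>B. F j a) \<oplus> \<zero> = (\<Oplus>j\<in>B. F j a)"
    using Fa by (intro r_zero finsum_closed) auto
  also have "(\<Oplus>k\<in>B. F a k) \<oplus> (\<Oplus>j\<in>B. F j a) = (\<Oplus>k\<in>B. F a k \<oplus> F k a)"
    by (rule finsum_addf[symmetric]) (use Fa in auto)
  also have "\<dots> = \<zero>"
    using insert.prems(2) neq by (intro finsum_zero_eqI) blast
  finally show ?case .
qed simp

section \<open>Linearity and sign rules for operators on the total modules\<close>

locale module_family =
  fixes R :: "('r, 'x) ring_scheme" and N :: "nat set" and M :: "int \<Rightarrow> ('r, 'm) module"
  assumes family_module: "\<And>l. right_module R (M l)" and finite_index: "finite N"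
begin

lemma finite_sub: "B \<in> Pow N \<Longrightarrow> finite B"
  using finite_index finite_subset by blast

lemma total_right_module: "right_module R (total_module N M l)"
  by (rule right_module_direct_sum[OF right_moduleD(2)[OF family_module] family_module])

lemma total_component:
  "v \<in> carrier (total_module N M l) \<Longrightarrow> B \<in> Pow N \<Longrightarrow> v B \<in> carrier (M (l - int (card B)))"
  by (rule direct_sum_mem(1))

lemma total_face:
  assumes "v \<in> carrier (total_module N M l)" "B \<in> Pow N" "k \<in> B"
  shows "v (B - {k}) \<in> carrier (M (l + 1 - int (card B)))"
proof -
  have "B - {k} \<in> Pow N" using assms(2) by auto
  then show ?thesis
    using total_component[OF assms(1)] unfolding degree_face[OF finite_sub[OF assms(2)] assms(3), symmetric]
    by blast
qed

lemma component_linear: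
  "B \<in> Pow N \<Longrightarrow> linear_map R (total_module N M l) (M (l - int (card B))) (\<lambda>v. v B)"
  by (rule linear_map_direct_sum_proj[OF right_moduleD(2)[OF family_module] family_module])

lemma face_linear:
  assumes "B \<in> Pow N" "k \<in> B"
  shows "linear_map R (total_module N M l) (M (l + 1 - int (card B))) (\<lambda>v. v (B - {k}))"
proof -
  have "B - {k} \<in> Pow N" using assms(1) by auto
  then show ?thesis
    using component_linear unfolding degree_face[OF finite_sub[OF assms(1)] assms(2), symmetric]
    by blast
qed

lemma into_total:
  assumes "right_module R W" "\<And>B. B \<in> Pow N \<Longrightarrow> linear_map R W (M (l - int (card B))) (\<lambda>w. f w B)"
  shows "linear_map R W (total_module N M l) (\<lambda>w. \<lambda>B\<in>Pow N. f w B)"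
  by (rule linear_map_into_direct_sum) (use finite_index assms in auto)

lemma total_a_inv:
  "v \<in> carrier (total_module N M l) \<Longrightarrow> B \<in> Pow N
    \<Longrightarrow> (\<ominus>\<^bsub>total_module N M l\<^esub> v) B = \<ominus>\<^bsub>M (l - int (card B))\<^esub> v B"
  by (rule linear_map_a_inv[OF component_linear])

lemma signed_diagonal_linear:
  assumes "\<And>m. linear_map R (M m) (M (m + p)) (\<phi> m)"
  shows "linear_map R (total_module N M l) (total_module N M (l + p)) (signed_diagonal N M p \<phi> l)"
  unfolding signed_diagonal_def[abs_def]
proof (rule into_total[OF total_right_module])
  fix B assume B: "B \<in> Pow N"
  have "linear_map R (M (l - int (card B))) (M (l + p - int (card B))) (\<phi> (l - int (card B)))"
    using assms[of "l - int (card B)"] by (simp add: algebra_simps)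
  from linear_map_int_multiple[OF linear_map_compose[OF component_linear[OF B] this]]
  show "linear_map R (total_module N M l) (M (l + p - int (card B)))
      (\<lambda>v. [((-1) ^ card B :: int)] \<cdot>\<^bsub>M (l + p - int (card B))\<^esub> \<phi> (l - int (card B)) (v B))" .
qed

lemma edge_operator_linear:
  assumes "\<And>k m. k \<in> N \<Longrightarrow> linear_map R (M m) (M m) (\<psi> k m)"
  shows "linear_map R (total_module N M l) (total_module N M (l + 1)) (edge_operator N M \<psi> l)"
  unfolding edge_operator_def[abs_def]
proof (rule into_total[OF total_right_module])
  fix B assume B: "B \<in> Pow N"
  show "linear_map R (total_module N M l) (M (l + 1 - int (card B)))
      (\<lambda>v. \<Oplus>\<^bsub>M (l + 1 - int (card B))\<^esub>k\<in>B. [(position_sign B k)] \<cdot>\<^bsub>M (l + 1 - int (card B))\<^esub>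
        \<psi> k (l + 1 - int (card B)) (v (B - {k})))"
  proof (rule linear_map_sum[OF total_right_module family_module])
    fix k assume k: "k \<in> B"
    then have "k \<in> N" using B by auto
    from linear_map_int_multiple[OF linear_map_compose[OF face_linear[OF B k] assms[OF this]]]
    show "linear_map R (total_module N M l) (M (l + 1 - int (card B)))
        (\<lambda>v. [(position_sign B k)] \<cdot>\<^bsub>M (l + 1 - int (card B))\<^esub> \<psi> k (l + 1 - int (card B)) (v (B - {k})))" .
  qed
qed

text \<open>The sign at B is (-1)^{|B|}, the sign at the face B - {k} is (-1)^{|B|-1}. Interchanging
  the two operators exchanges these signs and nothing else, since \<phi> commutes with every
  \<psi>_k.\<close>

lemma signed_diagonal_edge_operator:
  assumes \<phi>: "\<And>m. linear_map R (M m) (M (m + p)) (\<phi> m)"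
    and \<psi>: "\<And>k m. k \<in> N \<Longrightarrow> linear_map R (M m) (M m) (\<psi> k m)"
    and comm: "\<And>k m x. k \<in> N \<Longrightarrow> x \<in> carrier (M m) \<Longrightarrow> \<phi> m (\<psi> k m x) = \<psi> k (m + p) (\<phi> m x)"
    and v: "v \<in> carrier (total_module N M l)"
  shows "signed_diagonal N M p \<phi> (l + 1) (edge_operator N M \<psi> l v)
    = \<ominus>\<^bsub>total_module N M (l + 1 + p)\<^esub> edge_operator N M \<psi> (l + p) (signed_diagonal N M p \<phi> l v)"
proof (rule direct_sum_eqI)
  interpret T: right_module R "total_module N M (l + 1 + p)" by (rule total_right_module)
  have "linear_map R (total_module N M l) (total_module N M (l + 1)) (edge_operator N M \<psi> l)" for l
    by (rule edge_operator_linear) (rule \<psi>)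
  note e = linear_map_closed[OF this]
  note s = linear_map_closed[OF signed_diagonal_linear[OF \<phi>]]
  show "signed_diagonal N M p \<phi> (l + 1) (edge_operator N M \<psi> l v) \<in> carrier (total_module N M (l + 1 + p))"
    using s[OF e[OF v]] .
  have es: "edge_operator N M \<psi> (l + p) (signed_diagonal N M p \<phi> l v) \<in> carrier (total_module N M (l + 1 + p))"
    using e[OF s[OF v]] by (simp add: algebra_simps)
  then show "\<ominus>\<^bsub>total_module N M (l + 1 + p)\<^esub> edge_operator N M \<psi> (l + p) (signed_diagonal N M p \<phi> l v)
      \<in> carrier (total_module N M (l + 1 + p))" by simp
  fix B assume B: "B \<in> Pow N"
  note finB = finite_sub[OF B]
  define m where "m = l + 1 - int (card B)"
  have m: "l + 1 + p - int (card B) = m + p" "l + p + 1 - int (card B) = m + p" by (simp_all add: m_def)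
  interpret K: right_module R "M (m + p)" by (rule family_module)
  interpret W: right_module R "M m" by (rule family_module)
  have vk: "v (B - {k}) \<in> carrier (M m)" if "k \<in> B" for k
    using total_face[OF v B that] by (simp add: m_def)
  have kN: "k \<in> N" if "k \<in> B" for k using that B by auto
  have \<psi>vk: "\<psi> k m (v (B - {k})) \<in> carrier (M m)" if "k \<in> B" for k
    using linear_map_closed[OF \<psi>[OF kN[OF that]] vk[OF that]] .
  have t: "\<psi> k (m + p) (\<phi> m (v (B - {k}))) \<in> carrier (M (m + p))" if "k \<in> B" for k
    using linear_map_closed[OF \<psi>[OF kN[OF that]] linear_map_closed[OF \<phi> vk[OF that]]] .
  have "signed_diagonal N M p \<phi> (l + 1) (edge_operator N M \<psi> l v) B
      = [((-1) ^ card B :: int)] \<cdot>\<^bsub>M (m + p)\<^esub> \<phi> m (\<Oplus>\<^bsub>M m\<^esub>k\<in>B. [(position_sign B k)] \<cdot>\<^bsub>M m\<^esub> \<psi> k m (v (B - {k})))"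
    using B by (simp add: signed_diagonal_def edge_operator_def m m_def[symmetric])
  also have "\<dots> = (\<Oplus>\<^bsub>M (m + p)\<^esub>k\<in>B. [((-1) ^ card B :: int)] \<cdot>\<^bsub>M (m + p)\<^esub> \<phi> m ([(position_sign B k)] \<cdot>\<^bsub>M m\<^esub> \<psi> k m (v (B - {k}))))"
    by (rule linear_map_finsum[OF linear_map_int_multiple[OF \<phi>]]) (use \<psi>vk in \<open>auto simp: W.M.int_smult_closed\<close>)
  also have "\<dots> = (\<Oplus>\<^bsub>M (m + p)\<^esub>k\<in>B. \<ominus>\<^bsub>M (m + p)\<^esub> ([(position_sign B k)] \<cdot>\<^bsub>M (m + p)\<^esub>
      \<psi> k (m + p) ([((-1) ^ card (B - {k}) :: int)] \<cdot>\<^bsub>M (m + p)\<^esub> \<phi> m (v (B - {k})))))"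
  proof (rule K.M.finsum_cong'[OF refl])
    have cl: "[((-1) ^ card (B - {k}) :: int)] \<cdot>\<^bsub>M (m + p)\<^esub> \<phi> m (v (B - {k})) \<in> carrier (M (m + p))" if "k \<in> B" for k
      using linear_map_closed[OF \<phi> vk[OF that]] by (simp add: K.M.int_smult_closed)
    then show "(\<lambda>k. \<ominus>\<^bsub>M (m + p)\<^esub> ([(position_sign B k)] \<cdot>\<^bsub>M (m + p)\<^esub>
      \<psi> k (m + p) ([((-1) ^ card (B - {k}) :: int)] \<cdot>\<^bsub>M (m + p)\<^esub> \<phi> m (v (B - {k}))))) \<in> B \<rightarrow> carrier (M (m + p))"
      using linear_map_closed[OF \<psi>[OF kN]] by (auto simp: K.M.int_smult_closed)
    fix k assume k: "k \<in> B"
    obtain n where n: "card B = Suc n" "card (B - {k}) = n" using k finB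
      by (metis card_Suc_Diff1)
    let ?t = "\<psi> k (m + p) (\<phi> m (v (B - {k})))"
    have "[((-1) ^ card B :: int)] \<cdot>\<^bsub>M (m + p)\<^esub> \<phi> m ([(position_sign B k)] \<cdot>\<^bsub>M m\<^esub> \<psi> k m (v (B - {k})))
      = [((-1) ^ card B * position_sign B k)] \<cdot>\<^bsub>M (m + p)\<^esub> ?t"
      using linear_map_int_smult[OF \<phi> \<psi>vk[OF k]] comm[OF kN[OF k] vk[OF k]] t[OF k] by (simp add: K.M.int_smult_mult)
    also have "\<dots> = \<ominus>\<^bsub>M (m + p)\<^esub> ([(position_sign B k * (-1) ^ n)] \<cdot>\<^bsub>M (m + p)\<^esub> ?t)"
      unfolding K.M.int_smult_neg[OF t[OF k], symmetric] n by (simp add: mult.commute)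
    also have "\<dots> = \<ominus>\<^bsub>M (m + p)\<^esub> ([(position_sign B k)] \<cdot>\<^bsub>M (m + p)\<^esub>
      \<psi> k (m + p) ([((-1) ^ card (B - {k}) :: int)] \<cdot>\<^bsub>M (m + p)\<^esub> \<phi> m (v (B - {k}))))"
      using linear_map_int_smult[OF \<psi>[OF kN[OF k]] linear_map_closed[OF \<phi> vk[OF k]]] t[OF k] n
      by (simp add: K.M.int_smult_mult)
    finally show "[((-1) ^ card B :: int)] \<cdot>\<^bsub>M (m + p)\<^esub> \<phi> m ([(position_sign B k)] \<cdot>\<^bsub>M m\<^esub> \<psi> k m (v (B - {k})))
      = \<ominus>\<^bsub>M (m + p)\<^esub> ([(position_sign B k)] \<cdot>\<^bsub>M (m + p)\<^esub>
      \<psi> k (m + p) ([((-1) ^ card (B - {k}) :: int)] \<cdot>\<^bsub>M (m + p)\<^esub> \<phi> m (v (B - {k}))))" .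
  qed
  also have "\<dots> = \<ominus>\<^bsub>M (m + p)\<^esub> (\<Oplus>\<^bsub>M (m + p)\<^esub>k\<in>B. [(position_sign B k)] \<cdot>\<^bsub>M (m + p)\<^esub>
      \<psi> k (m + p) ([((-1) ^ card (B - {k}) :: int)] \<cdot>\<^bsub>M (m + p)\<^esub> \<phi> m (v (B - {k}))))"
    using finB vk linear_map_closed[OF \<psi>[OF kN]] linear_map_closed[OF \<phi>]
    by (intro K.M.finsum_a_inv) (auto simp: K.M.int_smult_closed)
  also have "(\<Oplus>\<^bsub>M (m + p)\<^esub>k\<in>B. [(position_sign B k)] \<cdot>\<^bsub>M (m + p)\<^esub>
      \<psi> k (m + p) ([((-1) ^ card (B - {k}) :: int)] \<cdot>\<^bsub>M (m + p)\<^esub> \<phi> m (v (B - {k}))))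
      = edge_operator N M \<psi> (l + p) (signed_diagonal N M p \<phi> l v) B"
  proof -
    have face: "signed_diagonal N M p \<phi> l v (B - {k}) = [((-1) ^ card (B - {k}) :: int)] \<cdot>\<^bsub>M (m + p)\<^esub> \<phi> m (v (B - {k}))"
      if "k \<in> B" for k
    proof -
      have "l - int (card (B - {k})) = m" "l + p - int (card (B - {k})) = m + p" "B - {k} \<in> Pow N"
        using degree_face[OF finB that] B by (auto simp: m_def)
      then show ?thesis by (simp only: signed_diagonal_def restrict_apply if_True)
    qed
    have "edge_operator N M \<psi> (l + p) (signed_diagonal N M p \<phi> l v) B
        = (\<Oplus>\<^bsub>M (m + p)\<^esub>k\<in>B. [(position_sign B k)] \<cdot>\<^bsub>M (m + p)\<^esub> \<psi> k (m + p) (signed_diagonal N M p \<phi> l v (B - {k})))"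
      using B by (simp only: edge_operator_def restrict_apply if_True m)
    also have "\<dots> = (\<Oplus>\<^bsub>M (m + p)\<^esub>k\<in>B. [(position_sign B k)] \<cdot>\<^bsub>M (m + p)\<^esub>
        \<psi> k (m + p) ([((-1) ^ card (B - {k}) :: int)] \<cdot>\<^bsub>M (m + p)\<^esub> \<phi> m (v (B - {k}))))"
      by (rule K.M.finsum_cong'[OF refl])
        (use linear_map_closed[OF \<psi>[OF kN]] linear_map_closed[OF \<phi>] vk in \<open>auto simp: face K.M.int_smult_closed\<close>)
    finally show ?thesis by simp
  qed
  also have "\<ominus>\<^bsub>M (m + p)\<^esub> edge_operator N M \<psi> (l + p) (signed_diagonal N M p \<phi> l v) B
      = (\<ominus>\<^bsub>total_module N M (l + 1 + p)\<^esub> edge_operator N M \<psi> (l + p) (signed_diagonal N M p \<phi> l v)) B"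
    using total_a_inv[OF es B] m by simp
  finally show "signed_diagonal N M p \<phi> (l + 1) (edge_operator N M \<psi> l v) B
      = (\<ominus>\<^bsub>total_module N M (l + 1 + p)\<^esub> edge_operator N M \<psi> (l + p) (signed_diagonal N M p \<phi> l v)) B" .
qed

text \<open>The square is a sum over ordered pairs of distinct elements j, k of B. The maps commute
  and the product of the two position signs is antisymmetric, so opposite pairs cancel.\<close>

lemma edge_operator_square:
  assumes \<psi>: "\<And>k m. k \<in> N \<Longrightarrow> linear_map R (M m) (M m) (\<psi> k m)"
    and comm: "\<And>j k m x. j \<in> N \<Longrightarrow> k \<in> N \<Longrightarrow> x \<in> carrier (M m) \<Longrightarrow> \<psi> j m (\<psi> k m x) = \<psi> k m (\<psi> j m x)"
    and v: "v \<in> carrier (total_module N M l)"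
  shows "edge_operator N M \<psi> (l + 1) (edge_operator N M \<psi> l v) = \<zero>\<^bsub>total_module N M (l + 2)\<^esub>"
proof (rule direct_sum_eqI)
  interpret T: right_module R "total_module N M (l + 2)" by (rule total_right_module)
  have el: "linear_map R (total_module N M l) (total_module N M (l + 1)) (edge_operator N M \<psi> l)" for l
    by (rule edge_operator_linear) (rule \<psi>)
  show "edge_operator N M \<psi> (l + 1) (edge_operator N M \<psi> l v) \<in> carrier (total_module N M (l + 2))"
    using linear_map_closed[OF el linear_map_closed[OF el v]] by (simp add: add.assoc)
  show "\<zero>\<^bsub>total_module N M (l + 2)\<^esub> \<in> carrier (total_module N M (l + 2))" by simp
  fix B assume B: "B \<in> Pow N"
  note finB = finite_sub[OF B]
  define m where "m = l + 2 - int (card B)"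
  interpret K: right_module R "M m" by (rule family_module)
  have kN: "k \<in> N" if "k \<in> B" for k using that B by auto
  let ?w = "\<lambda>j k. v (B - {j} - {k})"
  let ?F = "\<lambda>j k. [(position_sign B j * position_sign (B - {j}) k)] \<cdot>\<^bsub>M m\<^esub> \<psi> j m (\<psi> k m (?w j k))"
  have deg: "l + 1 - int (card (B - {j})) = m" if "j \<in> B" for j
    using degree_face[OF finB that, of "l + 1"] by (simp add: m_def)
  have wcl: "?w j k \<in> carrier (M m)" if "j \<in> B" "k \<in> B - {j}" for j k
    using total_face[OF v, of "B - {j}" k] deg[OF that(1)] that B by auto
  have \<psi>cl: "\<psi> k m x \<in> carrier (M m)" if "k \<in> B" "x \<in> carrier (M m)" for k x
    using linear_map_closed[OF \<psi>[OF kN[OF that(1)]] that(2)] .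
  have "edge_operator N M \<psi> (l + 1) (edge_operator N M \<psi> l v) B
      = (\<Oplus>\<^bsub>M m\<^esub>j\<in>B. [(position_sign B j)] \<cdot>\<^bsub>M m\<^esub> \<psi> j m (edge_operator N M \<psi> l v (B - {j})))"
    using B by (simp add: edge_operator_def[of N M \<psi> "l + 1"] m_def add.assoc)
  also have "\<dots> = (\<Oplus>\<^bsub>M m\<^esub>j\<in>B. \<Oplus>\<^bsub>M m\<^esub>k\<in>B - {j}. ?F j k)"
  proof (rule K.M.finsum_cong'[OF refl])
    show "(\<lambda>j. \<Oplus>\<^bsub>M m\<^esub>k\<in>B - {j}. ?F j k) \<in> B \<rightarrow> carrier (M m)"
      using wcl \<psi>cl by (intro funcsetI K.M.finsum_closed) (simp add: K.M.int_smult_closed)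
    fix j assume j: "j \<in> B"
    have Bj: "B - {j} \<in> Pow N" using B by auto
    have t: "[(position_sign (B - {j}) k)] \<cdot>\<^bsub>M m\<^esub> \<psi> k m (?w j k) \<in> carrier (M m)" if "k \<in> B - {j}" for k
      using that wcl[OF j that] \<psi>cl by (auto simp: K.M.int_smult_closed)
    have "edge_operator N M \<psi> l v (B - {j}) = (\<Oplus>\<^bsub>M m\<^esub>k\<in>B - {j}. [(position_sign (B - {j}) k)] \<cdot>\<^bsub>M m\<^esub> \<psi> k m (?w j k))"
      using Bj deg[OF j] by (simp only: edge_operator_def restrict_apply if_True)
    moreover have "[(position_sign B j)] \<cdot>\<^bsub>M m\<^esub> \<psi> j m (\<Oplus>\<^bsub>M m\<^esub>k\<in>B - {j}. [(position_sign (B - {j}) k)] \<cdot>\<^bsub>M m\<^esub> \<psi> k m (?w j k))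
      = (\<Oplus>\<^bsub>M m\<^esub>k\<in>B - {j}. [(position_sign B j)] \<cdot>\<^bsub>M m\<^esub> \<psi> j m ([(position_sign (B - {j}) k)] \<cdot>\<^bsub>M m\<^esub> \<psi> k m (?w j k)))"
      by (rule linear_map_finsum[OF linear_map_int_multiple[OF \<psi>[OF kN[OF j]]]]) (use t in auto)
    moreover have "\<dots> = (\<Oplus>\<^bsub>M m\<^esub>k\<in>B - {j}. ?F j k)"
    proof (rule K.M.finsum_cong'[OF refl])
      show "?F j \<in> B - {j} \<rightarrow> carrier (M m)"
        using wcl[OF j] \<psi>cl j by (auto simp: K.M.int_smult_closed)
      fix k assume k: "k \<in> B - {j}"
      then have "k \<in> B" by auto
      then show "[(position_sign B j)] \<cdot>\<^bsub>M m\<^esub> \<psi> j m ([(position_sign (B - {j}) k)] \<cdot>\<^bsub>M m\<^esub> \<psi> k m (?w j k)) = ?F j k"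
        using linear_map_int_smult[OF \<psi>[OF kN[OF j]] \<psi>cl[OF _ wcl[OF j k]], of k] \<psi>cl[OF _ \<psi>cl[OF _ wcl[OF j k]]] j
        by (simp add: K.M.int_smult_mult)
    qed
    ultimately show "[(position_sign B j)] \<cdot>\<^bsub>M m\<^esub> \<psi> j m (edge_operator N M \<psi> l v (B - {j})) = (\<Oplus>\<^bsub>M m\<^esub>k\<in>B - {j}. ?F j k)"
      by simp
  qed
  also have "\<dots> = \<zero>\<^bsub>M m\<^esub>"
  proof (rule K.M.finsum_antisymmetric[OF finB])
    fix j k assume jk: "j \<in> B" "k \<in> B" "j \<noteq> k"
    have w: "?w j k \<in> carrier (M m)" using wcl[of j k] jk by blast
    show "?F j k \<in> carrier (M m)" using w \<psi>cl jk by (simp add: K.M.int_smult_closed)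
    have weq: "B - {k} - {j} = B - {j} - {k}" by auto
    \<comment> \<open>Removing the smaller of the two elements shifts the position of the larger by
      one, while removing the larger leaves the smaller in place.\<close>
    have sgn: "position_sign B k * position_sign (B - {k}) j = - (position_sign B j * position_sign (B - {j}) k)"
      using position_sign_remove[OF finB] jk by (auto simp: mult.commute)
    have c: "\<psi> k m (\<psi> j m (?w j k)) = \<psi> j m (\<psi> k m (?w j k))"
      using comm[OF kN[OF jk(2)] kN[OF jk(1)] w] .
    have "\<psi> j m (\<psi> k m (?w j k)) \<in> carrier (M m)" using w \<psi>cl jk by blast
    then show "?F j k \<oplus>\<^bsub>M m\<^esub> ?F k j = \<zero>\<^bsub>M m\<^esub>"
      unfolding weq sgn c by (simp add: K.M.int_smult_neg K.M.r_neg K.M.int_smult_closed)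
  qed
  also have "\<dots> = \<zero>\<^bsub>total_module N M (l + 2)\<^esub> B"
    using B by (simp only: direct_sum_simps restrict_apply if_True m_def)
  finally show "edge_operator N M \<psi> (l + 1) (edge_operator N M \<psi> l v) B = \<zero>\<^bsub>total_module N M (l + 2)\<^esub> B" .
qed

lemma edge_operator_add:
  assumes \<psi>: "\<And>k m. k \<in> N \<Longrightarrow> linear_map R (M m) (M m) (\<psi> k m)"
    and \<chi>: "\<And>k m. k \<in> N \<Longrightarrow> linear_map R (M m) (M m) (\<chi> k m)"
    and v: "v \<in> carrier (total_module N M l)"
  shows "edge_operator N M (\<lambda>k m x. \<psi> k m x \<oplus>\<^bsub>M m\<^esub> \<chi> k m x) l v
    = edge_operator N M \<psi> l v \<oplus>\<^bsub>total_module N M (l + 1)\<^esub> edge_operator N M \<chi> l v"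
  unfolding edge_operator_def direct_sum_simps
proof (rule restrict_ext)
  fix B assume B: "B \<in> Pow N"
  define m where "m = l + 1 - int (card B)"
  interpret K: right_module R "M m" by (rule family_module)
  have cl: "\<psi> k m (v (B - {k})) \<in> carrier (M m)" "\<chi> k m (v (B - {k})) \<in> carrier (M m)" if "k \<in> B" for k
    using total_face[OF v B that] linear_map_closed[OF \<psi>] linear_map_closed[OF \<chi>] that B
    unfolding m_def by blast+
  have "(\<Oplus>\<^bsub>M m\<^esub>k\<in>B. [(position_sign B k)] \<cdot>\<^bsub>M m\<^esub> (\<psi> k m (v (B - {k})) \<oplus>\<^bsub>M m\<^esub> \<chi> k m (v (B - {k}))))
    = (\<Oplus>\<^bsub>M m\<^esub>k\<in>B. [(position_sign B k)] \<cdot>\<^bsub>M m\<^esub> \<psi> k m (v (B - {k})) \<oplus>\<^bsub>M m\<^esub> [(position_sign B k)] \<cdot>\<^bsub>M m\<^esub> \<chi> k m (v (B - {k})))"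
    by (rule K.M.finsum_cong'[OF refl]) (use cl in \<open>auto simp: K.M.int_smult_add K.M.int_smult_closed\<close>)
  also have "\<dots> = (\<Oplus>\<^bsub>M m\<^esub>k\<in>B. [(position_sign B k)] \<cdot>\<^bsub>M m\<^esub> \<psi> k m (v (B - {k})))
      \<oplus>\<^bsub>M m\<^esub> (\<Oplus>\<^bsub>M m\<^esub>k\<in>B. [(position_sign B k)] \<cdot>\<^bsub>M m\<^esub> \<chi> k m (v (B - {k})))"
    by (rule K.M.finsum_addf) (use cl in \<open>auto simp: K.M.int_smult_closed\<close>)
  finally show "(\<Oplus>\<^bsub>M (l + 1 - int (card B))\<^esub>k\<in>B. [(position_sign B k)] \<cdot>\<^bsub>M (l + 1 - int (card B))\<^esub>
        (\<psi> k (l + 1 - int (card B)) (v (B - {k})) \<oplus>\<^bsub>M (l + 1 - int (card B))\<^esub> \<chi> k (l + 1 - int (card B)) (v (B - {k}))))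
    = (\<lambda>B\<in>Pow N. \<Oplus>\<^bsub>M (l + 1 - int (card B))\<^esub>k\<in>B. [(position_sign B k)] \<cdot>\<^bsub>M (l + 1 - int (card B))\<^esub> \<psi> k (l + 1 - int (card B)) (v (B - {k}))) B
      \<oplus>\<^bsub>M (l + 1 - int (card B))\<^esub>
      (\<lambda>B\<in>Pow N. \<Oplus>\<^bsub>M (l + 1 - int (card B))\<^esub>k\<in>B. [(position_sign B k)] \<cdot>\<^bsub>M (l + 1 - int (card B))\<^esub> \<chi> k (l + 1 - int (card B)) (v (B - {k}))) B"
    using B by (simp only: m_def restrict_apply if_True)
qed

text \<open>By polarisation: the sums \<psi>_k + \<chi>_k commute as well, so their edge operator
  squares to zero, and expanding that square leaves only the two mixed terms.\<close>

lemma edge_operator_anticommute: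
  assumes \<psi>: "\<And>k m. k \<in> N \<Longrightarrow> linear_map R (M m) (M m) (\<psi> k m)"
    and \<chi>: "\<And>k m. k \<in> N \<Longrightarrow> linear_map R (M m) (M m) (\<chi> k m)"
    and \<psi>\<psi>: "\<And>j k m x. j \<in> N \<Longrightarrow> k \<in> N \<Longrightarrow> x \<in> carrier (M m) \<Longrightarrow> \<psi> j m (\<psi> k m x) = \<psi> k m (\<psi> j m x)"
    and \<chi>\<chi>: "\<And>j k m x. j \<in> N \<Longrightarrow> k \<in> N \<Longrightarrow> x \<in> carrier (M m) \<Longrightarrow> \<chi> j m (\<chi> k m x) = \<chi> k m (\<chi> j m x)"
    and \<psi>\<chi>: "\<And>j k m x. j \<in> N \<Longrightarrow> k \<in> N \<Longrightarrow> x \<in> carrier (M m) \<Longrightarrow> \<psi> j m (\<chi> k m x) = \<chi> k m (\<psi> j m x)"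
    and v: "v \<in> carrier (total_module N M l)"
  shows "edge_operator N M \<psi> (l + 1) (edge_operator N M \<chi> l v)
    = \<ominus>\<^bsub>total_module N M (l + 2)\<^esub> edge_operator N M \<chi> (l + 1) (edge_operator N M \<psi> l v)"
proof -
  let ?T = "total_module N M (l + 2)"
  interpret T: right_module R ?T by (rule total_right_module)
  define \<theta> where "\<theta> = (\<lambda>k m x. \<psi> k m x \<oplus>\<^bsub>M m\<^esub> \<chi> k m x)"
  have \<theta>: "linear_map R (M m) (M m) (\<theta> k m)" if "k \<in> N" for k m
    unfolding \<theta>_def by (rule linear_map_plus[OF \<psi>[OF that] \<chi>[OF that]])
  have \<theta>\<theta>: "\<theta> j m (\<theta> k m x) = \<theta> k m (\<theta> j m x)" if jk: "j \<in> N" "k \<in> N" and x: "x \<in> carrier (M m)" for j k m x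
  proof -
    interpret K: right_module R "M m" by (rule family_module)
    note cl = linear_map_closed[OF \<psi>[OF jk(1)]] linear_map_closed[OF \<psi>[OF jk(2)]]
      linear_map_closed[OF \<chi>[OF jk(1)]] linear_map_closed[OF \<chi>[OF jk(2)]]
    show ?thesis
      unfolding \<theta>_def
      using linear_map_add[OF \<psi>[OF jk(1)] cl(2)[OF x] cl(4)[OF x]] linear_map_add[OF \<psi>[OF jk(2)] cl(1)[OF x] cl(3)[OF x]]
        linear_map_add[OF \<chi>[OF jk(1)] cl(2)[OF x] cl(4)[OF x]] linear_map_add[OF \<chi>[OF jk(2)] cl(1)[OF x] cl(3)[OF x]]
        \<psi>\<psi>[OF jk x] \<chi>\<chi>[OF jk x] \<psi>\<chi>[OF jk x] \<psi>\<chi>[OF jk(2,1) x]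
        cl(1)[OF cl(2)[OF x]] cl(3)[OF cl(4)[OF x]] cl(2)[OF cl(3)[OF x]] cl(4)[OF cl(1)[OF x]]
      by (simp add: K.M.a_ac)
  qed
  let ?e = "edge_operator N M"
  have lin: "linear_map R (total_module N M l) (total_module N M (l + 1)) (?e \<psi> l)"
    "linear_map R (total_module N M l) (total_module N M (l + 1)) (?e \<chi> l)" for l
    using edge_operator_linear[of \<psi>] edge_operator_linear[of \<chi>] \<psi> \<chi> by blast+
  have e2: "l + 1 + 1 = l + 2" by simp
  have lin2: "linear_map R (total_module N M (l + 1)) ?T (?e \<psi> (l + 1))"
    "linear_map R (total_module N M (l + 1)) ?T (?e \<chi> (l + 1))"
    using lin[of "l + 1"] unfolding e2 by auto
  note c = linear_map_closed[OF lin(1) v] linear_map_closed[OF lin(2) v]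
  have sum: "?e \<psi> l v \<oplus>\<^bsub>total_module N M (l + 1)\<^esub> ?e \<chi> l v \<in> carrier (total_module N M (l + 1))"
    using abelian_groupE(1)[OF right_moduleD(1)[OF total_right_module]] c by blast
  have add: "?e \<theta> l w = ?e \<psi> l w \<oplus>\<^bsub>total_module N M (l + 1)\<^esub> ?e \<chi> l w"
    if "w \<in> carrier (total_module N M l)" for w l
    unfolding \<theta>_def by (rule edge_operator_add[OF _ _ that]) (erule \<psi>, erule \<chi>)
  have "\<zero>\<^bsub>?T\<^esub> = ?e \<theta> (l + 1) (?e \<theta> l v)"
    using edge_operator_square[OF \<theta> \<theta>\<theta> v] by simp
  also have "\<dots> = ?e \<psi> (l + 1) (?e \<psi> l v \<oplus>\<^bsub>total_module N M (l + 1)\<^esub> ?e \<chi> l v)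
      \<oplus>\<^bsub>?T\<^esub> ?e \<chi> (l + 1) (?e \<psi> l v \<oplus>\<^bsub>total_module N M (l + 1)\<^esub> ?e \<chi> l v)"
    using add[OF v] add[OF sum] by (simp add: e2)
  also have "\<dots> = ?e \<psi> (l + 1) (?e \<chi> l v) \<oplus>\<^bsub>?T\<^esub> ?e \<chi> (l + 1) (?e \<psi> l v)"
    using linear_map_add[OF lin2(1) c] linear_map_add[OF lin2(2) c]
      edge_operator_square[OF \<psi> \<psi>\<psi> v] edge_operator_square[OF \<chi> \<chi>\<chi> v]
      linear_map_closed[OF lin2(1) c(2)] linear_map_closed[OF lin2(2) c(1)] by simp
  finally show ?thesis
    using linear_map_closed[OF lin2(1) c(2)] linear_map_closed[OF lin2(2) c(1)]
    by (metis T.M.minus_equality)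
qed

end

section \<open>The differential of the totalisation\<close>

text \<open>The operator d - x, the part of the torus differential in which no h occurs.\<close>

definition total_differential ::
  "nat set \<Rightarrow> (int \<Rightarrow> ('r, 'm) module) \<Rightarrow> (int \<Rightarrow> 'm \<Rightarrow> 'm) \<Rightarrow> (nat \<Rightarrow> int \<Rightarrow> 'm \<Rightarrow> 'm) \<Rightarrow> int \<Rightarrow> (nat set \<Rightarrow> 'm) \<Rightarrow> nat set \<Rightarrow> 'm" where
  "total_differential N M d x l v =
    signed_diagonal N M 1 d l v \<ominus>\<^bsub>total_module N M (l + 1)\<^esub> edge_operator N M x l v"

lemma (in abelian_group) a_inv_zero: "\<ominus> \<zero> = \<zero>"
  by (metis l_zero minus_equality zero_closed)

lemma square_sign: "((-1) ^ n * (-1) ^ n :: int) = 1"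
  by (simp flip: power_add mult_2)

text \<open>A complex with commuting cochain self-maps x_k; for the torus these are the
  multiplications by the variables.\<close>

locale multicomplex = module_family +
  fixes d :: "int \<Rightarrow> 'm \<Rightarrow> 'm" and x :: "nat \<Rightarrow> int \<Rightarrow> 'm \<Rightarrow> 'm"
  assumes d_linear: "\<And>l. linear_map R (M l) (M (l + 1)) (d l)"
    and x_linear: "\<And>k l. k \<in> N \<Longrightarrow> linear_map R (M l) (M l) (x k l)"
    and d_square: "\<And>l y. y \<in> carrier (M l) \<Longrightarrow> d (l + 1) (d l y) = \<zero>\<^bsub>M (l + 2)\<^esub>"
    and x_commute: "\<And>j k l y. j \<in> N \<Longrightarrow> k \<in> N \<Longrightarrow> y \<in> carrier (M l) \<Longrightarrow> x j l (x k l y) = x k l (x j l y)"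
    and d_x: "\<And>k l y. k \<in> N \<Longrightarrow> y \<in> carrier (M l) \<Longrightarrow> d l (x k l y) = x k (l + 1) (d l y)"
begin

lemma x_operator_linear: "linear_map R (total_module N M l) (total_module N M (l + 1)) (edge_operator N M x l)"
  by (rule edge_operator_linear) (rule x_linear)

lemma d_operator_linear: "linear_map R (total_module N M l) (total_module N M (l + 1)) (signed_diagonal N M 1 d l)"
  by (rule signed_diagonal_linear) (rule d_linear)

lemma total_differential_linear:
  "linear_map R (total_module N M l) (total_module N M (l + 1)) (total_differential N M d x l)"
  unfolding total_differential_def[abs_def] by (rule linear_map_diff[OF d_operator_linear x_operator_linear])

lemma total_differential_component:
  assumes v: "v \<in> carrier (total_module N M l)" and B: "B \<in> Pow N"
  shows "total_differential N M d x l v B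
    = [((-1) ^ card B :: int)] \<cdot>\<^bsub>M (l + 1 - int (card B))\<^esub> d (l - int (card B)) (v B)
      \<ominus>\<^bsub>M (l + 1 - int (card B))\<^esub> (\<Oplus>\<^bsub>M (l + 1 - int (card B))\<^esub>k\<in>B.
        [(position_sign B k)] \<cdot>\<^bsub>M (l + 1 - int (card B))\<^esub> x k (l + 1 - int (card B)) (v (B - {k})))"
  unfolding total_differential_def
  using linear_map_minus[OF component_linear[OF B] linear_map_closed[OF d_operator_linear v] linear_map_closed[OF x_operator_linear v]] B
  by (simp only: signed_diagonal_def edge_operator_def restrict_apply if_True)

lemma d_operator_square:
  assumes v: "v \<in> carrier (total_module N M l)"
  shows "signed_diagonal N M 1 d (l + 1) (signed_diagonal N M 1 d l v) = \<zero>\<^bsub>total_module N M (l + 2)\<^esub>"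
proof (rule direct_sum_eqI)
  interpret T: right_module R "total_module N M (l + 2)" by (rule total_right_module)
  show "signed_diagonal N M 1 d (l + 1) (signed_diagonal N M 1 d l v) \<in> carrier (total_module N M (l + 2))"
    using linear_map_closed[OF d_operator_linear linear_map_closed[OF d_operator_linear v]] by (simp add: add.assoc)
  fix B assume B: "B \<in> Pow N"
  define m where "m = l - int (card B)"
  have m: "l + 1 - int (card B) = m + 1" "l + 1 + 1 - int (card B) = m + 2" "l + 2 - int (card B) = m + 2"
    by (simp_all add: m_def)
  interpret K1: right_module R "M (m + 1)" by (rule family_module)
  interpret K2: right_module R "M (m + 2)" by (rule family_module)
  have y: "v B \<in> carrier (M m)" using total_component[OF v B] by (simp add: m_def)
  have d2: "linear_map R (M (m + 1)) (M (m + 2)) (d (m + 1))" using d_linear[of "m + 1"] by (simp add: add.assoc)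
  have "signed_diagonal N M 1 d (l + 1) (signed_diagonal N M 1 d l v) B
    = [((-1) ^ card B :: int)] \<cdot>\<^bsub>M (m + 2)\<^esub> d (m + 1) ([((-1) ^ card B :: int)] \<cdot>\<^bsub>M (m + 1)\<^esub> d m (v B))"
    using B m m_def by (simp only: signed_diagonal_def restrict_apply if_True)
  also have "\<dots> = \<zero>\<^bsub>M (m + 2)\<^esub>"
    using linear_map_int_smult[OF d2 linear_map_closed[OF d_linear y]] d_square[OF y]
    by (simp add: K2.M.int_smult_zero)
  finally show "signed_diagonal N M 1 d (l + 1) (signed_diagonal N M 1 d l v) B = \<zero>\<^bsub>total_module N M (l + 2)\<^esub> B"
    using B m by (simp only: direct_sum_simps restrict_apply if_True)
qed (use abelian_groupE(2)[OF right_moduleD(1)[OF total_right_module]] in blast)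

text \<open>Expanding (d - x)^2 gives two squares, which vanish, and two mixed terms, which cancel
  because d and x anticommute.\<close>

lemma total_differential_square:
  assumes v: "v \<in> carrier (total_module N M l)"
  shows "total_differential N M d x (l + 1) (total_differential N M d x l v) = \<zero>\<^bsub>total_module N M (l + 2)\<^esub>"
proof -
  have e2: "l + 1 + 1 = l + 2" by simp
  interpret T: right_module R "total_module N M (l + 2)" by (rule total_right_module)
  let ?s = "signed_diagonal N M 1 d" and ?e = "edge_operator N M x"
  note s2 = d_operator_linear[of "l + 1", unfolded e2] and x2 = x_operator_linear[of "l + 1", unfolded e2]
  note c = linear_map_closed[OF d_operator_linear v] linear_map_closed[OF x_operator_linear v]
  have "?s (l + 1) (?e l v) = \<ominus>\<^bsub>total_module N M (l + 2)\<^esub> ?e (l + 1) (?s l v)"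
    using signed_diagonal_edge_operator[of 1 d x v l] d_linear x_linear d_x v by (simp only: e2)
  moreover have "?e (l + 1) (?e l v) = \<zero>\<^bsub>total_module N M (l + 2)\<^esub>"
    by (rule edge_operator_square[OF _ _ v]) (rule x_linear x_commute, assumption+)+
  ultimately show ?thesis
    unfolding total_differential_def e2
    using linear_map_minus[OF s2 c] linear_map_minus[OF x2 c] d_operator_square[OF v]
      linear_map_closed[OF x2 c(1)] linear_map_closed[OF s2 c(2)]
    by (simp add: a_minus_def T.M.r_neg T.M.a_inv_zero)
qed

end

lemma diagonal_linear:
  assumes "module_family R N M" "module_family R N K" "\<And>l. linear_map R (M l) (K l) (b l)"
  shows "linear_map R (total_module N M l) (total_module N K l) (diagonal N b l)"
proof -
  interpret M: module_family R N M by fact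
  interpret K: module_family R N K by fact
  show ?thesis
    unfolding diagonal_def[abs_def]
    by (rule K.into_total[OF M.total_right_module]) (rule linear_map_compose[OF M.component_linear assms(3)])
qed

text \<open>The unsigned diagonal operator of a degree 0 map meets the same signs before and after,
  so commuting with d and with each x_k suffices.\<close>

lemma diagonal_total_differential:
  assumes "multicomplex R N M d x" "multicomplex R N K dK xK" and b: "\<And>l. linear_map R (M l) (K l) (b l)"
    and bd: "\<And>l y. y \<in> carrier (M l) \<Longrightarrow> b (l + 1) (d l y) = dK l (b l y)"
    and bx: "\<And>k l y. k \<in> N \<Longrightarrow> y \<in> carrier (M l) \<Longrightarrow> b l (x k l y) = xK k l (b l y)"
    and v: "v \<in> carrier (total_module N M l)"
  shows "diagonal N b (l + 1) (total_differential N M d x l v) = total_differential N K dK xK l (diagonal N b l v)"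
proof (rule direct_sum_eqI)
  interpret M: multicomplex R N M d x by fact
  interpret K: multicomplex R N K dK xK by fact
  have diag: "linear_map R (total_module N M l) (total_module N K l) (diagonal N b l)" for l
    by (rule diagonal_linear[OF _ _ b]) unfold_locales
  show "diagonal N b (l + 1) (total_differential N M d x l v) \<in> carrier (total_module N K (l + 1))"
    using linear_map_closed[OF diag linear_map_closed[OF M.total_differential_linear v]] .
  have w: "diagonal N b l v \<in> carrier (total_module N K l)" using linear_map_closed[OF diag v] .
  then show "total_differential N K dK xK l (diagonal N b l v) \<in> carrier (total_module N K (l + 1))"
    using linear_map_closed[OF K.total_differential_linear] by blast
  fix B assume B: "B \<in> Pow N"
  note finB = M.finite_sub[OF B]
  define m where "m = l - int (card B)"
  have m: "l + 1 - int (card B) = m + 1" by (simp add: m_def)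
  interpret M1: right_module R "M (m + 1)" by (rule M.family_module)
  interpret K1: right_module R "K (m + 1)" by (rule K.family_module)
  have y: "v B \<in> carrier (M m)" using M.total_component[OF v B] by (simp add: m_def)
  have kN: "k \<in> N" if "k \<in> B" for k using that B by auto
  have vk: "v (B - {k}) \<in> carrier (M (m + 1))" if "k \<in> B" for k using M.total_face[OF v B that] by (simp add: m)
  note xk = linear_map_closed[OF M.x_linear[OF kN] vk]
  have face: "diagonal N b l v (B - {k}) = b (m + 1) (v (B - {k}))" if "k \<in> B" for k
  proof -
    have "l - int (card (B - {k})) = m + 1" "B - {k} \<in> Pow N" using degree_face[OF finB that] B m by auto
    then show ?thesis by (simp only: diagonal_def restrict_apply if_True)
  qed
  have s: "(\<Oplus>\<^bsub>M (m + 1)\<^esub>k\<in>B. [(position_sign B k)] \<cdot>\<^bsub>M (m + 1)\<^esub> x k (m + 1) (v (B - {k}))) \<in> carrier (M (m + 1))"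
    using xk by (intro M1.M.finsum_closed) (auto simp: M1.M.int_smult_closed)
  have "diagonal N b (l + 1) (total_differential N M d x l v) B
      = b (m + 1) ([((-1) ^ card B :: int)] \<cdot>\<^bsub>M (m + 1)\<^esub> d m (v B)
      \<ominus>\<^bsub>M (m + 1)\<^esub> (\<Oplus>\<^bsub>M (m + 1)\<^esub>k\<in>B. [(position_sign B k)] \<cdot>\<^bsub>M (m + 1)\<^esub> x k (m + 1) (v (B - {k}))))"
    using B M.total_differential_component[OF v B] m m_def by (simp only: diagonal_def restrict_apply if_True)
  also have "\<dots> = b (m + 1) ([((-1) ^ card B :: int)] \<cdot>\<^bsub>M (m + 1)\<^esub> d m (v B))
      \<ominus>\<^bsub>K (m + 1)\<^esub> b (m + 1) (\<Oplus>\<^bsub>M (m + 1)\<^esub>k\<in>B. [(position_sign B k)] \<cdot>\<^bsub>M (m + 1)\<^esub> x k (m + 1) (v (B - {k})))"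
    by (rule linear_map_minus[OF b _ s]) (simp add: M1.M.int_smult_closed linear_map_closed[OF M.d_linear y])
  also have "b (m + 1) ([((-1) ^ card B :: int)] \<cdot>\<^bsub>M (m + 1)\<^esub> d m (v B)) = [((-1) ^ card B :: int)] \<cdot>\<^bsub>K (m + 1)\<^esub> dK m (b m (v B))"
    using linear_map_int_smult[OF b linear_map_closed[OF M.d_linear y]] bd[OF y] by simp
  also have "b (m + 1) (\<Oplus>\<^bsub>M (m + 1)\<^esub>k\<in>B. [(position_sign B k)] \<cdot>\<^bsub>M (m + 1)\<^esub> x k (m + 1) (v (B - {k})))
      = (\<Oplus>\<^bsub>K (m + 1)\<^esub>k\<in>B. b (m + 1) ([(position_sign B k)] \<cdot>\<^bsub>M (m + 1)\<^esub> x k (m + 1) (v (B - {k}))))"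
    by (rule linear_map_finsum[OF b]) (use xk in \<open>auto simp: M1.M.int_smult_closed\<close>)
  also have "\<dots> = (\<Oplus>\<^bsub>K (m + 1)\<^esub>k\<in>B. [(position_sign B k)] \<cdot>\<^bsub>K (m + 1)\<^esub> xK k (m + 1) (diagonal N b l v (B - {k})))"
  proof (rule K1.M.finsum_cong'[OF refl])
    show "(\<lambda>k. [(position_sign B k)] \<cdot>\<^bsub>K (m + 1)\<^esub> xK k (m + 1) (diagonal N b l v (B - {k}))) \<in> B \<rightarrow> carrier (K (m + 1))"
    proof
      fix k assume k: "k \<in> B"
      show "[(position_sign B k)] \<cdot>\<^bsub>K (m + 1)\<^esub> xK k (m + 1) (diagonal N b l v (B - {k})) \<in> carrier (K (m + 1))"
        unfolding face[OF k]
        using linear_map_closed[OF K.x_linear[OF kN[OF k]] linear_map_closed[OF b vk[OF k]]]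
        by (simp add: K1.M.int_smult_closed)
    qed
    fix k assume k: "k \<in> B"
    show "b (m + 1) ([(position_sign B k)] \<cdot>\<^bsub>M (m + 1)\<^esub> x k (m + 1) (v (B - {k})))
        = [(position_sign B k)] \<cdot>\<^bsub>K (m + 1)\<^esub> xK k (m + 1) (diagonal N b l v (B - {k}))"
      unfolding face[OF k] using linear_map_int_smult[OF b xk[OF k k]] bx[OF kN[OF k] vk[OF k]] by simp
  qed
  finally show "diagonal N b (l + 1) (total_differential N M d x l v) B
      = total_differential N K dK xK l (diagonal N b l v) B"
    unfolding K.total_differential_component[OF w B]
    using B m m_def by (simp only: diagonal_def[of N b l v] restrict_apply if_True)
qed

section \<open>The operators h, G and P on the total modules\<close>

locale homotopy_data = zigzag_data R N M h G + M: multicomplex R N M d x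
  for R :: "('r, 'x) ring_scheme" and N :: "nat set" and M :: "int \<Rightarrow> ('r, 'm) module"
    and h G d x +
  assumes h_commute: "\<And>j k l y. j \<in> N \<Longrightarrow> k \<in> N \<Longrightarrow> y \<in> carrier (M l) \<Longrightarrow> h j l (h k l y) = h k l (h j l y)"
    and h_x: "\<And>j k l y. j \<in> N \<Longrightarrow> k \<in> N \<Longrightarrow> y \<in> carrier (M l) \<Longrightarrow> h j l (x k l y) = x k l (h j l y)"
    and d_h: "\<And>k l y. k \<in> N \<Longrightarrow> y \<in> carrier (M l) \<Longrightarrow> d l (h k l y) = h k (l + 1) (d l y)"
    and G_x: "\<And>k l y. k \<in> N \<Longrightarrow> y \<in> carrier (M l) \<Longrightarrow> G l (x k l y) = x k (l - 1) (G l y)"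
begin

abbreviation "T \<equiv> total_module N M"
abbreviation "dT \<equiv> total_differential N M d x"
abbreviation "hT \<equiv> edge_operator N M h"
abbreviation "GT \<equiv> signed_diagonal N M (-1) G"

lemma hT_linear: "linear_map R (T l) (T (l + 1)) (hT l)"
  by (rule M.edge_operator_linear) (rule h_linear)

lemma GT_linear: "linear_map R (T l) (T (l - 1)) (GT l)"
  using M.signed_diagonal_linear[of "-1" G l] G_linear by simp

text \<open>Both parts of d - x anticommute with h: d by the sign of a signed diagonal operator, x
  as the edge operator of maps that commute with all h_k.\<close>

lemma dT_hT:
  assumes v: "v \<in> carrier (T l)"
  shows "dT (l + 1) (hT l v) = \<ominus>\<^bsub>T (l + 2)\<^esub> hT (l + 1) (dT l v)"
proof -
  have e2: "l + 1 + 1 = l + 2" by simp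
  interpret T: right_module R "T (l + 2)" by (rule M.total_right_module)
  let ?s = "signed_diagonal N M 1 d" and ?e = "edge_operator N M x"
  note h2 = hT_linear[of "l + 1", unfolded e2]
  note c = linear_map_closed[OF M.d_operator_linear v] linear_map_closed[OF M.x_operator_linear v]
  have 1: "?s (l + 1) (hT l v) = \<ominus>\<^bsub>T (l + 2)\<^esub> hT (l + 1) (?s l v)"
    using M.signed_diagonal_edge_operator[of 1 d h v l] M.d_linear h_linear d_h v by (simp only: e2)
  have 2: "?e (l + 1) (hT l v) = \<ominus>\<^bsub>T (l + 2)\<^esub> hT (l + 1) (?e l v)"
    by (rule M.edge_operator_anticommute[OF _ _ _ _ _ v])
      (simp_all add: M.x_linear h_linear M.x_commute h_commute h_x)
  show ?thesis
    unfolding total_differential_def e2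
    using linear_map_minus[OF h2 c] 1 2 linear_map_closed[OF h2 c(1)] linear_map_closed[OF h2 c(2)]
    by (simp add: a_minus_def T.M.minus_add)
qed

lemma hT_square: "v \<in> carrier (T l) \<Longrightarrow> hT (l + 1) (hT l v) = \<zero>\<^bsub>T (l + 2)\<^esub>"
  by (rule M.edge_operator_square) (rule h_linear h_commute, assumption+)+

text \<open>The homotopy relation on the total modules, solved for d G. The signs of d and G at the
  same B cancel, which gives the relation for d alone. It persists for d - x because G anticommutes
  with the operator x, so that the two contributions of x cancel.\<close>

lemma dT_GT:
  assumes v: "v \<in> carrier (T l)"
    and c: "\<And>l. linear_map R (M l) (M l) (c l)"
    and homotopy: "\<And>l y. y \<in> carrier (M l) \<Longrightarrow> d (l - 1) (G l y) \<oplus>\<^bsub>M l\<^esub> G (l + 1) (d l y) = c l y \<ominus>\<^bsub>M l\<^esub> y"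
  shows "dT (l - 1) (GT l v) = diagonal N c l v \<ominus>\<^bsub>T l\<^esub> v \<ominus>\<^bsub>T l\<^esub> GT (l + 1) (dT l v)"
proof -
  have e: "l - 1 + 1 = l" "l + 1 - 1 = l" "l + 1 + - 1 = l" "l + - 1 = l - 1" by simp_all
  interpret T: right_module R "T l" by (rule M.total_right_module)
  let ?s = "signed_diagonal N M 1 d" and ?e = "edge_operator N M x"
  have cT: "linear_map R (T l) (T l) (diagonal N c l)"
    by (rule diagonal_linear[OF _ _ c]) unfold_locales
  note s1 = M.d_operator_linear[of "l - 1", unfolded e] and x1 = M.x_operator_linear[of "l - 1", unfolded e]
    and G1 = GT_linear[of "l + 1", unfolded e]
  note gv = linear_map_closed[OF GT_linear v]
  note cl = linear_map_closed[OF M.d_operator_linear v] linear_map_closed[OF M.x_operator_linear v]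
  have 1: "GT (l + 1) (?e l v) = \<ominus>\<^bsub>T l\<^esub> ?e (l - 1) (GT l v)"
    using M.signed_diagonal_edge_operator[of "-1" G x v l] G_linear M.x_linear G_x v by (simp only: e) simp
  have 2: "?s (l - 1) (GT l v) = diagonal N c l v \<ominus>\<^bsub>T l\<^esub> v \<ominus>\<^bsub>T l\<^esub> GT (l + 1) (?s l v)"
  proof (rule direct_sum_eqI)
    show "?s (l - 1) (GT l v) \<in> carrier (T l)" using linear_map_closed[OF s1 gv] .
    have cv: "diagonal N c l v \<in> carrier (T l)" using linear_map_closed[OF cT v] .
    have gd: "GT (l + 1) (?s l v) \<in> carrier (T l)" using linear_map_closed[OF G1 cl(1)] .
    show "diagonal N c l v \<ominus>\<^bsub>T l\<^esub> v \<ominus>\<^bsub>T l\<^esub> GT (l + 1) (?s l v) \<in> carrier (T l)" using cv gd v by simp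
    fix B assume B: "B \<in> Pow N"
    define m where "m = l - int (card B)"
    have m: "l + 1 - int (card B) = m + 1" "l - 1 - int (card B) = m - 1" "l + - 1 - int (card B) = m - 1"
      "l - 1 + 1 - int (card B) = m" "l + 1 + - 1 - int (card B) = m"
      by (simp_all add: m_def)
    have y: "v B \<in> carrier (M m)" using M.total_component[OF v B] by (simp add: m_def)
    interpret K: right_module R "M m" by (rule M.family_module)
    have dm: "linear_map R (M (m - 1)) (M m) (d (m - 1))" using M.d_linear[of "m - 1"] by simp
    have Gm: "linear_map R (M (m + 1)) (M m) (G (m + 1))" using G_linear[of "m + 1"] by simp
    note gy = linear_map_closed[OF G_linear y] and dy = linear_map_closed[OF M.d_linear y]
    note dgy = linear_map_closed[OF dm gy] and gdy = linear_map_closed[OF Gm dy]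
    have "?s (l - 1) (GT l v) B = [((-1) ^ card B :: int)] \<cdot>\<^bsub>M m\<^esub> d (m - 1) ([((-1) ^ card B :: int)] \<cdot>\<^bsub>M (m - 1)\<^esub> G m (v B))"
      using B m m_def by (simp only: signed_diagonal_def restrict_apply if_True)
    also have "\<dots> = d (m - 1) (G m (v B))"
      using linear_map_int_smult[OF dm gy] dgy by (simp add: K.M.int_smult_mult[symmetric] square_sign K.M.int_smult_one)
    also have "\<dots> = c m (v B) \<ominus>\<^bsub>M m\<^esub> v B \<ominus>\<^bsub>M m\<^esub> G (m + 1) (d m (v B))"
      unfolding homotopy[OF y, symmetric] using dgy gdy by (simp add: a_minus_def K.M.a_assoc K.M.r_neg)
    also have "G (m + 1) (d m (v B)) = [((-1) ^ card B :: int)] \<cdot>\<^bsub>M m\<^esub> G (m + 1) ([((-1) ^ card B :: int)] \<cdot>\<^bsub>M (m + 1)\<^esub> d m (v B))"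
      using linear_map_int_smult[OF Gm dy] gdy by (simp add: K.M.int_smult_mult[symmetric] square_sign K.M.int_smult_one)
    also have "\<dots> = GT (l + 1) (?s l v) B"
      using B m m_def by (simp only: signed_diagonal_def restrict_apply if_True)
    also have "c m (v B) = diagonal N c l v B"
      using B m_def by (simp only: diagonal_def restrict_apply if_True)
    finally show "?s (l - 1) (GT l v) B = (diagonal N c l v \<ominus>\<^bsub>T l\<^esub> v \<ominus>\<^bsub>T l\<^esub> GT (l + 1) (?s l v)) B"
      using linear_map_minus[OF M.component_linear[OF B], of "diagonal N c l v \<ominus>\<^bsub>T l\<^esub> v" l "GT (l + 1) (?s l v)"]
        linear_map_minus[OF M.component_linear[OF B] cv v] cv gd v by (simp add: m_def)
  qed
  \<comment> \<open>Subtracting x inside and moving G past it produces a plus sign; this matches the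
    term -x G on the other side.\<close>
  have 3: "GT (l + 1) (dT l v) = GT (l + 1) (?s l v) \<oplus>\<^bsub>T l\<^esub> ?e (l - 1) (GT l v)"
    unfolding total_differential_def
    using linear_map_minus[OF G1 cl] 1 linear_map_closed[OF x1 gv] by (simp add: a_minus_def)
  show ?thesis
    unfolding 3 unfolding total_differential_def 2 e
    using linear_map_closed[OF x1 gv] linear_map_closed[OF G1 cl(1)] linear_map_closed[OF cT v] v
    by (simp add: a_minus_def T.M.minus_add T.M.a_assoc)
qed

text \<open>The operator P. It is strictly triangular: an entry at (B, A) exists only for a proper
  subset A of B, and it depends on the difference set B - A.\<close>

definition zigzag_operator :: "int \<Rightarrow> (nat set \<Rightarrow> 'm) \<Rightarrow> nat set \<Rightarrow> 'm" where
  "zigzag_operator l v = (\<lambda>B\<in>Pow N. \<Oplus>\<^bsub>M (l + 1 - int (card B))\<^esub>A\<in>{A. A \<subset> B}.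
    [(entry_sign B A)] \<cdot>\<^bsub>M (l + 1 - int (card B))\<^esub> alternating_zigzag M h G (B - A) (l - int (card A)) (v A))"

lemma proper_subset_facts:
  assumes "B \<in> Pow N" "A \<subset> B"
  shows "A \<in> Pow N" "B - A \<noteq> {}" "B - A \<subseteq> N" "int (card (B - A)) = int (card B) - int (card A)"
proof -
  show "A \<in> Pow N" "B - A \<noteq> {}" "B - A \<subseteq> N" using assms by auto
  have "finite A" "card A \<le> card B"
    using assms M.finite_sub[OF assms(1)] finite_subset card_mono by (metis psubset_imp_subset)+
  then show "int (card (B - A)) = int (card B) - int (card A)"
    using assms by (simp add: card_Diff_subset psubset_imp_subset of_nat_diff)
qed

lemma zigzag_entry_linear:
  assumes B: "B \<in> Pow N" and A: "A \<subset> B"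
  shows "linear_map R (T l) (M (l + 1 - int (card B))) (\<lambda>v. alternating_zigzag M h G (B - A) (l - int (card A)) (v A))"
proof -
  note f = proper_subset_facts[OF B A]
  have "l - int (card A) + 1 - int (card (B - A)) = l + 1 - int (card B)" using f(4) by simp
  then have "linear_map R (M (l - int (card A))) (M (l + 1 - int (card B))) (alternating_zigzag M h G (B - A) (l - int (card A)))"
    using alternating_zigzag_linear[OF f(2,3), of "l - int (card A)"] by (simp only:)
  from linear_map_compose[OF M.component_linear[OF f(1)] this] show ?thesis .
qed

lemma zigzag_operator_linear: "linear_map R (T l) (T (l + 1)) (zigzag_operator l)"
  unfolding zigzag_operator_def[abs_def]
proof (rule M.into_total[OF M.total_right_module])
  fix B assume B: "B \<in> Pow N"
  show "linear_map R (T l) (M (l + 1 - int (card B))) (\<lambda>v. \<Oplus>\<^bsub>M (l + 1 - int (card B))\<^esub>A\<in>{A. A \<subset> B}.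
    [(entry_sign B A)] \<cdot>\<^bsub>M (l + 1 - int (card B))\<^esub> alternating_zigzag M h G (B - A) (l - int (card A)) (v A))"
    by (rule linear_map_sum[OF M.total_right_module M.family_module], rule linear_map_int_multiple,
        rule zigzag_entry_linear[OF B]) simp
qed

lemma homotopy_entry_linear:
  assumes B: "B \<in> Pow N" and A: "A \<subseteq> B"
  shows "linear_map R (T l) (M (l - int (card B))) (\<lambda>v. homotopy_zigzag (B - A) (l - int (card A)) (v A))"
proof -
  have AN: "A \<in> Pow N" "B - A \<subseteq> N" using assms by auto
  have "finite A" "card A \<le> card B"
    using A M.finite_sub[OF B] finite_subset card_mono by metis+
  then have "l - int (card A) - int (card (B - A)) = l - int (card B)"
    using A by (simp add: card_Diff_subset of_nat_diff)
  then have "linear_map R (M (l - int (card A))) (M (l - int (card B))) (homotopy_zigzag (B - A) (l - int (card A)))"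
    using homotopy_zigzag_linear[OF AN(2), of "l - int (card A)"] by (simp only:)
  from linear_map_compose[OF M.component_linear[OF AN(1)] this] show ?thesis .
qed

text \<open>The matrix of 1 + G P. The factor (-1)^{|B|} comes from the signed operator G, and the
  identity fills in the diagonal entry A = B.\<close>

lemma homotopy_series_component:
  assumes v: "v \<in> carrier (T l)" and B: "B \<in> Pow N"
  shows "(v \<oplus>\<^bsub>T l\<^esub> GT (l + 1) (zigzag_operator l v)) B = (\<Oplus>\<^bsub>M (l - int (card B))\<^esub>A\<in>{A. A \<subseteq> B}.
    [((-1) ^ card B * entry_sign B A)] \<cdot>\<^bsub>M (l - int (card B))\<^esub> homotopy_zigzag (B - A) (l - int (card A)) (v A))"
proof -
  define m where "m = l - int (card B)"
  have m: "l + 1 - int (card B) = m + 1" "l + 1 + - 1 - int (card B) = m" by (simp_all add: m_def)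
  interpret K: right_module R "M m" by (rule M.family_module)
  interpret K1: right_module R "M (m + 1)" by (rule M.family_module)
  note finB = M.finite_sub[OF B]
  have Gm: "linear_map R (M (m + 1)) (M m) (G (m + 1))" using G_linear[of "m + 1"] by simp
  have y: "v B \<in> carrier (M m)" using M.total_component[OF v B] by (simp add: m_def)
  let ?Z = "\<lambda>A. alternating_zigzag M h G (B - A) (l - int (card A)) (v A)"
  let ?H = "\<lambda>A. homotopy_zigzag (B - A) (l - int (card A)) (v A)"
  have Z: "?Z A \<in> carrier (M (m + 1))" if "A \<subset> B" for A
    using linear_map_closed[OF zigzag_entry_linear[OF B that] v] unfolding m .
  have H: "?H A \<in> carrier (M m)" if "A \<subseteq> B" for A
    using linear_map_closed[OF homotopy_entry_linear[OF B that] v] unfolding m_def .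
  have HG: "?H A = G (m + 1) (?Z A)" if "A \<subset> B" for A
  proof -
    note f = proper_subset_facts[OF B that]
    have "l - int (card A) + 1 - int (card (B - A)) = m + 1" using f(4) by (simp add: m_def)
    then show ?thesis using f(2) by (simp only: homotopy_zigzag_def if_False)
  qed
  have fin: "finite {A. A \<subset> B}" by (rule finite_subset[of _ "Pow B"]) (use finB in auto)
  have "GT (l + 1) (zigzag_operator l v) B
      = [((-1) ^ card B :: int)] \<cdot>\<^bsub>M m\<^esub> G (m + 1) (\<Oplus>\<^bsub>M (m + 1)\<^esub>A\<in>{A. A \<subset> B}. [(entry_sign B A)] \<cdot>\<^bsub>M (m + 1)\<^esub> ?Z A)"
    using B m by (simp only: signed_diagonal_def zigzag_operator_def restrict_apply if_True)
  also have "\<dots> = (\<Oplus>\<^bsub>M m\<^esub>A\<in>{A. A \<subset> B}. [((-1) ^ card B :: int)] \<cdot>\<^bsub>M m\<^esub> G (m + 1) ([(entry_sign B A)] \<cdot>\<^bsub>M (m + 1)\<^esub> ?Z A))"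
    by (rule linear_map_finsum[OF linear_map_int_multiple[OF Gm]]) (use Z in \<open>auto simp: K1.M.int_smult_closed\<close>)
  also have "\<dots> = (\<Oplus>\<^bsub>M m\<^esub>A\<in>{A. A \<subset> B}. [((-1) ^ card B * entry_sign B A)] \<cdot>\<^bsub>M m\<^esub> ?H A)"
  proof (rule K.M.finsum_cong'[OF refl])
    show "(\<lambda>A. [((-1) ^ card B * entry_sign B A)] \<cdot>\<^bsub>M m\<^esub> ?H A) \<in> {A. A \<subset> B} \<rightarrow> carrier (M m)"
      using H by (auto simp: K.M.int_smult_closed)
    fix A assume "A \<in> {A. A \<subset> B}"
    then have A: "A \<subset> B" by simp
    show "[((-1) ^ card B :: int)] \<cdot>\<^bsub>M m\<^esub> G (m + 1) ([(entry_sign B A)] \<cdot>\<^bsub>M (m + 1)\<^esub> ?Z A) = [((-1) ^ card B * entry_sign B A)] \<cdot>\<^bsub>M m\<^esub> ?H A"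
      using linear_map_int_smult[OF Gm Z[OF A]] linear_map_closed[OF Gm Z[OF A]] HG[OF A] by (simp add: K.M.int_smult_mult)
  qed
  finally have 1: "GT (l + 1) (zigzag_operator l v) B = (\<Oplus>\<^bsub>M m\<^esub>A\<in>{A. A \<subset> B}. [((-1) ^ card B * entry_sign B A)] \<cdot>\<^bsub>M m\<^esub> ?H A)" .
  \<comment> \<open>For A = B both signs are (-1)^{|B|}, so their product is 1 and the summand is v
    B itself.\<close>
  have "v B = [((-1) ^ card B * entry_sign B B)] \<cdot>\<^bsub>M m\<^esub> ?H B"
    using y finB by (simp add: homotopy_zigzag_def entry_sign_refl square_sign K.M.int_smult_one)
  then have "(v \<oplus>\<^bsub>T l\<^esub> GT (l + 1) (zigzag_operator l v)) B
      = [((-1) ^ card B * entry_sign B B)] \<cdot>\<^bsub>M m\<^esub> ?H B \<oplus>\<^bsub>M m\<^esub> (\<Oplus>\<^bsub>M m\<^esub>A\<in>{A. A \<subset> B}. [((-1) ^ card B * entry_sign B A)] \<cdot>\<^bsub>M m\<^esub> ?H A)"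
    using B 1 by (simp only: direct_sum_simps restrict_apply if_True m_def)
  also have "\<dots> = (\<Oplus>\<^bsub>M m\<^esub>A\<in>insert B {A. A \<subset> B}. [((-1) ^ card B * entry_sign B A)] \<cdot>\<^bsub>M m\<^esub> ?H A)"
    by (rule K.M.finsum_insert[symmetric]) (use fin H H[OF order_refl] in \<open>auto simp: K.M.int_smult_closed\<close>)
  also have "insert B {A. A \<subset> B} = {A. A \<subseteq> B}" by auto
  finally show ?thesis unfolding m_def .
qed

text \<open>Compare the entries at (B, A). Applying h to 1 + G P gives a sum over k in B and subsets
  A of B - {k}; after exchanging the order, the inner sum runs over k in B - A and is the expansion
  of the alternating sum by its first factor. The signs agree by
  \<open>entry_sign_step\<close>.\<close>

lemma zigzag_operator_rec:
  assumes v: "v \<in> carrier (T l)"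
  shows "zigzag_operator l v = hT l (v \<oplus>\<^bsub>T l\<^esub> GT (l + 1) (zigzag_operator l v))"
proof (rule direct_sum_eqI)
  have G1: "linear_map R (T (l + 1)) (T l) (GT (l + 1))" using GT_linear[of "l + 1"] by simp
  let ?u = "v \<oplus>\<^bsub>T l\<^esub> GT (l + 1) (zigzag_operator l v)"
  note P = linear_map_closed[OF zigzag_operator_linear v]
  then show "zigzag_operator l v \<in> carrier (T (l + 1))" .
  have u: "?u \<in> carrier (T l)"
    using abelian_groupE(1)[OF right_moduleD(1)[OF M.total_right_module] v linear_map_closed[OF G1 P]] .
  then show "hT l ?u \<in> carrier (T (l + 1))" by (rule linear_map_closed[OF hT_linear])
  fix B assume B: "B \<in> Pow N"
  define m where "m = l + 1 - int (card B)"
  interpret K: right_module R "M m" by (rule M.family_module)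
  note finB = M.finite_sub[OF B]
  have kN: "k \<in> N" if "k \<in> B" for k using that B by auto
  let ?H = "\<lambda>k A. homotopy_zigzag (B - {k} - A) (l - int (card A)) (v A)"
  have deg: "l - int (card (B - {k})) = m" if "k \<in> B" for k
    using degree_face[OF finB that] by (simp add: m_def)
  have H: "?H k A \<in> carrier (M m)" if "k \<in> B" "A \<subseteq> B - {k}" for k A
    using linear_map_closed[OF homotopy_entry_linear[OF _ that(2)] v] deg[OF that(1)] B by auto
  note hH = linear_map_closed[OF h_linear[OF kN] H]
  have fin: "finite {A. A \<subset> B}" by (rule finite_subset[of _ "Pow B"]) (use finB in auto)
  have "hT l ?u B = (\<Oplus>\<^bsub>M m\<^esub>k\<in>B. [(position_sign B k)] \<cdot>\<^bsub>M m\<^esub> h k m (?u (B - {k})))"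
    using B by (simp only: edge_operator_def restrict_apply if_True m_def)
  also have "\<dots> = (\<Oplus>\<^bsub>M m\<^esub>k\<in>B. \<Oplus>\<^bsub>M m\<^esub>A\<in>{A \<in> {A. A \<subset> B}. k \<notin> A}.
      [(entry_sign B A * position_sign (B - A) k)] \<cdot>\<^bsub>M m\<^esub> h k m (?H k A))"
  proof (rule K.M.finsum_cong'[OF refl])
    show "(\<lambda>k. \<Oplus>\<^bsub>M m\<^esub>A\<in>{A \<in> {A. A \<subset> B}. k \<notin> A}. [(entry_sign B A * position_sign (B - A) k)] \<cdot>\<^bsub>M m\<^esub> h k m (?H k A)) \<in> B \<rightarrow> carrier (M m)"
      using hH by (intro funcsetI K.M.finsum_closed) (auto intro!: K.M.int_smult_closed)
    fix k assume k: "k \<in> B"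
    have Bk: "B - {k} \<in> Pow N" using B by auto
    \<comment> \<open>A set inside B - {k} is the same as a proper subset of B that avoids k. In
      this form the range of A is independent of k up to a relation, as the exchange of sums
      requires.\<close>
    have set: "{A. A \<subseteq> B - {k}} = {A \<in> {A. A \<subset> B}. k \<notin> A}" using k by auto
    have "?u (B - {k}) = (\<Oplus>\<^bsub>M m\<^esub>A\<in>{A \<in> {A. A \<subset> B}. k \<notin> A}.
        [((-1) ^ card (B - {k}) * entry_sign (B - {k}) A)] \<cdot>\<^bsub>M m\<^esub> ?H k A)"
      using homotopy_series_component[OF v Bk] unfolding deg[OF k] set .
    then have "[(position_sign B k)] \<cdot>\<^bsub>M m\<^esub> h k m (?u (B - {k}))
      = [(position_sign B k)] \<cdot>\<^bsub>M m\<^esub> h k m (\<Oplus>\<^bsub>M m\<^esub>A\<in>{A \<in> {A. A \<subset> B}. k \<notin> A}.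
        [((-1) ^ card (B - {k}) * entry_sign (B - {k}) A)] \<cdot>\<^bsub>M m\<^esub> ?H k A)" by (rule arg_cong)
    also have "\<dots> = (\<Oplus>\<^bsub>M m\<^esub>A\<in>{A \<in> {A. A \<subset> B}. k \<notin> A}. [(position_sign B k)] \<cdot>\<^bsub>M m\<^esub> h k m
        ([((-1) ^ card (B - {k}) * entry_sign (B - {k}) A)] \<cdot>\<^bsub>M m\<^esub> ?H k A))"
      by (rule linear_map_finsum[OF linear_map_int_multiple[OF h_linear[OF kN[OF k]]]])
        (use H[OF k] in \<open>auto intro!: K.M.int_smult_closed\<close>)
    also have "\<dots> = (\<Oplus>\<^bsub>M m\<^esub>A\<in>{A \<in> {A. A \<subset> B}. k \<notin> A}.
        [(entry_sign B A * position_sign (B - A) k)] \<cdot>\<^bsub>M m\<^esub> h k m (?H k A))"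
    proof (rule K.M.finsum_cong'[OF refl])
      show "(\<lambda>A. [(entry_sign B A * position_sign (B - A) k)] \<cdot>\<^bsub>M m\<^esub> h k m (?H k A)) \<in> {A \<in> {A. A \<subset> B}. k \<notin> A} \<rightarrow> carrier (M m)"
        using hH[OF k k] by (auto intro!: K.M.int_smult_closed)
      fix A assume A: "A \<in> {A \<in> {A. A \<subset> B}. k \<notin> A}"
      then have A': "A \<subseteq> B - {k}" "A \<subseteq> B" "k \<in> B - A" using k by auto
      have "position_sign B k * ((-1) ^ card (B - {k}) * entry_sign (B - {k}) A) = entry_sign B A * position_sign (B - A) k"
        using entry_sign_step[OF finB A'(2,3)] k finB by simp
      then show "[(position_sign B k)] \<cdot>\<^bsub>M m\<^esub> h k m ([((-1) ^ card (B - {k}) * entry_sign (B - {k}) A)] \<cdot>\<^bsub>M m\<^esub> ?H k A)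
        = [(entry_sign B A * position_sign (B - A) k)] \<cdot>\<^bsub>M m\<^esub> h k m (?H k A)"
        using linear_map_int_smult[OF h_linear[OF kN[OF k]] H[OF k A'(1)]] hH[OF k k A'(1)]
        by (simp add: K.M.int_smult_mult[symmetric])
    qed
    finally show "[(position_sign B k)] \<cdot>\<^bsub>M m\<^esub> h k m (?u (B - {k})) = (\<Oplus>\<^bsub>M m\<^esub>A\<in>{A \<in> {A. A \<subset> B}. k \<notin> A}.
        [(entry_sign B A * position_sign (B - A) k)] \<cdot>\<^bsub>M m\<^esub> h k m (?H k A))" .
  qed
  \<comment> \<open>From here on the sum is organised by the source A.\<close>
  also have "\<dots> = (\<Oplus>\<^bsub>M m\<^esub>A\<in>{A. A \<subset> B}. \<Oplus>\<^bsub>M m\<^esub>k\<in>{k \<in> B. k \<notin> A}.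
      [(entry_sign B A * position_sign (B - A) k)] \<cdot>\<^bsub>M m\<^esub> h k m (?H k A))"
    by (rule K.M.finsum_swap_restrict[OF finB fin]) (use hH in \<open>auto intro!: K.M.int_smult_closed\<close>)
  also have "\<dots> = (\<Oplus>\<^bsub>M m\<^esub>A\<in>{A. A \<subset> B}. [(entry_sign B A)] \<cdot>\<^bsub>M m\<^esub> alternating_zigzag M h G (B - A) (l - int (card A)) (v A))"
  proof (rule K.M.finsum_cong'[OF refl])
    show "(\<lambda>A. [(entry_sign B A)] \<cdot>\<^bsub>M m\<^esub> alternating_zigzag M h G (B - A) (l - int (card A)) (v A)) \<in> {A. A \<subset> B} \<rightarrow> carrier (M m)"
      using linear_map_closed[OF zigzag_entry_linear[OF B] v]
      unfolding m_def[symmetric] by (intro funcsetI K.M.int_smult_closed) simp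
    fix A assume "A \<in> {A. A \<subset> B}"
    then have A: "A \<subset> B" by simp
    note f = proper_subset_facts[OF B A]
    have set: "{k \<in> B. k \<notin> A} = B - A" by auto
    have dg: "l - int (card A) + 1 - int (card (B - A)) = m" using f(4) by (simp add: m_def)
    have sw: "B - {k} - A = B - A - {k}" for k by auto
    have hH': "h k m (?H k A) \<in> carrier (M m)" if "k \<in> B - A" for k
      using hH[of k k A] that A by auto
    have "(\<Oplus>\<^bsub>M m\<^esub>k\<in>{k \<in> B. k \<notin> A}. [(entry_sign B A * position_sign (B - A) k)] \<cdot>\<^bsub>M m\<^esub> h k m (?H k A))
      = (\<Oplus>\<^bsub>M m\<^esub>k\<in>B - A. [(entry_sign B A)] \<cdot>\<^bsub>M m\<^esub> ([(position_sign (B - A) k)] \<cdot>\<^bsub>M m\<^esub> h k m (?H k A)))"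
      unfolding set by (rule K.M.finsum_cong'[OF refl])
        (use hH' in \<open>auto intro!: K.M.int_smult_closed K.M.int_smult_mult\<close>)
    also have "\<dots> = [(entry_sign B A)] \<cdot>\<^bsub>M m\<^esub> (\<Oplus>\<^bsub>M m\<^esub>k\<in>B - A. [(position_sign (B - A) k)] \<cdot>\<^bsub>M m\<^esub> h k m (?H k A))"
      by (rule linear_map_finsum[OF linear_map_int_multiple[OF linear_map_ident[OF M.family_module]], symmetric])
        (use hH' in \<open>auto intro!: K.M.int_smult_closed\<close>)
    also have "(\<Oplus>\<^bsub>M m\<^esub>k\<in>B - A. [(position_sign (B - A) k)] \<cdot>\<^bsub>M m\<^esub> h k m (?H k A))
        = alternating_zigzag M h G (B - A) (l - int (card A)) (v A)"
      using alternating_zigzag_rec[OF f(2,3) M.total_component[OF v f(1)]] unfolding dg sw by simp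
    finally show "(\<Oplus>\<^bsub>M m\<^esub>k\<in>{k \<in> B. k \<notin> A}. [(entry_sign B A * position_sign (B - A) k)] \<cdot>\<^bsub>M m\<^esub> h k m (?H k A))
      = [(entry_sign B A)] \<cdot>\<^bsub>M m\<^esub> alternating_zigzag M h G (B - A) (l - int (card A)) (v A)" .
  qed
  also have "\<dots> = zigzag_operator l v B"
    using B by (simp only: zigzag_operator_def restrict_apply if_True m_def)
  finally show "zigzag_operator l v B = hT l ?u B" by simp
qed

text \<open>G preserves the index set and h enlarges it by one element, so the component at B of a
  fixed point is built from the components at the faces of B. At the empty set the sum is empty, and
  induction on the cardinality does the rest.\<close>

lemma hT_GT_nilpotent:
  assumes q: "q \<in> carrier (T l)" and fp: "q = hT (l - 1) (GT l q)"
  shows "q = \<zero>\<^bsub>T l\<^esub>"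
proof (rule direct_sum_eqI[OF q])
  show "\<zero>\<^bsub>T l\<^esub> \<in> carrier (T l)" using abelian_groupE(2)[OF right_moduleD(1)[OF M.total_right_module]] .
  have zero: "q B = \<zero>\<^bsub>M (l - int (card B))\<^esub>" if "B \<in> Pow N" for B
    using that
  proof (induction "card B" arbitrary: B rule: less_induct)
    case less
    note B = less.prems and finB = M.finite_sub[OF less.prems]
    define m where "m = l - int (card B)"
    interpret K: right_module R "M m" by (rule M.family_module)
    interpret K1: right_module R "M (m + 1)" by (rule M.family_module)
    have m: "l - 1 + 1 - int (card B) = m" by (simp add: m_def)
    have Gm: "linear_map R (M (m + 1)) (M m) (G (m + 1))" using G_linear[of "m + 1"] by simp
    have "q B = (\<Oplus>\<^bsub>M m\<^esub>k\<in>B. [(position_sign B k)] \<cdot>\<^bsub>M m\<^esub> h k m (GT l q (B - {k})))"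
      using B fun_cong[OF fp, of B] m by (simp only: edge_operator_def restrict_apply if_True)
    also have "\<dots> = \<zero>\<^bsub>M m\<^esub>"
    proof (rule K.M.finsum_zero_eqI)
      fix k assume k: "k \<in> B"
      have kN: "k \<in> N" and Bk: "B - {k} \<in> Pow N" using k B by auto
      have dg: "l - int (card (B - {k})) = m + 1" "l + - 1 - int (card (B - {k})) = m"
        using degree_face[OF finB k, of l] by (simp_all add: m_def)
      have lt: "card (B - {k}) < card B" using finB k by (rule card_Diff1_less)
      have "q (B - {k}) = \<zero>\<^bsub>M (m + 1)\<^esub>" using less.hyps[OF lt Bk] unfolding dg .
      then have "GT l q (B - {k}) = \<zero>\<^bsub>M m\<^esub>"
        using Bk dg linear_map_zero[OF Gm] K.M.int_smult_zero by (simp only: signed_diagonal_def restrict_apply if_True)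
      then show "[(position_sign B k)] \<cdot>\<^bsub>M m\<^esub> h k m (GT l q (B - {k})) = \<zero>\<^bsub>M m\<^esub>"
        using linear_map_zero[OF h_linear[OF kN]] by (simp add: K.M.int_smult_zero)
    qed
    finally show ?case unfolding m_def .
  qed
  show "q B = \<zero>\<^bsub>T l\<^esub> B" if "B \<in> Pow N" for B
    using zero[OF that] that by (simp add: direct_sum_simps)
qed

end

section \<open>The perturbed differential and its identification with the totalisation\<close>

locale derived_data = homotopy_data R N M h G d x + K: multicomplex R N K dK xK
  for R :: "('r, 'x) ring_scheme" and N :: "nat set" and M :: "int \<Rightarrow> ('r, 'm) module"
    and h G d x and K :: "int \<Rightarrow> ('r, 'k) module" and dK xK +
  fixes a :: "int \<Rightarrow> 'k \<Rightarrow> 'm" and b :: "int \<Rightarrow> 'm \<Rightarrow> 'k"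
  assumes a_linear: "\<And>l. linear_map R (K l) (M l) (a l)"
    and b_linear: "\<And>l. linear_map R (M l) (K l) (b l)"
    and a_d: "\<And>l y. y \<in> carrier (K l) \<Longrightarrow> a (l + 1) (dK l y) = d l (a l y)"
    and b_d: "\<And>l y. y \<in> carrier (M l) \<Longrightarrow> b (l + 1) (d l y) = dK l (b l y)"
    and a_x: "\<And>k l y. k \<in> N \<Longrightarrow> y \<in> carrier (K l) \<Longrightarrow> a l (xK k l y) = x k l (a l y)"
    and b_x: "\<And>k l y. k \<in> N \<Longrightarrow> y \<in> carrier (M l) \<Longrightarrow> b l (x k l y) = xK k l (b l y)"
    and homotopy: "\<And>l y. y \<in> carrier (M l) \<Longrightarrow>
      d (l - 1) (G l y) \<oplus>\<^bsub>M l\<^esub> G (l + 1) (d l y) = a l (b l y) \<ominus>\<^bsub>M l\<^esub> y"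
begin

abbreviation "S \<equiv> total_module N K"
abbreviation "dS \<equiv> total_differential N K dK xK"

lemma aT_linear: "linear_map R (S l) (T l) (diagonal N a l)"
  by (rule diagonal_linear[OF _ _ a_linear]) unfold_locales

lemma bT_linear: "linear_map R (T l) (S l) (diagonal N b l)"
  by (rule diagonal_linear[OF _ _ b_linear]) unfold_locales

definition derived_differential :: "int \<Rightarrow> (nat set \<Rightarrow> 'k) \<Rightarrow> nat set \<Rightarrow> 'k" where
  "derived_differential l v =
    dS l v \<oplus>\<^bsub>S (l + 1)\<^esub> diagonal N b (l + 1) (zigzag_operator l (diagonal N a l v))"

lemma derived_differential_linear: "linear_map R (S l) (S (l + 1)) (derived_differential l)"
  unfolding derived_differential_def[abs_def]
  by (rule linear_map_plus[OF K.total_differential_linear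
        linear_map_compose[OF linear_map_compose[OF aT_linear zigzag_operator_linear] bT_linear]])

text \<open>The perturbation argument with d - x in place of d. All relations that it asks for hold
  because the variables commute with h, G, a and b.\<close>

lemma derived_differential_square:
  assumes v: "v \<in> carrier (S l)"
  shows "derived_differential (l + 1) (derived_differential l v) = \<zero>\<^bsub>S (l + 2)\<^esub>"
proof -
  have ab: "linear_map R (M l) (M l) (\<lambda>y. a l (b l y))" for l
    by (rule linear_map_compose[OF b_linear a_linear])
  have "dS (l + 1) (dS l v \<oplus>\<^bsub>S (l + 1)\<^esub> diagonal N b (l + 1) (zigzag_operator l (diagonal N a l v)))
      \<oplus>\<^bsub>S (l + 2)\<^esub> diagonal N b (l + 2) (zigzag_operator (l + 1) (diagonal N a (l + 1)
        (dS l v \<oplus>\<^bsub>S (l + 1)\<^esub> diagonal N b (l + 1) (zigzag_operator l (diagonal N a l v)))))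
    = \<zero>\<^bsub>S (l + 2)\<^esub>"
  proof (rule perturbation_square_zero[where R = R and T = T and T' = S and d = dT and h = hT
        and P = zigzag_operator and G = GT and a = "diagonal N a" and b = "diagonal N b" and d' = dS
        and b' = "diagonal N (\<lambda>l y. a l (b l y))"])
    fix m q assume "q \<in> carrier (T m)" "q = hT (m - 1) (GT m q)"
    then show "q = \<zero>\<^bsub>T m\<^esub>" by (rule hT_GT_nilpotent)
  next
    fix m w assume w: "w \<in> carrier (T m)"
    show "dT (m - 1) (GT m w) = diagonal N (\<lambda>l y. a l (b l y)) m w \<ominus>\<^bsub>T m\<^esub> w \<ominus>\<^bsub>T m\<^esub> GT (m + 1) (dT m w)"
      by (rule dT_GT[where c = "\<lambda>l y. a l (b l y)", OF w ab homotopy])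
    show "diagonal N (\<lambda>l y. a l (b l y)) m w = diagonal N a m (diagonal N b m w)"
      by (auto simp: diagonal_def)
    show "diagonal N b (m + 1) (dT m w) = dS m (diagonal N b m w)"
      by (rule diagonal_total_differential[where b = b, OF M.multicomplex_axioms K.multicomplex_axioms _ _ _ w])
        (rule b_linear, erule b_d, erule (1) b_x)
    show "dT (m + 1) (hT m w) = \<ominus>\<^bsub>T (m + 2)\<^esub> hT (m + 1) (dT m w)" by (rule dT_hT[OF w])
    show "hT (m + 1) (hT m w) = \<zero>\<^bsub>T (m + 2)\<^esub>" by (rule hT_square[OF w])
    show "zigzag_operator m w = hT m (w \<oplus>\<^bsub>T m\<^esub> GT (m + 1) (zigzag_operator m w))"
      by (rule zigzag_operator_rec[OF w])
  next
    fix m w assume w: "w \<in> carrier (S m)"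
    show "diagonal N a (m + 1) (dS m w) = dT m (diagonal N a m w)"
      by (rule diagonal_total_differential[where b = a, OF K.multicomplex_axioms M.multicomplex_axioms _ _ _ w])
        (rule a_linear, erule a_d, erule (1) a_x)
    show "dS (m + 1) (dS m w) = \<zero>\<^bsub>S (m + 2)\<^esub>" by (rule K.total_differential_square[OF w])
  qed (fact M.total_differential_linear hT_linear zigzag_operator_linear GT_linear aT_linear bT_linear
      K.total_differential_linear v)+
  then show ?thesis by (simp add: derived_differential_def add.assoc)
qed

lemma derived_differential_component:
  assumes v: "v \<in> carrier (S l)" and B: "B \<in> Pow N"
  shows "derived_differential l v B
    = [((-1) ^ card B :: int)] \<cdot>\<^bsub>K (l + 1 - int (card B))\<^esub> dK (l - int (card B)) (v B)
      \<ominus>\<^bsub>K (l + 1 - int (card B))\<^esub> (\<Oplus>\<^bsub>K (l + 1 - int (card B))\<^esub>k\<in>B.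
        [(position_sign B k)] \<cdot>\<^bsub>K (l + 1 - int (card B))\<^esub> xK k (l + 1 - int (card B)) (v (B - {k})))
      \<oplus>\<^bsub>K (l + 1 - int (card B))\<^esub> (\<Oplus>\<^bsub>K (l + 1 - int (card B))\<^esub>A\<in>{A. A \<subset> B}.
        [(entry_sign B A)] \<cdot>\<^bsub>K (l + 1 - int (card B))\<^esub> b (l + 1 - int (card B))
          (alternating_zigzag M h G (B - A) (l - int (card A)) (a (l - int (card A)) (v A))))"
proof -
  define m where "m = l + 1 - int (card B)"
  interpret M1: right_module R "M m" by (rule M.family_module)
  interpret K1: right_module R "K m" by (rule K.family_module)
  have w: "diagonal N a l v \<in> carrier (T l)" using linear_map_closed[OF aT_linear v] .
  have aA: "diagonal N a l v A = a (l - int (card A)) (v A)" if "A \<subset> B" for A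
    using proper_subset_facts(1)[OF B that] by (simp only: diagonal_def restrict_apply if_True)
  let ?Z = "\<lambda>A. alternating_zigzag M h G (B - A) (l - int (card A)) (a (l - int (card A)) (v A))"
  have Z: "?Z A \<in> carrier (M m)" if "A \<subset> B" for A
    using linear_map_closed[OF zigzag_entry_linear[OF B that] w] aA[OF that] by (simp add: m_def)
  have "zigzag_operator l (diagonal N a l v) B = (\<Oplus>\<^bsub>M m\<^esub>A\<in>{A. A \<subset> B}. [(entry_sign B A)] \<cdot>\<^bsub>M m\<^esub>
      alternating_zigzag M h G (B - A) (l - int (card A)) (diagonal N a l v A))"
    using B by (simp only: zigzag_operator_def restrict_apply if_True m_def)
  also have "\<dots> = (\<Oplus>\<^bsub>M m\<^esub>A\<in>{A. A \<subset> B}. [(entry_sign B A)] \<cdot>\<^bsub>M m\<^esub> ?Z A)"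
    by (rule M1.M.finsum_cong'[OF refl]) (use Z aA in \<open>auto intro!: M1.M.int_smult_closed\<close>)
  finally have "diagonal N b (l + 1) (zigzag_operator l (diagonal N a l v)) B
      = b m (\<Oplus>\<^bsub>M m\<^esub>A\<in>{A. A \<subset> B}. [(entry_sign B A)] \<cdot>\<^bsub>M m\<^esub> ?Z A)"
    using B by (simp only: diagonal_def[of N b] restrict_apply if_True m_def)
  also have "\<dots> = (\<Oplus>\<^bsub>K m\<^esub>A\<in>{A. A \<subset> B}. b m ([(entry_sign B A)] \<cdot>\<^bsub>M m\<^esub> ?Z A))"
    by (rule linear_map_finsum[OF b_linear]) (use Z in \<open>auto intro!: M1.M.int_smult_closed\<close>)
  also have "\<dots> = (\<Oplus>\<^bsub>K m\<^esub>A\<in>{A. A \<subset> B}. [(entry_sign B A)] \<cdot>\<^bsub>K m\<^esub> b m (?Z A))"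
    by (rule K1.M.finsum_cong'[OF refl])
      (use Z linear_map_closed[OF b_linear] linear_map_int_smult[OF b_linear] in \<open>auto intro!: K1.M.int_smult_closed\<close>)
  finally show ?thesis
    unfolding derived_differential_def
    using B K.total_differential_component[OF v B] by (simp only: direct_sum_simps restrict_apply if_True m_def)
qed

text \<open>Every other term reads v at a proper subset of B. Up to sign, the associated graded of
  the filtration by cardinality is therefore a sum of copies of the base complex.\<close>

lemma derived_differential_leading:
  assumes v: "v \<in> carrier (S l)" and B: "B \<in> Pow N" and van: "\<And>A. A \<subset> B \<Longrightarrow> v A = \<zero>\<^bsub>K (l - int (card A))\<^esub>"
  shows "derived_differential l v B
    = [((-1) ^ card B :: int)] \<cdot>\<^bsub>K (l + 1 - int (card B))\<^esub> dK (l - int (card B)) (v B)"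
proof -
  define m where "m = l + 1 - int (card B)"
  interpret K1: right_module R "K m" by (rule K.family_module)
  note finB = M.finite_sub[OF B]
  have kN: "k \<in> N" if "k \<in> B" for k using that B by auto
  have 1: "(\<Oplus>\<^bsub>K m\<^esub>k\<in>B. [(position_sign B k)] \<cdot>\<^bsub>K m\<^esub> xK k m (v (B - {k}))) = \<zero>\<^bsub>K m\<^esub>"
  proof (rule K1.M.finsum_zero_eqI)
    fix k assume k: "k \<in> B"
    have "v (B - {k}) = \<zero>\<^bsub>K m\<^esub>"
      using van[of "B - {k}", unfolded degree_face[OF finB k]] k by (auto simp: m_def)
    then show "[(position_sign B k)] \<cdot>\<^bsub>K m\<^esub> xK k m (v (B - {k})) = \<zero>\<^bsub>K m\<^esub>"
      using linear_map_zero[OF K.x_linear[OF kN[OF k]]] by (simp add: K1.M.int_smult_zero)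
  qed
  have 2: "(\<Oplus>\<^bsub>K m\<^esub>A\<in>{A. A \<subset> B}. [(entry_sign B A)] \<cdot>\<^bsub>K m\<^esub> b m
      (alternating_zigzag M h G (B - A) (l - int (card A)) (a (l - int (card A)) (v A)))) = \<zero>\<^bsub>K m\<^esub>"
  proof (rule K1.M.finsum_zero_eqI)
    fix A assume "A \<in> {A. A \<subset> B}"
    then have A: "A \<subset> B" by simp
    note f = proper_subset_facts[OF B A]
    have "l - int (card A) + 1 - int (card (B - A)) = m" using f(4) by (simp add: m_def)
    then have "alternating_zigzag M h G (B - A) (l - int (card A)) (a (l - int (card A)) (v A)) = \<zero>\<^bsub>M m\<^esub>"
      using linear_map_zero[OF alternating_zigzag_linear[OF f(2,3)], of "l - int (card A)"]
        linear_map_zero[OF a_linear] van[OF A] by simp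
    then show "[(entry_sign B A)] \<cdot>\<^bsub>K m\<^esub> b m
      (alternating_zigzag M h G (B - A) (l - int (card A)) (a (l - int (card A)) (v A))) = \<zero>\<^bsub>K m\<^esub>"
      using linear_map_zero[OF b_linear] by (simp add: K1.M.int_smult_zero)
  qed
  have dm: "linear_map R (K (l - int (card B))) (K m) (dK (l - int (card B)))"
    using K.d_linear[of "l - int (card B)"] by (simp add: m_def algebra_simps)
  have "[((-1) ^ card B :: int)] \<cdot>\<^bsub>K m\<^esub> dK (l - int (card B)) (v B) \<in> carrier (K m)"
    by (rule K1.M.int_smult_closed[OF linear_map_closed[OF dm K.total_component[OF v B]]])
  then show ?thesis
    unfolding derived_differential_component[OF v B] using 1 2
    unfolding m_def[symmetric] by (simp add: a_minus_def K1.M.a_inv_zero)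
qed

text \<open>Lets the edge maps be treated as the case of one element of the higher maps.\<close>

lemma alternating_zigzag_singleton:
  assumes "k \<in> N" "y \<in> carrier (M l)"
  shows "alternating_zigzag M h G {k} l y = h k l y"
proof -
  interpret K1: right_module R "M l" by (rule M.family_module)
  have "{x \<in> {k}. x < k} = {}" by auto
  then have "position_sign {k} k = 1" unfolding position_sign_def by (simp only: card.empty power_0)
  then show ?thesis
    using alternating_zigzag_rec[of "{k}" y l] assms linear_map_closed[OF h_linear[OF assms(1)] assms(2)]
    by (simp add: K1.M.finsum_insert homotopy_zigzag_def K1.M.int_smult_one)
qed

text \<open>The matrix of the torus is split into three parts: the diagonal, the entries of b P a at
  all proper subsets, and the correction by a variable, which occurs only on edges.\<close>

lemma totalisation_dif:
  assumes F: "obj (base F) = K" "dif (base F) = dK"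
    and edge: "\<And>k l y. k \<in> N \<Longrightarrow> y \<in> carrier (K l) \<Longrightarrow> edge F k l y = b l (h k l (a l y)) \<ominus>\<^bsub>K l\<^esub> xK k l y"
    and higher: "\<And>S l y. S \<subseteq> N \<Longrightarrow> card S \<ge> 2 \<Longrightarrow> y \<in> carrier (K l) \<Longrightarrow>
      higher F S l y = b (l + 1 - int (card S)) (alternating_zigzag M h G S l (a l y))"
    and v: "v \<in> carrier (S l)"
  shows "dif (totalisation N F) l v = derived_differential l v"
proof -
  have "(\<Oplus>\<^bsub>K (l + 1 - int (card B))\<^esub>A\<in>Pow N. if A \<subseteq> B
          then [((-1) ^ (card A * card B) * incidence B A)] \<cdot>\<^bsub>K (l + 1 - int (card B))\<^esub>
                 (cube_entry F (B - A) (l - int (card A)) (v A))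
          else \<zero>\<^bsub>K (l + 1 - int (card B))\<^esub>) = derived_differential l v B" if B: "B \<in> Pow N" for B
  proof -
    define m where "m = l + 1 - int (card B)"
    interpret K1: right_module R "K m" by (rule K.family_module)
    note finB = M.finite_sub[OF B]
    have fin: "finite {A. A \<subset> B}" by (rule finite_subset[of _ "Pow B"]) (use finB in auto)
    have kN: "k \<in> N" if "k \<in> B" for k using that B by auto
    let ?Z = "\<lambda>A. b m (alternating_zigzag M h G (B - A) (l - int (card A)) (a (l - int (card A)) (v A)))"
    \<comment> \<open>The variable to be subtracted, extended by zero from the edges to all pairs,
      so that the subtraction can be written uniformly for every A.\<close>
    let ?X = "\<lambda>A. if card (B - A) = 1 then xK (the_elem (B - A)) m (v A) else \<zero>\<^bsub>K m\<^esub>"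
    let ?c = "\<lambda>A. cube_entry F (B - A) (l - int (card A)) (v A)"
    have w: "diagonal N a l v \<in> carrier (T l)" using linear_map_closed[OF aT_linear v] .
    have Z: "?Z A \<in> carrier (K m)" if "A \<subset> B" for A
    proof -
      have "diagonal N a l v A = a (l - int (card A)) (v A)"
        using proper_subset_facts(1)[OF B that] by (simp only: diagonal_def restrict_apply if_True)
      then show ?thesis
        using linear_map_closed[OF b_linear linear_map_closed[OF zigzag_entry_linear[OF B that] w]]
        by (simp add: m_def)
    qed
    have single: "\<exists>k. k \<in> B \<and> A = B - {k} \<and> B - A = {k} \<and> l - int (card A) = m" if A: "A \<subset> B" and card1: "card (B - A) = 1" for A
    proof -
      obtain k where k: "B - A = {k}" using card1 card_1_singletonE by metis
      then have "k \<in> B" "A = B - {k}" using A by auto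
      then show ?thesis using degree_face[OF finB, of k l] k by (auto simp: m_def)
    qed
    have X: "?X A \<in> carrier (K m)" if A: "A \<subset> B" for A
    proof (cases "card (B - A) = 1")
      case True
      obtain k where k: "k \<in> B" "A = B - {k}" "B - A = {k}" "l - int (card A) = m" using single[OF A True] by blast
      have "v A \<in> carrier (K m)" using K.total_component[OF v proper_subset_facts(1)[OF B A]] k(4) by simp
      then show ?thesis using linear_map_closed[OF K.x_linear[OF kN[OF k(1)]]] k(3) by simp
    qed simp
    have c: "?c A = ?Z A \<ominus>\<^bsub>K m\<^esub> ?X A" if A: "A \<subset> B" for A
    proof (cases "card (B - A) = 1")
      case True
      obtain k where k: "k \<in> B" "A = B - {k}" "B - A = {k}" "l - int (card A) = m" using single[OF A True] by blast
      have y: "v A \<in> carrier (K m)" using K.total_component[OF v proper_subset_facts(1)[OF B A]] k(4) by simp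
      show ?thesis
        using k(3,4) edge[OF kN[OF k(1)] y] alternating_zigzag_singleton[OF kN[OF k(1)] linear_map_closed[OF a_linear y]]
        by (simp add: cube_entry_def)
    next
      case False
      note f = proper_subset_facts[OF B A]
      have "card (B - A) \<noteq> 0" using f(2) finB by auto
      then have 2: "card (B - A) \<ge> 2" using False by linarith
      have dg: "l - int (card A) + 1 - int (card (B - A)) = m" using f(4) by (simp add: m_def)
      have "?c A = ?Z A"
        using False f(2) higher[OF f(3) 2 K.total_component[OF v f(1)]] by (simp add: cube_entry_def dg)
      then show ?thesis using False Z[OF A] by (simp add: a_minus_def K1.M.a_inv_zero)
    qed
    have dcl: "[((-1) ^ card B :: int)] \<cdot>\<^bsub>K m\<^esub> dK (l - int (card B)) (v B) \<in> carrier (K m)"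
    proof -
      have dm: "linear_map R (K (l - int (card B))) (K m) (dK (l - int (card B)))"
        using K.d_linear[of "l - int (card B)"] by (simp add: m_def algebra_simps)
      show ?thesis
        by (rule K1.M.int_smult_closed[OF linear_map_closed[OF dm K.total_component[OF v B]]])
    qed
    have term_B: "[(entry_sign B B)] \<cdot>\<^bsub>K m\<^esub> ?c B = [((-1) ^ card B :: int)] \<cdot>\<^bsub>K m\<^esub> dK (l - int (card B)) (v B)"
      using F finB by (simp add: cube_entry_def entry_sign_refl)
    have cl: "[(entry_sign B A)] \<cdot>\<^bsub>K m\<^esub> ?c A \<in> carrier (K m)" if "A \<subseteq> B" for A
      using that dcl term_B c Z X by (cases "A = B") (auto intro!: K1.M.int_smult_closed)
    have "(\<Oplus>\<^bsub>K m\<^esub>A\<in>Pow N. if A \<subseteq> B then [((-1) ^ (card A * card B) * incidence B A)] \<cdot>\<^bsub>K m\<^esub> ?c A else \<zero>\<^bsub>K m\<^esub>)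
        = (\<Oplus>\<^bsub>K m\<^esub>A\<in>insert B {A. A \<subset> B}. [(entry_sign B A)] \<cdot>\<^bsub>K m\<^esub> ?c A)"
      by (rule K1.M.add.finprod_mono_neutral_cong_right)
        (use B K.finite_index cl in \<open>auto simp: entry_sign_def\<close>)
    also have "\<dots> = [((-1) ^ card B :: int)] \<cdot>\<^bsub>K m\<^esub> dK (l - int (card B)) (v B)
        \<oplus>\<^bsub>K m\<^esub> (\<Oplus>\<^bsub>K m\<^esub>A\<in>{A. A \<subset> B}. [(entry_sign B A)] \<cdot>\<^bsub>K m\<^esub> ?c A)"
      unfolding term_B[symmetric]
      by (rule K1.M.finsum_insert) (use fin cl cl[OF order_refl] in auto)
    also have "(\<Oplus>\<^bsub>K m\<^esub>A\<in>{A. A \<subset> B}. [(entry_sign B A)] \<cdot>\<^bsub>K m\<^esub> ?c A)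
        = (\<Oplus>\<^bsub>K m\<^esub>A\<in>{A. A \<subset> B}. [(entry_sign B A)] \<cdot>\<^bsub>K m\<^esub> ?Z A \<oplus>\<^bsub>K m\<^esub> \<ominus>\<^bsub>K m\<^esub> ([(entry_sign B A)] \<cdot>\<^bsub>K m\<^esub> ?X A))"
    proof (rule K1.M.finsum_cong'[OF refl])
      show "(\<lambda>A. [(entry_sign B A)] \<cdot>\<^bsub>K m\<^esub> ?Z A \<oplus>\<^bsub>K m\<^esub> \<ominus>\<^bsub>K m\<^esub> ([(entry_sign B A)] \<cdot>\<^bsub>K m\<^esub> ?X A)) \<in> {A. A \<subset> B} \<rightarrow> carrier (K m)"
        using Z X by (intro funcsetI K1.M.a_closed K1.M.a_inv_closed K1.M.int_smult_closed) auto
      fix A assume "A \<in> {A. A \<subset> B}"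
      then have A: "A \<subset> B" by simp
      show "[(entry_sign B A)] \<cdot>\<^bsub>K m\<^esub> ?c A = [(entry_sign B A)] \<cdot>\<^bsub>K m\<^esub> ?Z A \<oplus>\<^bsub>K m\<^esub> \<ominus>\<^bsub>K m\<^esub> ([(entry_sign B A)] \<cdot>\<^bsub>K m\<^esub> ?X A)"
        unfolding c[OF A] a_minus_def
          K1.M.int_smult_add[OF Z[OF A] K1.M.a_inv_closed[OF X[OF A]]] K1.M.int_smult_a_inv[OF X[OF A]] ..
    qed
    also have "\<dots> = (\<Oplus>\<^bsub>K m\<^esub>A\<in>{A. A \<subset> B}. [(entry_sign B A)] \<cdot>\<^bsub>K m\<^esub> ?Z A)
        \<oplus>\<^bsub>K m\<^esub> (\<Oplus>\<^bsub>K m\<^esub>A\<in>{A. A \<subset> B}. \<ominus>\<^bsub>K m\<^esub> ([(entry_sign B A)] \<cdot>\<^bsub>K m\<^esub> ?X A))"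
      using Z X by (intro K1.M.finsum_addf funcsetI K1.M.a_inv_closed K1.M.int_smult_closed) auto
    also have "(\<Oplus>\<^bsub>K m\<^esub>A\<in>{A. A \<subset> B}. \<ominus>\<^bsub>K m\<^esub> ([(entry_sign B A)] \<cdot>\<^bsub>K m\<^esub> ?X A))
        = \<ominus>\<^bsub>K m\<^esub> (\<Oplus>\<^bsub>K m\<^esub>A\<in>{A. A \<subset> B}. [(entry_sign B A)] \<cdot>\<^bsub>K m\<^esub> ?X A)"
      using X fin by (intro K1.M.finsum_a_inv funcsetI K1.M.int_smult_closed) auto
    also have "(\<Oplus>\<^bsub>K m\<^esub>A\<in>{A. A \<subset> B}. [(entry_sign B A)] \<cdot>\<^bsub>K m\<^esub> ?X A)
        = (\<Oplus>\<^bsub>K m\<^esub>A\<in>(\<lambda>k. B - {k}) ` B. [(entry_sign B A)] \<cdot>\<^bsub>K m\<^esub> ?X A)"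
    \<comment> \<open>Only the faces B - {k} carry a correction; the sum over subsets becomes a sum
      over k.\<close>
    proof (rule K1.M.add.finprod_mono_neutral_cong_right[OF fin])
      show "(\<lambda>k. B - {k}) ` B \<subseteq> {A. A \<subset> B}" by auto
      show "[(entry_sign B A)] \<cdot>\<^bsub>K m\<^esub> ?X A = \<zero>\<^bsub>K m\<^esub>" if "A \<in> {A. A \<subset> B} - (\<lambda>k. B - {k}) ` B" for A
      proof -
        have "card (B - A) \<noteq> 1" using single[of A] that by blast
        then show ?thesis by (simp add: K1.M.int_smult_zero)
      qed
      show "(\<lambda>A. [(entry_sign B A)] \<cdot>\<^bsub>K m\<^esub> ?X A) \<in> {A. A \<subset> B} \<rightarrow> carrier (K m)"
        using X by (intro funcsetI K1.M.int_smult_closed) auto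
    qed simp
    also have "\<dots> = (\<Oplus>\<^bsub>K m\<^esub>k\<in>B. [(entry_sign B (B - {k}))] \<cdot>\<^bsub>K m\<^esub> ?X (B - {k}))"
    proof (rule K1.M.finsum_reindex)
      show "inj_on (\<lambda>k. B - {k}) B" by (auto simp: inj_on_def)
      show "(\<lambda>A. [(entry_sign B A)] \<cdot>\<^bsub>K m\<^esub> ?X A) \<in> (\<lambda>k. B - {k}) ` B \<rightarrow> carrier (K m)"
        using X by (intro funcsetI K1.M.int_smult_closed) blast
    qed
    also have "\<dots> = (\<Oplus>\<^bsub>K m\<^esub>k\<in>B. [(position_sign B k)] \<cdot>\<^bsub>K m\<^esub> xK k m (v (B - {k})))"
    proof (rule K1.M.finsum_cong'[OF refl])
      show "(\<lambda>k. [(position_sign B k)] \<cdot>\<^bsub>K m\<^esub> xK k m (v (B - {k}))) \<in> B \<rightarrow> carrier (K m)"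
        using linear_map_closed[OF K.x_linear[OF kN]] K.total_face[OF v B]
        by (intro funcsetI K1.M.int_smult_closed) (simp add: m_def)
      fix k assume k: "k \<in> B"
      have "B - (B - {k}) = {k}" using k by auto
      then show "[(entry_sign B (B - {k}))] \<cdot>\<^bsub>K m\<^esub> ?X (B - {k}) = [(position_sign B k)] \<cdot>\<^bsub>K m\<^esub> xK k m (v (B - {k}))"
        using entry_sign_face[OF finB k] by simp
    qed
    finally have 1: "(\<Oplus>\<^bsub>K m\<^esub>A\<in>Pow N. if A \<subseteq> B then [((-1) ^ (card A * card B) * incidence B A)] \<cdot>\<^bsub>K m\<^esub> ?c A else \<zero>\<^bsub>K m\<^esub>)
      = [((-1) ^ card B :: int)] \<cdot>\<^bsub>K m\<^esub> dK (l - int (card B)) (v B)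
        \<oplus>\<^bsub>K m\<^esub> ((\<Oplus>\<^bsub>K m\<^esub>A\<in>{A. A \<subset> B}. [(entry_sign B A)] \<cdot>\<^bsub>K m\<^esub> ?Z A)
        \<oplus>\<^bsub>K m\<^esub> \<ominus>\<^bsub>K m\<^esub> (\<Oplus>\<^bsub>K m\<^esub>k\<in>B. [(position_sign B k)] \<cdot>\<^bsub>K m\<^esub> xK k m (v (B - {k}))))" .
    have s1: "(\<Oplus>\<^bsub>K m\<^esub>A\<in>{A. A \<subset> B}. [(entry_sign B A)] \<cdot>\<^bsub>K m\<^esub> ?Z A) \<in> carrier (K m)"
      using Z by (intro K1.M.finsum_closed funcsetI K1.M.int_smult_closed) auto
    have s2: "(\<Oplus>\<^bsub>K m\<^esub>k\<in>B. [(position_sign B k)] \<cdot>\<^bsub>K m\<^esub> xK k m (v (B - {k}))) \<in> carrier (K m)"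
      using linear_map_closed[OF K.x_linear[OF kN]] K.total_face[OF v B]
      by (intro K1.M.finsum_closed funcsetI K1.M.int_smult_closed) (simp add: m_def)
    show ?thesis
      unfolding derived_differential_component[OF v B] unfolding m_def[symmetric] 1
      using dcl K1.M.a_comm[OF s1 K1.M.a_inv_closed[OF s2]] s1 s2
      by (simp add: a_minus_def K1.M.a_assoc)
  qed
  \<comment> \<open>Elements of a direct sum are extensional functions, so the two sides must also
    agree at arguments that are not subsets of N.\<close>
  moreover have "derived_differential l v B = undefined" if "B \<notin> Pow N" for B
    using direct_sum_mem(2)[OF linear_map_closed[OF derived_differential_linear v] that] .
  ultimately show ?thesis
    by (intro ext) (simp add: totalisation_def matrix_map_def F cong: if_cong)
qed

text \<open>That the cubes in question are special is derived here from the perturbation argument,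
  not assumed.\<close>

lemma cochain_complex_totalisation:
  assumes F: "obj (base F) = K" "dif (base F) = dK"
    and edge: "\<And>k l y. k \<in> N \<Longrightarrow> y \<in> carrier (K l) \<Longrightarrow> edge F k l y = b l (h k l (a l y)) \<ominus>\<^bsub>K l\<^esub> xK k l y"
    and higher: "\<And>S l y. S \<subseteq> N \<Longrightarrow> card S \<ge> 2 \<Longrightarrow> y \<in> carrier (K l) \<Longrightarrow>
      higher F S l y = b (l + 1 - int (card S)) (alternating_zigzag M h G S l (a l y))"
  shows "cochain_complex R (totalisation N F)"
proof -
  have obj: "obj (totalisation N F) l = S l" for l using F by (simp add: totalisation_def)
  have eq: "dif (totalisation N F) l v = derived_differential l v" if "v \<in> carrier (S l)" for l v
    by (rule totalisation_dif[OF F _ _ that]) (erule (1) edge, erule (2) higher)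
  have lin: "linear_map R (S l) (S (l + 1)) (dif (totalisation N F) l)" for l
    by (rule linear_map_cong[OF derived_differential_linear]) (rule eq[symmetric])
  have "dif (totalisation N F) (l + 1) (dif (totalisation N F) l v) = \<zero>\<^bsub>S (l + 2)\<^esub>" if "v \<in> carrier (S l)" for l v
    using derived_differential_square[OF that] eq[OF that] eq[OF linear_map_closed[OF derived_differential_linear that]]
    by simp
  then show ?thesis
    using lin right_moduleD(2)[OF K.total_right_module] unfolding cochain_complex_def obj linear_map_def by blast
qed

end

section \<open>Quasi-isomorphisms\<close>

text \<open>Acyclicity of the mapping cone, spelled out on elements.\<close>

definition cone_exact :: "('r, 'm) cochain \<Rightarrow> ('r, 'k) cochain \<Rightarrow> (int \<Rightarrow> 'm \<Rightarrow> 'k) \<Rightarrow> bool" where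
  "cone_exact X Y f \<longleftrightarrow> (\<forall>l. \<forall>x\<in>carrier (obj X (l + 1)). \<forall>y\<in>carrier (obj Y l).
     dif X (l + 1) x = \<zero>\<^bsub>obj X (l + 2)\<^esub> \<and> f (l + 1) x = dif Y l y \<longrightarrow>
     (\<exists>x'\<in>carrier (obj X l). \<exists>y'\<in>carrier (obj Y (l - 1)).
        dif X l x' = x \<and> f l x' \<ominus>\<^bsub>obj Y l\<^esub> y = dif Y (l - 1) y'))"

lemma cochain_complexD:
  assumes "cochain_complex R C"
  shows "linear_map R (obj C l) (obj C (l + 1)) (dif C l)" "right_module R (obj C l)" "ring R"
    "x \<in> carrier (obj C l) \<Longrightarrow> dif C (l + 1) (dif C l x) = \<zero>\<^bsub>obj C (l + 2)\<^esub>"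
  using assms by (auto simp: cochain_complex_def linear_map_def)

lemma cochain_complex_previous:
  assumes "cochain_complex R C"
  shows "linear_map R (obj C (l - 1)) (obj C l) (dif C (l - 1))"
    "x \<in> carrier (obj C (l - 1)) \<Longrightarrow> dif C l (dif C (l - 1) x) = \<zero>\<^bsub>obj C (l + 1)\<^esub>"
  using cochain_complexD(1)[OF assms, of "l - 1"] cochain_complexD(4)[OF assms, of x "l - 1"]
  by (simp_all add: add.commute)

lemma cochain_mapD:
  assumes "cochain_map R C D f"
  shows "cochain_complex R C" "cochain_complex R D" "linear_map R (obj C l) (obj D l) (f l)"
    "x \<in> carrier (obj C l) \<Longrightarrow> f (l + 1) (dif C l x) = dif D l (f l x)"
  using assms by (auto simp: cochain_map_def cochain_complex_def linear_map_def)

text \<open>The coset of the coboundaries through z.\<close>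

definition cohomology_class :: "('r, 'm) cochain \<Rightarrow> int \<Rightarrow> 'm \<Rightarrow> 'm set" where
  "cohomology_class C l z = (\<lambda>b. b \<oplus>\<^bsub>obj C l\<^esub> z) ` coboundaries C l"

section \<open>Cocycles, coboundaries and cohomology classes\<close>

context
  fixes R :: "('r, 'x) ring_scheme" and C :: "('r, 'm) cochain"
  assumes C: "cochain_complex R C"
begin

lemma coboundary_facts:
  "b \<in> coboundaries C l \<Longrightarrow> b \<in> cocycles C l"
  "b \<in> coboundaries C l \<Longrightarrow> b \<in> carrier (obj C l)"
  "b \<in> coboundaries C l \<Longrightarrow> c \<in> coboundaries C l \<Longrightarrow> b \<oplus>\<^bsub>obj C l\<^esub> c \<in> coboundaries C l"
  "b \<in> coboundaries C l \<Longrightarrow> \<ominus>\<^bsub>obj C l\<^esub> b \<in> coboundaries C l"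
  "\<zero>\<^bsub>obj C l\<^esub> \<in> coboundaries C l"
proof -
  note d = cochain_complex_previous(1)[OF C, of l]
  interpret P: right_module R "obj C (l - 1)" using d by (rule linear_map_modules)
  show "b \<in> coboundaries C l \<Longrightarrow> b \<in> cocycles C l" "b \<in> coboundaries C l \<Longrightarrow> b \<in> carrier (obj C l)"
    using linear_map_closed[OF d] cochain_complex_previous(2)[OF C] by (auto simp: coboundaries_def cocycles_def)
  show "b \<in> coboundaries C l \<Longrightarrow> c \<in> coboundaries C l \<Longrightarrow> b \<oplus>\<^bsub>obj C l\<^esub> c \<in> coboundaries C l"
    unfolding coboundaries_def by clarify (metis linear_map_add[OF d] P.M.a_closed imageI)
  show "b \<in> coboundaries C l \<Longrightarrow> \<ominus>\<^bsub>obj C l\<^esub> b \<in> coboundaries C l"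
    unfolding coboundaries_def by clarify (metis linear_map_a_inv[OF d] P.M.a_inv_closed imageI)
  show "\<zero>\<^bsub>obj C l\<^esub> \<in> coboundaries C l"
    unfolding coboundaries_def by (metis linear_map_zero[OF d] P.M.zero_closed imageI)
qed

lemma cocycle_facts:
  "z \<in> cocycles C l \<Longrightarrow> z \<in> carrier (obj C l)"
  "z \<in> cocycles C l \<Longrightarrow> w \<in> cocycles C l \<Longrightarrow> z \<oplus>\<^bsub>obj C l\<^esub> w \<in> cocycles C l"
  "z \<in> cocycles C l \<Longrightarrow> \<ominus>\<^bsub>obj C l\<^esub> z \<in> cocycles C l"
proof -
  note d = cochain_complexD(1)[OF C, of l]
  interpret P: right_module R "obj C l" using d by (rule linear_map_modules)
  interpret Q: right_module R "obj C (l + 1)" using d by (rule linear_map_modules)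
  show "z \<in> cocycles C l \<Longrightarrow> z \<in> carrier (obj C l)" by (simp add: cocycles_def)
  show "z \<in> cocycles C l \<Longrightarrow> w \<in> cocycles C l \<Longrightarrow> z \<oplus>\<^bsub>obj C l\<^esub> w \<in> cocycles C l"
    using linear_map_add[OF d] by (auto simp: cocycles_def)
  show "z \<in> cocycles C l \<Longrightarrow> \<ominus>\<^bsub>obj C l\<^esub> z \<in> cocycles C l"
    using linear_map_a_inv[OF d] by (auto simp: cocycles_def Q.M.a_inv_zero)
qed

lemma carrier_cohomology: "carrier (cohomology C l) = cohomology_class C l ` cocycles C l"
  by (auto simp: cohomology_def FactGroup_def RCOSETS_def r_coset_def cohomology_class_def)

lemma cohomology_class_eq_iff:
  assumes z: "z \<in> cocycles C l" and w: "w \<in> cocycles C l"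
  shows "cohomology_class C l z = cohomology_class C l w \<longleftrightarrow> z \<ominus>\<^bsub>obj C l\<^esub> w \<in> coboundaries C l"
proof -
  interpret P: right_module R "obj C l" using C by (rule cochain_complexD)
  note [simp] = coboundary_facts cocycle_facts(1)[OF z] cocycle_facts(1)[OF w]
  have sub: "cohomology_class C l z \<subseteq> cohomology_class C l w"
    if "z \<ominus>\<^bsub>obj C l\<^esub> w \<in> coboundaries C l" and [simp]: "z \<in> carrier (obj C l)" "w \<in> carrier (obj C l)" for z w
  proof
    fix u assume "u \<in> cohomology_class C l z"
    then obtain b where b: "b \<in> coboundaries C l" "u = b \<oplus>\<^bsub>obj C l\<^esub> z" by (auto simp: cohomology_class_def)
    have "u = (b \<oplus>\<^bsub>obj C l\<^esub> (z \<ominus>\<^bsub>obj C l\<^esub> w)) \<oplus>\<^bsub>obj C l\<^esub> w"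
      using b by (simp add: P.M.a_assoc P.M.diff_add_cancel)
    then show "u \<in> cohomology_class C l w"
      using coboundary_facts(3)[OF b(1) that(1)] by (auto simp: cohomology_class_def)
  qed
  show ?thesis
  proof
    assume eq: "cohomology_class C l z = cohomology_class C l w"
    have "\<zero>\<^bsub>obj C l\<^esub> \<oplus>\<^bsub>obj C l\<^esub> z \<in> cohomology_class C l z"
      unfolding cohomology_class_def by (rule imageI) simp
    then have "z \<in> cohomology_class C l w" using eq by simp
    then obtain b where b: "b \<in> coboundaries C l" "z = b \<oplus>\<^bsub>obj C l\<^esub> w" by (auto simp: cohomology_class_def)
    then have "z \<ominus>\<^bsub>obj C l\<^esub> w = b" by (simp add: a_minus_def P.M.a_assoc P.M.r_neg)
    then show "z \<ominus>\<^bsub>obj C l\<^esub> w \<in> coboundaries C l" using b by simp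
  next
    assume h: "z \<ominus>\<^bsub>obj C l\<^esub> w \<in> coboundaries C l"
    have "w \<ominus>\<^bsub>obj C l\<^esub> z = \<ominus>\<^bsub>obj C l\<^esub> (z \<ominus>\<^bsub>obj C l\<^esub> w)" by (simp add: a_minus_def P.M.minus_add P.M.a_comm)
    then have "w \<ominus>\<^bsub>obj C l\<^esub> z \<in> coboundaries C l" using coboundary_facts(4)[OF h] by simp
    then show "cohomology_class C l z = cohomology_class C l w" using sub[OF h] sub[of w z] by auto
  qed
qed

lemma mult_cohomology:
  assumes z: "z \<in> cocycles C l" and w: "w \<in> cocycles C l"
  shows "cohomology_class C l z \<otimes>\<^bsub>cohomology C l\<^esub> cohomology_class C l w = cohomology_class C l (z \<oplus>\<^bsub>obj C l\<^esub> w)"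
proof -
  interpret P: right_module R "obj C l" using C by (rule cochain_complexD)
  note [simp] = coboundary_facts(2) cocycle_facts(1)[OF z] cocycle_facts(1)[OF w]
  have re: "(b \<oplus>\<^bsub>obj C l\<^esub> z) \<oplus>\<^bsub>obj C l\<^esub> (c \<oplus>\<^bsub>obj C l\<^esub> w) = (b \<oplus>\<^bsub>obj C l\<^esub> c) \<oplus>\<^bsub>obj C l\<^esub> (z \<oplus>\<^bsub>obj C l\<^esub> w)"
    if "b \<in> coboundaries C l" "c \<in> coboundaries C l" for b c
    using that by (simp add: P.M.a_ac)
  have "cohomology_class C l z \<otimes>\<^bsub>cohomology C l\<^esub> cohomology_class C l w
      = (\<Union>b\<in>coboundaries C l. \<Union>c\<in>coboundaries C l. {(b \<oplus>\<^bsub>obj C l\<^esub> z) \<oplus>\<^bsub>obj C l\<^esub> (c \<oplus>\<^bsub>obj C l\<^esub> w)})"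
    by (auto simp: cohomology_def FactGroup_def set_mult_def cohomology_class_def)
  also have "\<dots> = (\<Union>b\<in>coboundaries C l. \<Union>c\<in>coboundaries C l. {(b \<oplus>\<^bsub>obj C l\<^esub> c) \<oplus>\<^bsub>obj C l\<^esub> (z \<oplus>\<^bsub>obj C l\<^esub> w)})"
    using re by simp
  also have "\<dots> = cohomology_class C l (z \<oplus>\<^bsub>obj C l\<^esub> w)"
  proof (rule equalityI)
    show "(\<Union>b\<in>coboundaries C l. \<Union>c\<in>coboundaries C l. {(b \<oplus>\<^bsub>obj C l\<^esub> c) \<oplus>\<^bsub>obj C l\<^esub> (z \<oplus>\<^bsub>obj C l\<^esub> w)})
      \<subseteq> cohomology_class C l (z \<oplus>\<^bsub>obj C l\<^esub> w)"
      using coboundary_facts(3) unfolding cohomology_class_def by blast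
    show "cohomology_class C l (z \<oplus>\<^bsub>obj C l\<^esub> w) \<subseteq> (\<Union>b\<in>coboundaries C l. \<Union>c\<in>coboundaries C l. {(b \<oplus>\<^bsub>obj C l\<^esub> c) \<oplus>\<^bsub>obj C l\<^esub> (z \<oplus>\<^bsub>obj C l\<^esub> w)})"
    proof
      fix u assume "u \<in> cohomology_class C l (z \<oplus>\<^bsub>obj C l\<^esub> w)"
      then obtain b where b: "b \<in> coboundaries C l" "u = b \<oplus>\<^bsub>obj C l\<^esub> (z \<oplus>\<^bsub>obj C l\<^esub> w)"
        by (auto simp: cohomology_class_def)
      then have "u = (b \<oplus>\<^bsub>obj C l\<^esub> \<zero>\<^bsub>obj C l\<^esub>) \<oplus>\<^bsub>obj C l\<^esub> (z \<oplus>\<^bsub>obj C l\<^esub> w)" by simp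
      then show "u \<in> (\<Union>b\<in>coboundaries C l. \<Union>c\<in>coboundaries C l. {(b \<oplus>\<^bsub>obj C l\<^esub> c) \<oplus>\<^bsub>obj C l\<^esub> (z \<oplus>\<^bsub>obj C l\<^esub> w)})"
        using b(1) coboundary_facts(5) by blast
    qed
  qed
  finally show ?thesis .
qed

end

lemma cochain_map_cocycle:
  assumes "cochain_map R C D f" "z \<in> cocycles C l"
  shows "f l z \<in> cocycles D l"
  using cochain_mapD(4)[OF assms(1), of z l] linear_map_closed[OF cochain_mapD(3)[OF assms(1)], of z l]
    linear_map_zero[OF cochain_mapD(3)[OF assms(1)], of "l + 1"] assms(2)
  by (simp add: cocycles_def)

lemma cochain_map_coboundary:
  assumes f: "cochain_map R C D f" and b: "b \<in> coboundaries C l"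
  shows "f l b \<in> coboundaries D l"
proof -
  obtain c where c: "c \<in> carrier (obj C (l - 1))" "b = dif C (l - 1) c" using b by (auto simp: coboundaries_def)
  then have "f l b = dif D (l - 1) (f (l - 1) c)" using cochain_mapD(4)[OF f c(1)] by simp
  then show ?thesis using linear_map_closed[OF cochain_mapD(3)[OF f] c(1)] by (simp add: coboundaries_def)
qed

text \<open>The image of a coset under f is in general only part of a coset. Adding all coboundaries
  of the target, as \<open>cohomology_map\<close> does, completes it, and f maps coboundaries to
  coboundaries.\<close>

lemma cohomology_map_class:
  assumes f: "cochain_map R C D f" and z: "z \<in> cocycles C l"
  shows "cohomology_map D f l (cohomology_class C l z) = cohomology_class D l (f l z)"
proof -
  note C = cochain_mapD(1)[OF f] and D = cochain_mapD(2)[OF f]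
  interpret P: right_module R "obj C l" using C by (rule cochain_complexD)
  interpret Q: right_module R "obj D l" using D by (rule cochain_complexD)
  note zc = cocycle_facts(1)[OF C z]
  note fz = linear_map_closed[OF cochain_mapD(3)[OF f] zc]
  have eq: "c \<oplus>\<^bsub>obj D l\<^esub> f l (b \<oplus>\<^bsub>obj C l\<^esub> z) = (c \<oplus>\<^bsub>obj D l\<^esub> f l b) \<oplus>\<^bsub>obj D l\<^esub> f l z"
    if "b \<in> coboundaries C l" "c \<in> coboundaries D l" for b c
    using that linear_map_add[OF cochain_mapD(3)[OF f] coboundary_facts(2)[OF C that(1)] zc] fz
      coboundary_facts(2)[OF D that(2)] coboundary_facts(2)[OF D cochain_map_coboundary[OF f that(1)]]
    by (simp add: Q.M.a_assoc)
  have "cohomology_map D f l (cohomology_class C l z)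
      = (\<Union>c\<in>coboundaries D l. \<Union>b\<in>coboundaries C l. {c \<oplus>\<^bsub>obj D l\<^esub> f l (b \<oplus>\<^bsub>obj C l\<^esub> z)})"
    by (auto simp: cohomology_map_def cohomology_class_def set_mult_def)
  also have "\<dots> = (\<Union>c\<in>coboundaries D l. \<Union>b\<in>coboundaries C l. {(c \<oplus>\<^bsub>obj D l\<^esub> f l b) \<oplus>\<^bsub>obj D l\<^esub> f l z})"
    using eq by simp
  also have "\<dots> = cohomology_class D l (f l z)"
  proof (rule equalityI)
    show "(\<Union>c\<in>coboundaries D l. \<Union>b\<in>coboundaries C l. {(c \<oplus>\<^bsub>obj D l\<^esub> f l b) \<oplus>\<^bsub>obj D l\<^esub> f l z}) \<subseteq> cohomology_class D l (f l z)"
      using coboundary_facts(3)[OF D] cochain_map_coboundary[OF f] unfolding cohomology_class_def by blast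
    show "cohomology_class D l (f l z) \<subseteq> (\<Union>c\<in>coboundaries D l. \<Union>b\<in>coboundaries C l. {(c \<oplus>\<^bsub>obj D l\<^esub> f l b) \<oplus>\<^bsub>obj D l\<^esub> f l z})"
    proof
      fix u assume "u \<in> cohomology_class D l (f l z)"
      then obtain c where c: "c \<in> coboundaries D l" "u = c \<oplus>\<^bsub>obj D l\<^esub> f l z" by (auto simp: cohomology_class_def)
      then have "u = (c \<oplus>\<^bsub>obj D l\<^esub> f l \<zero>\<^bsub>obj C l\<^esub>) \<oplus>\<^bsub>obj D l\<^esub> f l z"
        using linear_map_zero[OF cochain_mapD(3)[OF f]] coboundary_facts(2)[OF D c(1)] by simp
      then show "u \<in> (\<Union>c\<in>coboundaries D l. \<Union>b\<in>coboundaries C l. {(c \<oplus>\<^bsub>obj D l\<^esub> f l b) \<oplus>\<^bsub>obj D l\<^esub> f l z})"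
        using c(1) coboundary_facts(5)[OF C] by blast
    qed
  qed
  finally show ?thesis .
qed

text \<open>Acyclicity of the cone combines two statements. Injectivity on cohomology turns a
  cocycle x with f x a coboundary into a coboundary, and surjectivity then adjusts its primitive.
  Conversely, injectivity is read off by applying exactness to a difference of cocycles,
  surjectivity by applying it to x = 0.\<close>

lemma quasi_isomorphism_iff_cone_exact:
  assumes f: "cochain_map R C D f"
  shows "quasi_isomorphism C D f \<longleftrightarrow> cone_exact C D f"
proof -
  note C = cochain_mapD(1)[OF f] and D = cochain_mapD(2)[OF f]
  have zeroC: "\<zero>\<^bsub>obj C l\<^esub> \<in> cocycles C l" for l using coboundary_facts(1)[OF C coboundary_facts(5)[OF C]] .
  show ?thesis
  proof
    assume q: "quasi_isomorphism C D f"
    have bij: "bij_betw (cohomology_map D f l) (cohomology_class C l ` cocycles C l) (cohomology_class D l ` cocycles D l)" for l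
      using q carrier_cohomology[OF C] carrier_cohomology[OF D] by (auto simp: quasi_isomorphism_def iso_def)
    show "cone_exact C D f"
      unfolding cone_exact_def
    proof (intro allI ballI impI)
      fix l x y
      assume x: "x \<in> carrier (obj C (l + 1))" and y: "y \<in> carrier (obj D l)"
        and h: "dif C (l + 1) x = \<zero>\<^bsub>obj C (l + 2)\<^esub> \<and> f (l + 1) x = dif D l y"
      interpret C0: right_module R "obj C l" using C by (rule cochain_complexD)
      interpret C1: right_module R "obj C (l + 1)" using C by (rule cochain_complexD)
      interpret D0: right_module R "obj D l" using D by (rule cochain_complexD)
      interpret D1: right_module R "obj D (l + 1)" using D by (rule cochain_complexD)
      interpret Dm: right_module R "obj D (l - 1)" using D by (rule cochain_complexD)
      note fl = cochain_mapD(3)[OF f]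
      have xz: "x \<in> cocycles C (l + 1)" using x h by (simp add: cocycles_def add.assoc)
      have "cohomology_map D f (l + 1) (cohomology_class C (l + 1) x) = cohomology_map D f (l + 1) (cohomology_class C (l + 1) \<zero>\<^bsub>obj C (l + 1)\<^esub>)"
      proof -
        have "f (l + 1) x \<ominus>\<^bsub>obj D (l + 1)\<^esub> f (l + 1) \<zero>\<^bsub>obj C (l + 1)\<^esub> = dif D l y"
          using h linear_map_zero[OF fl] linear_map_closed[OF cochain_complexD(1)[OF D] y]
          by (simp add: a_minus_def D1.M.a_inv_zero)
        moreover have "dif D l y \<in> coboundaries D (l + 1)" using y by (auto simp: coboundaries_def)
        ultimately show ?thesis
          unfolding cohomology_map_class[OF f xz] cohomology_map_class[OF f zeroC]
          using cohomology_class_eq_iff[OF D cochain_map_cocycle[OF f xz] cochain_map_cocycle[OF f zeroC]] by simp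
      qed
      then have "cohomology_class C (l + 1) x = cohomology_class C (l + 1) \<zero>\<^bsub>obj C (l + 1)\<^esub>"
        using bij_betw_imp_inj_on[OF bij[of "l + 1"]] xz zeroC by (auto dest: inj_onD)
      then have "x \<in> coboundaries C (l + 1)"
        using cohomology_class_eq_iff[OF C xz zeroC] x by (simp add: a_minus_def C1.M.a_inv_zero)
      then obtain u where u: "u \<in> carrier (obj C l)" "dif C l u = x" by (auto simp: coboundaries_def)
      note fu = linear_map_closed[OF fl u(1)]
      \<comment> \<open>The primitive u of x need not satisfy the second equation; the error y - f u
        is a cocycle. Surjectivity provides a cocycle z with f z cohomologous to it, and u + z
        solves both equations.\<close>
      let ?w = "y \<ominus>\<^bsub>obj D l\<^esub> f l u"
      have "dif D l ?w = dif D l y \<ominus>\<^bsub>obj D (l + 1)\<^esub> dif D l (f l u)"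
        using linear_map_minus[OF cochain_complexD(1)[OF D] y fu] .
      then have wz: "?w \<in> cocycles D l"
        using y fu h cochain_mapD(4)[OF f u(1)] u(2) linear_map_closed[OF cochain_complexD(1)[OF D] y]
        by (simp add: cocycles_def a_minus_def D1.M.r_neg)
      then have "cohomology_class D l ?w \<in> cohomology_map D f l ` (cohomology_class C l ` cocycles C l)"
        using bij_betw_imp_surj_on[OF bij[of l]] by blast
      then obtain z where z: "z \<in> cocycles C l" "cohomology_class D l ?w = cohomology_class D l (f l z)"
        using cohomology_map_class[OF f] by auto
      then have "f l z \<ominus>\<^bsub>obj D l\<^esub> ?w \<in> coboundaries D l"
        using cohomology_class_eq_iff[OF D cochain_map_cocycle[OF f z(1)] wz] by simp
      then obtain y' where y': "y' \<in> carrier (obj D (l - 1))" "f l z \<ominus>\<^bsub>obj D l\<^esub> ?w = dif D (l - 1) y'"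
        by (auto simp: coboundaries_def)
      note zc = cocycle_facts(1)[OF C z(1)]
      note fz = linear_map_closed[OF fl zc]
      show "\<exists>x'\<in>carrier (obj C l). \<exists>y'\<in>carrier (obj D (l - 1)). dif C l x' = x \<and> f l x' \<ominus>\<^bsub>obj D l\<^esub> y = dif D (l - 1) y'"
      proof (intro bexI conjI)
        show "u \<oplus>\<^bsub>obj C l\<^esub> z \<in> carrier (obj C l)" using u zc by simp
        show "dif C l (u \<oplus>\<^bsub>obj C l\<^esub> z) = x"
          using linear_map_add[OF cochain_complexD(1)[OF C] u(1) zc] u(2) z(1) x by (simp add: cocycles_def)
        show "f l (u \<oplus>\<^bsub>obj C l\<^esub> z) \<ominus>\<^bsub>obj D l\<^esub> y = dif D (l - 1) y'"
          unfolding linear_map_add[OF fl u(1) zc] y'(2)[symmetric]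
          using fu fz y by (simp add: a_minus_def D0.M.minus_add D0.M.a_ac)
      qed fact
    qed
  next
    assume e: "cone_exact C D f"
    show "quasi_isomorphism C D f"
      unfolding quasi_isomorphism_def
    proof
      fix l
      interpret C0: right_module R "obj C l" using C by (rule cochain_complexD)
      interpret D0: right_module R "obj D l" using D by (rule cochain_complexD)
      interpret C1: right_module R "obj C (l + 1)" using C by (rule cochain_complexD)
      interpret Dm: right_module R "obj D (l - 1)" using D by (rule cochain_complexD)
      note fl = cochain_mapD(3)[OF f]
      have hom: "cohomology_map D f l \<in> hom (cohomology C l) (cohomology D l)"
      proof (rule homI)
        fix X assume "X \<in> carrier (cohomology C l)"
        then obtain z where z: "z \<in> cocycles C l" "X = cohomology_class C l z" using carrier_cohomology[OF C] by auto
        show "cohomology_map D f l X \<in> carrier (cohomology D l)"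
          unfolding z(2) cohomology_map_class[OF f z(1)] carrier_cohomology[OF D] using cochain_map_cocycle[OF f z(1)] by simp
        fix W assume "W \<in> carrier (cohomology C l)"
        then obtain w where w: "w \<in> cocycles C l" "W = cohomology_class C l w" using carrier_cohomology[OF C] by auto
        show "cohomology_map D f l (X \<otimes>\<^bsub>cohomology C l\<^esub> W) = cohomology_map D f l X \<otimes>\<^bsub>cohomology D l\<^esub> cohomology_map D f l W"
          unfolding z(2) w(2) mult_cohomology[OF C z(1) w(1)] cohomology_map_class[OF f z(1)] cohomology_map_class[OF f w(1)]
            cohomology_map_class[OF f cocycle_facts(2)[OF C z(1) w(1)]]
            mult_cohomology[OF D cochain_map_cocycle[OF f z(1)] cochain_map_cocycle[OF f w(1)]]
            linear_map_add[OF fl cocycle_facts(1)[OF C z(1)] cocycle_facts(1)[OF C w(1)]] ..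
      qed
      have "inj_on (cohomology_map D f l) (carrier (cohomology C l))"
        unfolding carrier_cohomology[OF C]
      proof (rule inj_onI)
        fix X W assume X: "X \<in> cohomology_class C l ` cocycles C l" and W: "W \<in> cohomology_class C l ` cocycles C l"
          and eq: "cohomology_map D f l X = cohomology_map D f l W"
        obtain z where z: "z \<in> cocycles C l" "X = cohomology_class C l z" using X by auto
        obtain w where w: "w \<in> cocycles C l" "W = cohomology_class C l w" using W by auto
        let ?x = "z \<ominus>\<^bsub>obj C l\<^esub> w"
        note zc = cocycle_facts(1)[OF C z(1)] and wc = cocycle_facts(1)[OF C w(1)]
        have "f l z \<ominus>\<^bsub>obj D l\<^esub> f l w \<in> coboundaries D l"
          using eq unfolding z(2) w(2) cohomology_map_class[OF f z(1)] cohomology_map_class[OF f w(1)]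
          using cohomology_class_eq_iff[OF D cochain_map_cocycle[OF f z(1)] cochain_map_cocycle[OF f w(1)]] by simp
        then obtain y where y: "y \<in> carrier (obj D (l - 1))" "f l ?x = dif D (l - 1) y"
          using linear_map_minus[OF fl zc wc] by (auto simp: coboundaries_def)
        have xz: "?x \<in> cocycles C l"
          unfolding a_minus_def by (rule cocycle_facts(2)[OF C z(1) cocycle_facts(3)[OF C w(1)]])
        \<comment> \<open>Exactness is used one degree lower, so that x lies in degree l.\<close>
        have "\<exists>x'\<in>carrier (obj C (l - 1)). dif C (l - 1) x' = ?x"
          using e[unfolded cone_exact_def, rule_format, of ?x "l - 1" y] xz y
          by (auto simp: cocycles_def add.commute)
        then have "?x \<in> coboundaries C l" unfolding coboundaries_def by (metis imageI)
        then show "X = W" unfolding z(2) w(2) cohomology_class_eq_iff[OF C z(1) w(1)] .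
      qed
      moreover have "cohomology_map D f l ` carrier (cohomology C l) = carrier (cohomology D l)"
      proof (rule equalityI)
        show "cohomology_map D f l ` carrier (cohomology C l) \<subseteq> carrier (cohomology D l)"
          using hom by (auto simp: hom_def)
        show "carrier (cohomology D l) \<subseteq> cohomology_map D f l ` carrier (cohomology C l)"
        proof
          fix V assume "V \<in> carrier (cohomology D l)"
          then obtain y where y: "y \<in> cocycles D l" "V = cohomology_class D l y" using carrier_cohomology[OF D] by auto
          note yc = cocycle_facts(1)[OF D y(1)]
          \<comment> \<open>A cocycle y of the target makes (0, y) a solution of the hypotheses of
            \<open>cone_exact\<close>; the x' it produces is a cocycle, and f x' is cohomologous to
            y.\<close>
          have "f (l + 1) \<zero>\<^bsub>obj C (l + 1)\<^esub> = dif D l y"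
            using y(1) linear_map_zero[OF fl] by (simp add: cocycles_def)
          moreover have "dif C (l + 1) \<zero>\<^bsub>obj C (l + 1)\<^esub> = \<zero>\<^bsub>obj C (l + 2)\<^esub>"
            using linear_map_zero[OF cochain_complexD(1)[OF C, of "l + 1"]] by (simp add: add.assoc)
          ultimately obtain x' y' where x': "x' \<in> carrier (obj C l)" "dif C l x' = \<zero>\<^bsub>obj C (l + 1)\<^esub>"
            and y': "y' \<in> carrier (obj D (l - 1))" "f l x' \<ominus>\<^bsub>obj D l\<^esub> y = dif D (l - 1) y'"
            using e[unfolded cone_exact_def, rule_format, of "\<zero>\<^bsub>obj C (l + 1)\<^esub>" l y] yc C1.M.zero_closed by blast
          have xz: "x' \<in> cocycles C l" using x' by (simp add: cocycles_def)
          have "f l x' \<ominus>\<^bsub>obj D l\<^esub> y \<in> coboundaries D l" using y' by (auto simp: coboundaries_def)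
          then have "V = cohomology_map D f l (cohomology_class C l x')"
            unfolding y(2) cohomology_map_class[OF f xz]
            using cohomology_class_eq_iff[OF D cochain_map_cocycle[OF f xz] y(1)] by simp
          then show "V \<in> cohomology_map D f l ` carrier (cohomology C l)"
            using carrier_cohomology[OF C] xz by auto
        qed
      qed
      ultimately show "cohomology_map D f l \<in> iso (cohomology C l) (cohomology D l)"
        using hom by (simp add: iso_def bij_betw_def)
    qed
  qed
qed

text \<open>The predicates U and V describe decreasing filtrations of the two complexes. The step
  pushes a cocycle of the cone one stage deeper by subtracting a coboundary; after n stages nothing
  is left, and the sum of the corrections is the required primitive.\<close>

lemma cone_exact_filtered:
  fixes U :: "nat \<Rightarrow> int \<Rightarrow> 'm \<Rightarrow> bool" and V :: "nat \<Rightarrow> int \<Rightarrow> 'k \<Rightarrow> bool"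
  assumes f: "cochain_map R X Y f"
    and start: "\<And>l x. x \<in> carrier (obj X l) \<Longrightarrow> U 0 l x" "\<And>l y. y \<in> carrier (obj Y l) \<Longrightarrow> V 0 l y"
    and stop: "\<And>l x. x \<in> carrier (obj X l) \<Longrightarrow> U n l x \<Longrightarrow> x = \<zero>\<^bsub>obj X l\<^esub>"
      "\<And>l y. y \<in> carrier (obj Y l) \<Longrightarrow> V n l y \<Longrightarrow> y = \<zero>\<^bsub>obj Y l\<^esub>"
    and step: "\<And>k l x y. x \<in> carrier (obj X (l + 1)) \<Longrightarrow> y \<in> carrier (obj Y l) \<Longrightarrow> U k (l + 1) x \<Longrightarrow> V k l y \<Longrightarrow>
      dif X (l + 1) x = \<zero>\<^bsub>obj X (l + 2)\<^esub> \<Longrightarrow> f (l + 1) x = dif Y l y \<Longrightarrow>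
      \<exists>u\<in>carrier (obj X l). \<exists>w\<in>carrier (obj Y (l - 1)). U (Suc k) (l + 1) (x \<ominus>\<^bsub>obj X (l + 1)\<^esub> dif X l u)
        \<and> V (Suc k) l (y \<ominus>\<^bsub>obj Y l\<^esub> f l u \<oplus>\<^bsub>obj Y l\<^esub> dif Y (l - 1) w)"
  shows "cone_exact X Y f"
proof -
  note X = cochain_mapD(1)[OF f] and Y = cochain_mapD(2)[OF f]
  have main: "\<exists>x'\<in>carrier (obj X l). \<exists>y'\<in>carrier (obj Y (l - 1)). dif X l x' = x \<and> f l x' \<ominus>\<^bsub>obj Y l\<^esub> y = dif Y (l - 1) y'"
    if "k \<le> n" "x \<in> carrier (obj X (l + 1))" "y \<in> carrier (obj Y l)" "U k (l + 1) x" "V k l y"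
      "dif X (l + 1) x = \<zero>\<^bsub>obj X (l + 2)\<^esub>" "f (l + 1) x = dif Y l y" for k l x y
    using that
  \<comment> \<open>Induction downwards from n: the claim at stage k uses the one at stage k + 1 for
    the corrected pair.\<close>
  proof (induction k arbitrary: x y rule: inc_induct)
    case base
    interpret X0: right_module R "obj X l" using X by (rule cochain_complexD)
    interpret Y0: right_module R "obj Y l" using Y by (rule cochain_complexD)
    interpret Ym: right_module R "obj Y (l - 1)" using Y by (rule cochain_complexD)
    have "x = \<zero>\<^bsub>obj X (l + 1)\<^esub>" "y = \<zero>\<^bsub>obj Y l\<^esub>" using base stop by auto
    then show ?case
      using linear_map_zero[OF cochain_complexD(1)[OF X], of l] linear_map_zero[OF cochain_mapD(3)[OF f], of l]
        linear_map_zero[OF cochain_complex_previous(1)[OF Y], of l]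
      by (intro bexI[of _ "\<zero>\<^bsub>obj X l\<^esub>"] bexI[of _ "\<zero>\<^bsub>obj Y (l - 1)\<^esub>"]) (auto simp: a_minus_def Y0.M.r_neg)
  next
    case (step k)
    interpret X0: right_module R "obj X l" using X by (rule cochain_complexD)
    interpret X1: right_module R "obj X (l + 1)" using X by (rule cochain_complexD)
    interpret X2: right_module R "obj X (l + 2)" using X by (rule cochain_complexD)
    interpret Y0: right_module R "obj Y l" using Y by (rule cochain_complexD)
    interpret Y1: right_module R "obj Y (l + 1)" using Y by (rule cochain_complexD)
    interpret Ym: right_module R "obj Y (l - 1)" using Y by (rule cochain_complexD)
    note x = step.prems(1) and y = step.prems(2)
    obtain u w where u: "u \<in> carrier (obj X l)" and w: "w \<in> carrier (obj Y (l - 1))"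
      and U: "U (Suc k) (l + 1) (x \<ominus>\<^bsub>obj X (l + 1)\<^esub> dif X l u)"
      and V: "V (Suc k) l (y \<ominus>\<^bsub>obj Y l\<^esub> f l u \<oplus>\<^bsub>obj Y l\<^esub> dif Y (l - 1) w)"
      using assms(6)[OF step.prems] by blast
    note dX0 = cochain_complexD(1)[OF X, of l] and dY0 = cochain_complexD(1)[OF Y, of l]
      and dYm = cochain_complex_previous(1)[OF Y, of l]
    have dX1: "linear_map R (obj X (l + 1)) (obj X (l + 2)) (dif X (l + 1))"
      using cochain_complexD(1)[OF X, of "l + 1"] by (simp add: add.assoc)
    note du = linear_map_closed[OF dX0 u] and fu = linear_map_closed[OF cochain_mapD(3)[OF f] u]
      and dw = linear_map_closed[OF dYm w]
    let ?x = "x \<ominus>\<^bsub>obj X (l + 1)\<^esub> dif X l u" and ?y = "y \<ominus>\<^bsub>obj Y l\<^esub> f l u \<oplus>\<^bsub>obj Y l\<^esub> dif Y (l - 1) w"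
    have x': "?x \<in> carrier (obj X (l + 1))" and y': "?y \<in> carrier (obj Y l)" using x y du fu dw by auto
    have yfu: "y \<ominus>\<^bsub>obj Y l\<^esub> f l u \<in> carrier (obj Y l)" using y fu by simp
    have "dif X (l + 1) ?x = \<zero>\<^bsub>obj X (l + 2)\<^esub>"
      using linear_map_minus[OF dX1 x du] step.prems(5) cochain_complexD(4)[OF X u] by (simp add: a_minus_def X2.M.r_neg)
    moreover have "f (l + 1) ?x = dif Y l ?y"
      using linear_map_minus[OF cochain_mapD(3)[OF f] x du] step.prems(6) cochain_mapD(4)[OF f u]
        linear_map_add[OF dY0 yfu dw] linear_map_minus[OF dY0 y fu] cochain_complex_previous(2)[OF Y w]
        linear_map_closed[OF dY0 y] linear_map_closed[OF dY0 fu] by simp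
    ultimately obtain x3 y3 where 3: "x3 \<in> carrier (obj X l)" "y3 \<in> carrier (obj Y (l - 1))"
      "dif X l x3 = ?x" "f l x3 \<ominus>\<^bsub>obj Y l\<^esub> ?y = dif Y (l - 1) y3"
      using step.IH[OF x' y' U V] by blast
    note f3 = linear_map_closed[OF cochain_mapD(3)[OF f] 3(1)]
    show ?case
    proof (intro bexI conjI)
      show "x3 \<oplus>\<^bsub>obj X l\<^esub> u \<in> carrier (obj X l)" using 3 u by simp
      show "y3 \<oplus>\<^bsub>obj Y (l - 1)\<^esub> w \<in> carrier (obj Y (l - 1))" using 3 w by simp
      show "dif X l (x3 \<oplus>\<^bsub>obj X l\<^esub> u) = x"
        unfolding linear_map_add[OF dX0 3(1) u] 3(3) using x du by (simp add: X1.M.diff_add_cancel)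
      have "f l (x3 \<oplus>\<^bsub>obj X l\<^esub> u) \<ominus>\<^bsub>obj Y l\<^esub> y = (f l x3 \<oplus>\<^bsub>obj Y l\<^esub> f l u) \<ominus>\<^bsub>obj Y l\<^esub> y"
        unfolding linear_map_add[OF cochain_mapD(3)[OF f] 3(1) u] ..
      also have "\<dots> = (f l x3 \<ominus>\<^bsub>obj Y l\<^esub> ?y) \<oplus>\<^bsub>obj Y l\<^esub> dif Y (l - 1) w"
      proof -
        have "(f l x3 \<ominus>\<^bsub>obj Y l\<^esub> ?y) \<oplus>\<^bsub>obj Y l\<^esub> dif Y (l - 1) w
          = ((f l x3 \<oplus>\<^bsub>obj Y l\<^esub> f l u) \<ominus>\<^bsub>obj Y l\<^esub> y) \<oplus>\<^bsub>obj Y l\<^esub> (\<ominus>\<^bsub>obj Y l\<^esub> dif Y (l - 1) w \<oplus>\<^bsub>obj Y l\<^esub> dif Y (l - 1) w)"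
          using f3 fu dw y by (simp add: a_minus_def Y0.M.minus_add Y0.M.a_ac)
        then show ?thesis using f3 fu dw y by (simp add: Y0.M.l_neg)
      qed
      also have "\<dots> = dif Y (l - 1) (y3 \<oplus>\<^bsub>obj Y (l - 1)\<^esub> w)"
        unfolding 3(4) linear_map_add[OF dYm 3(2) w] ..
      finally show "f l (x3 \<oplus>\<^bsub>obj X l\<^esub> u) \<ominus>\<^bsub>obj Y l\<^esub> y = dif Y (l - 1) (y3 \<oplus>\<^bsub>obj Y (l - 1)\<^esub> w)" .
    qed
  qed
  show ?thesis
    unfolding cone_exact_def using main[OF le0] start by blast
qed

section \<open>Lifting properties and contractions\<close>

text \<open>The lifting property against one map g, for maps that take values in the image of g;
  surjectivity of g is not built in. Keeping g fixed leaves the types of its source and target free,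
  which a quantification over all g inside the definition could not do.\<close>

definition lifts_along ::
  "('r, 'x) ring_scheme \<Rightarrow> ('r, 'p) module \<Rightarrow> ('r, 'm) module \<Rightarrow> ('r, 'w) module \<Rightarrow> ('m \<Rightarrow> 'w) \<Rightarrow> bool" where
  "lifts_along R P M W g \<longleftrightarrow> (\<forall>\<phi>. linear_map R P W \<phi> \<longrightarrow> \<phi> ` carrier P \<subseteq> g ` carrier M \<longrightarrow>
     (\<exists>\<psi>. linear_map R P M \<psi> \<and> (\<forall>p\<in>carrier P. g (\<psi> p) = \<phi> p)))"

lemma linear_map_direct_sum_inj:
  assumes M: "\<And>i. i \<in> I \<Longrightarrow> right_module R (M i)" and I: "finite I" and j: "j \<in> I"
  shows "linear_map R (M j) (direct_sum I M) (\<lambda>m. \<lambda>i\<in>I. if i = j then m else \<zero>\<^bsub>M i\<^esub>)"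
proof (rule linear_map_into_direct_sum[OF I M[OF j]])
  fix i assume i: "i \<in> I"
  show "linear_map R (M j) (M i) (\<lambda>m. if i = j then m else \<zero>\<^bsub>M i\<^esub>)"
  proof (cases "i = j")
    case True
    then show ?thesis using linear_map_ident[OF M[OF j]] by simp
  next
    case False
    then show ?thesis using linear_map_const_zero[OF M[OF j] M[OF i]] by simp
  qed
qed

lemma direct_sum_decompose:
  assumes M: "\<And>i. i \<in> I \<Longrightarrow> right_module R (M i)" and I: "finite I" and R: "ring R" and v: "v \<in> carrier (direct_sum I M)"
  shows "v = (\<Oplus>\<^bsub>direct_sum I M\<^esub>j\<in>I. (\<lambda>i\<in>I. if i = j then v j else \<zero>\<^bsub>M i\<^esub>))"
proof (rule direct_sum_eqI[OF v])
  interpret S: right_module R "direct_sum I M" by (rule right_module_direct_sum[OF R]) (rule M)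
  have inj: "linear_map R (M j) (direct_sum I M) (\<lambda>m. \<lambda>i\<in>I. if i = j then m else \<zero>\<^bsub>M i\<^esub>)" if "j \<in> I" for j
    by (rule linear_map_direct_sum_inj[OF _ I that]) (rule M)
  have proj: "linear_map R (direct_sum I M) (M j) (\<lambda>v. v j)" if "j \<in> I" for j
    by (rule linear_map_direct_sum_proj[OF R _ that]) (rule M)
  have mem: "(\<lambda>i\<in>I. if i = j then v j else \<zero>\<^bsub>M i\<^esub>) \<in> carrier (direct_sum I M)" if "j \<in> I" for j
    using linear_map_closed[OF inj[OF that] direct_sum_mem(1)[OF v that]] .
  then show "(\<Oplus>\<^bsub>direct_sum I M\<^esub>j\<in>I. (\<lambda>i\<in>I. if i = j then v j else \<zero>\<^bsub>M i\<^esub>)) \<in> carrier (direct_sum I M)"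
    by (intro S.M.finsum_closed) blast
  fix k assume k: "k \<in> I"
  interpret K: right_module R "M k" using M[OF k] .
  have "(\<Oplus>\<^bsub>direct_sum I M\<^esub>j\<in>I. (\<lambda>i\<in>I. if i = j then v j else \<zero>\<^bsub>M i\<^esub>)) k
      = (\<Oplus>\<^bsub>M k\<^esub>j\<in>I. (\<lambda>i\<in>I. if i = j then v j else \<zero>\<^bsub>M i\<^esub>) k)"
    by (rule linear_map_finsum[OF proj[OF k]]) (use mem in blast)
  also have "\<dots> = (\<Oplus>\<^bsub>M k\<^esub>j\<in>I. if j = k then v j else \<zero>\<^bsub>M k\<^esub>)"
    using k direct_sum_mem(1)[OF v k] by (intro K.M.finsum_cong'[OF refl]) auto
  also have "\<dots> = v k" using K.M.finsum_delta[OF I k, of v] direct_sum_mem(1)[OF v k] by simp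
  finally show "v k = (\<Oplus>\<^bsub>direct_sum I M\<^esub>j\<in>I. (\<lambda>i\<in>I. if i = j then v j else \<zero>\<^bsub>M i\<^esub>)) k" by simp
qed

text \<open>Restrict to each summand, lift there, and add the lifts composed with the
  projections.\<close>

lemma lifts_along_direct_sum:
  assumes g: "linear_map R A W g" and I: "finite I" and M: "\<And>i. i \<in> I \<Longrightarrow> right_module R (M i)"
    and lift: "\<And>i. i \<in> I \<Longrightarrow> lifts_along R (M i) A W g"
  shows "lifts_along R (direct_sum I M) A W g"
  unfolding lifts_along_def
proof (intro allI impI)
  fix \<phi> assume \<phi>: "linear_map R (direct_sum I M) W \<phi>" and img: "\<phi> ` carrier (direct_sum I M) \<subseteq> g ` carrier A"
  have R: "ring R" using g by (rule linear_map_modules)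
  interpret A: right_module R A using g by (rule linear_map_modules)
  interpret W: right_module R W using g by (rule linear_map_modules)
  let ?inj = "\<lambda>j m. \<lambda>i\<in>I. if i = j then m else \<zero>\<^bsub>M i\<^esub>"
  have inj: "linear_map R (M j) (direct_sum I M) (?inj j)" if "j \<in> I" for j
    by (rule linear_map_direct_sum_inj[OF _ I that]) (rule M)
  have proj: "linear_map R (direct_sum I M) (M j) (\<lambda>v. v j)" if "j \<in> I" for j
    by (rule linear_map_direct_sum_proj[OF R _ that]) (rule M)
  have sum: "right_module R (direct_sum I M)" by (rule right_module_direct_sum[OF R]) (rule M)
  have "\<exists>\<psi>. linear_map R (M j) A \<psi> \<and> (\<forall>m\<in>carrier (M j). g (\<psi> m) = \<phi> (?inj j m))" if j: "j \<in> I" for j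
    using lift[OF j, unfolded lifts_along_def, rule_format, OF linear_map_compose[OF inj[OF j] \<phi>]]
      linear_map_closed[OF inj[OF j]] img by (auto simp: image_subset_iff)
  then have "\<forall>j\<in>I. \<exists>\<psi>. linear_map R (M j) A \<psi> \<and> (\<forall>m\<in>carrier (M j). g (\<psi> m) = \<phi> (?inj j m))" ..
  from bchoice[OF this] obtain \<psi> where
    \<psi>': "\<forall>j\<in>I. linear_map R (M j) A (\<psi> j) \<and> (\<forall>m\<in>carrier (M j). g (\<psi> j m) = \<phi> (?inj j m))" ..
  have \<psi>: "linear_map R (M j) A (\<psi> j)" "m \<in> carrier (M j) \<Longrightarrow> g (\<psi> j m) = \<phi> (?inj j m)" if "j \<in> I" for j m
    using bspec[OF \<psi>' that] by simp_all
  have lin: "linear_map R (direct_sum I M) A (\<lambda>v. \<Oplus>\<^bsub>A\<^esub>j\<in>I. \<psi> j (v j))"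
    by (rule linear_map_sum[OF sum A.right_module_axioms]) (rule linear_map_compose[OF proj \<psi>(1)])
  have "g (\<Oplus>\<^bsub>A\<^esub>j\<in>I. \<psi> j (v j)) = \<phi> v" if v: "v \<in> carrier (direct_sum I M)" for v
  proof -
    note vj = direct_sum_mem(1)[OF v]
    have "g (\<Oplus>\<^bsub>A\<^esub>j\<in>I. \<psi> j (v j)) = (\<Oplus>\<^bsub>W\<^esub>j\<in>I. g (\<psi> j (v j)))"
      by (rule linear_map_finsum[OF g]) (use linear_map_closed[OF \<psi>(1)] vj in blast)
    also have "\<dots> = (\<Oplus>\<^bsub>W\<^esub>j\<in>I. \<phi> (?inj j (v j)))"
      by (rule W.M.finsum_cong'[OF refl])
        (use \<psi>(2) vj linear_map_closed[OF \<phi> linear_map_closed[OF inj vj]] in auto)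
    also have "\<dots> = \<phi> (\<Oplus>\<^bsub>direct_sum I M\<^esub>j\<in>I. ?inj j (v j))"
      by (rule linear_map_finsum[OF \<phi>, symmetric]) (use linear_map_closed[OF inj vj] in blast)
    also have "\<dots> = \<phi> v" using direct_sum_decompose[OF _ I R v] M by simp
    finally show ?thesis .
  qed
  then show "\<exists>\<psi>. linear_map R (direct_sum I M) A \<psi> \<and> (\<forall>p\<in>carrier (direct_sum I M). g (\<psi> p) = \<phi> p)"
    using lin by blast
qed

text \<open>In \<open>direct_sum\<close> all summands have the same element type. The cone of a map
  between complexes of different types needs a product of two types.\<close>

definition product_module :: "('r, 'm) module \<Rightarrow> ('r, 'k) module \<Rightarrow> ('r, 'm \<times> 'k) module" where
  "product_module M K =
    \<lparr>carrier = carrier M \<times> carrier K, monoid.mult = undefined, one = undefined,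
     zero = (\<zero>\<^bsub>M\<^esub>, \<zero>\<^bsub>K\<^esub>), add = (\<lambda>p q. (fst p \<oplus>\<^bsub>M\<^esub> fst q, snd p \<oplus>\<^bsub>K\<^esub> snd q)),
     smult = (\<lambda>a p. (a \<odot>\<^bsub>M\<^esub> fst p, a \<odot>\<^bsub>K\<^esub> snd p))\<rparr>"

lemma product_module_simps:
  "carrier (product_module M K) = carrier M \<times> carrier K"
  "\<zero>\<^bsub>product_module M K\<^esub> = (\<zero>\<^bsub>M\<^esub>, \<zero>\<^bsub>K\<^esub>)"
  "p \<oplus>\<^bsub>product_module M K\<^esub> q = (fst p \<oplus>\<^bsub>M\<^esub> fst q, snd p \<oplus>\<^bsub>K\<^esub> snd q)"
  "a \<odot>\<^bsub>product_module M K\<^esub> p = (a \<odot>\<^bsub>M\<^esub> fst p, a \<odot>\<^bsub>K\<^esub> snd p)"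
  by (simp_all add: product_module_def)

lemma right_module_product:
  assumes "right_module R M" "right_module R K"
  shows "right_module R (product_module M K)"
proof -
  interpret M: right_module R M by fact
  interpret K: right_module R K by fact
  have "abelian_group (product_module M K)"
  proof (rule abelian_groupI)
    fix p assume "p \<in> carrier (product_module M K)"
    then show "\<exists>q\<in>carrier (product_module M K). q \<oplus>\<^bsub>product_module M K\<^esub> p = \<zero>\<^bsub>product_module M K\<^esub>"
      by (intro bexI[of _ "(\<ominus>\<^bsub>M\<^esub> fst p, \<ominus>\<^bsub>K\<^esub> snd p)"]) (auto simp: product_module_simps M.M.l_neg K.M.l_neg)
  qed (auto simp: product_module_simps M.M.a_ac K.M.a_ac)
  then show ?thesis
    using M.R.ring_axioms
    by (intro right_module.intro right_module_axioms.intro)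
      (auto simp: product_module_simps M.smult_closed K.smult_closed M.smult_scalar_distr K.smult_scalar_distr
        M.smult_vector_distr K.smult_vector_distr M.smult_assoc K.smult_assoc M.smult_one K.smult_one)
qed

section \<open>Projections, inclusions and lifting for binary products\<close>

context
  fixes R :: "('r, 'x) ring_scheme" and M :: "('r, 'm) module" and K :: "('r, 'k) module"
  assumes M: "right_module R M" and K: "right_module R K"
begin

interpretation M: right_module R M by (rule M)
interpretation K: right_module R K by (rule K)

lemma linear_map_fst: "linear_map R (product_module M K) M fst"
  by (rule linear_mapI[OF right_module_product[OF M K] M]) (auto simp: product_module_simps)

lemma linear_map_snd: "linear_map R (product_module M K) K snd"
  by (rule linear_mapI[OF right_module_product[OF M K] K]) (auto simp: product_module_simps)

lemma linear_map_inl: "linear_map R M (product_module M K) (\<lambda>m. (m, \<zero>\<^bsub>K\<^esub>))"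
  using linear_map_smult[OF linear_map_const_zero[OF K K] _ K.M.zero_closed]
  by (intro linear_mapI[OF M right_module_product[OF M K]]) (auto simp: product_module_simps)

lemma linear_map_inr: "linear_map R K (product_module M K) (\<lambda>k. (\<zero>\<^bsub>M\<^esub>, k))"
  using linear_map_smult[OF linear_map_const_zero[OF M M] _ M.M.zero_closed]
  by (intro linear_mapI[OF K right_module_product[OF M K]]) (auto simp: product_module_simps)

lemma linear_map_into_product:
  assumes "linear_map R W M f" "linear_map R W K g"
  shows "linear_map R W (product_module M K) (\<lambda>w. (f w, g w))"
  by (rule linear_mapI[OF linear_map_modules(1)[OF assms(1)] right_module_product[OF M K]])
    (simp_all add: product_module_simps linear_map_closed[OF assms(1)] linear_map_closed[OF assms(2)]
      linear_map_add[OF assms(1)] linear_map_add[OF assms(2)] linear_map_smult[OF assms(1)] linear_map_smult[OF assms(2)])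

lemma lifts_along_product:
  assumes g: "linear_map R A W g" and lift: "lifts_along R M A W g" "lifts_along R K A W g"
  shows "lifts_along R (product_module M K) A W g"
  unfolding lifts_along_def
proof (intro allI impI)
  fix \<phi> assume \<phi>: "linear_map R (product_module M K) W \<phi>" and img: "\<phi> ` carrier (product_module M K) \<subseteq> g ` carrier A"
  have "\<exists>\<psi>. linear_map R M A \<psi> \<and> (\<forall>m\<in>carrier M. g (\<psi> m) = \<phi> (m, \<zero>\<^bsub>K\<^esub>))"
    using lift(1)[unfolded lifts_along_def, rule_format, OF linear_map_compose[OF linear_map_inl \<phi>]]
      linear_map_closed[OF linear_map_inl] img by (auto simp: image_subset_iff)
  then obtain \<psi>1 where 1: "linear_map R M A \<psi>1" "\<And>m. m \<in> carrier M \<Longrightarrow> g (\<psi>1 m) = \<phi> (m, \<zero>\<^bsub>K\<^esub>)" by blast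
  have "\<exists>\<psi>. linear_map R K A \<psi> \<and> (\<forall>m\<in>carrier K. g (\<psi> m) = \<phi> (\<zero>\<^bsub>M\<^esub>, m))"
    using lift(2)[unfolded lifts_along_def, rule_format, OF linear_map_compose[OF linear_map_inr \<phi>]]
      linear_map_closed[OF linear_map_inr] img by (auto simp: image_subset_iff)
  then obtain \<psi>2 where 2: "linear_map R K A \<psi>2" "\<And>m. m \<in> carrier K \<Longrightarrow> g (\<psi>2 m) = \<phi> (\<zero>\<^bsub>M\<^esub>, m)" by blast
  have lin: "linear_map R (product_module M K) A (\<lambda>p. \<psi>1 (fst p) \<oplus>\<^bsub>A\<^esub> \<psi>2 (snd p))"
    by (rule linear_map_plus[OF linear_map_compose[OF linear_map_fst 1(1)] linear_map_compose[OF linear_map_snd 2(1)]])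
  have "g (\<psi>1 (fst p) \<oplus>\<^bsub>A\<^esub> \<psi>2 (snd p)) = \<phi> p" if p: "p \<in> carrier (product_module M K)" for p
  proof -
    have f: "fst p \<in> carrier M" and s: "snd p \<in> carrier K" using p by (auto simp: product_module_simps)
    have "g (\<psi>1 (fst p) \<oplus>\<^bsub>A\<^esub> \<psi>2 (snd p)) = \<phi> (fst p, \<zero>\<^bsub>K\<^esub>) \<oplus>\<^bsub>W\<^esub> \<phi> (\<zero>\<^bsub>M\<^esub>, snd p)"
      using linear_map_add[OF g linear_map_closed[OF 1(1) f] linear_map_closed[OF 2(1) s]] 1(2)[OF f] 2(2)[OF s] by simp
    also have "\<dots> = \<phi> ((fst p, \<zero>\<^bsub>K\<^esub>) \<oplus>\<^bsub>product_module M K\<^esub> (\<zero>\<^bsub>M\<^esub>, snd p))"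
      using linear_map_add[OF \<phi> linear_map_closed[OF linear_map_inl f] linear_map_closed[OF linear_map_inr s]] by simp
    finally show ?thesis using f s by (simp add: product_module_simps)
  qed
  then show "\<exists>\<psi>. linear_map R (product_module M K) A \<psi> \<and> (\<forall>p\<in>carrier (product_module M K). g (\<psi> p) = \<phi> p)"
    using lin by blast
qed

end

text \<open>The contraction is built downwards from the top degree. If s is already given out of
  degree k + 1 with d s d = d, then 1 - s d maps degree k into the cocycles, hence into the image of
  d, and a lift along d is the next component. It satisfies the contraction identity in degree k and
  again d s d = d one degree lower.\<close>

lemma contraction_exists:
  assumes E: "cochain_complex R E" and bounded: "bounded_above E"
    and acyclic: "\<And>l z. z \<in> carrier (obj E l) \<Longrightarrow> dif E l z = \<zero>\<^bsub>obj E (l + 1)\<^esub> \<Longrightarrow>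
      \<exists>w\<in>carrier (obj E (l - 1)). dif E (l - 1) w = z"
    and lift: "\<And>l. lifts_along R (obj E l) (obj E (l - 1)) (obj E l) (dif E (l - 1))"
  shows "\<exists>s. (\<forall>l. linear_map R (obj E l) (obj E (l - 1)) (s l)) \<and>
    (\<forall>l. \<forall>z\<in>carrier (obj E l). dif E (l - 1) (s l z) \<oplus>\<^bsub>obj E l\<^esub> s (l + 1) (dif E l z) = z)"
proof -
  obtain m where m: "\<And>l. l > m \<Longrightarrow> carrier (obj E l) = {\<zero>\<^bsub>obj E l\<^esub>}"
    using bounded by (auto simp: bounded_above_def)
  note d = cochain_complexD(1)[OF E] and d' = cochain_complex_previous(1)[OF E] and md = cochain_complexD(2)[OF E]
  \<comment> \<open>Indexed by n, the component out of degree m - n + 1. \<open>?P\<close> is the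
    invariant d s d = d, and \<open>?Q\<close> the contraction identity between two consecutive
    components.\<close>
  let ?P = "\<lambda>n s. linear_map R (obj E (m - int n + 1)) (obj E (m - int n)) s \<and>
    (\<forall>z\<in>carrier (obj E (m - int n)). dif E (m - int n) (s (dif E (m - int n) z)) = dif E (m - int n) z)"
  let ?Q = "\<lambda>n s s'. \<forall>z\<in>carrier (obj E (m - int n)). dif E (m - int n - 1) (s' z) \<oplus>\<^bsub>obj E (m - int n)\<^esub> s (dif E (m - int n) z) = z"
  have "\<exists>s. \<forall>n. ?P n (s n) \<and> ?Q n (s n) (s (Suc n))"
  proof (rule dependent_nat_choice)
    \<comment> \<open>Above degree m the complex vanishes, so zero serves as the first
      component.\<close>
    have "dif E m z = \<zero>\<^bsub>obj E (m + 1)\<^esub>" if "z \<in> carrier (obj E m)" for z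
      using linear_map_closed[OF d that] m[of "m + 1"] by simp
    then have "?P 0 (\<lambda>z. \<zero>\<^bsub>obj E m\<^esub>)"
      using linear_map_const_zero[OF md md, of "m + 1" m] linear_map_zero[OF d, of m] by simp
    then show "\<exists>s. ?P 0 s" by blast
  next
    fix s n assume P: "?P n s"
    define k where "k = m - int n"
    have ks: "m - int (Suc n) = k - 1" by (simp add: k_def)
    have s: "linear_map R (obj E (k + 1)) (obj E k) s" and sd: "\<And>z. z \<in> carrier (obj E k) \<Longrightarrow> dif E k (s (dif E k z)) = dif E k z"
      using P unfolding k_def by auto
    interpret E0: right_module R "obj E k" by (rule md)
    interpret E1: right_module R "obj E (k + 1)" by (rule md)
    \<comment> \<open>The map to be lifted along d; the invariant makes its values cocycles.\<close>
    let ?\<phi> = "\<lambda>z. z \<ominus>\<^bsub>obj E k\<^esub> s (dif E k z)"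
    have \<phi>: "linear_map R (obj E k) (obj E k) ?\<phi>"
      by (rule linear_map_diff[OF linear_map_ident[OF md] linear_map_compose[OF d s]])
    have "?\<phi> z \<in> dif E (k - 1) ` carrier (obj E (k - 1))" if z: "z \<in> carrier (obj E k)" for z
    proof -
      note sdz = linear_map_closed[OF s linear_map_closed[OF d z]]
      have "dif E k (?\<phi> z) = \<zero>\<^bsub>obj E (k + 1)\<^esub>"
        using linear_map_minus[OF d z sdz] sd[OF z] linear_map_closed[OF d z] by (simp add: a_minus_def E1.M.r_neg)
      then show ?thesis using acyclic[OF linear_map_closed[OF \<phi> z]] by (metis imageI)
    qed
    then obtain s' where s': "linear_map R (obj E k) (obj E (k - 1)) s'" "\<And>z. z \<in> carrier (obj E k) \<Longrightarrow> dif E (k - 1) (s' z) = ?\<phi> z"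
      using lift[of k, unfolded lifts_along_def, rule_format, OF \<phi>] by blast
    have Q: "dif E (k - 1) (s' z) \<oplus>\<^bsub>obj E k\<^esub> s (dif E k z) = z" if z: "z \<in> carrier (obj E k)" for z
      using s'(2)[OF z] z linear_map_closed[OF s linear_map_closed[OF d z]] by (simp add: E0.M.diff_add_cancel)
    have "dif E (k - 1) (s' (dif E (k - 1) z)) = dif E (k - 1) z" if z: "z \<in> carrier (obj E (k - 1))" for z
      using s'(2)[OF linear_map_closed[OF d' z]] cochain_complex_previous(2)[OF E z] linear_map_zero[OF s] linear_map_closed[OF d' z]
      by (simp add: a_minus_def E0.M.a_inv_zero)
    then have "?P (Suc n) s' \<and> ?Q n s s'"
      using s'(1) Q unfolding ks k_def[symmetric] by simp
    then show "\<exists>s'. ?P (Suc n) s' \<and> ?Q n s s'" by blast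
  qed
  then obtain s where s: "\<And>n. ?P n (s n)" "\<And>n. ?Q n (s n) (s (Suc n))" by blast
  \<comment> \<open>Degree l corresponds to n = m + 1 - l. In higher degrees the source is
    zero.\<close>
  define \<sigma> where "\<sigma> l = (if l \<le> m + 1 then s (nat (m + 1 - l)) else (\<lambda>z. \<zero>\<^bsub>obj E (l - 1)\<^esub>))" for l
  have lin: "linear_map R (obj E l) (obj E (l - 1)) (\<sigma> l)" for l
  proof (cases "l \<le> m + 1")
    case True
    then have "m - int (nat (m + 1 - l)) = l - 1" by simp
    then show ?thesis using s(1)[of "nat (m + 1 - l)"] True by (simp add: \<sigma>_def)
  next
    case False
    then show ?thesis using linear_map_const_zero[OF md md] by (simp add: \<sigma>_def)
  qed
  have "dif E (l - 1) (\<sigma> l z) \<oplus>\<^bsub>obj E l\<^esub> \<sigma> (l + 1) (dif E l z) = z" if z: "z \<in> carrier (obj E l)" for l z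
  proof (cases "l \<le> m")
    case True
    then have "m - int (nat (m - l)) = l" "Suc (nat (m - l)) = nat (m + 1 - l)" "nat (m + 1 - (l + 1)) = nat (m - l)" by auto
    then show ?thesis using s(2)[of "nat (m - l)"] True z by (simp add: \<sigma>_def)
  next
    case False
    interpret E0: right_module R "obj E l" by (rule md)
    have cl: "dif E (l - 1) (\<sigma> l z) \<oplus>\<^bsub>obj E l\<^esub> \<sigma> (l + 1) (dif E l z) \<in> carrier (obj E l)"
      using linear_map_closed[OF d' linear_map_closed[OF lin z]] linear_map_closed[OF lin[of "l + 1"] linear_map_closed[OF d z]] by simp
    then show ?thesis using m[of l] False z by auto
  qed
  then show ?thesis using lin by blast
qed

text \<open>Degree l consists of X in degree l + 1 and Y in degree l. The sign sits on the
  differential of X.\<close>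

definition mapping_cone :: "('r, 'm) cochain \<Rightarrow> ('r, 'k) cochain \<Rightarrow> (int \<Rightarrow> 'm \<Rightarrow> 'k) \<Rightarrow> ('r, 'm \<times> 'k) cochain" where
  "mapping_cone X Y f =
    \<lparr>obj = (\<lambda>l. product_module (obj X (l + 1)) (obj Y l)),
     dif = (\<lambda>l p. (\<ominus>\<^bsub>obj X (l + 2)\<^esub> dif X (l + 1) (fst p), f (l + 1) (fst p) \<oplus>\<^bsub>obj Y (l + 1)\<^esub> dif Y l (snd p)))\<rparr>"

section \<open>Contractions of the cone and homotopy equivalences\<close>

lemma mapping_cone_simps:
  "obj (mapping_cone X Y f) l = product_module (obj X (l + 1)) (obj Y l)"
  "dif (mapping_cone X Y f) l (x, y) = (\<ominus>\<^bsub>obj X (l + 2)\<^esub> dif X (l + 1) x, f (l + 1) x \<oplus>\<^bsub>obj Y (l + 1)\<^esub> dif Y l y)"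
  by (simp_all add: mapping_cone_def)

lemma cochain_complex_mapping_cone:
  assumes f: "cochain_map R X Y f"
  shows "cochain_complex R (mapping_cone X Y f)"
proof -
  note X = cochain_mapD(1)[OF f] and Y = cochain_mapD(2)[OF f] and fl = cochain_mapD(3)[OF f]
  note mX = cochain_complexD(2)[OF X] and mY = cochain_complexD(2)[OF Y]
  have dX1: "linear_map R (obj X (l + 1)) (obj X (l + 2)) (dif X (l + 1))" for l
    using cochain_complexD(1)[OF X, of "l + 1"] by (simp add: add.assoc)
  have e: "l + 1 + 1 = l + 2" "l + 1 + 2 = l + 2 + 1" "l + 2 + 1 = l + 3" for l :: int by simp_all
  have lin: "linear_map R (obj (mapping_cone X Y f) l) (obj (mapping_cone X Y f) (l + 1)) (dif (mapping_cone X Y f) l)" for l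
  proof -
    have "linear_map R (product_module (obj X (l + 1)) (obj Y l)) (product_module (obj X (l + 2)) (obj Y (l + 1)))
      (\<lambda>p. (\<ominus>\<^bsub>obj X (l + 2)\<^esub> dif X (l + 1) (fst p), f (l + 1) (fst p) \<oplus>\<^bsub>obj Y (l + 1)\<^esub> dif Y l (snd p)))"
      by (rule linear_map_into_product[OF mX mY
            linear_map_uminus[OF linear_map_compose[OF linear_map_fst[OF mX mY] dX1]]
            linear_map_plus[OF linear_map_compose[OF linear_map_fst[OF mX mY] fl]
              linear_map_compose[OF linear_map_snd[OF mX mY] cochain_complexD(1)[OF Y]]]])
    then show ?thesis by (simp add: mapping_cone_def e)
  qed
  have "dif (mapping_cone X Y f) (l + 1) (dif (mapping_cone X Y f) l p) = \<zero>\<^bsub>obj (mapping_cone X Y f) (l + 2)\<^esub>"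
    if p: "p \<in> carrier (obj (mapping_cone X Y f) l)" for l p
  proof -
    interpret X2: right_module R "obj X (l + 2)" by (rule mX)
    interpret X3: right_module R "obj X (l + 3)" by (rule mX)
    interpret Y2: right_module R "obj Y (l + 2)" by (rule mY)
    obtain x y where xy: "p = (x, y)" "x \<in> carrier (obj X (l + 1))" "y \<in> carrier (obj Y l)"
      using p by (auto simp: mapping_cone_simps product_module_simps)
    have dX2: "linear_map R (obj X (l + 2)) (obj X (l + 3)) (dif X (l + 2))"
      using cochain_complexD(1)[OF X, of "l + 2"] by (simp add: add.assoc)
    have dY1: "linear_map R (obj Y (l + 1)) (obj Y (l + 2)) (dif Y (l + 1))"
      using cochain_complexD(1)[OF Y, of "l + 1"] by (simp add: add.assoc)
    note dx = linear_map_closed[OF dX1 xy(2)] and fx = linear_map_closed[OF fl xy(2)]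
      and dy = linear_map_closed[OF cochain_complexD(1)[OF Y] xy(3)]
    have 1: "dif X (l + 2) (\<ominus>\<^bsub>obj X (l + 2)\<^esub> dif X (l + 1) x) = \<zero>\<^bsub>obj X (l + 3)\<^esub>"
      using linear_map_a_inv[OF dX2 dx] cochain_complexD(4)[OF X xy(2)] by (simp add: e X3.M.a_inv_zero)
    have 2: "f (l + 2) (\<ominus>\<^bsub>obj X (l + 2)\<^esub> dif X (l + 1) x) = \<ominus>\<^bsub>obj Y (l + 2)\<^esub> dif Y (l + 1) (f (l + 1) x)"
      using linear_map_a_inv[OF fl dx] cochain_mapD(4)[OF f xy(2)] by (simp add: e)
    have 3: "dif Y (l + 1) (f (l + 1) x \<oplus>\<^bsub>obj Y (l + 1)\<^esub> dif Y l y) = dif Y (l + 1) (f (l + 1) x)"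
      using linear_map_add[OF dY1 fx dy] cochain_complexD(4)[OF Y xy(3)] linear_map_closed[OF dY1 fx] by simp
    have 4: "\<ominus>\<^bsub>obj Y (l + 2)\<^esub> dif Y (l + 1) (f (l + 1) x) \<oplus>\<^bsub>obj Y (l + 2)\<^esub> dif Y (l + 1) (f (l + 1) x) = \<zero>\<^bsub>obj Y (l + 2)\<^esub>"
      using linear_map_closed[OF dY1 fx] by (simp add: Y2.M.l_neg)
    show ?thesis
      unfolding xy(1) mapping_cone_simps product_module_simps e using 1 2 3 4 by (simp add: X3.M.a_inv_zero)
  qed
  then show ?thesis
    using lin cochain_complexD(3)[OF X] unfolding cochain_complex_def linear_map_def by blast
qed

text \<open>Read a contraction of the cone as a two by two matrix. Its entry from Y to X is a
  homotopy inverse g, and its diagonal entries are, up to sign, the homotopies on X and on Y; the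
  matrix form of the identity ds + sd = 1 contains all the required equations.\<close>

lemma homotopy_equivalence_of_contraction:
  assumes f: "cochain_map R X Y f"
    and s: "\<And>l. linear_map R (obj (mapping_cone X Y f) l) (obj (mapping_cone X Y f) (l - 1)) (s l)"
    and contr: "\<And>l z. z \<in> carrier (obj (mapping_cone X Y f) l) \<Longrightarrow>
      dif (mapping_cone X Y f) (l - 1) (s l z) \<oplus>\<^bsub>obj (mapping_cone X Y f) l\<^esub> s (l + 1) (dif (mapping_cone X Y f) l z) = z"
  shows "homotopy_equivalence R X Y f"
proof -
  note X = cochain_mapD(1)[OF f] and Y = cochain_mapD(2)[OF f] and fl = cochain_mapD(3)[OF f]
  note mX = cochain_complexD(2)[OF X] and mY = cochain_complexD(2)[OF Y]
  have e: "l - 1 + 1 = l" "l + 1 - 1 = l" "l - 1 + 2 = l + 1" for l :: int by simp_all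
  have s': "linear_map R (product_module (obj X (l + 1)) (obj Y l)) (product_module (obj X l) (obj Y (l - 1))) (s l)" for l
    using s[of l] by (simp add: mapping_cone_simps)
  have sm: "linear_map R (product_module (obj X l) (obj Y (l - 1))) (product_module (obj X (l - 1)) (obj Y (l - 1 - 1))) (s (l - 1))" for l
    using s'[of "l - 1"] by simp
  \<comment> \<open>The three entries of the matrix of s that are used: g from Y to X, u from Y to
    Y, and r from X to X. For r the index is l - 1, since X in degree l belongs to the cone in
    degree l - 1.\<close>
  define g where "g l y = fst (s l (\<zero>\<^bsub>obj X (l + 1)\<^esub>, y))" for l y
  define u where "u l y = snd (s l (\<zero>\<^bsub>obj X (l + 1)\<^esub>, y))" for l y
  define r where "r l x = fst (s (l - 1) (x, \<zero>\<^bsub>obj Y (l - 1)\<^esub>))" for l x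
  have g: "linear_map R (obj Y l) (obj X l) (g l)" for l
    unfolding g_def[abs_def]
    by (rule linear_map_compose[OF linear_map_compose[OF linear_map_inr[OF mX mY] s'] linear_map_fst[OF mX mY]])
  have u: "linear_map R (obj Y l) (obj Y (l - 1)) (u l)" for l
    unfolding u_def[abs_def]
    by (rule linear_map_compose[OF linear_map_compose[OF linear_map_inr[OF mX mY] s'] linear_map_snd[OF mX mY]])
  have r: "linear_map R (obj X l) (obj X (l - 1)) (r l)" for l
    unfolding r_def[abs_def]
    by (rule linear_map_compose[OF linear_map_compose[OF linear_map_inl[OF mX mY] sm] linear_map_fst[OF mX mY]])
  \<comment> \<open>The contraction identity at (0, y): its first component says that g commutes
    with the differentials, its second that f g is homotopic to the identity.\<close>
  have Yeq: "g (l + 1) (dif Y l y) = dif X l (g l y)"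
    "f l (g l y) \<oplus>\<^bsub>obj Y l\<^esub> dif Y (l - 1) (u l y) \<oplus>\<^bsub>obj Y l\<^esub> u (l + 1) (dif Y l y) = y"
    if y: "y \<in> carrier (obj Y l)" for l y
  proof -
    interpret X1: right_module R "obj X (l + 1)" by (rule mX)
    interpret X2: right_module R "obj X (l + 2)" by (rule mX)
    interpret Y1: right_module R "obj Y (l + 1)" by (rule mY)
    have dX1: "linear_map R (obj X (l + 1)) (obj X (l + 2)) (dif X (l + 1))"
      using cochain_complexD(1)[OF X, of "l + 1"] by (simp add: add.assoc)
    let ?z = "(\<zero>\<^bsub>obj X (l + 1)\<^esub>, y)"
    have z: "?z \<in> carrier (obj (mapping_cone X Y f) l)" using y by (simp add: mapping_cone_simps product_module_simps)
    have dz: "dif (mapping_cone X Y f) l ?z = (\<zero>\<^bsub>obj X (l + 2)\<^esub>, dif Y l y)"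
      using linear_map_zero[OF dX1] linear_map_zero[OF fl] linear_map_closed[OF cochain_complexD(1)[OF Y] y]
      by (simp add: mapping_cone_simps X2.M.a_inv_zero)
    have sz: "s l ?z = (g l y, u l y)" by (simp add: g_def u_def)
    have sdz: "s (l + 1) (\<zero>\<^bsub>obj X (l + 2)\<^esub>, dif Y l y) = (g (l + 1) (dif Y l y), u (l + 1) (dif Y l y))"
      by (simp add: g_def u_def add.assoc)
    have "dif (mapping_cone X Y f) (l - 1) (g l y, u l y)
        = (\<ominus>\<^bsub>obj X (l + 1)\<^esub> dif X l (g l y), f l (g l y) \<oplus>\<^bsub>obj Y l\<^esub> dif Y (l - 1) (u l y))"
      by (simp only: mapping_cone_simps e)
    then have eq: "\<ominus>\<^bsub>obj X (l + 1)\<^esub> dif X l (g l y) \<oplus>\<^bsub>obj X (l + 1)\<^esub> g (l + 1) (dif Y l y) = \<zero>\<^bsub>obj X (l + 1)\<^esub>"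
      "f l (g l y) \<oplus>\<^bsub>obj Y l\<^esub> dif Y (l - 1) (u l y) \<oplus>\<^bsub>obj Y l\<^esub> u (l + 1) (dif Y l y) = y"
      using contr[OF z] by (auto simp: dz sz sdz mapping_cone_simps(1) product_module_simps)
    show "f l (g l y) \<oplus>\<^bsub>obj Y l\<^esub> dif Y (l - 1) (u l y) \<oplus>\<^bsub>obj Y l\<^esub> u (l + 1) (dif Y l y) = y" by (rule eq(2))
    have c: "dif X l (g l y) \<in> carrier (obj X (l + 1))" "g (l + 1) (dif Y l y) \<in> carrier (obj X (l + 1))"
      using linear_map_closed[OF cochain_complexD(1)[OF X] linear_map_closed[OF g y]]
        linear_map_closed[OF g linear_map_closed[OF cochain_complexD(1)[OF Y] y]] by auto
    then show "g (l + 1) (dif Y l y) = dif X l (g l y)"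
      using eq(1) by (metis X1.M.a_inv_closed X1.M.minus_equality X1.M.minus_minus X1.M.a_comm)
  qed
  \<comment> \<open>The first component of the contraction identity at (x, 0) in degree l - 1 of the
    cone.\<close>
  have Xeq: "dif X (l - 1) (r l x) \<oplus>\<^bsub>obj X l\<^esub> r (l + 1) (dif X l x) = g l (f l x) \<ominus>\<^bsub>obj X l\<^esub> x"
    if x: "x \<in> carrier (obj X l)" for l x
  proof -
    interpret X0: right_module R "obj X l" by (rule mX)
    interpret X1: right_module R "obj X (l + 1)" by (rule mX)
    interpret Y0: right_module R "obj Y l" by (rule mY)
    interpret Ym: right_module R "obj Y (l - 1)" by (rule mY)
    let ?z = "(x, \<zero>\<^bsub>obj Y (l - 1)\<^esub>)"
    note dx = linear_map_closed[OF cochain_complexD(1)[OF X] x] and fx = linear_map_closed[OF fl x]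
    have z: "?z \<in> carrier (obj (mapping_cone X Y f) (l - 1))" using x by (simp add: mapping_cone_simps product_module_simps)
    have dz: "dif (mapping_cone X Y f) (l - 1) ?z = (\<ominus>\<^bsub>obj X (l + 1)\<^esub> dif X l x, f l x)"
      using linear_map_zero[OF cochain_complex_previous(1)[OF Y], of l] fx by (simp add: mapping_cone_simps add.commute)
    have d1: "(\<ominus>\<^bsub>obj X (l + 1)\<^esub> dif X l x, \<zero>\<^bsub>obj Y l\<^esub>) \<in> carrier (product_module (obj X (l + 1)) (obj Y l))"
      and d2: "(\<zero>\<^bsub>obj X (l + 1)\<^esub>, f l x) \<in> carrier (product_module (obj X (l + 1)) (obj Y l))"
      using dx fx by (auto simp: product_module_simps)
    have split: "(\<ominus>\<^bsub>obj X (l + 1)\<^esub> dif X l x, f l x) = (\<ominus>\<^bsub>obj X (l + 1)\<^esub> dif X l x, \<zero>\<^bsub>obj Y l\<^esub>)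
        \<oplus>\<^bsub>product_module (obj X (l + 1)) (obj Y l)\<^esub> (\<zero>\<^bsub>obj X (l + 1)\<^esub>, f l x)"
      using dx fx by (simp add: product_module_simps)
    have "fst (s l (\<ominus>\<^bsub>obj X (l + 1)\<^esub> dif X l x, \<zero>\<^bsub>obj Y l\<^esub>)) = r (l + 1) (\<ominus>\<^bsub>obj X (l + 1)\<^esub> dif X l x)"
      by (simp add: r_def)
    also have "\<dots> = \<ominus>\<^bsub>obj X l\<^esub> r (l + 1) (dif X l x)"
      using linear_map_a_inv[OF r dx] by simp
    finally have fst_s: "fst (s l (\<ominus>\<^bsub>obj X (l + 1)\<^esub> dif X l x, f l x)) = \<ominus>\<^bsub>obj X l\<^esub> r (l + 1) (dif X l x) \<oplus>\<^bsub>obj X l\<^esub> g l (f l x)"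
      unfolding split linear_map_add[OF s' d1 d2] by (simp add: product_module_simps g_def)
    have fst_d: "fst (dif (mapping_cone X Y f) (l - 1 - 1) (s (l - 1) ?z)) = \<ominus>\<^bsub>obj X l\<^esub> dif X (l - 1) (r l x)"
      by (simp add: mapping_cone_def r_def)
    have eq: "\<ominus>\<^bsub>obj X l\<^esub> dif X (l - 1) (r l x) \<oplus>\<^bsub>obj X l\<^esub> (\<ominus>\<^bsub>obj X l\<^esub> r (l + 1) (dif X l x) \<oplus>\<^bsub>obj X l\<^esub> g l (f l x)) = x"
      using arg_cong[OF contr[OF z], of fst] fst_s fst_d
      by (simp add: dz mapping_cone_simps(1) product_module_simps)
    have c: "dif X (l - 1) (r l x) \<in> carrier (obj X l)" "r (l + 1) (dif X l x) \<in> carrier (obj X l)" "g l (f l x) \<in> carrier (obj X l)"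
      using linear_map_closed[OF cochain_complex_previous(1)[OF X] linear_map_closed[OF r x]]
        linear_map_closed[OF r dx] linear_map_closed[OF g fx] by auto
    let ?p = "dif X (l - 1) (r l x) \<oplus>\<^bsub>obj X l\<^esub> r (l + 1) (dif X l x)"
    have "x = g l (f l x) \<ominus>\<^bsub>obj X l\<^esub> ?p"
      using eq c by (simp add: a_minus_def X0.M.minus_add X0.M.a_ac)
    then have "\<ominus>\<^bsub>obj X l\<^esub> x = \<ominus>\<^bsub>obj X l\<^esub> (g l (f l x) \<ominus>\<^bsub>obj X l\<^esub> ?p)" by (rule arg_cong)
    also have "\<dots> = \<ominus>\<^bsub>obj X l\<^esub> g l (f l x) \<oplus>\<^bsub>obj X l\<^esub> ?p"
      using c by (simp add: a_minus_def X0.M.minus_add)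
    finally have "g l (f l x) \<ominus>\<^bsub>obj X l\<^esub> x = g l (f l x) \<oplus>\<^bsub>obj X l\<^esub> (\<ominus>\<^bsub>obj X l\<^esub> g l (f l x) \<oplus>\<^bsub>obj X l\<^esub> ?p)"
      by (simp only: a_minus_def)
    also have "\<dots> = (g l (f l x) \<oplus>\<^bsub>obj X l\<^esub> \<ominus>\<^bsub>obj X l\<^esub> g l (f l x)) \<oplus>\<^bsub>obj X l\<^esub> ?p"
      using c by (simp add: X0.M.a_assoc)
    also have "\<dots> = ?p" using c by (simp add: X0.M.r_neg)
    finally show ?thesis by simp
  qed
  have "cochain_map R Y X g"
    using X Y g Yeq(1) unfolding cochain_map_def linear_map_def by blast
  moreover have "cochain_homotopy R X X r (\<lambda>l. id) (\<lambda>l. g l \<circ> f l)"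
    using r Xeq unfolding cochain_homotopy_def linear_map_def by simp
  \<comment> \<open>The identity reads f g + d u + u d = 1, so the homotopy from the identity to f g
    is -u.\<close>
  moreover have "cochain_homotopy R Y Y (\<lambda>l y. \<ominus>\<^bsub>obj Y (l - 1)\<^esub> u l y) (\<lambda>l. id) (\<lambda>l. f l \<circ> g l)"
    unfolding cochain_homotopy_def
  proof (intro allI conjI ballI)
    fix l
    show "(\<lambda>y. \<ominus>\<^bsub>obj Y (l - 1)\<^esub> u l y) \<in> lin_hom R (obj Y l) (obj Y (l - 1))"
      using linear_map_uminus[OF u] unfolding linear_map_def by blast
    fix y assume y: "y \<in> carrier (obj Y l)"
    interpret Y0: right_module R "obj Y l" by (rule mY)
    note dYm = cochain_complex_previous(1)[OF Y, of l] and uy = linear_map_closed[OF u y]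
    have u1: "linear_map R (obj Y (l + 1)) (obj Y l) (u (l + 1))" using u[of "l + 1"] by simp
    have c: "f l (g l y) \<in> carrier (obj Y l)" "dif Y (l - 1) (u l y) \<in> carrier (obj Y l)" "u (l + 1) (dif Y l y) \<in> carrier (obj Y l)"
      using linear_map_closed[OF fl linear_map_closed[OF g y]] linear_map_closed[OF dYm uy]
        linear_map_closed[OF u1 linear_map_closed[OF cochain_complexD(1)[OF Y] y]] by auto
    let ?p = "dif Y (l - 1) (u l y) \<oplus>\<^bsub>obj Y l\<^esub> u (l + 1) (dif Y l y)"
    have "y = f l (g l y) \<oplus>\<^bsub>obj Y l\<^esub> ?p" using Yeq(2)[OF y] c by (simp add: Y0.M.a_assoc)
    then have "\<ominus>\<^bsub>obj Y l\<^esub> y = \<ominus>\<^bsub>obj Y l\<^esub> (f l (g l y) \<oplus>\<^bsub>obj Y l\<^esub> ?p)" by (rule arg_cong)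
    also have "\<dots> = \<ominus>\<^bsub>obj Y l\<^esub> f l (g l y) \<oplus>\<^bsub>obj Y l\<^esub> \<ominus>\<^bsub>obj Y l\<^esub> ?p"
      using c by (simp add: Y0.M.minus_add)
    finally have "f l (g l y) \<ominus>\<^bsub>obj Y l\<^esub> y = f l (g l y) \<oplus>\<^bsub>obj Y l\<^esub> (\<ominus>\<^bsub>obj Y l\<^esub> f l (g l y) \<oplus>\<^bsub>obj Y l\<^esub> \<ominus>\<^bsub>obj Y l\<^esub> ?p)"
      by (simp only: a_minus_def)
    also have "\<dots> = (f l (g l y) \<oplus>\<^bsub>obj Y l\<^esub> \<ominus>\<^bsub>obj Y l\<^esub> f l (g l y)) \<oplus>\<^bsub>obj Y l\<^esub> \<ominus>\<^bsub>obj Y l\<^esub> ?p"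
      using c by (simp add: Y0.M.a_assoc)
    also have "\<dots> = \<ominus>\<^bsub>obj Y l\<^esub> dif Y (l - 1) (u l y) \<oplus>\<^bsub>obj Y l\<^esub> \<ominus>\<^bsub>obj Y l\<^esub> u (l + 1) (dif Y l y)"
      using c by (simp add: Y0.M.r_neg Y0.M.minus_add)
    also have "\<dots> = dif Y (l - 1) (\<ominus>\<^bsub>obj Y (l - 1)\<^esub> u l y) \<oplus>\<^bsub>obj Y l\<^esub> \<ominus>\<^bsub>obj Y (l + 1 - 1)\<^esub> u (l + 1) (dif Y l y)"
      using linear_map_a_inv[OF dYm uy] by simp
    finally show "dif Y (l - 1) (\<ominus>\<^bsub>obj Y (l - 1)\<^esub> u l y) \<oplus>\<^bsub>obj Y l\<^esub> \<ominus>\<^bsub>obj Y (l + 1 - 1)\<^esub> u (l + 1) (dif Y l y)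
      = (f l \<circ> g l) y \<ominus>\<^bsub>obj Y l\<^esub> id y" by simp
  qed
  ultimately show ?thesis using f unfolding homotopy_equivalence_def by blast
qed

text \<open>The lifting hypotheses concern modules of pairs, because the only maps along which
  anything is lifted are the differentials of the cone.\<close>

lemma homotopy_equivalence_of_cone_exact:
  assumes f: "cochain_map R X Y f" and exact: "cone_exact X Y f" and bounded: "bounded_above X" "bounded_above Y"
    and lift: "\<And>l (A :: ('r, 'm \<times> 'k) module) (W :: ('r, 'm \<times> 'k) module) g. linear_map R A W g \<Longrightarrow> lifts_along R (obj X l) A W g"
      "\<And>l (A :: ('r, 'm \<times> 'k) module) (W :: ('r, 'm \<times> 'k) module) g. linear_map R A W g \<Longrightarrow> lifts_along R (obj Y l) A W g"
  shows "homotopy_equivalence R (X :: ('r, 'm) cochain) (Y :: ('r, 'k) cochain) f"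
proof -
  let ?E = "mapping_cone X Y f"
  note X = cochain_mapD(1)[OF f] and Y = cochain_mapD(2)[OF f] and fl = cochain_mapD(3)[OF f]
  note mX = cochain_complexD(2)[OF X] and mY = cochain_complexD(2)[OF Y]
  note E = cochain_complex_mapping_cone[OF f]
  have "\<exists>s. (\<forall>l. linear_map R (obj ?E l) (obj ?E (l - 1)) (s l)) \<and>
    (\<forall>l. \<forall>z\<in>carrier (obj ?E l). dif ?E (l - 1) (s l z) \<oplus>\<^bsub>obj ?E l\<^esub> s (l + 1) (dif ?E l z) = z)"
  proof (rule contraction_exists[OF E])
    obtain p where p: "\<And>l. l > p \<Longrightarrow> carrier (obj X l) = {\<zero>\<^bsub>obj X l\<^esub>}" using bounded(1) by (auto simp: bounded_above_def)
    obtain q where q: "\<And>l. l > q \<Longrightarrow> carrier (obj Y l) = {\<zero>\<^bsub>obj Y l\<^esub>}" using bounded(2) by (auto simp: bounded_above_def)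
    show "bounded_above ?E"
      unfolding bounded_above_def
      by (rule exI[of _ "max p q"]) (use p q in \<open>auto simp: mapping_cone_simps product_module_simps\<close>)
    show "lifts_along R (obj ?E l) (obj ?E (l - 1)) (obj ?E l) (dif ?E (l - 1))" for l
      unfolding mapping_cone_simps(1)[of X Y f l, symmetric]
      using lifts_along_product[OF mX mY _ lift(1) lift(2), OF cochain_complex_previous(1)[OF E] cochain_complex_previous(1)[OF E] cochain_complex_previous(1)[OF E]]
      by (simp add: mapping_cone_simps(1))
    fix l z assume z: "z \<in> carrier (obj ?E l)" and dz: "dif ?E l z = \<zero>\<^bsub>obj ?E (l + 1)\<^esub>"
    interpret X0: right_module R "obj X l" by (rule mX)
    interpret X1: right_module R "obj X (l + 1)" by (rule mX)
    interpret X2: right_module R "obj X (l + 2)" by (rule mX)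
    interpret Y0: right_module R "obj Y l" by (rule mY)
    interpret Y1: right_module R "obj Y (l + 1)" by (rule mY)
    obtain x y where xy: "z = (x, y)" "x \<in> carrier (obj X (l + 1))" "y \<in> carrier (obj Y l)"
      using z by (auto simp: mapping_cone_simps product_module_simps)
    have dX1: "linear_map R (obj X (l + 1)) (obj X (l + 2)) (dif X (l + 1))"
      using cochain_complexD(1)[OF X, of "l + 1"] by (simp add: add.assoc)
    note dx = linear_map_closed[OF dX1 xy(2)] and dy = linear_map_closed[OF cochain_complexD(1)[OF Y] xy(3)]
      and fx = linear_map_closed[OF fl xy(2)]
    have h: "\<ominus>\<^bsub>obj X (l + 2)\<^esub> dif X (l + 1) x = \<zero>\<^bsub>obj X (l + 2)\<^esub>" "f (l + 1) x \<oplus>\<^bsub>obj Y (l + 1)\<^esub> dif Y l y = \<zero>\<^bsub>obj Y (l + 1)\<^esub>"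
      using dz by (auto simp: xy(1) mapping_cone_simps product_module_simps add.assoc)
    have "dif X (l + 1) x = \<zero>\<^bsub>obj X (l + 2)\<^esub>" using h(1) dx by (metis X2.M.minus_minus X2.M.a_inv_zero)
    \<comment> \<open>Cocycles (x, y) of the cone satisfy f x + d y = 0, whereas
      \<open>cone_exact\<close> expects f x = d y. Hence the sign on y, here and in the
      primitive.\<close>
    moreover have "f (l + 1) x = dif Y l (\<ominus>\<^bsub>obj Y l\<^esub> y)"
      using h(2) fx dy linear_map_a_inv[OF cochain_complexD(1)[OF Y] xy(3)] by (metis Y1.M.minus_equality)
    ultimately obtain x' y' where x': "x' \<in> carrier (obj X l)" "dif X l x' = x"
      and y': "y' \<in> carrier (obj Y (l - 1))" "f l x' \<ominus>\<^bsub>obj Y l\<^esub> (\<ominus>\<^bsub>obj Y l\<^esub> y) = dif Y (l - 1) y'"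
      using exact[unfolded cone_exact_def, rule_format, of x l "\<ominus>\<^bsub>obj Y l\<^esub> y"] xy(2,3) Y0.M.a_inv_closed by blast
    note fx' = linear_map_closed[OF fl x'(1)]
    have "\<ominus>\<^bsub>obj X (l + 1)\<^esub> dif X l (\<ominus>\<^bsub>obj X l\<^esub> x') = x"
      using linear_map_a_inv[OF cochain_complexD(1)[OF X] x'(1)] x'(2) xy(2) by simp
    moreover have "f l (\<ominus>\<^bsub>obj X l\<^esub> x') \<oplus>\<^bsub>obj Y l\<^esub> dif Y (l - 1) y' = y"
    proof -
      have "f l (\<ominus>\<^bsub>obj X l\<^esub> x') \<oplus>\<^bsub>obj Y l\<^esub> dif Y (l - 1) y' = (\<ominus>\<^bsub>obj Y l\<^esub> f l x' \<oplus>\<^bsub>obj Y l\<^esub> f l x') \<oplus>\<^bsub>obj Y l\<^esub> y"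
        unfolding y'(2)[symmetric] linear_map_a_inv[OF fl x'(1)] using fx' xy(3) by (simp add: a_minus_def Y0.M.a_assoc)
      then show ?thesis using fx' xy(3) by (simp add: Y0.M.l_neg)
    qed
    ultimately have "dif ?E (l - 1) (\<ominus>\<^bsub>obj X l\<^esub> x', y') = z"
      by (simp add: mapping_cone_simps xy(1) add.commute)
    then show "\<exists>w\<in>carrier (obj ?E (l - 1)). dif ?E (l - 1) w = z"
      using x'(1) y'(1) by (intro bexI[of _ "(\<ominus>\<^bsub>obj X l\<^esub> x', y')"]) (auto simp: mapping_cone_simps product_module_simps)
  qed
  then show ?thesis using homotopy_equivalence_of_contraction[OF f] by blast
qed

section \<open>The Laurent polynomial ring\<close>

definition laurent_monomial :: "('r, 'x) ring_scheme \<Rightarrow> 'r \<Rightarrow> (nat \<Rightarrow> int) \<Rightarrow> (nat \<Rightarrow> int) \<Rightarrow> 'r" where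
  "laurent_monomial R a u = (\<lambda>e. if e = u then a else \<zero>\<^bsub>R\<^esub>)"

definition exponents :: "nat set \<Rightarrow> (nat \<Rightarrow> int) set" where
  "exponents N = {e. \<forall>k. k \<notin> N \<longrightarrow> e k = 0}"

definition support :: "('r, 'x) ring_scheme \<Rightarrow> ((nat \<Rightarrow> int) \<Rightarrow> 'r) \<Rightarrow> (nat \<Rightarrow> int) set" where
  "support R p = {e. p e \<noteq> \<zero>\<^bsub>R\<^esub>}"

lemma laurent_simps:
  "p \<in> carrier (laurent R N) \<longleftrightarrow> (\<forall>e. p e \<in> carrier R) \<and> finite (support R p) \<and> support R p \<subseteq> exponents N"
  "p \<oplus>\<^bsub>laurent R N\<^esub> q = (\<lambda>e. p e \<oplus>\<^bsub>R\<^esub> q e)"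
  "\<zero>\<^bsub>laurent R N\<^esub> = (\<lambda>e. \<zero>\<^bsub>R\<^esub>)"
  "\<one>\<^bsub>laurent R N\<^esub> = laurent_monomial R \<one>\<^bsub>R\<^esub> (\<lambda>k. 0)"
  "p \<otimes>\<^bsub>laurent R N\<^esub> q = (\<lambda>e. \<Oplus>\<^bsub>R\<^esub>u\<in>support R p. p u \<otimes>\<^bsub>R\<^esub> q (\<lambda>k. e k - u k))"
  by (auto simp: laurent_def laurent_monomial_def support_def exponents_def)

lemma laurent_const_monomial: "laurent_const R a = laurent_monomial R a (\<lambda>k. 0)"
  by (simp add: laurent_const_def laurent_monomial_def)

lemma laurent_var_monomial: "laurent_var R k = laurent_monomial R \<one>\<^bsub>R\<^esub> (\<lambda>i. if i = k then 1 else 0)"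
  by (simp add: laurent_var_def laurent_monomial_def)

section \<open>The ring structure on Laurent polynomials and their monomials\<close>

context ring
begin

lemma laurent_coeff: "p \<in> carrier (laurent R N) \<Longrightarrow> p e \<in> carrier R"
  by (simp add: laurent_simps)

text \<open>Exponents outside the support contribute zero. Distributivity and associativity need
  products of different first factors expanded over one common finite set.\<close>

lemma laurent_mult_superset:
  assumes p: "p \<in> carrier (laurent R N)" and q: "q \<in> carrier (laurent R N)"
    and E: "finite E" "support R p \<subseteq> E"
  shows "(p \<otimes>\<^bsub>laurent R N\<^esub> q) e = (\<Oplus>u\<in>E. p u \<otimes> q (\<lambda>k. e k - u k))"
  unfolding laurent_simps
  by (rule add.finprod_mono_neutral_cong_left)
    (use assms in \<open>auto simp: support_def laurent_coeff[OF q] laurent_coeff[OF p]\<close>)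

lemma abelian_group_laurent: "abelian_group (laurent R N)"
proof (rule abelian_groupI)
  fix p assume p: "p \<in> carrier (laurent R N)"
  show "\<exists>q\<in>carrier (laurent R N). q \<oplus>\<^bsub>laurent R N\<^esub> p = \<zero>\<^bsub>laurent R N\<^esub>"
  proof (rule bexI)
    show "(\<lambda>e. \<ominus> p e) \<oplus>\<^bsub>laurent R N\<^esub> p = \<zero>\<^bsub>laurent R N\<^esub>"
      using laurent_coeff[OF p] by (simp add: laurent_simps l_neg)
    have "support R (\<lambda>e. \<ominus> p e) \<subseteq> support R p" by (auto simp: support_def a_inv_zero)
    then show "(\<lambda>e. \<ominus> p e) \<in> carrier (laurent R N)"
      using p finite_subset unfolding laurent_simps(1) by (metis a_inv_closed subset_trans)
  qed
  show "\<zero>\<^bsub>laurent R N\<^esub> \<oplus>\<^bsub>laurent R N\<^esub> p = p" using laurent_coeff[OF p] by (simp add: laurent_simps)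
  fix q assume q: "q \<in> carrier (laurent R N)"
  have sub: "support R (\<lambda>e. p e \<oplus> q e) \<subseteq> support R p \<union> support R q" by (auto simp: support_def)
  have fin: "finite (support R p \<union> support R q)" and exp: "support R p \<union> support R q \<subseteq> exponents N"
    using p q unfolding laurent_simps(1) by blast+
  show "p \<oplus>\<^bsub>laurent R N\<^esub> q \<in> carrier (laurent R N)"
    unfolding laurent_simps(1,2)
    using finite_subset[OF sub fin] subset_trans[OF sub exp] laurent_coeff[OF p] laurent_coeff[OF q] by blast
  show "p \<oplus>\<^bsub>laurent R N\<^esub> q = q \<oplus>\<^bsub>laurent R N\<^esub> p"
    using laurent_coeff[OF p] laurent_coeff[OF q] by (simp add: laurent_simps a_comm)
  fix r assume r: "r \<in> carrier (laurent R N)"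
  show "p \<oplus>\<^bsub>laurent R N\<^esub> q \<oplus>\<^bsub>laurent R N\<^esub> r = p \<oplus>\<^bsub>laurent R N\<^esub> (q \<oplus>\<^bsub>laurent R N\<^esub> r)"
    using laurent_coeff[OF p] laurent_coeff[OF q] laurent_coeff[OF r] by (simp add: laurent_simps a_assoc)
next
  show "\<zero>\<^bsub>laurent R N\<^esub> \<in> carrier (laurent R N)" by (simp add: laurent_simps support_def)
qed

lemma laurent_monomial_closed:
  assumes "a \<in> carrier R" "u \<in> exponents N"
  shows "laurent_monomial R a u \<in> carrier (laurent R N)"
proof -
  have "support R (laurent_monomial R a u) \<subseteq> {u}" by (auto simp: support_def laurent_monomial_def)
  then show ?thesis
    using assms finite_subset[of _ "{u}"] by (auto simp: laurent_simps laurent_monomial_def)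
qed

lemma laurent_monomial_mult:
  assumes a: "a \<in> carrier R" "u \<in> exponents N" and p: "p \<in> carrier (laurent R N)"
  shows "laurent_monomial R a u \<otimes>\<^bsub>laurent R N\<^esub> p = (\<lambda>e. a \<otimes> p (\<lambda>k. e k - u k))"
proof
  fix e
  have "(laurent_monomial R a u \<otimes>\<^bsub>laurent R N\<^esub> p) e
      = (\<Oplus>w\<in>{u}. laurent_monomial R a u w \<otimes> p (\<lambda>k. e k - w k))"
    by (rule laurent_mult_superset[OF laurent_monomial_closed[OF a] p]) (auto simp: support_def laurent_monomial_def)
  then show "(laurent_monomial R a u \<otimes>\<^bsub>laurent R N\<^esub> p) e = a \<otimes> p (\<lambda>k. e k - u k)"
    using a laurent_coeff[OF p] by (simp add: laurent_monomial_def)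
qed

lemma laurent_mult_support:
  assumes p: "p \<in> carrier (laurent R N)" and q: "q \<in> carrier (laurent R N)"
  shows "support R (p \<otimes>\<^bsub>laurent R N\<^esub> q) \<subseteq> (\<lambda>(u, w) k. u k + w k) ` (support R p \<times> support R q)"
proof
  fix e assume e: "e \<in> support R (p \<otimes>\<^bsub>laurent R N\<^esub> q)"
  have "\<exists>u\<in>support R p. q (\<lambda>k. e k - u k) \<noteq> \<zero>"
  proof (rule ccontr)
    assume "\<not> ?thesis"
    then have "(p \<otimes>\<^bsub>laurent R N\<^esub> q) e = \<zero>"
      unfolding laurent_simps using laurent_coeff[OF p] by (intro finsum_zero_eqI) auto
    then show False using e by (simp add: support_def)
  qed
  then obtain u where u: "u \<in> support R p" "(\<lambda>k. e k - u k) \<in> support R q" by (auto simp: support_def)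
  then show "e \<in> (\<lambda>(u, w) k. u k + w k) ` (support R p \<times> support R q)"
    by (intro image_eqI[of _ _ "(u, \<lambda>k. e k - u k)"]) auto
qed

lemma laurent_mult_closed:
  assumes p: "p \<in> carrier (laurent R N)" and q: "q \<in> carrier (laurent R N)"
  shows "p \<otimes>\<^bsub>laurent R N\<^esub> q \<in> carrier (laurent R N)"
proof -
  have fin: "finite ((\<lambda>(u, w) k. u k + w k) ` (support R p \<times> support R q))"
    using p q by (simp add: laurent_simps)
  have exp: "(\<lambda>(u, w) k. u k + w k) ` (support R p \<times> support R q) \<subseteq> exponents N"
    using p q unfolding laurent_simps exponents_def by fastforce
  have "(p \<otimes>\<^bsub>laurent R N\<^esub> q) e \<in> carrier R" for e
    unfolding laurent_simps(5) using laurent_coeff[OF p] laurent_coeff[OF q] by (intro finsum_closed) auto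
  then show ?thesis
    unfolding laurent_simps(1)
    using finite_subset[OF laurent_mult_support[OF p q] fin] subset_trans[OF laurent_mult_support[OF p q] exp] by blast
qed

lemma ring_laurent: "ring (laurent R N)"
proof (rule ringI)
  show "abelian_group (laurent R N)" by (rule abelian_group_laurent)
  have zero_exp: "(\<lambda>k. 0) \<in> exponents N" by (simp add: exponents_def)
  show "Group.monoid (laurent R N)"
  proof (rule monoidI)
    show "\<one>\<^bsub>laurent R N\<^esub> \<in> carrier (laurent R N)"
      unfolding laurent_simps(4) using zero_exp by (intro laurent_monomial_closed) simp_all
    fix p assume p: "p \<in> carrier (laurent R N)"
    show "\<one>\<^bsub>laurent R N\<^esub> \<otimes>\<^bsub>laurent R N\<^esub> p = p"
      unfolding laurent_simps(4) using laurent_coeff[OF p] by (simp add: laurent_monomial_mult[OF one_closed zero_exp p])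
    show "p \<otimes>\<^bsub>laurent R N\<^esub> \<one>\<^bsub>laurent R N\<^esub> = p"
    proof
      fix e
      have "(p \<otimes>\<^bsub>laurent R N\<^esub> \<one>\<^bsub>laurent R N\<^esub>) e = (\<Oplus>u\<in>insert e (support R p). p u \<otimes> \<one>\<^bsub>laurent R N\<^esub> (\<lambda>k. e k - u k))"
        using p by (intro laurent_mult_superset)
          (auto simp: laurent_simps(4) laurent_simps(1)[of p] intro!: laurent_monomial_closed zero_exp)
      also have "\<dots> = (\<Oplus>u\<in>insert e (support R p). if u = e then p u else \<zero>)"
      proof (rule finsum_cong'[OF refl])
        fix u
        have "(\<lambda>k. e k - u k) = (\<lambda>k. 0) \<longleftrightarrow> u = e" by (auto simp: fun_eq_iff)
        then show "p u \<otimes> \<one>\<^bsub>laurent R N\<^esub> (\<lambda>k. e k - u k) = (if u = e then p u else \<zero>)"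
          using laurent_coeff[OF p] by (simp add: laurent_simps(4) laurent_monomial_def)
      qed (use laurent_coeff[OF p] in auto)
      also have "\<dots> = p e"
        using p laurent_coeff[OF p] finsum_delta[of "insert e (support R p)" e p] by (simp add: laurent_simps(1))
      finally show "(p \<otimes>\<^bsub>laurent R N\<^esub> \<one>\<^bsub>laurent R N\<^esub>) e = p e" .
    qed
    fix q assume q: "q \<in> carrier (laurent R N)"
    show "p \<otimes>\<^bsub>laurent R N\<^esub> q \<in> carrier (laurent R N)" by (rule laurent_mult_closed[OF p q])
    fix r assume r: "r \<in> carrier (laurent R N)"
    note [simp] = laurent_coeff[OF p] laurent_coeff[OF q] laurent_coeff[OF r]
    let ?P = "support R p" and ?Q = "support R q"
    \<comment> \<open>All sums of an exponent of p and one of q. Cancellation and zero divisors may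
      make the support of the product smaller; over this larger fixed set the two summations can be
      exchanged.\<close>
    let ?W = "(\<lambda>(u, w) k. u k + w k) ` (?P \<times> ?Q)"
    have fin: "finite ?P" "finite ?Q" "finite ?W" using p q by (simp_all add: laurent_simps(1))
    show "p \<otimes>\<^bsub>laurent R N\<^esub> q \<otimes>\<^bsub>laurent R N\<^esub> r = p \<otimes>\<^bsub>laurent R N\<^esub> (q \<otimes>\<^bsub>laurent R N\<^esub> r)"
    proof
      fix e
      have "(p \<otimes>\<^bsub>laurent R N\<^esub> q \<otimes>\<^bsub>laurent R N\<^esub> r) e
          = (\<Oplus>w\<in>?W. (p \<otimes>\<^bsub>laurent R N\<^esub> q) w \<otimes> r (\<lambda>k. e k - w k))"
        by (rule laurent_mult_superset[OF laurent_mult_closed[OF p q] r fin(3) laurent_mult_support[OF p q]])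
      also have "\<dots> = (\<Oplus>w\<in>?W. \<Oplus>u\<in>?P. p u \<otimes> (q (\<lambda>k. w k - u k) \<otimes> r (\<lambda>k. e k - w k)))"
      proof (rule finsum_cong'[OF refl])
        fix w
        have "(p \<otimes>\<^bsub>laurent R N\<^esub> q) w \<otimes> r (\<lambda>k. e k - w k) = (\<Oplus>u\<in>?P. p u \<otimes> q (\<lambda>k. w k - u k) \<otimes> r (\<lambda>k. e k - w k))"
          unfolding laurent_simps(5) using fin by (intro finsum_ldistr) auto
        also have "\<dots> = (\<Oplus>u\<in>?P. p u \<otimes> (q (\<lambda>k. w k - u k) \<otimes> r (\<lambda>k. e k - w k)))"
          by (rule finsum_cong'[OF refl]) (auto simp: m_assoc)
        finally show "(p \<otimes>\<^bsub>laurent R N\<^esub> q) w \<otimes> r (\<lambda>k. e k - w k) = \<dots>" .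
      qed (auto intro!: finsum_closed)
      also have "\<dots> = (\<Oplus>u\<in>?P. \<Oplus>w\<in>?W. p u \<otimes> (q (\<lambda>k. w k - u k) \<otimes> r (\<lambda>k. e k - w k)))"
        using fin by (intro finsum_swap) auto
      also have "\<dots> = (\<Oplus>u\<in>?P. p u \<otimes> (q \<otimes>\<^bsub>laurent R N\<^esub> r) (\<lambda>k. e k - u k))"
      proof (rule finsum_cong'[OF refl])
        show "(\<lambda>u. p u \<otimes> (q \<otimes>\<^bsub>laurent R N\<^esub> r) (\<lambda>k. e k - u k)) \<in> ?P \<rightarrow> carrier R"
          using laurent_coeff[OF laurent_mult_closed[OF q r]] by simp
        fix u assume u: "u \<in> ?P"
        \<comment> \<open>Substitution of u plus an exponent of q: for fixed u only these exponents
          contribute, and translation by u is injective.\<close>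
        let ?t = "\<lambda>w k. u k + w k"
        have "(\<Oplus>w\<in>?W. p u \<otimes> (q (\<lambda>k. w k - u k) \<otimes> r (\<lambda>k. e k - w k)))
            = (\<Oplus>w\<in>?t ` ?Q. p u \<otimes> (q (\<lambda>k. w k - u k) \<otimes> r (\<lambda>k. e k - w k)))"
        proof (rule add.finprod_mono_neutral_cong_right[OF fin(3)])
          show "?t ` ?Q \<subseteq> ?W" using u by auto
          fix w assume w: "w \<in> ?W - ?t ` ?Q"
          have "w \<in> ?t ` ?Q" if "(\<lambda>k. w k - u k) \<in> ?Q"
            by (rule image_eqI[OF _ that]) auto
          then have "(\<lambda>k. w k - u k) \<notin> ?Q" using w by blast
          then show "p u \<otimes> (q (\<lambda>k. w k - u k) \<otimes> r (\<lambda>k. e k - w k)) = \<zero>" by (simp add: support_def)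
        qed auto
        also have "\<dots> = (\<Oplus>w\<in>?Q. p u \<otimes> (q (\<lambda>k. ?t w k - u k) \<otimes> r (\<lambda>k. e k - ?t w k)))"
          by (rule finsum_reindex) (auto simp: inj_on_def fun_eq_iff)
        also have "\<dots> = (\<Oplus>w\<in>?Q. p u \<otimes> (q w \<otimes> r (\<lambda>k. (e k - u k) - w k)))"
          by (simp add: diff_diff_eq)
        also have "\<dots> = p u \<otimes> (\<Oplus>w\<in>?Q. q w \<otimes> r (\<lambda>k. (e k - u k) - w k))"
          using fin by (intro finsum_rdistr[symmetric]) auto
        finally show "(\<Oplus>w\<in>?W. p u \<otimes> (q (\<lambda>k. w k - u k) \<otimes> r (\<lambda>k. e k - w k)))
            = p u \<otimes> (q \<otimes>\<^bsub>laurent R N\<^esub> r) (\<lambda>k. e k - u k)"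
          by (simp add: laurent_simps(5))
      qed
      also have "\<dots> = (p \<otimes>\<^bsub>laurent R N\<^esub> (q \<otimes>\<^bsub>laurent R N\<^esub> r)) e"
        by (simp only: laurent_simps(5)[where p = p])
      finally show "(p \<otimes>\<^bsub>laurent R N\<^esub> q \<otimes>\<^bsub>laurent R N\<^esub> r) e = (p \<otimes>\<^bsub>laurent R N\<^esub> (q \<otimes>\<^bsub>laurent R N\<^esub> r)) e" .
    qed
  qed
  fix p q r
  assume p: "p \<in> carrier (laurent R N)" and q: "q \<in> carrier (laurent R N)" and r: "r \<in> carrier (laurent R N)"
  note [simp] = laurent_coeff[OF p] laurent_coeff[OF q] laurent_coeff[OF r]
  have sum: "p \<oplus>\<^bsub>laurent R N\<^esub> q \<in> carrier (laurent R N)"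
    by (rule abelian_groupE(1)[OF abelian_group_laurent p q])
  show "(p \<oplus>\<^bsub>laurent R N\<^esub> q) \<otimes>\<^bsub>laurent R N\<^esub> r = p \<otimes>\<^bsub>laurent R N\<^esub> r \<oplus>\<^bsub>laurent R N\<^esub> q \<otimes>\<^bsub>laurent R N\<^esub> r"
  proof
    fix e
    let ?E = "support R p \<union> support R q"
    have E: "finite ?E" using p q by (simp add: laurent_simps(1))
    have "support R (p \<oplus>\<^bsub>laurent R N\<^esub> q) \<subseteq> ?E" by (auto simp: support_def laurent_simps(2))
    then have "((p \<oplus>\<^bsub>laurent R N\<^esub> q) \<otimes>\<^bsub>laurent R N\<^esub> r) e = (\<Oplus>u\<in>?E. (p u \<oplus> q u) \<otimes> r (\<lambda>k. e k - u k))"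
      using laurent_mult_superset[OF sum r E] by (simp add: laurent_simps(2))
    also have "\<dots> = (\<Oplus>u\<in>?E. p u \<otimes> r (\<lambda>k. e k - u k) \<oplus> q u \<otimes> r (\<lambda>k. e k - u k))"
      by (rule finsum_cong'[OF refl]) (auto simp: l_distr)
    also have "\<dots> = (\<Oplus>u\<in>?E. p u \<otimes> r (\<lambda>k. e k - u k)) \<oplus> (\<Oplus>u\<in>?E. q u \<otimes> r (\<lambda>k. e k - u k))"
      by (rule finsum_addf) auto
    also have "\<dots> = (p \<otimes>\<^bsub>laurent R N\<^esub> r) e \<oplus> (q \<otimes>\<^bsub>laurent R N\<^esub> r) e"
      using laurent_mult_superset[OF p r E] laurent_mult_superset[OF q r E] by simp
    finally show "((p \<oplus>\<^bsub>laurent R N\<^esub> q) \<otimes>\<^bsub>laurent R N\<^esub> r) e = (p \<otimes>\<^bsub>laurent R N\<^esub> r \<oplus>\<^bsub>laurent R N\<^esub> q \<otimes>\<^bsub>laurent R N\<^esub> r) e"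
      by (simp only: laurent_simps(2))
  qed
  show "r \<otimes>\<^bsub>laurent R N\<^esub> (p \<oplus>\<^bsub>laurent R N\<^esub> q) = r \<otimes>\<^bsub>laurent R N\<^esub> p \<oplus>\<^bsub>laurent R N\<^esub> r \<otimes>\<^bsub>laurent R N\<^esub> q"
  proof
    fix e
    have "(r \<otimes>\<^bsub>laurent R N\<^esub> (p \<oplus>\<^bsub>laurent R N\<^esub> q)) e
        = (\<Oplus>u\<in>support R r. r u \<otimes> p (\<lambda>k. e k - u k) \<oplus> r u \<otimes> q (\<lambda>k. e k - u k))"
      unfolding laurent_simps(2,5) by (rule finsum_cong'[OF refl]) (auto simp: r_distr)
    also have "\<dots> = (r \<otimes>\<^bsub>laurent R N\<^esub> p) e \<oplus> (r \<otimes>\<^bsub>laurent R N\<^esub> q) e"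
      unfolding laurent_simps(5) by (rule finsum_addf) auto
    finally show "(r \<otimes>\<^bsub>laurent R N\<^esub> (p \<oplus>\<^bsub>laurent R N\<^esub> q)) e = (r \<otimes>\<^bsub>laurent R N\<^esub> p \<oplus>\<^bsub>laurent R N\<^esub> r \<otimes>\<^bsub>laurent R N\<^esub> q) e"
      by (simp only: laurent_simps(2))
  qed
qed

lemma laurent_const_closed: "a \<in> carrier R \<Longrightarrow> laurent_const R a \<in> carrier (laurent R N)"
  unfolding laurent_const_monomial by (rule laurent_monomial_closed) (simp_all add: exponents_def)

lemma laurent_const_mult:
  "a \<in> carrier R \<Longrightarrow> p \<in> carrier (laurent R N) \<Longrightarrow> laurent_const R a \<otimes>\<^bsub>laurent R N\<^esub> p = (\<lambda>e. a \<otimes> p e)"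
  unfolding laurent_const_monomial by (subst laurent_monomial_mult) (simp_all add: exponents_def)

lemma laurent_const_hom:
  assumes "a \<in> carrier R" "b \<in> carrier R"
  shows "laurent_const R (a \<oplus> b) = laurent_const R a \<oplus>\<^bsub>laurent R N\<^esub> laurent_const R b"
    "laurent_const R (a \<otimes> b) = laurent_const R a \<otimes>\<^bsub>laurent R N\<^esub> laurent_const R b"
    "laurent_const R \<one> = \<one>\<^bsub>laurent R N\<^esub>"
proof -
  show "laurent_const R (a \<oplus> b) = laurent_const R a \<oplus>\<^bsub>laurent R N\<^esub> laurent_const R b"
    by (auto simp: laurent_const_def laurent_simps(2))
  show "laurent_const R (a \<otimes> b) = laurent_const R a \<otimes>\<^bsub>laurent R N\<^esub> laurent_const R b"
    unfolding laurent_const_mult[OF assms(1) laurent_const_closed[OF assms(2)]]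
    using assms by (auto simp: laurent_const_def)
  show "laurent_const R \<one> = \<one>\<^bsub>laurent R N\<^esub>" by (simp add: laurent_simps laurent_const_monomial)
qed

lemma laurent_var_closed: "k \<in> N \<Longrightarrow> laurent_var R k \<in> carrier (laurent R N)"
  unfolding laurent_var_monomial by (rule laurent_monomial_closed) (auto simp: exponents_def)

lemma laurent_var_mult:
  "k \<in> N \<Longrightarrow> p \<in> carrier (laurent R N) \<Longrightarrow>
    laurent_var R k \<otimes>\<^bsub>laurent R N\<^esub> p = (\<lambda>e. p (\<lambda>i. e i - (if i = k then 1 else 0)))"
  unfolding laurent_var_monomial
  by (subst laurent_monomial_mult) (auto simp: exponents_def laurent_coeff)

lemma laurent_var_commute:
  assumes "j \<in> N" "k \<in> N" "p \<in> carrier (laurent R N)"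
  shows "laurent_var R j \<otimes>\<^bsub>laurent R N\<^esub> (laurent_var R k \<otimes>\<^bsub>laurent R N\<^esub> p)
    = laurent_var R k \<otimes>\<^bsub>laurent R N\<^esub> (laurent_var R j \<otimes>\<^bsub>laurent R N\<^esub> p)"
  using laurent_var_mult[OF assms(1) laurent_mult_closed[OF laurent_var_closed[OF assms(2)] assms(3)]]
    laurent_var_mult[OF assms(2) laurent_mult_closed[OF laurent_var_closed[OF assms(1)] assms(3)]]
    laurent_var_mult[OF assms(1,3)] laurent_var_mult[OF assms(2,3)]
  by (simp add: algebra_simps)

text \<open>The variables are central although R need not be commutative. This makes left
  multiplication by a variable respect the relations of the tensor product over R.\<close>

lemma laurent_var_const:
  assumes "k \<in> N" "a \<in> carrier R" "p \<in> carrier (laurent R N)"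
  shows "laurent_var R k \<otimes>\<^bsub>laurent R N\<^esub> (laurent_const R a \<otimes>\<^bsub>laurent R N\<^esub> p)
    = laurent_const R a \<otimes>\<^bsub>laurent R N\<^esub> (laurent_var R k \<otimes>\<^bsub>laurent R N\<^esub> p)"
  using laurent_var_mult[OF assms(1) laurent_mult_closed[OF laurent_const_closed[OF assms(2)] assms(3)]]
    laurent_const_mult[OF assms(2) laurent_mult_closed[OF laurent_var_closed[OF assms(1)] assms(3)]]
    laurent_var_mult[OF assms(1,3)] laurent_const_mult[OF assms(2,3)]
  by simp

text \<open>The set E may exceed the support, so that several polynomials can be expanded over the
  same exponents.\<close>

lemma laurent_decompose:
  assumes p: "p \<in> carrier (laurent R N)" and E: "finite E" "support R p \<subseteq> E" "E \<subseteq> exponents N"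
  shows "p = (\<Oplus>\<^bsub>laurent R N\<^esub>e\<in>E. laurent_monomial R (p e) e)"
proof
  fix u
  have hom: "abelian_group_hom (laurent R N) R (\<lambda>p. p u)"
    by (rule abelian_group_homI[OF abelian_group_laurent abelian_group_axioms]) (simp_all add: laurent_coeff laurent_simps(2))
  have "(\<Oplus>\<^bsub>laurent R N\<^esub>e\<in>E. laurent_monomial R (p e) e) u = (\<Oplus>e\<in>E. laurent_monomial R (p e) e u)"
    by (rule abelian_group_hom.hom_finsum[OF hom])
      (use E laurent_coeff[OF p] in \<open>auto intro!: laurent_monomial_closed\<close>)
  also have "\<dots> = (\<Oplus>e\<in>insert u E. if e = u then p e else \<zero>)"
    by (rule add.finprod_mono_neutral_cong) (use E laurent_coeff[OF p] in \<open>auto simp: laurent_monomial_def support_def\<close>)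
  also have "\<dots> = p u" using E laurent_coeff[OF p] by (intro finsum_delta) auto
  finally show "p u = (\<Oplus>\<^bsub>laurent R N\<^esub>e\<in>E. laurent_monomial R (p e) e) u" by simp
qed

end

section \<open>Extension of scalars\<close>

definition tensor_class ::
  "('r, 'x) ring_scheme \<Rightarrow> ('l, 'y) ring_scheme \<Rightarrow> ('r \<Rightarrow> 'l) \<Rightarrow> ('r, 'm) module
    \<Rightarrow> ('m \<times> 'l \<Rightarrow>\<^sub>0 int) \<Rightarrow> ('m \<times> 'l \<Rightarrow>\<^sub>0 int) set" where
  "tensor_class R L \<iota> M z = (\<lambda>t. t + z) ` tensor_relations R L \<iota> M"

definition pure_tensor ::
  "('r, 'x) ring_scheme \<Rightarrow> ('l, 'y) ring_scheme \<Rightarrow> ('r \<Rightarrow> 'l) \<Rightarrow> ('r, 'm) module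
    \<Rightarrow> 'm \<Rightarrow> 'l \<Rightarrow> ('m \<times> 'l \<Rightarrow>\<^sub>0 int) set" where
  "pure_tensor R L \<iota> M m p = tensor_class R L \<iota> M (frag_of (m, p))"

text \<open>Stated for an abstract ring L under R, so that the arguments about tensor products never
  look inside Laurent polynomials.\<close>

locale scalar_extension = R: ring R + L: ring L
  for R :: "('r, 'x) ring_scheme" and L :: "('l, 'y) ring_scheme" +
  fixes \<iota> :: "'r \<Rightarrow> 'l"
  assumes \<iota>_closed: "a \<in> carrier R \<Longrightarrow> \<iota> a \<in> carrier L"
    and \<iota>_add: "a \<in> carrier R \<Longrightarrow> b \<in> carrier R \<Longrightarrow> \<iota> (a \<oplus>\<^bsub>R\<^esub> b) = \<iota> a \<oplus>\<^bsub>L\<^esub> \<iota> b"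
    and \<iota>_mult: "a \<in> carrier R \<Longrightarrow> b \<in> carrier R \<Longrightarrow> \<iota> (a \<otimes>\<^bsub>R\<^esub> b) = \<iota> a \<otimes>\<^bsub>L\<^esub> \<iota> b"
begin

abbreviation "rel \<equiv> tensor_relations R L \<iota>"
abbreviation "cls \<equiv> tensor_class R L \<iota>"
abbreviation "pure \<equiv> pure_tensor R L \<iota>"
abbreviation "tens \<equiv> tensor R L \<iota>"

section \<open>The tensor product as an abelian group and its universal property\<close>

context
  fixes M :: "('r, 'm) module"
  assumes M: "right_module R M"
begin

interpretation M: right_module R M by (rule M)

definition generators :: "('m \<times> 'l \<Rightarrow>\<^sub>0 int) set" where
  "generators =
    {frag_of (x \<oplus>\<^bsub>M\<^esub> y, p) - frag_of (x, p) - frag_of (y, p) |x y p.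
        x \<in> carrier M \<and> y \<in> carrier M \<and> p \<in> carrier L}
   \<union> {frag_of (x, p \<oplus>\<^bsub>L\<^esub> q) - frag_of (x, p) - frag_of (x, q) |x p q.
        x \<in> carrier M \<and> p \<in> carrier L \<and> q \<in> carrier L}
   \<union> {frag_of (a \<odot>\<^bsub>M\<^esub> x, p) - frag_of (x, \<iota> a \<otimes>\<^bsub>L\<^esub> p) |x a p.
        x \<in> carrier M \<and> a \<in> carrier R \<and> p \<in> carrier L}"

lemma rel_generate: "rel M = generate (tensor_free L M) generators"
  by (simp add: tensor_relations_def generators_def)

lemma free_comm_group: "comm_group (tensor_free L M)" "Group.group (tensor_free L M)"
  by (simp_all add: tensor_free_def abelian_free_Abelian_group)

lemma free_simps:
  "z \<in> carrier (tensor_free L M) \<longleftrightarrow> Poly_Mapping.keys z \<subseteq> carrier M \<times> carrier L"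
  "z \<otimes>\<^bsub>tensor_free L M\<^esub> w = z + w" "\<one>\<^bsub>tensor_free L M\<^esub> = 0"
  "z \<in> carrier (tensor_free L M) \<Longrightarrow> m_inv (tensor_free L M) z = - z"
  by (simp_all add: tensor_free_def)

lemma free_closed:
  "z \<in> carrier (tensor_free L M) \<Longrightarrow> w \<in> carrier (tensor_free L M) \<Longrightarrow> z + w \<in> carrier (tensor_free L M)"
  "z \<in> carrier (tensor_free L M) \<Longrightarrow> w \<in> carrier (tensor_free L M) \<Longrightarrow> z - w \<in> carrier (tensor_free L M)"
  "z \<in> carrier (tensor_free L M) \<Longrightarrow> - z \<in> carrier (tensor_free L M)"
  "m \<in> carrier M \<Longrightarrow> p \<in> carrier L \<Longrightarrow> frag_of (m, p) \<in> carrier (tensor_free L M)"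
  "0 \<in> carrier (tensor_free L M)"
  using keys_add[of z w] keys_diff[of z w] unfolding free_simps by auto

lemma generators_closed: "generators \<subseteq> carrier (tensor_free L M)"
  unfolding generators_def
  by (auto intro!: free_closed M.smult_closed \<iota>_closed simp del: frag_of_in_free_Abelian_group)

lemma rel_subgroup: "subgroup (rel M) (tensor_free L M)"
  unfolding rel_generate by (rule group.generate_is_subgroup[OF free_comm_group(2) generators_closed])

lemma rel_closed:
  "t \<in> rel M \<Longrightarrow> t \<in> carrier (tensor_free L M)"
  "t \<in> rel M \<Longrightarrow> s \<in> rel M \<Longrightarrow> t + s \<in> rel M"
  "t \<in> rel M \<Longrightarrow> - t \<in> rel M"
  "0 \<in> rel M"
proof -
  show 1: "t \<in> rel M \<Longrightarrow> t \<in> carrier (tensor_free L M)" for t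
    using subgroup.subset[OF rel_subgroup] by blast
  show "t \<in> rel M \<Longrightarrow> s \<in> rel M \<Longrightarrow> t + s \<in> rel M"
    using subgroup.m_closed[OF rel_subgroup] unfolding free_simps .
  show "t \<in> rel M \<Longrightarrow> - t \<in> rel M"
    using subgroup.m_inv_closed[OF rel_subgroup] free_simps(4) 1 by metis
  show "0 \<in> rel M" using subgroup.one_closed[OF rel_subgroup] unfolding free_simps .
qed

lemma generators_rel: "z \<in> generators \<Longrightarrow> z \<in> rel M"
  unfolding rel_generate by (rule generate.incl)

lemma rel_subset: "generators \<subseteq> H \<Longrightarrow> subgroup H (tensor_free L M) \<Longrightarrow> rel M \<subseteq> H"
  unfolding rel_generate by (rule group.generate_subgroup_incl[OF free_comm_group(2)])

lemma cls_eqI: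
  assumes "z - w \<in> rel M"
  shows "cls M z = cls M w"
proof -
  have sub: "cls M z \<subseteq> cls M w" if "z - w \<in> rel M" for z w
  proof
    fix u assume "u \<in> cls M z"
    then obtain t where t: "t \<in> rel M" "u = t + z" by (auto simp: tensor_class_def)
    have "u = (t + (z - w)) + w" using t by simp
    then show "u \<in> cls M w" unfolding tensor_class_def using rel_closed(2)[OF t(1) that] by (rule image_eqI)
  qed
  have "w - z \<in> rel M" using rel_closed(3)[OF assms] by simp
  then show ?thesis using sub[OF assms] sub[of w z] by auto
qed

lemma carrier_tens: "carrier (tens M) = cls M ` carrier (tensor_free L M)"
  by (auto simp: tensor_def Let_def FactGroup_def RCOSETS_def r_coset_def tensor_class_def tensor_free_def)

lemma zero_tens: "\<zero>\<^bsub>tens M\<^esub> = cls M 0"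
  by (simp add: tensor_def Let_def FactGroup_def tensor_class_def)

lemma add_tens: "cls M z \<oplus>\<^bsub>tens M\<^esub> cls M w = cls M (z + w)"
proof -
  have "cls M z \<oplus>\<^bsub>tens M\<^esub> cls M w = (\<Union>t\<in>rel M. \<Union>s\<in>rel M. {(t + z) + (s + w)})"
    by (auto simp: tensor_def Let_def FactGroup_def set_mult_def tensor_class_def tensor_free_def)
  also have "\<dots> = cls M (z + w)"
  proof (rule equalityI)
    show "(\<Union>t\<in>rel M. \<Union>s\<in>rel M. {(t + z) + (s + w)}) \<subseteq> cls M (z + w)"
    proof
      fix u assume "u \<in> (\<Union>t\<in>rel M. \<Union>s\<in>rel M. {(t + z) + (s + w)})"
      then obtain t s where ts: "t \<in> rel M" "s \<in> rel M" "u = (t + z) + (s + w)" by blast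
      then have "u = (t + s) + (z + w)" by (simp add: ac_simps)
      then show "u \<in> cls M (z + w)" unfolding tensor_class_def using rel_closed(2)[OF ts(1,2)] by (rule image_eqI)
    qed
    show "cls M (z + w) \<subseteq> (\<Union>t\<in>rel M. \<Union>s\<in>rel M. {(t + z) + (s + w)})"
    proof
      fix u assume "u \<in> cls M (z + w)"
      then obtain t where t: "t \<in> rel M" "u = t + (z + w)" by (auto simp: tensor_class_def)
      then have "u = (t + z) + (0 + w)" by (simp add: ac_simps)
      then show "u \<in> (\<Union>t\<in>rel M. \<Union>s\<in>rel M. {(t + z) + (s + w)})" using t(1) rel_closed(4) by blast
    qed
  qed
  finally show ?thesis .
qed

lemma abelian_group_tens: "abelian_group (tens M)"
proof (rule abelian_groupI)
  fix X assume "X \<in> carrier (tens M)"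
  then obtain z where z: "z \<in> carrier (tensor_free L M)" "X = cls M z" by (auto simp: carrier_tens)
  show "\<exists>Y\<in>carrier (tens M). Y \<oplus>\<^bsub>tens M\<^esub> X = \<zero>\<^bsub>tens M\<^esub>"
    unfolding z(2) carrier_tens using free_closed(3)[OF z(1)]
    by (intro bexI[of _ "cls M (- z)"] imageI) (simp_all add: add_tens zero_tens)
  show "\<zero>\<^bsub>tens M\<^esub> \<oplus>\<^bsub>tens M\<^esub> X = X" unfolding z(2) zero_tens add_tens by simp
  fix Y assume "Y \<in> carrier (tens M)"
  then obtain w where w: "w \<in> carrier (tensor_free L M)" "Y = cls M w" by (auto simp: carrier_tens)
  show "X \<oplus>\<^bsub>tens M\<^esub> Y \<in> carrier (tens M)"
    unfolding z(2) w(2) add_tens carrier_tens using free_closed(1)[OF z(1) w(1)] by (rule imageI)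
  show "X \<oplus>\<^bsub>tens M\<^esub> Y = Y \<oplus>\<^bsub>tens M\<^esub> X" unfolding z(2) w(2) add_tens by (simp add: add.commute)
  fix V assume "V \<in> carrier (tens M)"
  then obtain v where v: "v \<in> carrier (tensor_free L M)" "V = cls M v" by (auto simp: carrier_tens)
  show "X \<oplus>\<^bsub>tens M\<^esub> Y \<oplus>\<^bsub>tens M\<^esub> V = X \<oplus>\<^bsub>tens M\<^esub> (Y \<oplus>\<^bsub>tens M\<^esub> V)"
    unfolding z(2) w(2) v(2) add_tens by (simp add: add.assoc)
next
  show "\<zero>\<^bsub>tens M\<^esub> \<in> carrier (tens M)" unfolding zero_tens carrier_tens using free_closed(5) by (rule imageI)
qed

lemma minus_tens:
  assumes "z \<in> carrier (tensor_free L M)" "w \<in> carrier (tensor_free L M)"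
  shows "cls M z \<ominus>\<^bsub>tens M\<^esub> cls M w = cls M (z - w)"
proof -
  interpret T: abelian_group "tens M" by (rule abelian_group_tens)
  have mem: "cls M w \<in> carrier (tens M)" "cls M (- w) \<in> carrier (tens M)"
    unfolding carrier_tens using assms free_closed(3) by blast+
  have "cls M (- w) \<oplus>\<^bsub>tens M\<^esub> cls M w = \<zero>\<^bsub>tens M\<^esub>" by (simp add: add_tens zero_tens)
  then have "\<ominus>\<^bsub>tens M\<^esub> cls M w = cls M (- w)" using mem T.minus_equality by blast
  then show ?thesis by (simp add: a_minus_def add_tens)
qed

lemma pure_closed: "m \<in> carrier M \<Longrightarrow> p \<in> carrier L \<Longrightarrow> pure M m p \<in> carrier (tens M)"
  unfolding pure_tensor_def carrier_tens by (intro imageI free_closed)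

lemma pure_add_left:
  assumes "x \<in> carrier M" "y \<in> carrier M" "p \<in> carrier L"
  shows "pure M (x \<oplus>\<^bsub>M\<^esub> y) p = pure M x p \<oplus>\<^bsub>tens M\<^esub> pure M y p"
  unfolding pure_tensor_def add_tens
proof (intro cls_eqI generators_rel)
  have "frag_of (x \<oplus>\<^bsub>M\<^esub> y, p) - (frag_of (x, p) + frag_of (y, p)) = frag_of (x \<oplus>\<^bsub>M\<^esub> y, p) - frag_of (x, p) - frag_of (y, p)"
    by simp
  then show "frag_of (x \<oplus>\<^bsub>M\<^esub> y, p) - (frag_of (x, p) + frag_of (y, p)) \<in> generators"
    unfolding generators_def using assms by blast
qed

lemma pure_add_right:
  assumes "x \<in> carrier M" "p \<in> carrier L" "q \<in> carrier L"
  shows "pure M x (p \<oplus>\<^bsub>L\<^esub> q) = pure M x p \<oplus>\<^bsub>tens M\<^esub> pure M x q"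
  unfolding pure_tensor_def add_tens
proof (intro cls_eqI generators_rel)
  have "frag_of (x, p \<oplus>\<^bsub>L\<^esub> q) - (frag_of (x, p) + frag_of (x, q)) = frag_of (x, p \<oplus>\<^bsub>L\<^esub> q) - frag_of (x, p) - frag_of (x, q)"
    by simp
  then show "frag_of (x, p \<oplus>\<^bsub>L\<^esub> q) - (frag_of (x, p) + frag_of (x, q)) \<in> generators"
    unfolding generators_def using assms by blast
qed

lemma pure_balanced:
  assumes "x \<in> carrier M" "a \<in> carrier R" "p \<in> carrier L"
  shows "pure M (a \<odot>\<^bsub>M\<^esub> x) p = pure M x (\<iota> a \<otimes>\<^bsub>L\<^esub> p)"
  unfolding pure_tensor_def
  by (intro cls_eqI generators_rel) (use assms in \<open>auto simp: generators_def\<close>)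

lemma pure_left_hom: "p \<in> carrier L \<Longrightarrow> abelian_group_hom M (tens M) (\<lambda>m. pure M m p)"
  by (rule abelian_group_homI[OF M.M.abelian_group_axioms abelian_group_tens]) (simp_all add: pure_closed pure_add_left)

lemma pure_right_hom: "m \<in> carrier M \<Longrightarrow> abelian_group_hom L (tens M) (pure M m)"
  by (rule abelian_group_homI[OF L.abelian_group_axioms abelian_group_tens]) (simp_all add: pure_closed pure_add_right)

text \<open>Lifts the induction principle of free abelian groups to the quotient; differences take
  care of sums and negatives at once.\<close>

lemma tens_induct:
  assumes X: "X \<in> carrier (tens M)" and zero: "P \<zero>\<^bsub>tens M\<^esub>"
    and minus: "\<And>X Y. X \<in> carrier (tens M) \<Longrightarrow> Y \<in> carrier (tens M) \<Longrightarrow> P X \<Longrightarrow> P Y \<Longrightarrow> P (X \<ominus>\<^bsub>tens M\<^esub> Y)"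
    and pure: "\<And>m p. m \<in> carrier M \<Longrightarrow> p \<in> carrier L \<Longrightarrow> P (pure M m p)"
  shows "P X"
proof -
  obtain z where z: "z \<in> carrier (tensor_free L M)" "X = cls M z" using X by (auto simp: carrier_tens)
  have "P (cls M z)"
  proof (rule free_Abelian_group_induct[where P = "\<lambda>z. P (cls M z)", OF z(1)[unfolded free_simps(1)]])
    show "P (cls M 0)" using zero by (simp add: zero_tens)
    fix x y :: "'m \<times> 'l \<Rightarrow>\<^sub>0 int"
    assume xy: "Poly_Mapping.keys x \<subseteq> carrier M \<times> carrier L" "Poly_Mapping.keys y \<subseteq> carrier M \<times> carrier L"
      "P (cls M x)" "P (cls M y)"
    then have c: "x \<in> carrier (tensor_free L M)" "y \<in> carrier (tensor_free L M)" by (simp_all add: free_simps)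
    then show "P (cls M (x - y))"
      using minus[of "cls M x" "cls M y"] xy(3,4) unfolding minus_tens[OF c] carrier_tens by blast
  next
    fix a assume "a \<in> carrier M \<times> carrier L"
    then show "P (cls M (frag_of a))" using pure unfolding pure_tensor_def by (cases a) auto
  qed
  then show ?thesis by (simp add: z(2))
qed

lemma tens_hom_eqI:
  assumes f: "abelian_group_hom (tens M) K f" and g: "abelian_group_hom (tens M) K g"
    and eq: "\<And>m p. m \<in> carrier M \<Longrightarrow> p \<in> carrier L \<Longrightarrow> f (pure M m p) = g (pure M m p)"
    and X: "X \<in> carrier (tens M)"
  shows "f X = g X"
proof (rule tens_induct[where P = "\<lambda>X. f X = g X", OF X])
  show "f \<zero>\<^bsub>tens M\<^esub> = g \<zero>\<^bsub>tens M\<^esub>"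
    using abelian_group_hom.hom_zero[OF f] abelian_group_hom.hom_zero[OF g] by simp
  fix X Y assume X: "X \<in> carrier (tens M)" "Y \<in> carrier (tens M)" "f X = g X" "f Y = g Y"
  show "f (X \<ominus>\<^bsub>tens M\<^esub> Y) = g (X \<ominus>\<^bsub>tens M\<^esub> Y)"
    using abelian_group_hom.hom_minus[OF f X(1,2)] abelian_group_hom.hom_minus[OF g X(1,2)] X(3,4) by simp
qed (rule eq)

text \<open>Extend f to the free abelian group. Its kernel is a subgroup that contains the
  generating relations, hence all of them, and the extension descends to cosets.\<close>

lemma tens_universal:
  assumes K: "abelian_group K"
    and cl: "\<And>m p. m \<in> carrier M \<Longrightarrow> p \<in> carrier L \<Longrightarrow> f m p \<in> carrier K"
    and left: "\<And>x y p. x \<in> carrier M \<Longrightarrow> y \<in> carrier M \<Longrightarrow> p \<in> carrier L \<Longrightarrow> f (x \<oplus>\<^bsub>M\<^esub> y) p = f x p \<oplus>\<^bsub>K\<^esub> f y p"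
    and right: "\<And>x p q. x \<in> carrier M \<Longrightarrow> p \<in> carrier L \<Longrightarrow> q \<in> carrier L \<Longrightarrow> f x (p \<oplus>\<^bsub>L\<^esub> q) = f x p \<oplus>\<^bsub>K\<^esub> f x q"
    and bal: "\<And>x a p. x \<in> carrier M \<Longrightarrow> a \<in> carrier R \<Longrightarrow> p \<in> carrier L \<Longrightarrow> f (a \<odot>\<^bsub>M\<^esub> x) p = f x (\<iota> a \<otimes>\<^bsub>L\<^esub> p)"
  shows "\<exists>F. abelian_group_hom (tens M) K F \<and> (\<forall>m\<in>carrier M. \<forall>p\<in>carrier L. F (pure M m p) = f m p)"
proof -
  interpret K: abelian_group K by (rule K)
  have img: "(\<lambda>(m, p). f m p) ` (carrier M \<times> carrier L) \<subseteq> carrier (add_monoid K)" using cl by auto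
  obtain h where h: "h \<in> hom (tensor_free L M) (add_monoid K)"
    and hf: "\<And>z. z \<in> carrier M \<times> carrier L \<Longrightarrow> h (frag_of z) = (case z of (m, p) \<Rightarrow> f m p)"
    using comm_group.free_Abelian_group_universal[OF K.a_comm_group img] unfolding tensor_free_def by blast
  interpret h: group_hom "tensor_free L M" "add_monoid K" h
    using h free_comm_group(2) K.a_group by (simp add: group_hom_def group_hom_axioms_def)
  have hcl: "h z \<in> carrier K" if "z \<in> carrier (tensor_free L M)" for z using h.hom_closed[OF that] by simp
  have hadd: "h (z + w) = h z \<oplus>\<^bsub>K\<^esub> h w" if "z \<in> carrier (tensor_free L M)" "w \<in> carrier (tensor_free L M)" for z w
    using h.hom_mult[OF that] by (simp add: free_simps)
  have hneg: "h (- z) = \<ominus>\<^bsub>K\<^esub> h z" if "z \<in> carrier (tensor_free L M)" for z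
    using h.hom_inv[OF that] free_simps(4)[OF that] by (simp add: a_inv_def)
  have hdiff: "h (z - w) = h z \<ominus>\<^bsub>K\<^esub> h w" if "z \<in> carrier (tensor_free L M)" "w \<in> carrier (tensor_free L M)" for z w
    using hadd[OF that(1) free_closed(3)[OF that(2)]] hneg[OF that(2)] by (simp add: a_minus_def)
  have hpure: "h (frag_of (m, p)) = f m p" if "m \<in> carrier M" "p \<in> carrier L" for m p
    using hf[of "(m, p)"] that by simp
  have cancel: "(u \<oplus>\<^bsub>K\<^esub> v) \<ominus>\<^bsub>K\<^esub> u \<ominus>\<^bsub>K\<^esub> v = \<zero>\<^bsub>K\<^esub>" if "u \<in> carrier K" "v \<in> carrier K" for u v
  proof -
    have "(u \<oplus>\<^bsub>K\<^esub> v) \<ominus>\<^bsub>K\<^esub> u \<ominus>\<^bsub>K\<^esub> v = (u \<oplus>\<^bsub>K\<^esub> v) \<oplus>\<^bsub>K\<^esub> \<ominus>\<^bsub>K\<^esub> (u \<oplus>\<^bsub>K\<^esub> v)"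
      using that by (simp add: a_minus_def K.minus_add K.a_assoc)
    then show ?thesis using that by (simp add: K.r_neg)
  qed
  have "generators \<subseteq> kernel (tensor_free L M) (add_monoid K) h"
  proof
    fix z assume z: "z \<in> generators"
    then have "z \<in> carrier (tensor_free L M)" using generators_closed by blast
    moreover have "h z = \<zero>\<^bsub>K\<^esub>"
      using z unfolding generators_def
    proof (elim UnE CollectE exE conjE)
      fix x y p assume z: "z = frag_of (x \<oplus>\<^bsub>M\<^esub> y, p) - frag_of (x, p) - frag_of (y, p)"
        and c: "x \<in> carrier M" "y \<in> carrier M" "p \<in> carrier L"
      have xy: "x \<oplus>\<^bsub>M\<^esub> y \<in> carrier M" using c by simp
      note fr = free_closed(4)[OF xy c(3)] free_closed(4)[OF c(1,3)] free_closed(4)[OF c(2,3)]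
      show "h z = \<zero>\<^bsub>K\<^esub>"
        unfolding z hdiff[OF free_closed(2)[OF fr(1,2)] fr(3)] hdiff[OF fr(1,2)]
          hpure[OF xy c(3)] hpure[OF c(1,3)] hpure[OF c(2,3)] left[OF c]
        by (rule cancel[OF cl[OF c(1,3)] cl[OF c(2,3)]])
    next
      fix x p q assume z: "z = frag_of (x, p \<oplus>\<^bsub>L\<^esub> q) - frag_of (x, p) - frag_of (x, q)"
        and c: "x \<in> carrier M" "p \<in> carrier L" "q \<in> carrier L"
      have pq: "p \<oplus>\<^bsub>L\<^esub> q \<in> carrier L" using c by simp
      note fr = free_closed(4)[OF c(1) pq] free_closed(4)[OF c(1,2)] free_closed(4)[OF c(1,3)]
      show "h z = \<zero>\<^bsub>K\<^esub>"
        unfolding z hdiff[OF free_closed(2)[OF fr(1,2)] fr(3)] hdiff[OF fr(1,2)]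
          hpure[OF c(1) pq] hpure[OF c(1,2)] hpure[OF c(1,3)] right[OF c]
        by (rule cancel[OF cl[OF c(1,2)] cl[OF c(1,3)]])
    next
      fix x a p assume z: "z = frag_of (a \<odot>\<^bsub>M\<^esub> x, p) - frag_of (x, \<iota> a \<otimes>\<^bsub>L\<^esub> p)"
        and c: "x \<in> carrier M" "a \<in> carrier R" "p \<in> carrier L"
      have ax: "a \<odot>\<^bsub>M\<^esub> x \<in> carrier M" and ap: "\<iota> a \<otimes>\<^bsub>L\<^esub> p \<in> carrier L"
        using c by (simp_all add: M.smult_closed \<iota>_closed)
      note fr = free_closed(4)[OF ax c(3)] free_closed(4)[OF c(1) ap]
      show "h z = \<zero>\<^bsub>K\<^esub>"
        unfolding z hdiff[OF fr] hpure[OF ax c(3)] hpure[OF c(1) ap] bal[OF c]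
        using cl[OF c(1) ap] by (simp add: a_minus_def K.r_neg)
    qed
    ultimately show "z \<in> kernel (tensor_free L M) (add_monoid K) h" by (simp add: kernel_def)
  qed
  then have ker: "h t = \<zero>\<^bsub>K\<^esub>" if "t \<in> rel M" for t
    using rel_subset[OF _ h.subgroup_kernel] that by (auto simp: kernel_def)
  \<comment> \<open>The extension h is constant on each coset, so its image there is a
    singleton.\<close>
  define F where "F X = the_elem (h ` X)" for X
  have Fcls: "F (cls M z) = h z" if z: "z \<in> carrier (tensor_free L M)" for z
  proof -
    have eq: "h (t + z) = h z" if "t \<in> rel M" for t
      using hadd[OF rel_closed(1)[OF that] z] ker[OF that] hcl[OF z] by simp
    have "h ` cls M z = {h z}"
    proof (rule equalityI)
      show "h ` cls M z \<subseteq> {h z}" using eq by (auto simp: tensor_class_def)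
      have "0 + z \<in> cls M z" unfolding tensor_class_def using rel_closed(4) by (rule imageI)
      then show "{h z} \<subseteq> h ` cls M z" by auto
    qed
    then show ?thesis by (simp add: F_def)
  qed
  have "abelian_group_hom (tens M) K F"
  proof (rule abelian_group_homI[OF abelian_group_tens K])
    fix X assume "X \<in> carrier (tens M)"
    then obtain z where z: "z \<in> carrier (tensor_free L M)" "X = cls M z" by (auto simp: carrier_tens)
    show "F X \<in> carrier K" unfolding z(2) Fcls[OF z(1)] by (rule hcl[OF z(1)])
    fix Y assume "Y \<in> carrier (tens M)"
    then obtain w where w: "w \<in> carrier (tensor_free L M)" "Y = cls M w" by (auto simp: carrier_tens)
    show "F (X \<oplus>\<^bsub>tens M\<^esub> Y) = F X \<oplus>\<^bsub>K\<^esub> F Y"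
      unfolding z(2) w(2) add_tens Fcls[OF z(1)] Fcls[OF w(1)] Fcls[OF free_closed(1)[OF z(1) w(1)]]
      by (rule hadd[OF z(1) w(1)])
  qed
  moreover have "F (pure M m p) = f m p" if "m \<in> carrier M" "p \<in> carrier L" for m p
    unfolding pure_tensor_def Fcls[OF free_closed(4)[OF that]] by (rule hpure[OF that])
  ultimately show ?thesis by blast
qed

end

text \<open>The map on free groups takes generating relations to generating relations: additivity of
  \<phi> and \<psi> handles the first two kinds, linearity of \<phi> together with \<psi>\<iota> the
  balancing relation. As with cohomology, adding all relations of the target completes the image of
  a coset to a coset.\<close>

lemma tensor_map_pure_hom:
  assumes \<phi>: "linear_map R M M' \<phi>" and \<psi>: "abelian_group_hom L L \<psi>"
    and \<psi>\<iota>: "\<And>a p. a \<in> carrier R \<Longrightarrow> p \<in> carrier L \<Longrightarrow> \<psi> (\<iota> a \<otimes>\<^bsub>L\<^esub> p) = \<iota> a \<otimes>\<^bsub>L\<^esub> \<psi> p"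
  shows "abelian_group_hom (tens M) (tens M') (tensor_map R L \<iota> M' \<phi> \<psi>)"
    "m \<in> carrier M \<Longrightarrow> p \<in> carrier L \<Longrightarrow> tensor_map R L \<iota> M' \<phi> \<psi> (pure M m p) = pure M' (\<phi> m) (\<psi> p)"
proof -
  have M: "right_module R M" and M': "right_module R M'" using \<phi> by (auto dest: linear_map_modules)
  let ?g = "frag_extend (\<lambda>(x, p). frag_of (\<phi> x, \<psi> p))"
  note \<psi>cl = abelian_group_hom.hom_closed[OF \<psi>]
  have gcl: "?g z \<in> carrier (tensor_free L M')" if z: "z \<in> carrier (tensor_free L M)" for z
  proof -
    have "Poly_Mapping.keys (?g z) \<subseteq> (\<Union>x\<in>Poly_Mapping.keys z. Poly_Mapping.keys (case x of (x, p) \<Rightarrow> frag_of (\<phi> x, \<psi> p)))"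
      by (rule keys_frag_extend)
    also have "\<dots> \<subseteq> carrier M' \<times> carrier L"
    proof (rule UN_least)
      fix x assume "x \<in> Poly_Mapping.keys z"
      then obtain m p where x: "x = (m, p)" "m \<in> carrier M" "p \<in> carrier L"
        using z unfolding free_simps(1)[OF M] by blast
      then show "Poly_Mapping.keys (case x of (x, p) \<Rightarrow> frag_of (\<phi> x, \<psi> p)) \<subseteq> carrier M' \<times> carrier L"
        using linear_map_closed[OF \<phi> x(2)] \<psi>cl[OF x(3)] by simp
    qed
    finally show ?thesis unfolding free_simps(1)[OF M'] .
  qed
  \<comment> \<open>The elements that are sent to relations form a subgroup, so it is enough to test
    generators.\<close>
  have sub: "subgroup {z \<in> carrier (tensor_free L M). ?g z \<in> rel M'} (tensor_free L M)"
  proof (rule group.subgroupI[OF free_comm_group(2)[OF M]])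
    show "{z \<in> carrier (tensor_free L M). ?g z \<in> rel M'} \<noteq> {}"
      using free_closed(5)[OF M] rel_closed(4)[OF M'] by force
  qed (auto simp: free_simps(2,4)[OF M] frag_extend_add frag_extend_minus intro: rel_closed(2,3)[OF M'] free_closed(1,3)[OF M])
  have "generators M \<subseteq> {z \<in> carrier (tensor_free L M). ?g z \<in> rel M'}"
  proof
    fix z assume z: "z \<in> generators M"
    have "?g z \<in> generators M'"
      using z unfolding generators_def[OF M]
    proof (elim UnE CollectE exE conjE)
      fix x y p assume "z = frag_of (x \<oplus>\<^bsub>M\<^esub> y, p) - frag_of (x, p) - frag_of (y, p)"
        and c: "x \<in> carrier M" "y \<in> carrier M" "p \<in> carrier L"
      then have "?g z = frag_of (\<phi> x \<oplus>\<^bsub>M'\<^esub> \<phi> y, \<psi> p) - frag_of (\<phi> x, \<psi> p) - frag_of (\<phi> y, \<psi> p)"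
        by (simp add: frag_extend_diff linear_map_add[OF \<phi>])
      then show ?thesis
        unfolding generators_def[OF M'] using linear_map_closed[OF \<phi> c(1)] linear_map_closed[OF \<phi> c(2)] \<psi>cl[OF c(3)] by blast
    next
      fix x p q assume "z = frag_of (x, p \<oplus>\<^bsub>L\<^esub> q) - frag_of (x, p) - frag_of (x, q)"
        and c: "x \<in> carrier M" "p \<in> carrier L" "q \<in> carrier L"
      then have "?g z = frag_of (\<phi> x, \<psi> p \<oplus>\<^bsub>L\<^esub> \<psi> q) - frag_of (\<phi> x, \<psi> p) - frag_of (\<phi> x, \<psi> q)"
        by (simp add: frag_extend_diff abelian_group_hom.hom_add[OF \<psi>])
      then show ?thesis
        unfolding generators_def[OF M'] using linear_map_closed[OF \<phi> c(1)] \<psi>cl[OF c(2)] \<psi>cl[OF c(3)] by blast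
    next
      fix x a p assume "z = frag_of (a \<odot>\<^bsub>M\<^esub> x, p) - frag_of (x, \<iota> a \<otimes>\<^bsub>L\<^esub> p)"
        and c: "x \<in> carrier M" "a \<in> carrier R" "p \<in> carrier L"
      then have "?g z = frag_of (a \<odot>\<^bsub>M'\<^esub> \<phi> x, \<psi> p) - frag_of (\<phi> x, \<iota> a \<otimes>\<^bsub>L\<^esub> \<psi> p)"
        by (simp add: frag_extend_diff linear_map_smult[OF \<phi>] \<psi>\<iota>)
      then show ?thesis
        unfolding generators_def[OF M'] using linear_map_closed[OF \<phi> c(1)] c(2) \<psi>cl[OF c(3)] by blast
    qed
    then show "z \<in> {z \<in> carrier (tensor_free L M). ?g z \<in> rel M'}"
      using generators_rel[OF M'] generators_closed[OF M] z by blast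
  qed
  from rel_subset[OF M this sub] have grel: "?g t \<in> rel M'" if "t \<in> rel M" for t using that by blast
  have Tcls: "tensor_map R L \<iota> M' \<phi> \<psi> (cls M z) = cls M' (?g z)" for z
  proof -
    have "tensor_map R L \<iota> M' \<phi> \<psi> (cls M z) = (\<Union>s\<in>rel M'. \<Union>t\<in>rel M. {s + ?g (t + z)})"
      by (auto simp: tensor_map_def set_mult_def tensor_class_def free_simps[OF M'])
    also have "\<dots> = cls M' (?g z)"
    proof (rule equalityI)
      show "(\<Union>s\<in>rel M'. \<Union>t\<in>rel M. {s + ?g (t + z)}) \<subseteq> cls M' (?g z)"
      proof
        fix u assume "u \<in> (\<Union>s\<in>rel M'. \<Union>t\<in>rel M. {s + ?g (t + z)})"
        then obtain s t where st: "s \<in> rel M'" "t \<in> rel M" "u = s + ?g (t + z)" by blast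
        then have "u = (s + ?g t) + ?g z" by (simp add: frag_extend_add add.assoc)
        then show "u \<in> cls M' (?g z)"
          unfolding tensor_class_def using rel_closed(2)[OF M' st(1) grel[OF st(2)]] by (rule image_eqI)
      qed
      show "cls M' (?g z) \<subseteq> (\<Union>s\<in>rel M'. \<Union>t\<in>rel M. {s + ?g (t + z)})"
      proof
        fix u assume "u \<in> cls M' (?g z)"
        then obtain s where s: "s \<in> rel M'" "u = s + ?g z" by (auto simp: tensor_class_def)
        then have "u = s + ?g (0 + z)" by simp
        then show "u \<in> (\<Union>s\<in>rel M'. \<Union>t\<in>rel M. {s + ?g (t + z)})" using s(1) rel_closed(4)[OF M] by blast
      qed
    qed
    finally show ?thesis .
  qed
  show "abelian_group_hom (tens M) (tens M') (tensor_map R L \<iota> M' \<phi> \<psi>)"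
  proof (rule abelian_group_homI[OF abelian_group_tens[OF M] abelian_group_tens[OF M']])
    fix X assume "X \<in> carrier (tens M)"
    then obtain z where z: "z \<in> carrier (tensor_free L M)" "X = cls M z" by (auto simp: carrier_tens[OF M])
    show "tensor_map R L \<iota> M' \<phi> \<psi> X \<in> carrier (tens M')"
      unfolding z(2) Tcls carrier_tens[OF M'] by (rule imageI[OF gcl[OF z(1)]])
    fix Y assume "Y \<in> carrier (tens M)"
    then obtain w where w: "w \<in> carrier (tensor_free L M)" "Y = cls M w" by (auto simp: carrier_tens[OF M])
    show "tensor_map R L \<iota> M' \<phi> \<psi> (X \<oplus>\<^bsub>tens M\<^esub> Y) = tensor_map R L \<iota> M' \<phi> \<psi> X \<oplus>\<^bsub>tens M'\<^esub> tensor_map R L \<iota> M' \<phi> \<psi> Y"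
      unfolding z(2) w(2) add_tens[OF M] Tcls add_tens[OF M'] by (simp add: frag_extend_add)
  qed
  show "m \<in> carrier M \<Longrightarrow> p \<in> carrier L \<Longrightarrow> tensor_map R L \<iota> M' \<phi> \<psi> (pure M m p) = pure M' (\<phi> m) (\<psi> p)"
    unfolding pure_tensor_def Tcls by simp
qed

lemma right_mult_hom: "q \<in> carrier L \<Longrightarrow> abelian_group_hom L L (\<lambda>p. p \<otimes>\<^bsub>L\<^esub> q)"
  by (rule abelian_group_homI[OF L.abelian_group_axioms L.abelian_group_axioms]) (simp_all add: L.l_distr)

section \<open>The action of L on the tensor product\<close>

context
  fixes M :: "('r, 'm) module"
  assumes M: "right_module R M"
begin

interpretation M: right_module R M by (rule M)

lemma smult_tens: "q \<odot>\<^bsub>tens M\<^esub> X = tensor_map R L \<iota> M id (\<lambda>p. p \<otimes>\<^bsub>L\<^esub> q) X"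
  by (simp add: tensor_def Let_def)

lemma smult_tens_hom:
  assumes q: "q \<in> carrier L"
  shows "abelian_group_hom (tens M) (tens M) (\<lambda>X. q \<odot>\<^bsub>tens M\<^esub> X)"
    "m \<in> carrier M \<Longrightarrow> p \<in> carrier L \<Longrightarrow> q \<odot>\<^bsub>tens M\<^esub> pure M m p = pure M m (p \<otimes>\<^bsub>L\<^esub> q)"
proof -
  have id: "linear_map R M M id" using linear_map_ident[OF M] by (simp add: id_def)
  have assoc: "\<iota> a \<otimes>\<^bsub>L\<^esub> p \<otimes>\<^bsub>L\<^esub> q = \<iota> a \<otimes>\<^bsub>L\<^esub> (p \<otimes>\<^bsub>L\<^esub> q)" if "a \<in> carrier R" "p \<in> carrier L" for a p
    using that q by (simp add: L.m_assoc \<iota>_closed)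
  note h = tensor_map_pure_hom[OF id right_mult_hom[OF q] assoc]
  show "abelian_group_hom (tens M) (tens M) (\<lambda>X. q \<odot>\<^bsub>tens M\<^esub> X)"
    unfolding smult_tens using h(1) by simp
  show "m \<in> carrier M \<Longrightarrow> p \<in> carrier L \<Longrightarrow> q \<odot>\<^bsub>tens M\<^esub> pure M m p = pure M m (p \<otimes>\<^bsub>L\<^esub> q)"
    unfolding smult_tens using h(2) by simp
qed

text \<open>Each axiom about scalars is an equality of two additive maps in the tensor, so it is
  checked on pure tensors, where it is a law of L.\<close>

lemma right_module_tens: "right_module L (tens M)"
proof -
  interpret T: abelian_group "tens M" by (rule abelian_group_tens[OF M])
  note sm = smult_tens_hom
  have "right_module_axioms L (tens M)"
  proof
    fix a X assume a: "a \<in> carrier L" and X: "X \<in> carrier (tens M)"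
    show "a \<odot>\<^bsub>tens M\<^esub> X \<in> carrier (tens M)" using abelian_group_hom.hom_closed[OF sm(1)[OF a] X] .
    fix b assume b: "b \<in> carrier L"
    have ab: "a \<oplus>\<^bsub>L\<^esub> b \<in> carrier L" "a \<otimes>\<^bsub>L\<^esub> b \<in> carrier L" using a b by auto
    have sum: "abelian_group_hom (tens M) (tens M) (\<lambda>X. a \<odot>\<^bsub>tens M\<^esub> X \<oplus>\<^bsub>tens M\<^esub> b \<odot>\<^bsub>tens M\<^esub> X)"
      using abelian_group_hom.hom_closed[OF sm(1)[OF a]] abelian_group_hom.hom_closed[OF sm(1)[OF b]]
      by (intro abelian_group_homI[OF T.abelian_group_axioms T.abelian_group_axioms])
        (simp_all add: abelian_group_hom.hom_add[OF sm(1)[OF a]] abelian_group_hom.hom_add[OF sm(1)[OF b]] T.a_ac)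
    show "(a \<oplus>\<^bsub>L\<^esub> b) \<odot>\<^bsub>tens M\<^esub> X = a \<odot>\<^bsub>tens M\<^esub> X \<oplus>\<^bsub>tens M\<^esub> b \<odot>\<^bsub>tens M\<^esub> X"
      by (rule tens_hom_eqI[OF M sm(1)[OF ab(1)] sum _ X])
        (simp add: sm(2)[OF a] sm(2)[OF b] sm(2)[OF ab(1)] L.r_distr a b pure_add_right[OF M])
    show "(a \<otimes>\<^bsub>L\<^esub> b) \<odot>\<^bsub>tens M\<^esub> X = b \<odot>\<^bsub>tens M\<^esub> (a \<odot>\<^bsub>tens M\<^esub> X)"
      by (rule tens_hom_eqI[OF M sm(1)[OF ab(2)] abelian_group_hom_compose[OF sm(1)[OF a] sm(1)[OF b]] _ X])
        (simp add: sm(2)[OF a] sm(2)[OF b] sm(2)[OF ab(2)] L.m_assoc a b)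
  next
    fix a X Y assume a: "a \<in> carrier L" and X: "X \<in> carrier (tens M)" "Y \<in> carrier (tens M)"
    show "a \<odot>\<^bsub>tens M\<^esub> (X \<oplus>\<^bsub>tens M\<^esub> Y) = a \<odot>\<^bsub>tens M\<^esub> X \<oplus>\<^bsub>tens M\<^esub> a \<odot>\<^bsub>tens M\<^esub> Y"
      using abelian_group_hom.hom_add[OF sm(1)[OF a] X] .
  next
    fix X assume X: "X \<in> carrier (tens M)"
    have "abelian_group_hom (tens M) (tens M) (\<lambda>X. X)"
      by (rule abelian_group_homI[OF T.abelian_group_axioms T.abelian_group_axioms]) simp_all
    from tens_hom_eqI[OF M sm(1)[OF L.one_closed] this _ X]
    show "\<one>\<^bsub>L\<^esub> \<odot>\<^bsub>tens M\<^esub> X = X" by (simp add: sm(2)[OF L.one_closed])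
  qed
  then show ?thesis using L.ring_axioms T.abelian_group_axioms by (simp add: right_module_def)
qed

end

lemma tensor_map_linear:
  assumes \<phi>: "linear_map R M M' \<phi>" and \<psi>: "abelian_group_hom L L \<psi>"
    and \<psi>\<iota>: "\<And>a p. a \<in> carrier R \<Longrightarrow> p \<in> carrier L \<Longrightarrow> \<psi> (\<iota> a \<otimes>\<^bsub>L\<^esub> p) = \<iota> a \<otimes>\<^bsub>L\<^esub> \<psi> p"
    and \<psi>q: "\<And>p q. p \<in> carrier L \<Longrightarrow> q \<in> carrier L \<Longrightarrow> \<psi> (p \<otimes>\<^bsub>L\<^esub> q) = \<psi> p \<otimes>\<^bsub>L\<^esub> q"
  shows "linear_map L (tens M) (tens M') (tensor_map R L \<iota> M' \<phi> \<psi>)"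
proof -
  have M: "right_module R M" and M': "right_module R M'" using \<phi> by (auto dest: linear_map_modules)
  have h1: "abelian_group_hom (tens M) (tens M') (tensor_map R L \<iota> M' \<phi> \<psi>)"
    by (rule tensor_map_pure_hom(1)[OF \<phi> \<psi>]) (rule \<psi>\<iota>)
  have h2: "tensor_map R L \<iota> M' \<phi> \<psi> (pure M m p) = pure M' (\<phi> m) (\<psi> p)" if "m \<in> carrier M" "p \<in> carrier L" for m p
    by (rule tensor_map_pure_hom(2)[OF \<phi> \<psi> _ that]) (rule \<psi>\<iota>)
  show ?thesis
  proof (rule linear_mapI[OF right_module_tens[OF M] right_module_tens[OF M']])
    fix X assume X: "X \<in> carrier (tens M)"
    show "tensor_map R L \<iota> M' \<phi> \<psi> X \<in> carrier (tens M')" using abelian_group_hom.hom_closed[OF h1 X] .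
    show "tensor_map R L \<iota> M' \<phi> \<psi> (X \<oplus>\<^bsub>tens M\<^esub> Y) = tensor_map R L \<iota> M' \<phi> \<psi> X \<oplus>\<^bsub>tens M'\<^esub> tensor_map R L \<iota> M' \<phi> \<psi> Y"
      if "Y \<in> carrier (tens M)" for Y using abelian_group_hom.hom_add[OF h1 X that] .
    fix q assume q: "q \<in> carrier L"
    show "tensor_map R L \<iota> M' \<phi> \<psi> (q \<odot>\<^bsub>tens M\<^esub> X) = q \<odot>\<^bsub>tens M'\<^esub> tensor_map R L \<iota> M' \<phi> \<psi> X"
    proof (rule tens_hom_eqI[OF M abelian_group_hom_compose[OF smult_tens_hom(1)[OF M q] h1]
            abelian_group_hom_compose[OF h1 smult_tens_hom(1)[OF M' q]] _ X])
      fix m p assume m: "m \<in> carrier M" "p \<in> carrier L"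
      have pq: "p \<otimes>\<^bsub>L\<^esub> q \<in> carrier L" using m q by simp
      show "tensor_map R L \<iota> M' \<phi> \<psi> (q \<odot>\<^bsub>tens M\<^esub> pure M m p) = q \<odot>\<^bsub>tens M'\<^esub> tensor_map R L \<iota> M' \<phi> \<psi> (pure M m p)"
        unfolding smult_tens_hom(2)[OF M q m] h2[OF m] h2[OF m(1) pq] \<psi>q[OF m(2) q]
          smult_tens_hom(2)[OF M' q linear_map_closed[OF \<phi> m(1)] abelian_group_hom.hom_closed[OF \<psi> m(2)]] ..
    qed
  qed
qed

lemma tensor_map_id:
  assumes \<phi>: "linear_map R M M' \<phi>"
  shows "linear_map L (tens M) (tens M') (tensor_map R L \<iota> M' \<phi> id)"
    "m \<in> carrier M \<Longrightarrow> p \<in> carrier L \<Longrightarrow> tensor_map R L \<iota> M' \<phi> id (pure M m p) = pure M' (\<phi> m) p"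
proof -
  have id: "abelian_group_hom L L id"
    by (rule abelian_group_homI[OF L.abelian_group_axioms L.abelian_group_axioms]) simp_all
  show "linear_map L (tens M) (tens M') (tensor_map R L \<iota> M' \<phi> id)"
    by (rule tensor_map_linear[OF \<phi> id]) simp_all
  show "m \<in> carrier M \<Longrightarrow> p \<in> carrier L \<Longrightarrow> tensor_map R L \<iota> M' \<phi> id (pure M m p) = pure M' (\<phi> m) p"
    using tensor_map_pure_hom(2)[OF \<phi> id] by simp
qed

end

lemma (in ring) right_module_regular: "right_module R (regular_module R)"
proof -
  have "abelian_group (regular_module R)"
    by (rule abelian_groupI) (auto simp: regular_module_def a_ac intro: bexI[of _ "\<ominus> _"] l_neg)
  then show ?thesis
    using ring_axioms
    by (intro right_module.intro right_module_axioms.intro)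
      (auto simp: regular_module_def l_distr r_distr m_assoc)
qed

lemma (in ring) regular_module_simps:
  "carrier (regular_module R) = carrier R" "x \<oplus>\<^bsub>regular_module R\<^esub> y = x \<oplus> y"
  "\<zero>\<^bsub>regular_module R\<^esub> = \<zero>" "a \<odot>\<^bsub>regular_module R\<^esub> x = x \<otimes> a"
  by (simp_all add: regular_module_def)

text \<open>
  A linear map out of the extended module amounts to a linear map out of \<open>P\<close>, and the latter is
  lifted on the basis of a free module of which \<open>P\<close> is a summand.
\<close>

lemma (in scalar_extension) tens_lifts_along:
  fixes P :: "('r, 'p) module"
  assumes P: "projective_module R P" and g: "linear_map L A W g"
  shows "lifts_along L (tens P) A W g"
  unfolding lifts_along_def
proof (intro allI impI)
  fix \<phi> assume \<phi>: "linear_map L (tens P) W \<phi>" and img: "\<phi> ` carrier (tens P) \<subseteq> g ` carrier A"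
  have mP: "right_module R P" using P by (simp add: projective_module_def)
  interpret P: right_module R P by (rule mP)
  interpret A: right_module L A using g by (rule linear_map_modules)
  interpret W: right_module L W using g by (rule linear_map_modules)
  let ?F = "\<lambda>I :: 'p set. direct_sum I (\<lambda>_. regular_module R)"
  have mF: "right_module R (?F I)" for I
    by (rule right_module_direct_sum[OF R.ring_axioms R.right_module_regular])
  obtain I :: "'p set" and i r where ir: "i \<in> lin_hom R P (?F I)" "r \<in> lin_hom R (?F I) P" and ri: "\<And>x. x \<in> carrier P \<Longrightarrow> r (i x) = x"
    using P unfolding projective_module_def by blast
  have i: "linear_map R P (?F I) i" and r: "linear_map R (?F I) P r"
    using ir mF[of I] mP by (auto simp: linear_map_def)
  interpret F: right_module R "?F I" by (rule mF)
  \<comment> \<open>The basis of the free module. The images r (e j), together with the coordinates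
    of i, form a dual basis of P.\<close>
  define e where "e j = (\<lambda>k\<in>I. if k = j then \<one>\<^bsub>R\<^esub> else \<zero>\<^bsub>R\<^esub>)" for j
  have e: "e j \<in> carrier (?F I)" for j
    unfolding e_def by (rule restrict_in_direct_sum[where E = "{j}"]) (auto simp: R.regular_module_simps)
  have icl: "i x j \<in> carrier R" if "x \<in> carrier P" "j \<in> I" for x j
    using direct_sum_mem(1)[OF linear_map_closed[OF i that(1)] that(2)] by (simp add: R.regular_module_simps)
  have iadd: "i (x \<oplus>\<^bsub>P\<^esub> y) j = i x j \<oplus>\<^bsub>R\<^esub> i y j" if "x \<in> carrier P" "y \<in> carrier P" "j \<in> I" for x y j
    using linear_map_add[OF i that(1,2)] that(3) by (simp add: direct_sum_simps R.regular_module_simps)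
  have ismult: "i (a \<odot>\<^bsub>P\<^esub> x) j = i x j \<otimes>\<^bsub>R\<^esub> a" if "a \<in> carrier R" "x \<in> carrier P" "j \<in> I" for a x j
    using linear_map_smult[OF i that(1,2)] that(3) by (simp add: direct_sum_simps R.regular_module_simps)
  \<comment> \<open>The finitely many coordinates of x that are nonzero.\<close>
  define s where "s x = {j \<in> I. i x j \<noteq> \<zero>\<^bsub>R\<^esub>}" for x
  have fin: "finite (s x)" "s x \<subseteq> I" if "x \<in> carrier P" for x
    using direct_sum_mem(3)[OF linear_map_closed[OF i that]] by (auto simp: s_def R.regular_module_simps)
  have decompose: "x = (\<Oplus>\<^bsub>P\<^esub>j\<in>s x. i x j \<odot>\<^bsub>P\<^esub> r (e j))" if x: "x \<in> carrier P" for x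
  proof -
    have ej: "i x j \<odot>\<^bsub>?F I\<^esub> e j \<in> carrier (?F I)" if "j \<in> s x" for j
      using that fin[OF x] icl[OF x] e F.smult_closed by blast
    have "i x = (\<Oplus>\<^bsub>?F I\<^esub>j\<in>s x. i x j \<odot>\<^bsub>?F I\<^esub> e j)"
    proof (rule direct_sum_eqI[OF linear_map_closed[OF i x]])
      show "(\<Oplus>\<^bsub>?F I\<^esub>j\<in>s x. i x j \<odot>\<^bsub>?F I\<^esub> e j) \<in> carrier (?F I)" using ej by (intro F.M.finsum_closed) blast
      fix k assume k: "k \<in> I"
      have "linear_map R (?F I) (regular_module R) (\<lambda>v. v k)"
        by (rule linear_map_direct_sum_proj[where M = "\<lambda>_. regular_module R", OF R.ring_axioms R.right_module_regular k])
      then have "(\<Oplus>\<^bsub>?F I\<^esub>j\<in>s x. i x j \<odot>\<^bsub>?F I\<^esub> e j) k = (\<Oplus>\<^bsub>regular_module R\<^esub>j\<in>s x. (i x j \<odot>\<^bsub>?F I\<^esub> e j) k)"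
        by (rule linear_map_finsum) (use ej in blast)
      also have "\<dots> = (\<Oplus>\<^bsub>regular_module R\<^esub>j\<in>insert k (s x). if j = k then i x j else \<zero>\<^bsub>regular_module R\<^esub>)"
      proof -
        interpret reg: right_module R "regular_module R" by (rule R.right_module_regular)
        show ?thesis
        proof (rule reg.M.add.finprod_mono_neutral_cong)
          show "(i x j \<odot>\<^bsub>?F I\<^esub> e j) k = (if j = k then i x j else \<zero>\<^bsub>regular_module R\<^esub>)" if "j \<in> s x \<inter> insert k (s x)" for j
            using that k icl[OF x] fin(2)[OF x] by (auto simp: direct_sum_simps R.regular_module_simps e_def)
          show "(\<lambda>j. (i x j \<odot>\<^bsub>?F I\<^esub> e j) k) \<in> s x \<rightarrow> carrier (regular_module R)"
            using direct_sum_mem(1)[OF ej k] by auto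
          show "(\<lambda>j. if j = k then i x j else \<zero>\<^bsub>regular_module R\<^esub>) \<in> insert k (s x) \<rightarrow> carrier (regular_module R)"
            using icl[OF x k] by (auto simp: R.regular_module_simps)
          show "(if j = k then i x j else \<zero>\<^bsub>regular_module R\<^esub>) = \<zero>\<^bsub>regular_module R\<^esub>" if "j \<in> insert k (s x) - s x" for j
            using that k by (auto simp: s_def R.regular_module_simps)
        qed (use fin[OF x] in auto)
      qed
      also have "\<dots> = i x k"
        using abelian_group.finsum_delta[OF right_moduleD(1)[OF R.right_module_regular], of "insert k (s x)" k "i x"]
          fin[OF x] icl[OF x k] by (simp add: R.regular_module_simps)
      finally show "i x k = (\<Oplus>\<^bsub>?F I\<^esub>j\<in>s x. i x j \<odot>\<^bsub>?F I\<^esub> e j) k" by simp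
    qed
    then have "x = r (\<Oplus>\<^bsub>?F I\<^esub>j\<in>s x. i x j \<odot>\<^bsub>?F I\<^esub> e j)" using ri[OF x] by simp
    also have "\<dots> = (\<Oplus>\<^bsub>P\<^esub>j\<in>s x. r (i x j \<odot>\<^bsub>?F I\<^esub> e j))" by (rule linear_map_finsum[OF r]) (use ej in blast)
    also have "\<dots> = (\<Oplus>\<^bsub>P\<^esub>j\<in>s x. i x j \<odot>\<^bsub>P\<^esub> r (e j))"
    proof (rule P.M.finsum_cong'[OF refl])
      fix j assume "j \<in> s x"
      then have "i x j \<in> carrier R" using fin[OF x] icl[OF x] by blast
      then show "r (i x j \<odot>\<^bsub>?F I\<^esub> e j) = i x j \<odot>\<^bsub>P\<^esub> r (e j)" by (rule linear_map_smult[OF r _ e])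
    next
      show "(\<lambda>j. i x j \<odot>\<^bsub>P\<^esub> r (e j)) \<in> s x \<rightarrow> carrier P"
        using fin[OF x] icl[OF x] linear_map_closed[OF r e] P.smult_closed by blast
    qed
    finally show ?thesis .
  qed
  \<comment> \<open>The lift is forced up to choice: prescribe a preimage under g of the value at
    the tensor of r (e j) with 1, for every j.\<close>
  have "\<forall>j. \<exists>c. c \<in> carrier A \<and> g c = \<phi> (pure P (r (e j)) \<one>\<^bsub>L\<^esub>)"
  proof
    fix j
    have "pure P (r (e j)) \<one>\<^bsub>L\<^esub> \<in> carrier (tens P)"
      by (rule pure_closed[OF mP linear_map_closed[OF r e] L.one_closed])
    then have "\<phi> (pure P (r (e j)) \<one>\<^bsub>L\<^esub>) \<in> g ` carrier A" using img by blast
    then show "\<exists>c. c \<in> carrier A \<and> g c = \<phi> (pure P (r (e j)) \<one>\<^bsub>L\<^esub>)" by (metis imageE)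
  qed
  from choice[OF this] obtain c where c': "\<forall>j. c j \<in> carrier A \<and> g (c j) = \<phi> (pure P (r (e j)) \<one>\<^bsub>L\<^esub>)" ..
  have c: "c j \<in> carrier A" "g (c j) = \<phi> (pure P (r (e j)) \<one>\<^bsub>L\<^esub>)" for j using c' by blast+
  \<comment> \<open>The candidate on pure tensors, obtained by expanding x in the dual basis and
    moving the coordinates across the tensor sign.\<close>
  define f where "f x p = (\<Oplus>\<^bsub>A\<^esub>j\<in>s x. (\<iota> (i x j) \<otimes>\<^bsub>L\<^esub> p) \<odot>\<^bsub>A\<^esub> c j)" for x p
  have \<iota>hom: "abelian_group_hom R L \<iota>"
    by (rule abelian_group_homI[OF R.abelian_group_axioms L.abelian_group_axioms]) (simp_all add: \<iota>_closed \<iota>_add)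
  have summand: "(\<iota> (i x j) \<otimes>\<^bsub>L\<^esub> p) \<odot>\<^bsub>A\<^esub> c j \<in> carrier A" if "x \<in> carrier P" "p \<in> carrier L" "j \<in> I" for x p j
    by (rule A.smult_closed[OF L.m_closed[OF \<iota>_closed[OF icl[OF that(1,3)]] that(2)] c(1)])
  \<comment> \<open>The range of summation depends on x. Additivity in x needs a finite set that
    works for two elements and their sum.\<close>
  have super: "f x p = (\<Oplus>\<^bsub>A\<^esub>j\<in>E. (\<iota> (i x j) \<otimes>\<^bsub>L\<^esub> p) \<odot>\<^bsub>A\<^esub> c j)"
    if x: "x \<in> carrier P" and p: "p \<in> carrier L" and E: "finite E" "s x \<subseteq> E" "E \<subseteq> I" for x p E
    unfolding f_def
  proof (rule A.M.add.finprod_mono_neutral_cong_left[OF E(1,2)])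
    fix j assume j: "j \<in> E - s x"
    then have "i x j = \<zero>\<^bsub>R\<^esub>" using E by (auto simp: s_def)
    then show "(\<iota> (i x j) \<otimes>\<^bsub>L\<^esub> p) \<odot>\<^bsub>A\<^esub> c j = \<zero>\<^bsub>A\<^esub>"
      using abelian_group_hom.hom_zero[OF \<iota>hom] p abelian_group_hom.hom_zero[OF A.scalar_hom[OF c(1)]] by simp
  qed (use summand[OF x p] E in auto)
  have fcl: "f x p \<in> carrier A" if "x \<in> carrier P" "p \<in> carrier L" for x p
    unfolding f_def using summand[OF that] fin[OF that(1)] by (intro A.M.finsum_closed) blast
  have sum2: "(\<Oplus>\<^bsub>A\<^esub>j\<in>E. u j) \<oplus>\<^bsub>A\<^esub> (\<Oplus>\<^bsub>A\<^esub>j\<in>E. v j) = (\<Oplus>\<^bsub>A\<^esub>j\<in>E. w j)"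
    if "\<And>j. j \<in> E \<Longrightarrow> u j \<in> carrier A" "\<And>j. j \<in> E \<Longrightarrow> v j \<in> carrier A" "\<And>j. j \<in> E \<Longrightarrow> w j = u j \<oplus>\<^bsub>A\<^esub> v j"
    for E :: "'p set" and u v w
  proof -
    have "(\<Oplus>\<^bsub>A\<^esub>j\<in>E. u j) \<oplus>\<^bsub>A\<^esub> (\<Oplus>\<^bsub>A\<^esub>j\<in>E. v j) = (\<Oplus>\<^bsub>A\<^esub>j\<in>E. u j \<oplus>\<^bsub>A\<^esub> v j)"
      by (rule A.M.finsum_addf[symmetric]) (use that in auto)
    also have "\<dots> = (\<Oplus>\<^bsub>A\<^esub>j\<in>E. w j)" by (rule A.M.finsum_cong'[OF refl]) (use that in auto)
    finally show ?thesis .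
  qed
  have "\<exists>\<Psi>. abelian_group_hom (tens P) A \<Psi> \<and> (\<forall>m\<in>carrier P. \<forall>p\<in>carrier L. \<Psi> (pure P m p) = f m p)"
  proof (rule tens_universal[OF mP A.M.abelian_group_axioms fcl])
    fix x y p assume x: "x \<in> carrier P" and y: "y \<in> carrier P" and p: "p \<in> carrier L"
    let ?E = "s x \<union> s y"
    have xy: "x \<oplus>\<^bsub>P\<^esub> y \<in> carrier P" using x y by simp
    have E: "finite ?E" "?E \<subseteq> I" using fin[OF x] fin[OF y] by auto
    have "s (x \<oplus>\<^bsub>P\<^esub> y) \<subseteq> ?E"
    proof
      fix j assume j: "j \<in> s (x \<oplus>\<^bsub>P\<^esub> y)"
      then have "j \<in> I" "i x j \<oplus>\<^bsub>R\<^esub> i y j \<noteq> \<zero>\<^bsub>R\<^esub>" using iadd[OF x y] by (auto simp: s_def)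
      then show "j \<in> ?E" by (auto simp: s_def)
    qed
    note sxy = super[OF xy p E(1) this E(2)] and sx = super[OF x p E(1) _ E(2)] and sy = super[OF y p E(1) _ E(2)]
    show "f (x \<oplus>\<^bsub>P\<^esub> y) p = f x p \<oplus>\<^bsub>A\<^esub> f y p"
      unfolding sxy sx[OF Un_upper1] sy[OF Un_upper2]
    proof (rule sum2[symmetric])
      fix j assume "j \<in> ?E"
      then have j: "j \<in> I" using E by blast
      show "(\<iota> (i x j) \<otimes>\<^bsub>L\<^esub> p) \<odot>\<^bsub>A\<^esub> c j \<in> carrier A" "(\<iota> (i y j) \<otimes>\<^bsub>L\<^esub> p) \<odot>\<^bsub>A\<^esub> c j \<in> carrier A"
        using summand x y p j by blast+
      show "(\<iota> (i (x \<oplus>\<^bsub>P\<^esub> y) j) \<otimes>\<^bsub>L\<^esub> p) \<odot>\<^bsub>A\<^esub> c j = (\<iota> (i x j) \<otimes>\<^bsub>L\<^esub> p) \<odot>\<^bsub>A\<^esub> c j \<oplus>\<^bsub>A\<^esub> (\<iota> (i y j) \<otimes>\<^bsub>L\<^esub> p) \<odot>\<^bsub>A\<^esub> c j"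
        using icl[OF x j] icl[OF y j] p
        by (simp add: iadd[OF x y j] \<iota>_add L.l_distr \<iota>_closed A.smult_scalar_distr c(1))
    qed
  next
    fix x p q assume x: "x \<in> carrier P" and p: "p \<in> carrier L" and q: "q \<in> carrier L"
    show "f x (p \<oplus>\<^bsub>L\<^esub> q) = f x p \<oplus>\<^bsub>A\<^esub> f x q"
      unfolding f_def
    proof (rule sum2[symmetric])
      fix j assume "j \<in> s x"
      then have j: "j \<in> I" using fin[OF x] by blast
      show "(\<iota> (i x j) \<otimes>\<^bsub>L\<^esub> p) \<odot>\<^bsub>A\<^esub> c j \<in> carrier A" "(\<iota> (i x j) \<otimes>\<^bsub>L\<^esub> q) \<odot>\<^bsub>A\<^esub> c j \<in> carrier A"
        using summand x p q j by blast+
      show "(\<iota> (i x j) \<otimes>\<^bsub>L\<^esub> (p \<oplus>\<^bsub>L\<^esub> q)) \<odot>\<^bsub>A\<^esub> c j = (\<iota> (i x j) \<otimes>\<^bsub>L\<^esub> p) \<odot>\<^bsub>A\<^esub> c j \<oplus>\<^bsub>A\<^esub> (\<iota> (i x j) \<otimes>\<^bsub>L\<^esub> q) \<odot>\<^bsub>A\<^esub> c j"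
        using icl[OF x j] p q by (simp add: L.r_distr \<iota>_closed A.smult_scalar_distr c(1))
    qed
  next
    fix x a p assume x: "x \<in> carrier P" and a: "a \<in> carrier R" and p: "p \<in> carrier L"
    have ax: "a \<odot>\<^bsub>P\<^esub> x \<in> carrier P" using x a by (simp add: P.smult_closed)
    have "s (a \<odot>\<^bsub>P\<^esub> x) \<subseteq> s x" using ismult[OF a x] a by (auto simp: s_def)
    from super[OF ax p fin(1)[OF x] this fin(2)[OF x]]
    have "f (a \<odot>\<^bsub>P\<^esub> x) p = (\<Oplus>\<^bsub>A\<^esub>j\<in>s x. (\<iota> (i (a \<odot>\<^bsub>P\<^esub> x) j) \<otimes>\<^bsub>L\<^esub> p) \<odot>\<^bsub>A\<^esub> c j)" .
    also have "\<dots> = f x (\<iota> a \<otimes>\<^bsub>L\<^esub> p)"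
      unfolding f_def
    proof (rule A.M.finsum_cong'[OF refl])
      show "(\<lambda>j. (\<iota> (i x j) \<otimes>\<^bsub>L\<^esub> (\<iota> a \<otimes>\<^bsub>L\<^esub> p)) \<odot>\<^bsub>A\<^esub> c j) \<in> s x \<rightarrow> carrier A"
        using summand[OF x L.m_closed[OF \<iota>_closed[OF a] p]] fin[OF x] by blast
      fix j assume "j \<in> s x"
      then have j: "j \<in> I" using fin[OF x] by blast
      show "(\<iota> (i (a \<odot>\<^bsub>P\<^esub> x) j) \<otimes>\<^bsub>L\<^esub> p) \<odot>\<^bsub>A\<^esub> c j = (\<iota> (i x j) \<otimes>\<^bsub>L\<^esub> (\<iota> a \<otimes>\<^bsub>L\<^esub> p)) \<odot>\<^bsub>A\<^esub> c j"
        using icl[OF x j] a p by (simp add: ismult[OF a x j] \<iota>_mult L.m_assoc \<iota>_closed)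
    qed
    finally show "f (a \<odot>\<^bsub>P\<^esub> x) p = f x (\<iota> a \<otimes>\<^bsub>L\<^esub> p)" .
  qed
  then obtain \<Psi> where \<Psi>: "abelian_group_hom (tens P) A \<Psi>" and \<Psi>p: "\<And>m p. m \<in> carrier P \<Longrightarrow> p \<in> carrier L \<Longrightarrow> \<Psi> (pure P m p) = f m p"
    by blast
  have lin: "linear_map L (tens P) A \<Psi>"
  proof (rule linear_mapI[OF right_module_tens[OF mP] A.right_module_axioms])
    fix X assume X: "X \<in> carrier (tens P)"
    show "\<Psi> X \<in> carrier A" using abelian_group_hom.hom_closed[OF \<Psi> X] .
    show "\<Psi> (X \<oplus>\<^bsub>tens P\<^esub> Y) = \<Psi> X \<oplus>\<^bsub>A\<^esub> \<Psi> Y" if "Y \<in> carrier (tens P)" for Y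
      using abelian_group_hom.hom_add[OF \<Psi> X that] .
    fix q assume q: "q \<in> carrier L"
    show "\<Psi> (q \<odot>\<^bsub>tens P\<^esub> X) = q \<odot>\<^bsub>A\<^esub> \<Psi> X"
    proof (rule tens_hom_eqI[OF mP abelian_group_hom_compose[OF smult_tens_hom(1)[OF mP q] \<Psi>]
            abelian_group_hom_compose[OF \<Psi> A.smult_hom[OF q]] _ X])
      fix m p assume m: "m \<in> carrier P" and p: "p \<in> carrier L"
      have pq: "p \<otimes>\<^bsub>L\<^esub> q \<in> carrier L" using p q by simp
      have "\<Psi> (q \<odot>\<^bsub>tens P\<^esub> pure P m p) = f m (p \<otimes>\<^bsub>L\<^esub> q)"
        unfolding smult_tens_hom(2)[OF mP q m p] by (rule \<Psi>p[OF m pq])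
      also have "\<dots> = (\<Oplus>\<^bsub>A\<^esub>j\<in>s m. q \<odot>\<^bsub>A\<^esub> ((\<iota> (i m j) \<otimes>\<^bsub>L\<^esub> p) \<odot>\<^bsub>A\<^esub> c j))"
        unfolding f_def
      proof (rule A.M.finsum_cong'[OF refl])
        show "(\<lambda>j. q \<odot>\<^bsub>A\<^esub> ((\<iota> (i m j) \<otimes>\<^bsub>L\<^esub> p) \<odot>\<^bsub>A\<^esub> c j)) \<in> s m \<rightarrow> carrier A"
          using summand[OF m p] fin[OF m] A.smult_closed[OF q] by blast
        fix j assume "j \<in> s m"
        then have j: "j \<in> I" using fin[OF m] by blast
        show "(\<iota> (i m j) \<otimes>\<^bsub>L\<^esub> (p \<otimes>\<^bsub>L\<^esub> q)) \<odot>\<^bsub>A\<^esub> c j = q \<odot>\<^bsub>A\<^esub> ((\<iota> (i m j) \<otimes>\<^bsub>L\<^esub> p) \<odot>\<^bsub>A\<^esub> c j)"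
          using icl[OF m j] p q by (simp add: A.smult_assoc[symmetric] \<iota>_closed c(1) L.m_assoc)
      qed
      also have "\<dots> = q \<odot>\<^bsub>A\<^esub> f m p"
        unfolding f_def by (rule abelian_group_hom.hom_finsum[OF A.smult_hom[OF q], symmetric])
          (use summand[OF m p] fin[OF m] in blast)
      finally show "\<Psi> (q \<odot>\<^bsub>tens P\<^esub> pure P m p) = q \<odot>\<^bsub>A\<^esub> \<Psi> (pure P m p)"
        unfolding \<Psi>p[OF m p] .
    qed
  qed
  have "g (\<Psi> X) = \<phi> X" if X: "X \<in> carrier (tens P)" for X
  proof (rule tens_hom_eqI[OF mP abelian_group_hom_compose[OF \<Psi> linear_map_abelian_group_hom[OF g]]
        linear_map_abelian_group_hom[OF \<phi>] _ X])
    fix m p assume m: "m \<in> carrier P" and p: "p \<in> carrier L"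
    have b: "i m j \<odot>\<^bsub>P\<^esub> r (e j) \<in> carrier P" if "j \<in> I" for j
      by (rule P.smult_closed[OF icl[OF m that] linear_map_closed[OF r e]])
    have "g (\<Psi> (pure P m p)) = (\<Oplus>\<^bsub>W\<^esub>j\<in>s m. g ((\<iota> (i m j) \<otimes>\<^bsub>L\<^esub> p) \<odot>\<^bsub>A\<^esub> c j))"
      unfolding \<Psi>p[OF m p] f_def by (rule linear_map_finsum[OF g]) (use summand[OF m p] fin[OF m] in blast)
    also have "\<dots> = (\<Oplus>\<^bsub>W\<^esub>j\<in>s m. \<phi> (pure P (i m j \<odot>\<^bsub>P\<^esub> r (e j)) p))"
    proof (rule W.M.finsum_cong'[OF refl])
      show "(\<lambda>j. \<phi> (pure P (i m j \<odot>\<^bsub>P\<^esub> r (e j)) p)) \<in> s m \<rightarrow> carrier W"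
        using linear_map_closed[OF \<phi> pure_closed[OF mP b p]] fin[OF m] by blast
      fix j assume "j \<in> s m"
      then have j: "j \<in> I" using fin[OF m] by blast
      have q: "\<iota> (i m j) \<otimes>\<^bsub>L\<^esub> p \<in> carrier L" using icl[OF m j] p by (simp add: \<iota>_closed)
      note rej = linear_map_closed[OF r e[of j]]
      have "g ((\<iota> (i m j) \<otimes>\<^bsub>L\<^esub> p) \<odot>\<^bsub>A\<^esub> c j) = \<phi> ((\<iota> (i m j) \<otimes>\<^bsub>L\<^esub> p) \<odot>\<^bsub>tens P\<^esub> pure P (r (e j)) \<one>\<^bsub>L\<^esub>)"
        unfolding linear_map_smult[OF g q c(1)] c(2) linear_map_smult[OF \<phi> q pure_closed[OF mP rej L.one_closed]] ..
      also have "(\<iota> (i m j) \<otimes>\<^bsub>L\<^esub> p) \<odot>\<^bsub>tens P\<^esub> pure P (r (e j)) \<one>\<^bsub>L\<^esub> = pure P (i m j \<odot>\<^bsub>P\<^esub> r (e j)) p"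
        unfolding smult_tens_hom(2)[OF mP q rej L.one_closed] pure_balanced[OF mP rej icl[OF m j] p] using q by simp
      finally show "g ((\<iota> (i m j) \<otimes>\<^bsub>L\<^esub> p) \<odot>\<^bsub>A\<^esub> c j) = \<phi> (pure P (i m j \<odot>\<^bsub>P\<^esub> r (e j)) p)" .
    qed
    also have "\<dots> = \<phi> (\<Oplus>\<^bsub>tens P\<^esub>j\<in>s m. pure P (i m j \<odot>\<^bsub>P\<^esub> r (e j)) p)"
      by (rule linear_map_finsum[OF \<phi>, symmetric]) (use pure_closed[OF mP b p] fin[OF m] in blast)
    also have "(\<Oplus>\<^bsub>tens P\<^esub>j\<in>s m. pure P (i m j \<odot>\<^bsub>P\<^esub> r (e j)) p) = pure P (\<Oplus>\<^bsub>P\<^esub>j\<in>s m. i m j \<odot>\<^bsub>P\<^esub> r (e j)) p"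
      by (rule abelian_group_hom.hom_finsum[OF pure_left_hom[OF mP p], symmetric]) (use b fin[OF m] in blast)
    finally show "g (\<Psi> (pure P m p)) = \<phi> (pure P m p)" unfolding decompose[OF m, symmetric] .
  qed
  then show "\<exists>\<psi>. linear_map L (tens P) A \<psi> \<and> (\<forall>p\<in>carrier (tens P). g (\<psi> p) = \<phi> p)" using lin by blast
qed

section \<open>Exactness\<close>

text \<open>Filter both complexes by families that vanish on sets with fewer than k elements. In the
  graded piece only the leading terms of the differentials remain, so it is a finite product of
  copies of the cone of b with the common sign (-1)^k, and the equations are solved at each set of
  size k separately.\<close>

lemma cone_exact_triangular:
  fixes M :: "int \<Rightarrow> ('l, 'm) module" and K :: "int \<Rightarrow> ('l, 'k) module" and N :: "nat set"
  assumes f: "cochain_map L X Y f" and N: "finite N"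
    and objX: "\<And>l. obj X l = total_module N M l" and objY: "\<And>l. obj Y l = total_module N K l"
    and d: "\<And>l. linear_map L (M l) (M (l + 1)) (d l)" and dK: "\<And>l. linear_map L (K l) (K (l + 1)) (dK l)"
    and b: "\<And>l. linear_map L (M l) (K l) (b l)"
    and leadX: "\<And>l v B. v \<in> carrier (total_module N M l) \<Longrightarrow> B \<in> Pow N \<Longrightarrow> (\<And>A. A \<subset> B \<Longrightarrow> v A = \<zero>\<^bsub>M (l - int (card A))\<^esub>) \<Longrightarrow>
      dif X l v B = [((-1) ^ card B :: int)] \<cdot>\<^bsub>M (l + 1 - int (card B))\<^esub> d (l - int (card B)) (v B)"
    and leadY: "\<And>l v B. v \<in> carrier (total_module N K l) \<Longrightarrow> B \<in> Pow N \<Longrightarrow> (\<And>A. A \<subset> B \<Longrightarrow> v A = \<zero>\<^bsub>K (l - int (card A))\<^esub>) \<Longrightarrow>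
      dif Y l v B = [((-1) ^ card B :: int)] \<cdot>\<^bsub>K (l + 1 - int (card B))\<^esub> dK (l - int (card B)) (v B)"
    and diag: "\<And>l v B. v \<in> carrier (total_module N M l) \<Longrightarrow> B \<in> Pow N \<Longrightarrow> f l v B = b (l - int (card B)) (v B)"
    and exact: "cone_exact \<lparr>obj = M, dif = d\<rparr> \<lparr>obj = K, dif = dK\<rparr> b"
  shows "cone_exact X Y f"
\<comment> \<open>The bound is one more than |N| because the condition is strict and N itself has to
  be covered.\<close>
proof (rule cone_exact_filtered[where n = "Suc (card N)"
      and U = "\<lambda>k l v. \<forall>A\<in>Pow N. card A < k \<longrightarrow> v A = \<zero>\<^bsub>M (l - int (card A))\<^esub>"
      and V = "\<lambda>k l v. \<forall>A\<in>Pow N. card A < k \<longrightarrow> v A = \<zero>\<^bsub>K (l - int (card A))\<^esub>", OF f])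
  interpret M: module_family L N M by (rule module_family.intro[OF linear_map_modules(1)[OF d] N])
  interpret K: module_family L N K by (rule module_family.intro[OF linear_map_modules(1)[OF dK] N])
  note X = cochain_mapD(1)[OF f] and Y = cochain_mapD(2)[OF f]
  have card_le: "card A < Suc (card N)" if "A \<in> Pow N" for A
    using that N card_mono by (auto simp: less_Suc_eq_le)
  fix l
  show "x = \<zero>\<^bsub>obj X l\<^esub>" if "x \<in> carrier (obj X l)" and van: "\<forall>A\<in>Pow N. card A < Suc (card N) \<longrightarrow> x A = \<zero>\<^bsub>M (l - int (card A))\<^esub>" for x
    unfolding objX
  proof (rule direct_sum_eqI)
    show "x \<in> carrier (total_module N M l)" using that(1) unfolding objX .
    show "\<zero>\<^bsub>total_module N M l\<^esub> \<in> carrier (total_module N M l)"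
      by (rule abelian_groupE(2)[OF right_moduleD(1)[OF M.total_right_module]])
    show "x A = \<zero>\<^bsub>total_module N M l\<^esub> A" if "A \<in> Pow N" for A
      using bspec[OF van that] card_le[OF that] that by (simp add: direct_sum_simps)
  qed
  show "y = \<zero>\<^bsub>obj Y l\<^esub>" if "y \<in> carrier (obj Y l)" and van: "\<forall>A\<in>Pow N. card A < Suc (card N) \<longrightarrow> y A = \<zero>\<^bsub>K (l - int (card A))\<^esub>" for y
    unfolding objY
  proof (rule direct_sum_eqI)
    show "y \<in> carrier (total_module N K l)" using that(1) unfolding objY .
    show "\<zero>\<^bsub>total_module N K l\<^esub> \<in> carrier (total_module N K l)"
      by (rule abelian_groupE(2)[OF right_moduleD(1)[OF K.total_right_module]])
    show "y A = \<zero>\<^bsub>total_module N K l\<^esub> A" if "A \<in> Pow N" for A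
      using bspec[OF van that] card_le[OF that] that by (simp add: direct_sum_simps)
  qed
  fix k x y
  assume x: "x \<in> carrier (obj X (l + 1))" and y: "y \<in> carrier (obj Y l)"
    and xv: "\<forall>A\<in>Pow N. card A < k \<longrightarrow> x A = \<zero>\<^bsub>M (l + 1 - int (card A))\<^esub>"
    and yv: "\<forall>A\<in>Pow N. card A < k \<longrightarrow> y A = \<zero>\<^bsub>K (l - int (card A))\<^esub>"
    and dx: "dif X (l + 1) x = \<zero>\<^bsub>obj X (l + 2)\<^esub>" and fx: "f (l + 1) x = dif Y l y"
  note x' = x[unfolded objX] and y' = y[unfolded objY]
  define m where "m = l - int k"
  \<comment> \<open>The sign of both leading terms at sets of size k; it is its own inverse.\<close>
  define s :: int where "s = (-1) ^ k"
  have ss: "s * s = 1" by (simp add: s_def square_sign)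
  have sub: "A' \<in> Pow N \<and> card A' < card A" if "A \<in> Pow N" "A' \<subset> A" for A A'
    using that N finite_subset psubset_card_mono by (metis Pow_iff psubset_imp_subset subset_trans)
  interpret M0: right_module L "M m" by (rule M.family_module)
  interpret M1: right_module L "M (m + 1)" by (rule M.family_module)
  interpret M2: right_module L "M (m + 2)" by (rule M.family_module)
  interpret K0: right_module L "K m" by (rule K.family_module)
  interpret K1: right_module L "K (m + 1)" by (rule K.family_module)
  interpret Km: right_module L "K (m - 1)" by (rule K.family_module)
  have dKm: "linear_map L (K (m - 1)) (K m) (dK (m - 1))" using dK[of "m - 1"] by simp
  have deg: "l - int (card A) = m" "l + 1 - int (card A) = m + 1" "l - 1 - int (card A) = m - 1"
    "l + 1 + 1 - int (card A) = m + 2" "l + 2 - int (card A) = m + 2" "l - 1 + 1 - int (card A) = m" if "card A = k" for A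
    using that by (simp_all add: m_def)
  \<comment> \<open>At a set A of size k the hypotheses become d x_A = 0 and b x_A = d (s y_A), so
    exactness for b is applied to the pair (x_A, s y_A).\<close>
  have "\<exists>u w. u \<in> carrier (M m) \<and> w \<in> carrier (K (m - 1)) \<and> d m u = x A \<and>
      b m u \<ominus>\<^bsub>K m\<^esub> [s] \<cdot>\<^bsub>K m\<^esub> y A = dK (m - 1) w" if A: "A \<in> Pow N" "card A = k" for A
  proof -
    note dg = deg[OF A(2)]
    have xA: "x A \<in> carrier (M (m + 1))" using M.total_component[OF x' A(1)] unfolding dg .
    have yA: "y A \<in> carrier (K m)" using K.total_component[OF y' A(1)] unfolding dg .
    have vx: "x A' = \<zero>\<^bsub>M (l + 1 - int (card A'))\<^esub>" if "A' \<subset> A" for A' using xv sub[OF A(1) that] A(2) by blast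
    have vy: "y A' = \<zero>\<^bsub>K (l - int (card A'))\<^esub>" if "A' \<subset> A" for A' using yv sub[OF A(1) that] A(2) by blast
    have d1: "linear_map L (M (m + 1)) (M (m + 2)) (d (m + 1))" using d[of "m + 1"] by (simp add: add.assoc)
    note dxA = linear_map_closed[OF d1 xA] and dyA = linear_map_closed[OF dK yA]
    have "dif X (l + 1) x A = [((-1) ^ card A :: int)] \<cdot>\<^bsub>M (l + 1 + 1 - int (card A))\<^esub> d (l + 1 - int (card A)) (x A)"
      by (rule leadX[OF x' A(1)]) (rule vx)
    then have "dif X (l + 1) x A = [s] \<cdot>\<^bsub>M (m + 2)\<^esub> d (m + 1) (x A)"
      unfolding dg unfolding A(2) s_def .
    moreover have "dif X (l + 1) x A = \<zero>\<^bsub>M (m + 2)\<^esub>"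
      using dx A(1) unfolding objX by (simp add: direct_sum_simps dg)
    ultimately have "[s] \<cdot>\<^bsub>M (m + 2)\<^esub> d (m + 1) (x A) = \<zero>\<^bsub>M (m + 2)\<^esub>" by (rule trans[OF sym])
    then have "[s] \<cdot>\<^bsub>M (m + 2)\<^esub> ([s] \<cdot>\<^bsub>M (m + 2)\<^esub> d (m + 1) (x A)) = \<zero>\<^bsub>M (m + 2)\<^esub>"
      by (simp only: M2.M.int_smult_zero)
    then have 1: "d (m + 1) (x A) = \<zero>\<^bsub>M (m + 2)\<^esub>"
      using dxA by (simp add: M2.M.int_smult_mult[symmetric] ss M2.M.int_smult_one)
    have "dif Y l y A = [((-1) ^ card A :: int)] \<cdot>\<^bsub>K (l + 1 - int (card A))\<^esub> dK (l - int (card A)) (y A)"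
      by (rule leadY[OF y' A(1)]) (rule vy)
    then have dyA': "dif Y l y A = [s] \<cdot>\<^bsub>K (m + 1)\<^esub> dK m (y A)"
      unfolding dg unfolding A(2) s_def .
    have "b (m + 1) (x A) = f (l + 1) x A" using diag[OF x' A(1)] unfolding dg by simp
    also have "\<dots> = [s] \<cdot>\<^bsub>K (m + 1)\<^esub> dK m (y A)"
      unfolding fx by (rule dyA')
    also have "\<dots> = dK m ([s] \<cdot>\<^bsub>K m\<^esub> y A)" using linear_map_int_smult[OF dK yA] by simp
    finally have 2: "b (m + 1) (x A) = dK m ([s] \<cdot>\<^bsub>K m\<^esub> y A)" .
    show ?thesis
      using exact[unfolded cone_exact_def, simplified, rule_format, of "x A" m "[s] \<cdot>\<^bsub>K m\<^esub> y A"] xA 1 2 K0.M.int_smult_closed[OF yA]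
      by blast
  qed
  then have "\<forall>A. \<exists>p. A \<in> Pow N \<and> card A = k \<longrightarrow> fst p \<in> carrier (M m) \<and> snd p \<in> carrier (K (m - 1)) \<and>
      d m (fst p) = x A \<and> b m (fst p) \<ominus>\<^bsub>K m\<^esub> [s] \<cdot>\<^bsub>K m\<^esub> y A = dK (m - 1) (snd p)"
    by (metis fst_conv snd_conv)
  from choice[OF this] obtain p where p: "\<forall>A. A \<in> Pow N \<and> card A = k \<longrightarrow> fst (p A) \<in> carrier (M m) \<and> snd (p A) \<in> carrier (K (m - 1)) \<and>
      d m (fst (p A)) = x A \<and> b m (fst (p A)) \<ominus>\<^bsub>K m\<^esub> [s] \<cdot>\<^bsub>K m\<^esub> y A = dK (m - 1) (snd (p A))" ..
  \<comment> \<open>The factor s compensates the sign of the leading term, so that the differential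
    of u hits x_A exactly. The other correction w needs no sign: its differential contributes s b p
    - y_A, with p the solution at A, which cancels y_A - s b p.\<close>
  define u where "u = (\<lambda>A\<in>Pow N. if card A = k then [s] \<cdot>\<^bsub>M m\<^esub> fst (p A) else \<zero>\<^bsub>M (l - int (card A))\<^esub>)"
  define w where "w = (\<lambda>A\<in>Pow N. if card A = k then snd (p A) else \<zero>\<^bsub>K (l - 1 - int (card A))\<^esub>)"
  have finP: "finite (Pow N)" using N by simp
  have u: "u \<in> carrier (total_module N M l)"
    unfolding u_def
  proof (rule restrict_in_direct_sum[OF _ finP])
    fix A assume A: "A \<in> Pow N"
    show "(if card A = k then [s] \<cdot>\<^bsub>M m\<^esub> fst (p A) else \<zero>\<^bsub>M (l - int (card A))\<^esub>) \<in> carrier (M (l - int (card A)))"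
    proof (cases "card A = k")
      case True
      then have "[s] \<cdot>\<^bsub>M m\<^esub> fst (p A) \<in> carrier (M m)" using p A by (simp add: M0.M.int_smult_closed)
      then show ?thesis unfolding deg(1)[OF True] using True by simp
    qed (use abelian_groupE(2)[OF right_moduleD(1)[OF M.family_module]] in simp)
  qed simp
  have w: "w \<in> carrier (total_module N K (l - 1))"
    unfolding w_def
  proof (rule restrict_in_direct_sum[OF _ finP])
    fix A assume A: "A \<in> Pow N"
    show "(if card A = k then snd (p A) else \<zero>\<^bsub>K (l - 1 - int (card A))\<^esub>) \<in> carrier (K (l - 1 - int (card A)))"
    proof (cases "card A = k")
      case True
      then have "snd (p A) \<in> carrier (K (m - 1))" using p A by simp
      then show ?thesis unfolding deg(3)[OF True] using True by simp
    qed (use abelian_groupE(2)[OF right_moduleD(1)[OF K.family_module]] in simp)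
  qed simp
  have uz: "u A = \<zero>\<^bsub>M (l - int (card A))\<^esub>" and wz: "w A = \<zero>\<^bsub>K (l - 1 - int (card A))\<^esub>" if "A \<in> Pow N" "card A < k" for A
    using that by (simp_all add: u_def w_def)
  have du: "dif X l u A = [((-1) ^ card A :: int)] \<cdot>\<^bsub>M (l + 1 - int (card A))\<^esub> d (l - int (card A)) (u A)" if A: "A \<in> Pow N" "card A \<le> k" for A
  proof (rule leadX[OF u A(1)])
    fix A' assume "A' \<subset> A"
    then have "A' \<in> Pow N" "card A' < k" using sub[OF A(1)] A(2) by (auto intro: less_le_trans)
    then show "u A' = \<zero>\<^bsub>M (l - int (card A'))\<^esub>" by (rule uz)
  qed
  have dw: "dif Y (l - 1) w A = [((-1) ^ card A :: int)] \<cdot>\<^bsub>K (l - 1 + 1 - int (card A))\<^esub> dK (l - 1 - int (card A)) (w A)" if A: "A \<in> Pow N" "card A \<le> k" for A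
  proof (rule leadY[OF w A(1)])
    fix A' assume "A' \<subset> A"
    then have "A' \<in> Pow N" "card A' < k" using sub[OF A(1)] A(2) by (auto intro: less_le_trans)
    then show "w A' = \<zero>\<^bsub>K (l - 1 - int (card A'))\<^esub>" by (rule wz)
  qed
  have duc: "dif X l u \<in> carrier (total_module N M (l + 1))"
    using linear_map_closed[OF cochain_complexD(1)[OF X], of u l] u unfolding objX .
  have dwc: "dif Y (l - 1) w \<in> carrier (total_module N K l)"
    using linear_map_closed[OF cochain_complex_previous(1)[OF Y], of w l] w unfolding objY .
  have fuc: "f l u \<in> carrier (total_module N K l)"
    using linear_map_closed[OF cochain_mapD(3)[OF f], of u l] u unfolding objX objY .
  interpret S0: right_module L "total_module N K l" by (rule K.total_right_module)
  show "\<exists>u\<in>carrier (obj X l). \<exists>w\<in>carrier (obj Y (l - 1)).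
      (\<forall>A\<in>Pow N. card A < Suc k \<longrightarrow> (x \<ominus>\<^bsub>obj X (l + 1)\<^esub> dif X l u) A = \<zero>\<^bsub>M (l + 1 - int (card A))\<^esub>) \<and>
      (\<forall>A\<in>Pow N. card A < Suc k \<longrightarrow> (y \<ominus>\<^bsub>obj Y l\<^esub> f l u \<oplus>\<^bsub>obj Y l\<^esub> dif Y (l - 1) w) A = \<zero>\<^bsub>K (l - int (card A))\<^esub>)"
  proof (intro bexI conjI ballI impI)
    show "u \<in> carrier (obj X l)" "w \<in> carrier (obj Y (l - 1))" using u w unfolding objX objY by auto
    fix A assume A: "A \<in> Pow N" and cA: "card A < Suc k"
    interpret MA: right_module L "M (l - int (card A))" by (rule M.family_module)
    interpret MA1: right_module L "M (l + 1 - int (card A))" by (rule M.family_module)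
    interpret KA: right_module L "K (l - int (card A))" by (rule K.family_module)
    have xu: "(x \<ominus>\<^bsub>total_module N M (l + 1)\<^esub> dif X l u) A = x A \<ominus>\<^bsub>M (l + 1 - int (card A))\<^esub> dif X l u A"
      using linear_map_minus[OF M.component_linear[OF A] x' duc] .
    have yu: "(y \<ominus>\<^bsub>total_module N K l\<^esub> f l u \<oplus>\<^bsub>total_module N K l\<^esub> dif Y (l - 1) w) A
        = y A \<ominus>\<^bsub>K (l - int (card A))\<^esub> f l u A \<oplus>\<^bsub>K (l - int (card A))\<^esub> dif Y (l - 1) w A"
      using linear_map_minus[OF K.component_linear[OF A] y' fuc]
        linear_map_add[OF K.component_linear[OF A] S0.M.minus_closed[OF y' fuc] dwc] by simp
    consider "card A < k" | "card A = k" using cA by linarith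
    then have "x A \<ominus>\<^bsub>M (l + 1 - int (card A))\<^esub> dif X l u A = \<zero>\<^bsub>M (l + 1 - int (card A))\<^esub> \<and>
      y A \<ominus>\<^bsub>K (l - int (card A))\<^esub> f l u A \<oplus>\<^bsub>K (l - int (card A))\<^esub> dif Y (l - 1) w A = \<zero>\<^bsub>K (l - int (card A))\<^esub>"
    proof cases
      case 1
      have e: "l - int (card A) + 1 = l + 1 - int (card A)" "l - 1 - int (card A) + 1 = l - int (card A)" "l - 1 + 1 - int (card A) = l - int (card A)"
        by simp_all
      have "dif X l u A = \<zero>\<^bsub>M (l + 1 - int (card A))\<^esub>"
        using du[OF A less_imp_le[OF 1]] uz[OF A 1] linear_map_zero[OF d, of "l - int (card A)"]
        by (simp add: e MA1.M.int_smult_zero)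
      moreover have "dif Y (l - 1) w A = \<zero>\<^bsub>K (l - int (card A))\<^esub>"
        using dw[OF A less_imp_le[OF 1]] wz[OF A 1] linear_map_zero[OF dK, of "l - 1 - int (card A)"]
        by (simp add: e KA.M.int_smult_zero)
      moreover have "f l u A = \<zero>\<^bsub>K (l - int (card A))\<^esub>"
        using diag[OF u A] uz[OF A 1] linear_map_zero[OF b] by simp
      ultimately show ?thesis
        using xv yv A 1 by (simp add: a_minus_def MA1.M.a_inv_zero KA.M.a_inv_zero)
    next
      case 2
      note dg = deg[OF 2]
      have pA: "fst (p A) \<in> carrier (M m)" "snd (p A) \<in> carrier (K (m - 1))" "d m (fst (p A)) = x A"
        "b m (fst (p A)) \<ominus>\<^bsub>K m\<^esub> [s] \<cdot>\<^bsub>K m\<^esub> y A = dK (m - 1) (snd (p A))"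
        using p A 2 by auto
      have uA: "u A = [s] \<cdot>\<^bsub>M m\<^esub> fst (p A)" and wA: "w A = snd (p A)" using A 2 by (simp_all add: u_def w_def)
      have xA: "x A \<in> carrier (M (m + 1))" using M.total_component[OF x' A] unfolding dg .
      have yA: "y A \<in> carrier (K m)" using K.total_component[OF y' A] unfolding dg .
      note bp = linear_map_closed[OF b pA(1)]
      have "dif X l u A = x A"
        using du[OF A eq_imp_le[OF 2]] linear_map_int_smult[OF d pA(1), of s] pA(3) xA
        unfolding dg unfolding 2 uA s_def[symmetric] by (simp add: M1.M.int_smult_mult[symmetric] ss M1.M.int_smult_one)
      moreover have "y A \<ominus>\<^bsub>K m\<^esub> f l u A \<oplus>\<^bsub>K m\<^esub> dif Y (l - 1) w A = \<zero>\<^bsub>K m\<^esub>"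
      proof -
        have "f l u A = [s] \<cdot>\<^bsub>K m\<^esub> b m (fst (p A))"
          using diag[OF u A] linear_map_int_smult[OF b pA(1)] unfolding dg uA by simp
        moreover have "dif Y (l - 1) w A = [s] \<cdot>\<^bsub>K m\<^esub> (b m (fst (p A)) \<ominus>\<^bsub>K m\<^esub> [s] \<cdot>\<^bsub>K m\<^esub> y A)"
          using dw[OF A eq_imp_le[OF 2]] unfolding dg unfolding 2 wA s_def[symmetric] pA(4) .
        moreover have "\<dots> = [s] \<cdot>\<^bsub>K m\<^esub> b m (fst (p A)) \<ominus>\<^bsub>K m\<^esub> y A"
          using bp yA by (simp add: a_minus_def K0.M.int_smult_add K0.M.int_smult_closed K0.M.int_smult_a_inv
              K0.M.int_smult_mult[symmetric] ss K0.M.int_smult_one)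
        moreover have "y A \<ominus>\<^bsub>K m\<^esub> z \<oplus>\<^bsub>K m\<^esub> (z \<ominus>\<^bsub>K m\<^esub> y A) = \<zero>\<^bsub>K m\<^esub>" if "z \<in> carrier (K m)" for z
          using that yA K0.M.diff_add_cancel[of "y A" z] by (simp add: a_minus_def K0.M.a_assoc[symmetric] K0.M.r_neg)
        ultimately show ?thesis using bp by (simp add: K0.M.int_smult_closed)
      qed
      ultimately show ?thesis using xA unfolding dg by (simp add: a_minus_def M1.M.r_neg)
    qed
    then show "(x \<ominus>\<^bsub>obj X (l + 1)\<^esub> dif X l u) A = \<zero>\<^bsub>M (l + 1 - int (card A))\<^esub>"
      "(y \<ominus>\<^bsub>obj Y l\<^esub> f l u \<oplus>\<^bsub>obj Y l\<^esub> dif Y (l - 1) w) A = \<zero>\<^bsub>K (l - int (card A))\<^esub>"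
      unfolding objX objY xu yu by auto
  qed
qed simp_all

lemma (in ring) scalar_extension_laurent: "scalar_extension R (laurent R N) (laurent_const R)"
  using ring_axioms ring_laurent
  by (intro scalar_extension.intro scalar_extension_axioms.intro) (simp_all add: laurent_const_closed laurent_const_hom)

definition laurent_complex where
  "laurent_complex R N C =
    \<lparr>obj = (\<lambda>l. laurent_tensor R N (obj C l)),
     dif = (\<lambda>l. laurent_tensor_map R N (obj C (l + 1)) (dif C l) id)\<rparr>"

section \<open>Coefficients of tensors and exactness over the Laurent ring\<close>

context ring
begin

context
  fixes N :: "nat set"
begin

interpretation ext: scalar_extension R "laurent R N" "laurent_const R"
  by (rule scalar_extension_laurent)

text \<open>The component at the monomial x^e, when M \<otimes> L is viewed as a direct sum of
  copies of M indexed by exponents. The universal property determines it on all tensors, and the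
  choice operator only names the map it provides.\<close>

definition coefficient :: "('a, 'm) module \<Rightarrow> (nat \<Rightarrow> int) \<Rightarrow> ('m \<times> ((nat \<Rightarrow> int) \<Rightarrow> 'a) \<Rightarrow>\<^sub>0 int) set \<Rightarrow> 'm" where
  "coefficient M e = (SOME F. abelian_group_hom (laurent_tensor R N M) M F \<and>
    (\<forall>m\<in>carrier M. \<forall>p\<in>carrier (laurent R N). F (ext.pure M m p) = p e \<odot>\<^bsub>M\<^esub> m))"

lemma coefficient:
  assumes M: "right_module R M"
  shows "abelian_group_hom (laurent_tensor R N M) M (coefficient M e)"
    "m \<in> carrier M \<Longrightarrow> p \<in> carrier (laurent R N) \<Longrightarrow> coefficient M e (ext.pure M m p) = p e \<odot>\<^bsub>M\<^esub> m"
proof -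
  interpret M: right_module R M by (rule M)
  have "\<exists>F. abelian_group_hom (laurent_tensor R N M) M F \<and>
    (\<forall>m\<in>carrier M. \<forall>p\<in>carrier (laurent R N). F (ext.pure M m p) = p e \<odot>\<^bsub>M\<^esub> m)"
  proof (rule ext.tens_universal[OF M M.M.abelian_group_axioms])
    fix m p assume m: "m \<in> carrier M" and p: "p \<in> carrier (laurent R N)"
    note pe = laurent_coeff[OF p, of e]
    show "p e \<odot>\<^bsub>M\<^esub> m \<in> carrier M" using m pe by (simp add: M.smult_closed)
    show "p e \<odot>\<^bsub>M\<^esub> (m \<oplus>\<^bsub>M\<^esub> y) = p e \<odot>\<^bsub>M\<^esub> m \<oplus>\<^bsub>M\<^esub> p e \<odot>\<^bsub>M\<^esub> y" if "y \<in> carrier M" for y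
      using m pe that by (simp add: M.smult_vector_distr)
    show "(p \<oplus>\<^bsub>laurent R N\<^esub> q) e \<odot>\<^bsub>M\<^esub> m = p e \<odot>\<^bsub>M\<^esub> m \<oplus>\<^bsub>M\<^esub> q e \<odot>\<^bsub>M\<^esub> m" if "q \<in> carrier (laurent R N)" for q
      using m pe laurent_coeff[OF that] by (simp add: M.smult_scalar_distr laurent_simps(2))
    show "p e \<odot>\<^bsub>M\<^esub> (a \<odot>\<^bsub>M\<^esub> m) = (laurent_const R a \<otimes>\<^bsub>laurent R N\<^esub> p) e \<odot>\<^bsub>M\<^esub> m" if "a \<in> carrier R" for a
      using m pe that by (simp add: laurent_const_mult[OF that p] M.smult_assoc)
  qed
  from someI_ex[OF this] show "abelian_group_hom (laurent_tensor R N M) M (coefficient M e)"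
    "m \<in> carrier M \<Longrightarrow> p \<in> carrier (laurent R N) \<Longrightarrow> coefficient M e (ext.pure M m p) = p e \<odot>\<^bsub>M\<^esub> m"
    unfolding coefficient_def by blast+
qed

lemma coefficient_natural:
  assumes \<phi>: "linear_map R M M' \<phi>" and X: "X \<in> carrier (laurent_tensor R N M)"
  shows "coefficient M' e (laurent_tensor_map R N M' \<phi> id X) = \<phi> (coefficient M e X)"
proof -
  have M: "right_module R M" and M': "right_module R M'" using \<phi> by (auto dest: linear_map_modules)
  show ?thesis
  proof (rule ext.tens_hom_eqI[OF M abelian_group_hom_compose[OF linear_map_abelian_group_hom[OF ext.tensor_map_id(1)[OF \<phi>]] coefficient(1)[OF M']]
        abelian_group_hom_compose[OF coefficient(1)[OF M] linear_map_abelian_group_hom[OF \<phi>]] _ X])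
    fix m p assume m: "m \<in> carrier M" and p: "p \<in> carrier (laurent R N)"
    show "coefficient M' e (laurent_tensor_map R N M' \<phi> id (ext.pure M m p)) = \<phi> (coefficient M e (ext.pure M m p))"
      unfolding ext.tensor_map_id(2)[OF \<phi> m p] coefficient(2)[OF M m p] coefficient(2)[OF M' linear_map_closed[OF \<phi> m] p]
        linear_map_smult[OF \<phi> laurent_coeff[OF p] m] ..
  qed
qed

text \<open>Freeness of L over R: a tensor is the finite sum of its coefficients times monomials.
  The formula is claimed for all large enough finite sets of exponents, so that different tensors
  can be expanded over the same set.\<close>

lemma monomial_tensor_decompose:
  assumes M: "right_module R M" and X: "X \<in> carrier (laurent_tensor R N M)"
  shows "\<exists>E. finite E \<and> E \<subseteq> exponents N \<and> (\<forall>E'. finite E' \<longrightarrow> E \<subseteq> E' \<longrightarrow> E' \<subseteq> exponents N \<longrightarrow>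
    X = (\<Oplus>\<^bsub>laurent_tensor R N M\<^esub>e\<in>E'. ext.pure M (coefficient M e X) (laurent_monomial R \<one> e)))"
proof -
  interpret M: right_module R M by (rule M)
  interpret T: right_module "laurent R N" "laurent_tensor R N M" by (rule ext.right_module_tens[OF M])
  let ?t = "\<lambda>e m. ext.pure M m (laurent_monomial R \<one> e)"
  have t: "abelian_group_hom M (laurent_tensor R N M) (?t e)" if "e \<in> exponents N" for e
    by (rule ext.pure_left_hom[OF M laurent_monomial_closed[OF one_closed that]])
  have tc: "abelian_group_hom (laurent_tensor R N M) (laurent_tensor R N M) (\<lambda>X. ?t e (coefficient M e X))" if "e \<in> exponents N" for e
    by (rule abelian_group_hom_compose[OF coefficient(1)[OF M] t[OF that]])
  let ?S = "\<lambda>E X. \<Oplus>\<^bsub>laurent_tensor R N M\<^esub>e\<in>E. ?t e (coefficient M e X)"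
  show ?thesis
  proof (rule ext.tens_induct[OF M X, where P = "\<lambda>X. \<exists>E. finite E \<and> E \<subseteq> exponents N \<and>
      (\<forall>E'. finite E' \<longrightarrow> E \<subseteq> E' \<longrightarrow> E' \<subseteq> exponents N \<longrightarrow> X = ?S E' X)"])
    have "?S E' \<zero>\<^bsub>laurent_tensor R N M\<^esub> = \<zero>\<^bsub>laurent_tensor R N M\<^esub>" if "E' \<subseteq> exponents N" for E'
      using abelian_group_hom.hom_zero[OF tc] that by (intro T.M.finsum_zero_eqI) blast
    then show "\<exists>E. finite E \<and> E \<subseteq> exponents N \<and> (\<forall>E'. finite E' \<longrightarrow> E \<subseteq> E' \<longrightarrow> E' \<subseteq> exponents N \<longrightarrow>
        \<zero>\<^bsub>laurent_tensor R N M\<^esub> = ?S E' \<zero>\<^bsub>laurent_tensor R N M\<^esub>)"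
      by (intro exI[of _ "{}"]) simp
  next
    fix X Y assume XY: "X \<in> carrier (laurent_tensor R N M)" "Y \<in> carrier (laurent_tensor R N M)"
    assume "\<exists>E. finite E \<and> E \<subseteq> exponents N \<and> (\<forall>E'. finite E' \<longrightarrow> E \<subseteq> E' \<longrightarrow> E' \<subseteq> exponents N \<longrightarrow> X = ?S E' X)"
    then obtain E1 where E1: "finite E1" "E1 \<subseteq> exponents N" "\<And>E'. finite E' \<Longrightarrow> E1 \<subseteq> E' \<Longrightarrow> E' \<subseteq> exponents N \<Longrightarrow> X = ?S E' X" by blast
    assume "\<exists>E. finite E \<and> E \<subseteq> exponents N \<and> (\<forall>E'. finite E' \<longrightarrow> E \<subseteq> E' \<longrightarrow> E' \<subseteq> exponents N \<longrightarrow> Y = ?S E' Y)"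
    then obtain E2 where E2: "finite E2" "E2 \<subseteq> exponents N" "\<And>E'. finite E' \<Longrightarrow> E2 \<subseteq> E' \<Longrightarrow> E' \<subseteq> exponents N \<Longrightarrow> Y = ?S E' Y" by blast
    have "X \<ominus>\<^bsub>laurent_tensor R N M\<^esub> Y = ?S E' (X \<ominus>\<^bsub>laurent_tensor R N M\<^esub> Y)"
      if E': "finite E'" "E1 \<union> E2 \<subseteq> E'" "E' \<subseteq> exponents N" for E'
    proof -
      have cl: "?t e (coefficient M e Z) \<in> carrier (laurent_tensor R N M)" if "e \<in> E'" "Z \<in> carrier (laurent_tensor R N M)" for e Z
        using abelian_group_hom.hom_closed[OF tc that(2)] that(1) E'(3) by blast
      have "?S E' (X \<ominus>\<^bsub>laurent_tensor R N M\<^esub> Y)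
          = (\<Oplus>\<^bsub>laurent_tensor R N M\<^esub>e\<in>E'. ?t e (coefficient M e X) \<oplus>\<^bsub>laurent_tensor R N M\<^esub> \<ominus>\<^bsub>laurent_tensor R N M\<^esub> ?t e (coefficient M e Y))"
      proof (rule T.M.finsum_cong'[OF refl])
        show "(\<lambda>e. ?t e (coefficient M e X) \<oplus>\<^bsub>laurent_tensor R N M\<^esub> \<ominus>\<^bsub>laurent_tensor R N M\<^esub> ?t e (coefficient M e Y)) \<in> E' \<rightarrow> carrier (laurent_tensor R N M)"
          using cl XY by simp
        fix e assume "e \<in> E'"
        then have "e \<in> exponents N" using E'(3) by blast
        from abelian_group_hom.hom_minus[OF tc[OF this] XY]
        show "?t e (coefficient M e (X \<ominus>\<^bsub>laurent_tensor R N M\<^esub> Y)) = ?t e (coefficient M e X) \<oplus>\<^bsub>laurent_tensor R N M\<^esub> \<ominus>\<^bsub>laurent_tensor R N M\<^esub> ?t e (coefficient M e Y)"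
          unfolding a_minus_def .
      qed
      also have "\<dots> = ?S E' X \<oplus>\<^bsub>laurent_tensor R N M\<^esub> (\<Oplus>\<^bsub>laurent_tensor R N M\<^esub>e\<in>E'. \<ominus>\<^bsub>laurent_tensor R N M\<^esub> ?t e (coefficient M e Y))"
        by (rule T.M.finsum_addf) (use cl XY in auto)
      also have "(\<Oplus>\<^bsub>laurent_tensor R N M\<^esub>e\<in>E'. \<ominus>\<^bsub>laurent_tensor R N M\<^esub> ?t e (coefficient M e Y)) = \<ominus>\<^bsub>laurent_tensor R N M\<^esub> ?S E' Y"
        by (rule T.M.finsum_a_inv[OF E'(1)]) (use cl XY in auto)
      finally show ?thesis using E1(3)[OF E'(1) _ E'(3)] E2(3)[OF E'(1) _ E'(3)] E'(2) by (simp add: a_minus_def)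
    qed
    then show "\<exists>E. finite E \<and> E \<subseteq> exponents N \<and> (\<forall>E'. finite E' \<longrightarrow> E \<subseteq> E' \<longrightarrow> E' \<subseteq> exponents N \<longrightarrow>
        X \<ominus>\<^bsub>laurent_tensor R N M\<^esub> Y = ?S E' (X \<ominus>\<^bsub>laurent_tensor R N M\<^esub> Y))"
      using E1(1,2) E2(1,2) by (intro exI[of _ "E1 \<union> E2"]) simp
  next
    fix m p assume m: "m \<in> carrier M" and p: "p \<in> carrier (laurent R N)"
    have "ext.pure M m p = ?S E' (ext.pure M m p)" if E': "finite E'" "support R p \<subseteq> E'" "E' \<subseteq> exponents N" for E'
    proof -
      have mono: "laurent_monomial R (p e) e \<in> carrier (laurent R N)" if "e \<in> E'" for e
        using laurent_monomial_closed[OF laurent_coeff[OF p]] that E'(3) by blast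
      have "ext.pure M m p = ext.pure M m (\<Oplus>\<^bsub>laurent R N\<^esub>e\<in>E'. laurent_monomial R (p e) e)"
        using laurent_decompose[OF p E'] by simp
      also have "\<dots> = (\<Oplus>\<^bsub>laurent_tensor R N M\<^esub>e\<in>E'. ext.pure M m (laurent_monomial R (p e) e))"
        by (rule abelian_group_hom.hom_finsum[OF ext.pure_right_hom[OF M m]]) (use mono in blast)
      also have "\<dots> = ?S E' (ext.pure M m p)"
      proof (rule T.M.finsum_cong'[OF refl])
        show "(\<lambda>e. ?t e (coefficient M e (ext.pure M m p))) \<in> E' \<rightarrow> carrier (laurent_tensor R N M)"
          using abelian_group_hom.hom_closed[OF tc ext.pure_closed[OF M m p]] E'(3) by blast
        fix e assume "e \<in> E'"
        then have e: "e \<in> exponents N" using E'(3) by blast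
        have 1: "laurent_monomial R \<one> e \<in> carrier (laurent R N)" by (rule laurent_monomial_closed[OF one_closed e])
        have "laurent_const R (p e) \<otimes>\<^bsub>laurent R N\<^esub> laurent_monomial R \<one> e = laurent_monomial R (p e) e"
          unfolding laurent_const_mult[OF laurent_coeff[OF p] 1] using laurent_coeff[OF p] by (auto simp: laurent_monomial_def)
        then show "ext.pure M m (laurent_monomial R (p e) e) = ?t e (coefficient M e (ext.pure M m p))"
          unfolding coefficient(2)[OF M m p] ext.pure_balanced[OF M m laurent_coeff[OF p] 1] by simp
      qed
      finally show ?thesis .
    qed
    then show "\<exists>E. finite E \<and> E \<subseteq> exponents N \<and> (\<forall>E'. finite E' \<longrightarrow> E \<subseteq> E' \<longrightarrow> E' \<subseteq> exponents N \<longrightarrow>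
        ext.pure M m p = ?S E' (ext.pure M m p))"
      using p unfolding laurent_simps(1) by blast
  qed
qed

text \<open>Taking coefficients is natural, so the equations of the cone hold at every exponent over
  R. They are solved there one by one, and the solutions are put together with monomials.\<close>

lemma cone_exact_laurent:
  assumes \<beta>: "cochain_map R D C \<beta>" and exact: "cone_exact D C \<beta>"
  shows "cone_exact (laurent_complex R N D) (laurent_complex R N C) (\<lambda>l. laurent_tensor_map R N (obj C l) (\<beta> l) id)"
  unfolding cone_exact_def
proof (intro allI ballI impI)
  let ?T = "\<lambda>M. laurent_tensor R N M"
  let ?m = "\<lambda>M \<phi>. laurent_tensor_map R N M \<phi> id"
  note D = cochain_mapD(1)[OF \<beta>] and C = cochain_mapD(2)[OF \<beta>] and \<beta>l = cochain_mapD(3)[OF \<beta>]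
  note mD = cochain_complexD(2)[OF D] and mC = cochain_complexD(2)[OF C]
  fix l X Y
  assume X: "X \<in> carrier (obj (laurent_complex R N D) (l + 1))" and Y: "Y \<in> carrier (obj (laurent_complex R N C) l)"
    and h: "dif (laurent_complex R N D) (l + 1) X = \<zero>\<^bsub>obj (laurent_complex R N D) (l + 2)\<^esub> \<and>
      ?m (obj C (l + 1)) (\<beta> (l + 1)) X = dif (laurent_complex R N C) l Y"
  have X': "X \<in> carrier (?T (obj D (l + 1)))" and Y': "Y \<in> carrier (?T (obj C l))"
    and dX: "?m (obj D (l + 2)) (dif D (l + 1)) X = \<zero>\<^bsub>?T (obj D (l + 2))\<^esub>"
    and \<beta>X: "?m (obj C (l + 1)) (\<beta> (l + 1)) X = ?m (obj C (l + 1)) (dif C l) Y"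
    using X Y h by (simp_all add: laurent_complex_def add.assoc)
  have dD1: "linear_map R (obj D (l + 1)) (obj D (l + 2)) (dif D (l + 1))"
    using cochain_complexD(1)[OF D, of "l + 1"] by (simp add: add.assoc)
  note dD = cochain_complexD(1)[OF D, of l] and dC = cochain_complexD(1)[OF C, of l] and dCm = cochain_complex_previous(1)[OF C, of l]
  define x where "x e = coefficient (obj D (l + 1)) e X" for e
  define y where "y e = coefficient (obj C l) e Y" for e
  have x: "x e \<in> carrier (obj D (l + 1))" and y: "y e \<in> carrier (obj C l)" for e
    unfolding x_def y_def using abelian_group_hom.hom_closed[OF coefficient(1)[OF mD] X'] abelian_group_hom.hom_closed[OF coefficient(1)[OF mC] Y'] by auto
  have "\<forall>e. \<exists>q. fst q \<in> carrier (obj D l) \<and> snd q \<in> carrier (obj C (l - 1)) \<and> dif D l (fst q) = x e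
      \<and> \<beta> l (fst q) \<ominus>\<^bsub>obj C l\<^esub> y e = dif C (l - 1) (snd q)"
  proof
    fix e
    have "dif D (l + 1) (x e) = \<zero>\<^bsub>obj D (l + 2)\<^esub>"
      using coefficient_natural[OF dD1 X', of e] abelian_group_hom.hom_zero[OF coefficient(1)[OF mD]] by (simp add: dX x_def)
    moreover have "\<beta> (l + 1) (x e) = dif C l (y e)"
      using coefficient_natural[OF \<beta>l X', of e] coefficient_natural[OF dC Y', of e] by (simp add: \<beta>X x_def y_def)
    ultimately have "\<exists>x'\<in>carrier (obj D l). \<exists>y'\<in>carrier (obj C (l - 1)). dif D l x' = x e \<and> \<beta> l x' \<ominus>\<^bsub>obj C l\<^esub> y e = dif C (l - 1) y'"
      using exact x y unfolding cone_exact_def by blast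
    then show "\<exists>q. fst q \<in> carrier (obj D l) \<and> snd q \<in> carrier (obj C (l - 1)) \<and> dif D l (fst q) = x e
      \<and> \<beta> l (fst q) \<ominus>\<^bsub>obj C l\<^esub> y e = dif C (l - 1) (snd q)" by auto
  qed
  from choice[OF this] obtain q where q: "\<forall>e. fst (q e) \<in> carrier (obj D l) \<and> snd (q e) \<in> carrier (obj C (l - 1)) \<and> dif D l (fst (q e)) = x e
      \<and> \<beta> l (fst (q e)) \<ominus>\<^bsub>obj C l\<^esub> y e = dif C (l - 1) (snd (q e))" ..
  have q1: "fst (q e) \<in> carrier (obj D l)" and q2: "snd (q e) \<in> carrier (obj C (l - 1))" and q3: "dif D l (fst (q e)) = x e"
    and q4: "\<beta> l (fst (q e)) \<ominus>\<^bsub>obj C l\<^esub> y e = dif C (l - 1) (snd (q e))" for e using q by auto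
  let ?mono = "laurent_monomial R \<one>"
  obtain E1 where E1: "finite E1" "E1 \<subseteq> exponents N" "\<And>E'. finite E' \<Longrightarrow> E1 \<subseteq> E' \<Longrightarrow> E' \<subseteq> exponents N \<Longrightarrow>
      X = (\<Oplus>\<^bsub>?T (obj D (l + 1))\<^esub>e\<in>E'. ext.pure (obj D (l + 1)) (x e) (?mono e))"
    using monomial_tensor_decompose[OF mD X'] unfolding x_def by blast
  obtain E2 where E2: "finite E2" "E2 \<subseteq> exponents N" "\<And>E'. finite E' \<Longrightarrow> E2 \<subseteq> E' \<Longrightarrow> E' \<subseteq> exponents N \<Longrightarrow>
      Y = (\<Oplus>\<^bsub>?T (obj C l)\<^esub>e\<in>E'. ext.pure (obj C l) (y e) (?mono e))"
    using monomial_tensor_decompose[OF mC Y'] unfolding y_def by blast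
  \<comment> \<open>A common finite set of exponents for X and Y.\<close>
  define E where "E = E1 \<union> E2"
  have E: "finite E" "E \<subseteq> exponents N" using E1(1,2) E2(1,2) by (auto simp: E_def)
  have Xs: "X = (\<Oplus>\<^bsub>?T (obj D (l + 1))\<^esub>e\<in>E. ext.pure (obj D (l + 1)) (x e) (?mono e))"
    using E1(3)[OF E(1) _ E(2)] by (simp add: E_def)
  have Ys: "Y = (\<Oplus>\<^bsub>?T (obj C l)\<^esub>e\<in>E. ext.pure (obj C l) (y e) (?mono e))"
    using E2(3)[OF E(1) _ E(2)] by (simp add: E_def)
  have mono: "?mono e \<in> carrier (laurent R N)" if "e \<in> E" for e using laurent_monomial_closed[OF one_closed] that E(2) by blast
  \<comment> \<open>Solutions were chosen at every exponent, also where both coefficients vanish and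
    the solution may still be nonzero. Summing over E only keeps the result finite.\<close>
  define U where "U = (\<Oplus>\<^bsub>?T (obj D l)\<^esub>e\<in>E. ext.pure (obj D l) (fst (q e)) (?mono e))"
  define V where "V = (\<Oplus>\<^bsub>?T (obj C (l - 1))\<^esub>e\<in>E. ext.pure (obj C (l - 1)) (snd (q e)) (?mono e))"
  interpret TD: right_module "laurent R N" "?T (obj D l)" by (rule ext.right_module_tens[OF mD])
  interpret TD1: right_module "laurent R N" "?T (obj D (l + 1))" by (rule ext.right_module_tens[OF mD])
  interpret TC: right_module "laurent R N" "?T (obj C l)" by (rule ext.right_module_tens[OF mC])
  interpret TCm: right_module "laurent R N" "?T (obj C (l - 1))" by (rule ext.right_module_tens[OF mC])
  have Ucl: "U \<in> carrier (?T (obj D l))"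
    unfolding U_def using ext.pure_closed[OF mD q1 mono] by (intro TD.M.finsum_closed) blast
  have Vcl: "V \<in> carrier (?T (obj C (l - 1)))"
    unfolding V_def using ext.pure_closed[OF mC q2 mono] by (intro TCm.M.finsum_closed) blast
  have "?m (obj D (l + 1)) (dif D l) U = (\<Oplus>\<^bsub>?T (obj D (l + 1))\<^esub>e\<in>E. ?m (obj D (l + 1)) (dif D l) (ext.pure (obj D l) (fst (q e)) (?mono e)))"
    unfolding U_def by (rule linear_map_finsum[OF ext.tensor_map_id(1)[OF dD]]) (use ext.pure_closed[OF mD q1 mono] in blast)
  also have "\<dots> = X"
    unfolding Xs by (rule TD1.M.finsum_cong'[OF refl])
      (use ext.pure_closed[OF mD x mono] in \<open>auto simp: ext.tensor_map_id(2)[OF dD q1 mono] q3\<close>)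
  finally have 1: "?m (obj D (l + 1)) (dif D l) U = X" .
  have pm: "ext.pure (obj C l) (\<beta> l (fst (q e))) (?mono e) \<in> carrier (?T (obj C l))" "ext.pure (obj C l) (y e) (?mono e) \<in> carrier (?T (obj C l))"
    if "e \<in> E" for e
    using ext.pure_closed[OF mC linear_map_closed[OF \<beta>l q1] mono[OF that]] ext.pure_closed[OF mC y mono[OF that]] by auto
  have "?m (obj C l) (\<beta> l) U = (\<Oplus>\<^bsub>?T (obj C l)\<^esub>e\<in>E. ?m (obj C l) (\<beta> l) (ext.pure (obj D l) (fst (q e)) (?mono e)))"
    unfolding U_def by (rule linear_map_finsum[OF ext.tensor_map_id(1)[OF \<beta>l]]) (use ext.pure_closed[OF mD q1 mono] in blast)
  also have "\<dots> = (\<Oplus>\<^bsub>?T (obj C l)\<^esub>e\<in>E. ext.pure (obj C l) (\<beta> l (fst (q e))) (?mono e))"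
    by (rule TC.M.finsum_cong'[OF refl]) (use pm in \<open>auto simp: ext.tensor_map_id(2)[OF \<beta>l q1 mono]\<close>)
  finally have "?m (obj C l) (\<beta> l) U \<ominus>\<^bsub>?T (obj C l)\<^esub> Y
      = (\<Oplus>\<^bsub>?T (obj C l)\<^esub>e\<in>E. ext.pure (obj C l) (\<beta> l (fst (q e))) (?mono e))
        \<oplus>\<^bsub>?T (obj C l)\<^esub> (\<Oplus>\<^bsub>?T (obj C l)\<^esub>e\<in>E. \<ominus>\<^bsub>?T (obj C l)\<^esub> ext.pure (obj C l) (y e) (?mono e))"
    unfolding Ys a_minus_def using TC.M.finsum_a_inv[OF E(1), of "\<lambda>e. ext.pure (obj C l) (y e) (?mono e)"] pm(2) by simp
  also have "\<dots> = (\<Oplus>\<^bsub>?T (obj C l)\<^esub>e\<in>E. ext.pure (obj C l) (\<beta> l (fst (q e))) (?mono e)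
      \<oplus>\<^bsub>?T (obj C l)\<^esub> \<ominus>\<^bsub>?T (obj C l)\<^esub> ext.pure (obj C l) (y e) (?mono e))"
    by (rule TC.M.finsum_addf[symmetric]) (use pm in auto)
  also have "\<dots> = (\<Oplus>\<^bsub>?T (obj C l)\<^esub>e\<in>E. ?m (obj C l) (dif C (l - 1)) (ext.pure (obj C (l - 1)) (snd (q e)) (?mono e)))"
  proof (rule TC.M.finsum_cong'[OF refl])
    show "(\<lambda>e. ?m (obj C l) (dif C (l - 1)) (ext.pure (obj C (l - 1)) (snd (q e)) (?mono e))) \<in> E \<rightarrow> carrier (?T (obj C l))"
      using linear_map_closed[OF ext.tensor_map_id(1)[OF dCm] ext.pure_closed[OF mC q2 mono]] by blast
    fix e assume e: "e \<in> E"
    show "ext.pure (obj C l) (\<beta> l (fst (q e))) (?mono e) \<oplus>\<^bsub>?T (obj C l)\<^esub> \<ominus>\<^bsub>?T (obj C l)\<^esub> ext.pure (obj C l) (y e) (?mono e)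
      = ?m (obj C l) (dif C (l - 1)) (ext.pure (obj C (l - 1)) (snd (q e)) (?mono e))"
      unfolding ext.tensor_map_id(2)[OF dCm q2 mono[OF e]] q4[symmetric]
      using abelian_group_hom.hom_minus[OF ext.pure_left_hom[OF mC mono[OF e]] linear_map_closed[OF \<beta>l q1[of e]] y[of e]]
      by (simp add: a_minus_def)
  qed
  also have "\<dots> = ?m (obj C l) (dif C (l - 1)) V"
    unfolding V_def by (rule linear_map_finsum[OF ext.tensor_map_id(1)[OF dCm], symmetric]) (use ext.pure_closed[OF mC q2 mono] in blast)
  finally have 2: "?m (obj C l) (\<beta> l) U \<ominus>\<^bsub>?T (obj C l)\<^esub> Y = ?m (obj C l) (dif C (l - 1)) V" .
  show "\<exists>x'\<in>carrier (obj (laurent_complex R N D) l). \<exists>y'\<in>carrier (obj (laurent_complex R N C) (l - 1)).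
      dif (laurent_complex R N D) l x' = X \<and>
      ?m (obj C l) (\<beta> l) x' \<ominus>\<^bsub>obj (laurent_complex R N C) l\<^esub> Y = dif (laurent_complex R N C) (l - 1) y'"
    using Ucl Vcl 1 2 by (auto simp: laurent_complex_def)
qed

end

end

section \<open>Mapping tori\<close>

context scalar_extension
begin

lemma tensor_map_compose:
  assumes \<phi>: "linear_map R M M1 \<phi>" and \<chi>: "linear_map R M1 M2 \<chi>" and X: "X \<in> carrier (tens M)"
  shows "tensor_map R L \<iota> M2 \<chi> id (tensor_map R L \<iota> M1 \<phi> id X) = tensor_map R L \<iota> M2 (\<lambda>m. \<chi> (\<phi> m)) id X"
proof (rule tens_hom_eqI[OF linear_map_modules(1)[OF \<phi>]
      abelian_group_hom_compose[OF linear_map_abelian_group_hom[OF tensor_map_id(1)[OF \<phi>]] linear_map_abelian_group_hom[OF tensor_map_id(1)[OF \<chi>]]]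
      linear_map_abelian_group_hom[OF tensor_map_id(1)[OF linear_map_compose[OF \<phi> \<chi>]]] _ X])
  fix m p assume m: "m \<in> carrier M" and p: "p \<in> carrier L"
  show "tensor_map R L \<iota> M2 \<chi> id (tensor_map R L \<iota> M1 \<phi> id (pure M m p)) = tensor_map R L \<iota> M2 (\<lambda>m. \<chi> (\<phi> m)) id (pure M m p)"
    unfolding tensor_map_id(2)[OF \<phi> m p] tensor_map_id(2)[OF \<chi> linear_map_closed[OF \<phi> m] p]
      tensor_map_id(2)[OF linear_map_compose[OF \<phi> \<chi>] m p] ..
qed

lemma tensor_map_cong:
  assumes \<phi>: "linear_map R M M' \<phi>" and \<chi>: "linear_map R M M' \<chi>" and eq: "\<And>m. m \<in> carrier M \<Longrightarrow> \<phi> m = \<chi> m"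
    and X: "X \<in> carrier (tens M)"
  shows "tensor_map R L \<iota> M' \<phi> id X = tensor_map R L \<iota> M' \<chi> id X"
  by (rule tens_hom_eqI[OF linear_map_modules(1)[OF \<phi>] linear_map_abelian_group_hom[OF tensor_map_id(1)[OF \<phi>]]
        linear_map_abelian_group_hom[OF tensor_map_id(1)[OF \<chi>]] _ X])
    (simp add: tensor_map_id(2)[OF \<phi>] tensor_map_id(2)[OF \<chi>] eq)

lemma tensor_map_square:
  assumes "linear_map R M M1 \<phi>" "linear_map R M1 M2 \<chi>" "linear_map R M M1' \<phi>'" "linear_map R M1' M2 \<chi>'"
    "\<And>m. m \<in> carrier M \<Longrightarrow> \<chi> (\<phi> m) = \<chi>' (\<phi>' m)" "X \<in> carrier (tens M)"
  shows "tensor_map R L \<iota> M2 \<chi> id (tensor_map R L \<iota> M1 \<phi> id X) = tensor_map R L \<iota> M2 \<chi>' id (tensor_map R L \<iota> M1' \<phi>' id X)"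
  unfolding tensor_map_compose[OF assms(1,2,6)] tensor_map_compose[OF assms(3,4,6)]
  by (rule tensor_map_cong[OF linear_map_compose[OF assms(1,2)] linear_map_compose[OF assms(3,4)] assms(5,6)])

lemma tens_zero_module:
  assumes M: "right_module R M" and zero: "carrier M = {\<zero>\<^bsub>M\<^esub>}"
  shows "carrier (tens M) = {\<zero>\<^bsub>tens M\<^esub>}"
proof -
  interpret T: right_module L "tens M" by (rule right_module_tens[OF M])
  have "X = \<zero>\<^bsub>tens M\<^esub>" if X: "X \<in> carrier (tens M)" for X
  proof (rule tens_hom_eqI[OF M linear_map_abelian_group_hom[OF linear_map_ident[OF T.right_module_axioms]]
        linear_map_abelian_group_hom[OF linear_map_const_zero[OF T.right_module_axioms T.right_module_axioms]] _ X])
    fix m p assume "m \<in> carrier M" "p \<in> carrier L"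
    then show "pure M m p = \<zero>\<^bsub>tens M\<^esub>" using abelian_group_hom.hom_zero[OF pure_left_hom[OF M]] zero by auto
  qed
  then show ?thesis by auto
qed

end

section \<open>The mapping torus as an instance of the perturbation data\<close>

context ring
begin

context
  fixes N :: "nat set"
begin

interpretation ext: scalar_extension R "laurent R N" "laurent_const R"
  by (rule scalar_extension_laurent)

abbreviation tmap where "tmap M \<phi> \<equiv> laurent_tensor_map R N M \<phi> id"
abbreviation vmap where "vmap M k \<equiv> laurent_tensor_map R N M id (\<lambda>p. laurent_var R k \<otimes>\<^bsub>laurent R N\<^esub> p)"
abbreviation "ltens \<equiv> \<lambda>M. laurent_tensor R N M"

lemma vmap_linear:
  assumes k: "k \<in> N" and M: "right_module R M"
  shows "linear_map (laurent R N) (ltens M) (ltens M) (vmap M k)"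
    "m \<in> carrier M \<Longrightarrow> p \<in> carrier (laurent R N) \<Longrightarrow> vmap M k (ext.pure M m p) = ext.pure M m (laurent_var R k \<otimes>\<^bsub>laurent R N\<^esub> p)"
proof -
  note v = laurent_var_closed[OF k]
  have hom: "abelian_group_hom (laurent R N) (laurent R N) (\<lambda>p. laurent_var R k \<otimes>\<^bsub>laurent R N\<^esub> p)"
    by (rule abelian_group_homI[OF abelian_group_laurent abelian_group_laurent]) (simp_all add: v ext.L.r_distr)
  have id: "linear_map R M M id" using linear_map_ident[OF M] by (simp add: id_def)
  show "linear_map (laurent R N) (ltens M) (ltens M) (vmap M k)"
    by (rule ext.tensor_map_linear[OF id hom]) (simp_all add: laurent_var_const[OF k] ext.L.m_assoc v)
  show "vmap M k (ext.pure M m p) = ext.pure M m (laurent_var R k \<otimes>\<^bsub>laurent R N\<^esub> p)"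
    if "m \<in> carrier M" "p \<in> carrier (laurent R N)"
    using ext.tensor_map_pure_hom(2)[OF id hom _ that] laurent_var_const[OF k] by simp
qed

text \<open>One map acts on the first tensor factor, the other on the second.\<close>

lemma tmap_vmap:
  assumes k: "k \<in> N" and \<phi>: "linear_map R M M' \<phi>" and X: "X \<in> carrier (ltens M)"
  shows "tmap M' \<phi> (vmap M k X) = vmap M' k (tmap M' \<phi> X)"
proof -
  have M: "right_module R M" and M': "right_module R M'" using \<phi> by (auto dest: linear_map_modules)
  note v = vmap_linear[OF k M] and v' = vmap_linear[OF k M']
  show ?thesis
  proof (rule ext.tens_hom_eqI[OF M
        abelian_group_hom_compose[OF linear_map_abelian_group_hom[OF v(1)] linear_map_abelian_group_hom[OF ext.tensor_map_id(1)[OF \<phi>]]]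
        abelian_group_hom_compose[OF linear_map_abelian_group_hom[OF ext.tensor_map_id(1)[OF \<phi>]] linear_map_abelian_group_hom[OF v'(1)]] _ X])
    fix m p assume m: "m \<in> carrier M" and p: "p \<in> carrier (laurent R N)"
    note kp = laurent_mult_closed[OF laurent_var_closed[OF k] p]
    show "tmap M' \<phi> (vmap M k (ext.pure M m p)) = vmap M' k (tmap M' \<phi> (ext.pure M m p))"
      unfolding v(2)[OF m p] ext.tensor_map_id(2)[OF \<phi> m p] ext.tensor_map_id(2)[OF \<phi> m kp] v'(2)[OF linear_map_closed[OF \<phi> m] p] ..
  qed
qed

lemma vmap_commute:
  assumes j: "j \<in> N" and k: "k \<in> N" and M: "right_module R M" and X: "X \<in> carrier (ltens M)"
  shows "vmap M j (vmap M k X) = vmap M k (vmap M j X)"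
proof (rule ext.tens_hom_eqI[OF M
      abelian_group_hom_compose[OF linear_map_abelian_group_hom[OF vmap_linear(1)[OF k M]] linear_map_abelian_group_hom[OF vmap_linear(1)[OF j M]]]
      abelian_group_hom_compose[OF linear_map_abelian_group_hom[OF vmap_linear(1)[OF j M]] linear_map_abelian_group_hom[OF vmap_linear(1)[OF k M]]] _ X])
  fix m p assume m: "m \<in> carrier M" and p: "p \<in> carrier (laurent R N)"
  note kp = laurent_mult_closed[OF laurent_var_closed[OF k] p] and jp = laurent_mult_closed[OF laurent_var_closed[OF j] p]
  show "vmap M j (vmap M k (ext.pure M m p)) = vmap M k (vmap M j (ext.pure M m p))"
    unfolding vmap_linear(2)[OF k M m p] vmap_linear(2)[OF j M m p] vmap_linear(2)[OF j M m kp] vmap_linear(2)[OF k M m jp]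
      laurent_var_commute[OF j k p] ..
qed

lemma laurent_multicomplex:
  assumes C: "cochain_complex R C" and N: "finite N"
  shows "multicomplex (laurent R N) N (\<lambda>l. ltens (obj C l)) (\<lambda>l. tmap (obj C (l + 1)) (dif C l)) (\<lambda>k l. vmap (obj C l) k)"
proof -
  note mC = cochain_complexD(2)[OF C] and d = cochain_complexD(1)[OF C]
  show ?thesis
  proof (rule multicomplex.intro[OF module_family.intro[OF ext.right_module_tens[OF mC] N]], rule multicomplex_axioms.intro)
    fix l
    show "linear_map (laurent R N) (ltens (obj C l)) (ltens (obj C (l + 1))) (tmap (obj C (l + 1)) (dif C l))"
      by (rule ext.tensor_map_id(1)[OF d])
    fix y assume y: "y \<in> carrier (ltens (obj C l))"
    have d1: "linear_map R (obj C (l + 1)) (obj C (l + 2)) (dif C (l + 1))" using d[of "l + 1"] by (simp add: add.assoc)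
    interpret T2: right_module "laurent R N" "ltens (obj C (l + 2))" by (rule ext.right_module_tens[OF mC])
    have "tmap (obj C (l + 2)) (\<lambda>m. dif C (l + 1) (dif C l m)) y = \<zero>\<^bsub>ltens (obj C (l + 2))\<^esub>"
      by (rule ext.tens_hom_eqI[OF mC linear_map_abelian_group_hom[OF ext.tensor_map_id(1)[OF linear_map_compose[OF d d1]]]
            linear_map_abelian_group_hom[OF linear_map_const_zero[OF ext.right_module_tens[OF mC] ext.right_module_tens[OF mC]]] _ y])
        (use abelian_group_hom.hom_zero[OF ext.pure_left_hom[OF mC]] in
          \<open>simp add: ext.tensor_map_id(2)[OF linear_map_compose[OF d d1]] cochain_complexD(4)[OF C]\<close>)
    then show "tmap (obj C (l + 1 + 1)) (dif C (l + 1)) (tmap (obj C (l + 1)) (dif C l) y) = \<zero>\<^bsub>ltens (obj C (l + 2))\<^esub>"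
      using ext.tensor_map_compose[OF d d1 y] by (simp add: add.assoc)
    fix k assume k: "k \<in> N"
    show "tmap (obj C (l + 1)) (dif C l) (vmap (obj C l) k y) = vmap (obj C (l + 1)) k (tmap (obj C (l + 1)) (dif C l) y)"
      by (rule tmap_vmap[OF k d y])
    fix j assume j: "j \<in> N"
    show "vmap (obj C l) j (vmap (obj C l) k y) = vmap (obj C l) k (vmap (obj C l) j y)"
      by (rule vmap_commute[OF j k mC y])
  next
    fix k l assume "k \<in> N"
    then show "linear_map (laurent R N) (ltens (obj C l)) (ltens (obj C l)) (vmap (obj C l) k)"
      by (rule vmap_linear(1)[OF _ mC])
  qed
qed

context
  fixes D :: "('a, 'd) cochain" and h :: "nat \<Rightarrow> int \<Rightarrow> 'd \<Rightarrow> 'd" and G :: "int \<Rightarrow> 'd \<Rightarrow> 'd"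
  assumes N: "finite N" and D: "cochain_complex R D"
    and h: "\<And>k. k \<in> N \<Longrightarrow> cochain_map R D D (h k)"
    and hh: "\<And>j k l x. j \<in> N \<Longrightarrow> k \<in> N \<Longrightarrow> x \<in> carrier (obj D l) \<Longrightarrow> h j l (h k l x) = h k l (h j l x)"
    and G: "\<And>l. linear_map R (obj D l) (obj D (l - 1)) (G l)"
begin

abbreviation "MD \<equiv> \<lambda>l. ltens (obj D l)"
abbreviation "hL \<equiv> \<lambda>k l. tmap (obj D l) (h k l)"
abbreviation "GL \<equiv> \<lambda>l. tmap (obj D (l - 1)) (G l)"

lemma zigzag_base: "zigzag_data R N (obj D) h G"
  by (rule zigzag_data.intro) (rule cochain_mapD(3)[OF h], assumption, rule G, rule N)

lemma zigzag_laurent: "zigzag_data (laurent R N) N MD hL GL"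
  by (rule zigzag_data.intro)
    (rule ext.tensor_map_id(1)[OF cochain_mapD(3)[OF h]], assumption, rule ext.tensor_map_id(1)[OF G], rule N)

lemma laurent_homotopy_data:
  "homotopy_data (laurent R N) N MD hL GL (\<lambda>l. tmap (obj D (l + 1)) (dif D l)) (\<lambda>k l. vmap (obj D l) k)"
proof (rule homotopy_data.intro[OF zigzag_laurent laurent_multicomplex[OF D N]], rule homotopy_data_axioms.intro)
  fix k l y assume k: "k \<in> N" and y: "y \<in> carrier (MD l)"
  note hk = cochain_mapD(3)[OF h[OF k]]
  show "tmap (obj D (l + 1)) (dif D l) (hL k l y) = hL k (l + 1) (tmap (obj D (l + 1)) (dif D l) y)"
    by (rule ext.tensor_map_square[OF hk cochain_complexD(1)[OF D] cochain_complexD(1)[OF D] hk _ y])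
      (rule cochain_mapD(4)[OF h[OF k], symmetric])
  show "GL l (vmap (obj D l) k y) = vmap (obj D (l - 1)) k (GL l y)"
    by (rule tmap_vmap[OF k G y])
  fix j assume j: "j \<in> N"
  show "hL k l (hL j l y) = hL j l (hL k l y)"
    by (rule ext.tensor_map_square[OF cochain_mapD(3)[OF h[OF j]] hk hk cochain_mapD(3)[OF h[OF j]] _ y]) (rule hh[OF k j])
  show "hL k l (vmap (obj D l) j y) = vmap (obj D l) j (hL k l y)"
    by (rule tmap_vmap[OF j hk y])
qed

lemma zigzag_pure:
  "ks \<noteq> [] \<Longrightarrow> set ks \<subseteq> N \<Longrightarrow> m \<in> carrier (obj D l) \<Longrightarrow> p \<in> carrier (laurent R N) \<Longrightarrow>
    zigzag hL GL ks l (ext.pure (obj D l) m p) = ext.pure (obj D (l + 1 - int (length ks))) (zigzag h G ks l m) p"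
proof (induction ks)
  case (Cons k ks)
  then have k: "k \<in> N" by simp
  note hk = cochain_mapD(3)[OF h[OF k]]
  show ?case
  proof (cases "ks = []")
    case True
    then show ?thesis using ext.tensor_map_id(2)[OF hk Cons.prems(3,4)] by (simp add: id_def)
  next
    case False
    interpret zigzag_data R N "obj D" h G by (rule zigzag_base)
    let ?n = "l + 1 - int (length ks)"
    have e: "?n - 1 = l - int (length ks)" "l + 1 - int (length (k # ks)) = l - int (length ks)" by simp_all
    have sub: "set ks \<subseteq> N" using Cons.prems(2) by simp
    note z = linear_map_closed[OF zigzag_linear[OF False sub] Cons.prems(3)]
    have Gn: "linear_map R (obj D ?n) (obj D (l - int (length ks))) (G ?n)" using G[of ?n] unfolding e .
    note gz = linear_map_closed[OF Gn z]
    have "GL ?n (zigzag hL GL ks l (ext.pure (obj D l) m p))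
        = ext.pure (obj D (l - int (length ks))) (G ?n (zigzag h G ks l m)) p"
      unfolding Cons.IH[OF False sub Cons.prems(3,4)] e by (rule ext.tensor_map_id(2)[OF Gn z Cons.prems(4)])
    then show ?thesis
      unfolding zigzag_Cons[OF False] e using ext.tensor_map_id(2)[OF hk gz Cons.prems(4)] by simp
  qed
qed simp

text \<open>The torus tensors the finished sum H_S with L, whereas the operator P is assembled from
  maps that are already tensored. Both are additive and agree on pure tensors.\<close>

lemma alternating_zigzag_laurent:
  assumes S: "S \<noteq> {}" "S \<subseteq> N" and X: "X \<in> carrier (MD l)"
  shows "tmap (obj D (l + 1 - int (card S))) (alternating_zigzag (obj D) h G S l) X = alternating_zigzag MD hL GL S l X"
proof -
  interpret B: zigzag_data R N "obj D" h G by (rule zigzag_base)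
  interpret Z: zigzag_data "laurent R N" N MD hL GL by (rule zigzag_laurent)
  note mD = cochain_complexD(2)[OF D]
  let ?n = "l + 1 - int (card S)"
  have fin: "finite S" using S N finite_subset by blast
  interpret K: right_module R "obj D ?n" by (rule mD)
  interpret T: right_module "laurent R N" "MD ?n" by (rule ext.right_module_tens[OF mD])
  note lin = B.alternating_zigzag_linear[OF S, of l]
  show ?thesis
  proof (rule ext.tens_hom_eqI[OF mD linear_map_abelian_group_hom[OF ext.tensor_map_id(1)[OF lin]]
        linear_map_abelian_group_hom[OF Z.alternating_zigzag_linear[OF S]] _ X])
    fix m p assume m: "m \<in> carrier (obj D l)" and p: "p \<in> carrier (laurent R N)"
    let ?z = "\<lambda>\<sigma>. zigzag h G (map \<sigma> (sorted_list_of_set S)) l m"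
    have ks: "map \<sigma> (sorted_list_of_set S) \<noteq> []" "set (map \<sigma> (sorted_list_of_set S)) \<subseteq> N" "length (map \<sigma> (sorted_list_of_set S)) = card S"
      if "\<sigma> permutes S" for \<sigma>
      using permutes_image[OF that] fin S by auto
    have z: "?z \<sigma> \<in> carrier (obj D ?n)" if "\<sigma> permutes S" for \<sigma>
      using linear_map_closed[OF B.zigzag_linear[OF ks(1,2)[OF that]] m] unfolding ks(3)[OF that] .
    note ph = ext.pure_left_hom[OF mD p]
    have "tmap (obj D ?n) (alternating_zigzag (obj D) h G S l) (ext.pure (obj D l) m p)
        = ext.pure (obj D ?n) (\<Oplus>\<^bsub>obj D ?n\<^esub>\<sigma>\<in>{\<sigma>. \<sigma> permutes S}. [(sign \<sigma>)] \<cdot>\<^bsub>obj D ?n\<^esub> ?z \<sigma>) p"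
      unfolding ext.tensor_map_id(2)[OF lin m p] by (simp only: alternating_zigzag_def)
    also have "\<dots> = (\<Oplus>\<^bsub>MD ?n\<^esub>\<sigma>\<in>{\<sigma>. \<sigma> permutes S}. ext.pure (obj D ?n) ([(sign \<sigma>)] \<cdot>\<^bsub>obj D ?n\<^esub> ?z \<sigma>) p)"
      by (rule abelian_group_hom.hom_finsum[OF ph]) (use z in \<open>auto intro!: K.M.int_smult_closed\<close>)
    also have "\<dots> = (\<Oplus>\<^bsub>MD ?n\<^esub>\<sigma>\<in>{\<sigma>. \<sigma> permutes S}. [(sign \<sigma>)] \<cdot>\<^bsub>MD ?n\<^esub>
        zigzag hL GL (map \<sigma> (sorted_list_of_set S)) l (ext.pure (obj D l) m p))"
    proof (rule T.M.finsum_cong'[OF refl])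
      have zp: "zigzag hL GL (map \<sigma> (sorted_list_of_set S)) l (ext.pure (obj D l) m p) = ext.pure (obj D ?n) (?z \<sigma>) p" if "\<sigma> permutes S" for \<sigma>
        using zigzag_pure[OF ks(1,2)[OF that] m p] unfolding ks(3)[OF that] .
      show "(\<lambda>\<sigma>. [(sign \<sigma>)] \<cdot>\<^bsub>MD ?n\<^esub> zigzag hL GL (map \<sigma> (sorted_list_of_set S)) l (ext.pure (obj D l) m p)) \<in> {\<sigma>. \<sigma> permutes S} \<rightarrow> carrier (MD ?n)"
        using zp ext.pure_closed[OF mD z p] by (auto intro!: T.M.int_smult_closed)
      fix \<sigma> assume "\<sigma> \<in> {\<sigma>. \<sigma> permutes S}"
      then have s: "\<sigma> permutes S" by simp
      show "ext.pure (obj D ?n) ([(sign \<sigma>)] \<cdot>\<^bsub>obj D ?n\<^esub> ?z \<sigma>) p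
          = [(sign \<sigma>)] \<cdot>\<^bsub>MD ?n\<^esub> zigzag hL GL (map \<sigma> (sorted_list_of_set S)) l (ext.pure (obj D l) m p)"
        unfolding zp[OF s] by (rule abelian_group_hom.hom_int_smult[OF ph z[OF s]])
    qed
    also have "\<dots> = alternating_zigzag MD hL GL S l (ext.pure (obj D l) m p)" by (simp only: alternating_zigzag_def)
    finally show "tmap (obj D ?n) (alternating_zigzag (obj D) h G S l) (ext.pure (obj D l) m p)
        = alternating_zigzag MD hL GL S l (ext.pure (obj D l) m p)" .
  qed
qed

context
  fixes C :: "('a, 'c) cochain" and \<alpha> :: "int \<Rightarrow> 'c \<Rightarrow> 'd" and \<beta> :: "int \<Rightarrow> 'd \<Rightarrow> 'c"
  assumes \<alpha>: "cochain_map R C D \<alpha>" and \<beta>: "cochain_map R D C \<beta>"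
    and homotopy: "\<And>l x. x \<in> carrier (obj D l) \<Longrightarrow>
      dif D (l - 1) (G l x) \<oplus>\<^bsub>obj D l\<^esub> G (l + 1) (dif D l x) = \<alpha> l (\<beta> l x) \<ominus>\<^bsub>obj D l\<^esub> x"
begin

text \<open>Relations among maps of the form \<phi> \<otimes> 1 are inherited from R by
  functoriality or by testing pure tensors; those that involve a variable hold because the variables
  act on the other factor.\<close>

lemma laurent_derived_data:
  "derived_data (laurent R N) N MD hL GL (\<lambda>l. tmap (obj D (l + 1)) (dif D l)) (\<lambda>k l. vmap (obj D l) k)
    (\<lambda>l. ltens (obj C l)) (\<lambda>l. tmap (obj C (l + 1)) (dif C l)) (\<lambda>k l. vmap (obj C l) k)
    (\<lambda>l. tmap (obj D l) (\<alpha> l)) (\<lambda>l. tmap (obj C l) (\<beta> l))"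
proof -
  note C = cochain_mapD(1)[OF \<alpha>] and a = cochain_mapD(3)[OF \<alpha>] and b = cochain_mapD(3)[OF \<beta>]
  note mD = cochain_complexD(2)[OF D] and mC = cochain_complexD(2)[OF C]
  note dD = cochain_complexD(1)[OF D] and dC = cochain_complexD(1)[OF C]
  show ?thesis
  proof (rule derived_data.intro[OF laurent_homotopy_data laurent_multicomplex[OF C N]], rule derived_data_axioms.intro)
    fix l
    show "linear_map (laurent R N) (ltens (obj C l)) (MD l) (tmap (obj D l) (\<alpha> l))" by (rule ext.tensor_map_id(1)[OF a])
    show "linear_map (laurent R N) (MD l) (ltens (obj C l)) (tmap (obj C l) (\<beta> l))" by (rule ext.tensor_map_id(1)[OF b])
    show "tmap (obj D (l + 1)) (\<alpha> (l + 1)) (tmap (obj C (l + 1)) (dif C l) y) = tmap (obj D (l + 1)) (dif D l) (tmap (obj D l) (\<alpha> l) y)"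
      if "y \<in> carrier (ltens (obj C l))" for y
      by (rule ext.tensor_map_square[OF dC a a dD _ that]) (rule cochain_mapD(4)[OF \<alpha>])
    show "tmap (obj D l) (\<alpha> l) (vmap (obj C l) k y) = vmap (obj D l) k (tmap (obj D l) (\<alpha> l) y)"
      if "k \<in> N" "y \<in> carrier (ltens (obj C l))" for k y
      by (rule tmap_vmap[OF that(1) a that(2)])
    fix y assume y: "y \<in> carrier (MD l)"
    show "tmap (obj C (l + 1)) (\<beta> (l + 1)) (tmap (obj D (l + 1)) (dif D l) y) = tmap (obj C (l + 1)) (dif C l) (tmap (obj C l) (\<beta> l) y)"
      by (rule ext.tensor_map_square[OF dD b b dC _ y]) (rule cochain_mapD(4)[OF \<beta>])
    show "tmap (obj C l) (\<beta> l) (vmap (obj D l) k y) = vmap (obj C l) k (tmap (obj C l) (\<beta> l) y)" if "k \<in> N" for k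
      by (rule tmap_vmap[OF that b y])
    have e: "l - 1 + 1 = l" "l + 1 - 1 = l" by simp_all
    note dm = dD[of "l - 1", unfolded e] and G1 = G[of "l + 1", unfolded e]
    interpret T: right_module "laurent R N" "MD l" by (rule ext.right_module_tens[OF mD])
    interpret D0: right_module R "obj D l" by (rule mD)
    have "tmap (obj D l) (dif D (l - 1)) (GL l y) \<oplus>\<^bsub>MD l\<^esub> tmap (obj D l) (G (l + 1)) (tmap (obj D (l + 1)) (dif D l) y)
        = tmap (obj D l) (\<alpha> l) (tmap (obj C l) (\<beta> l) y) \<ominus>\<^bsub>MD l\<^esub> y"
    proof (rule ext.tens_hom_eqI[OF mD linear_map_abelian_group_hom[OF linear_map_plus[OF
            linear_map_compose[OF ext.tensor_map_id(1)[OF G] ext.tensor_map_id(1)[OF dm]]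
            linear_map_compose[OF ext.tensor_map_id(1)[OF dD] ext.tensor_map_id(1)[OF G1]]]]
          linear_map_abelian_group_hom[OF linear_map_diff[OF
            linear_map_compose[OF ext.tensor_map_id(1)[OF b] ext.tensor_map_id(1)[OF a]]
            linear_map_ident[OF ext.right_module_tens[OF mD]]]] _ y])
      fix m p assume m: "m \<in> carrier (obj D l)" and p: "p \<in> carrier (laurent R N)"
      note gm = linear_map_closed[OF G m] and dmm = linear_map_closed[OF dD m] and bm = linear_map_closed[OF b m]
      note ph = ext.pure_left_hom[OF mD p]
      show "tmap (obj D l) (dif D (l - 1)) (GL l (ext.pure (obj D l) m p))
          \<oplus>\<^bsub>MD l\<^esub> tmap (obj D l) (G (l + 1)) (tmap (obj D (l + 1)) (dif D l) (ext.pure (obj D l) m p))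
        = tmap (obj D l) (\<alpha> l) (tmap (obj C l) (\<beta> l) (ext.pure (obj D l) m p)) \<ominus>\<^bsub>MD l\<^esub> ext.pure (obj D l) m p"
        unfolding ext.tensor_map_id(2)[OF G m p] ext.tensor_map_id(2)[OF dm gm p] ext.tensor_map_id(2)[OF dD m p]
          ext.tensor_map_id(2)[OF G1 dmm p] ext.tensor_map_id(2)[OF b m p] ext.tensor_map_id(2)[OF a bm p]
          abelian_group_hom.hom_add[OF ph linear_map_closed[OF dm gm] linear_map_closed[OF G1 dmm], symmetric]
          abelian_group_hom.hom_minus[OF ph linear_map_closed[OF a bm] m, symmetric] homotopy[OF m] ..
    qed
    then show "tmap (obj D (l - 1 + 1)) (dif D (l - 1)) (GL l y) \<oplus>\<^bsub>MD l\<^esub> GL (l + 1) (tmap (obj D (l + 1)) (dif D l) y)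
        = tmap (obj D l) (\<alpha> l) (tmap (obj C l) (\<beta> l) y) \<ominus>\<^bsub>MD l\<^esub> y"
      unfolding e .
  qed
qed

text \<open>Functoriality turns the entries of the cube, which are formed over R and then tensored,
  into composites of tensored maps. In this form they match the derived data over the Laurent
  ring.\<close>

lemma laurent_cube_entries:
  fixes F defines "F \<equiv> laurent_cube R N (derived_cube C D \<alpha> \<beta> G h)"
  shows "obj (base F) = (\<lambda>l. ltens (obj C l))" "dif (base F) = (\<lambda>l. tmap (obj C (l + 1)) (dif C l))"
    "k \<in> N \<Longrightarrow> y \<in> carrier (ltens (obj C l)) \<Longrightarrow>
      edge F k l y = tmap (obj C l) (\<beta> l) (hL k l (tmap (obj D l) (\<alpha> l) y)) \<ominus>\<^bsub>ltens (obj C l)\<^esub> vmap (obj C l) k y"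
    "S \<subseteq> N \<Longrightarrow> card S \<ge> 2 \<Longrightarrow> y \<in> carrier (ltens (obj C l)) \<Longrightarrow>
      higher F S l y = tmap (obj C (l + 1 - int (card S))) (\<beta> (l + 1 - int (card S)))
        (alternating_zigzag MD hL GL S l (tmap (obj D l) (\<alpha> l) y))"
proof -
  note a = cochain_mapD(3)[OF \<alpha>] and b = cochain_mapD(3)[OF \<beta>]
  show "obj (base F) = (\<lambda>l. ltens (obj C l))" "dif (base F) = (\<lambda>l. tmap (obj C (l + 1)) (dif C l))"
    by (simp_all add: F_def laurent_cube_def derived_cube_def)
  assume y: "y \<in> carrier (ltens (obj C l))"
  note ay = linear_map_closed[OF ext.tensor_map_id(1)[OF a] y]
  show "edge F k l y = tmap (obj C l) (\<beta> l) (hL k l (tmap (obj D l) (\<alpha> l) y)) \<ominus>\<^bsub>ltens (obj C l)\<^esub> vmap (obj C l) k y" if k: "k \<in> N"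
  proof -
    note hk = cochain_mapD(3)[OF h[OF k]]
    show ?thesis
      unfolding ext.tensor_map_compose[OF hk b ay] ext.tensor_map_compose[OF a linear_map_compose[OF hk b] y]
      by (simp add: F_def laurent_cube_def derived_cube_def)
  qed
  show "higher F S l y = tmap (obj C (l + 1 - int (card S))) (\<beta> (l + 1 - int (card S)))
        (alternating_zigzag MD hL GL S l (tmap (obj D l) (\<alpha> l) y))" if S: "S \<subseteq> N" "card S \<ge> 2"
  proof -
    have ne: "S \<noteq> {}" using S(2) by auto
    interpret B: zigzag_data R N "obj D" h G by (rule zigzag_base)
    note z = B.alternating_zigzag_linear[OF ne S(1), of l]
    show ?thesis
      unfolding alternating_zigzag_laurent[OF ne S(1) ay, symmetric] ext.tensor_map_compose[OF z b ay]
        ext.tensor_map_compose[OF a linear_map_compose[OF z b] y]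
      by (simp add: F_def laurent_cube_def derived_cube_def alternating_zigzag_def[abs_def])
  qed
qed

end

end

end

end

text \<open>The summand of a set A is shifted up by |A|, so the bound grows by at most |N|.\<close>

lemma bounded_above_laurent_total:
  assumes C: "cochain_complex R C" and N: "finite N" and bounded: "bounded_above C"
    and objX: "\<And>l. obj X l = total_module N (\<lambda>l. laurent_tensor R N (obj C l)) l"
  shows "bounded_above X"
proof -
  interpret R: ring R using C by (rule cochain_complexD)
  interpret ext: scalar_extension R "laurent R N" "laurent_const R" by (rule R.scalar_extension_laurent)
  note mC = cochain_complexD(2)[OF C]
  interpret F: module_family "laurent R N" N "\<lambda>l. laurent_tensor R N (obj C l)"
    by (rule module_family.intro[OF ext.right_module_tens[OF mC] N])
  obtain m where m: "\<And>l. l > m \<Longrightarrow> carrier (obj C l) = {\<zero>\<^bsub>obj C l\<^esub>}" using bounded by (auto simp: bounded_above_def)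
  have "carrier (obj X l) = {\<zero>\<^bsub>obj X l\<^esub>}" if l: "l > m + int (card N)" for l
  proof -
    interpret T: right_module "laurent R N" "total_module N (\<lambda>l. laurent_tensor R N (obj C l)) l" by (rule F.total_right_module)
    have "v = \<zero>\<^bsub>total_module N (\<lambda>l. laurent_tensor R N (obj C l)) l\<^esub>"
      if v: "v \<in> carrier (total_module N (\<lambda>l. laurent_tensor R N (obj C l)) l)" for v
    proof (rule direct_sum_eqI[OF v T.M.zero_closed])
      fix A assume A: "A \<in> Pow N"
      have "card A \<le> card N" using A N by (auto intro: card_mono)
      then have "l - int (card A) > m" using l by linarith
      from ext.tens_zero_module[OF mC m[OF this]] F.total_component[OF v A]
      show "v A = \<zero>\<^bsub>total_module N (\<lambda>l. laurent_tensor R N (obj C l)) l\<^esub> A" using A by (simp add: direct_sum_simps)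
    qed
    then show ?thesis unfolding objX using T.M.zero_closed by blast
  qed
  then show ?thesis unfolding bounded_above_def by blast
qed

text \<open>Y and Z are derived data over the same maps on D \<otimes> L, so one and the same P
  occurs in both differentials; the comparison rests on this. The objects are recorded because
  boundedness and lifting are checked on them.\<close>

lemma mapping_torus_comparison:
  fixes R :: "('r, 'x) ring_scheme" and C :: "('r, 'c) cochain" and D :: "('r, 'd) cochain"
  assumes N: "finite N" and D: "cochain_complex R D"
    and h: "\<And>k. k \<in> N \<Longrightarrow> cochain_map R D D (h k)"
    and hh: "\<And>j k l x. \<lbrakk>j \<in> N; k \<in> N; x \<in> carrier (obj D l)\<rbrakk> \<Longrightarrow> h j l (h k l x) = h k l (h j l x)"
    and \<alpha>: "cochain_map R C D \<alpha>" and \<beta>: "cochain_map R D C \<beta>"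
    and G: "cochain_homotopy R D D G (\<lambda>l. id) (\<lambda>l. \<alpha> l \<circ> \<beta> l)"
  defines "Y \<equiv> mapping_torus R N (derived_cube D D (\<lambda>l. \<alpha> l \<circ> \<beta> l) (\<lambda>l. id) G h)"
    and "Z \<equiv> mapping_torus R N (derived_cube C D \<alpha> \<beta> G h)"
    and "J \<equiv> diagonal_map R N C \<beta>"
  shows "cochain_map (laurent R N) Y Z J"
    and "cone_exact D C \<beta> \<Longrightarrow> cone_exact Y Z J"
    and "obj Y l = total_module N (\<lambda>l. laurent_tensor R N (obj D l)) l"
    and "obj Z l = total_module N (\<lambda>l. laurent_tensor R N (obj C l)) l"
proof -
  interpret R: ring R using D by (rule cochain_complexD)
  interpret ext: scalar_extension R "laurent R N" "laurent_const R" by (rule R.scalar_extension_laurent)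
  note C = cochain_mapD(1)[OF \<alpha>]
  note mD = cochain_complexD(2)[OF D] and mC = cochain_complexD(2)[OF C]
  note a = cochain_mapD(3)[OF \<alpha>] and b = cochain_mapD(3)[OF \<beta>]
  have Gl: "linear_map R (obj D l) (obj D (l - 1)) (G l)" for l
    using G mD by (simp add: cochain_homotopy_def linear_map_def)
  have hom: "dif D (l - 1) (G l x) \<oplus>\<^bsub>obj D l\<^esub> G (l + 1) (dif D l x) = \<alpha> l (\<beta> l x) \<ominus>\<^bsub>obj D l\<^esub> x" if "x \<in> carrier (obj D l)" for l x
    using G that by (simp add: cochain_homotopy_def)
  have idl: "linear_map R (obj D l) (obj D l) id" for l using linear_map_ident[OF mD] by (simp add: id_def)
  have abl: "linear_map R (obj D l) (obj D l) (\<alpha> l \<circ> \<beta> l)" for l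
    using linear_map_compose[OF b a] by (simp add: comp_def)
  have \<alpha>\<beta>: "cochain_map R D D (\<lambda>l. \<alpha> l \<circ> \<beta> l)"
    using D abl cochain_mapD(4)[OF \<beta>] cochain_mapD(4)[OF \<alpha> linear_map_closed[OF b]] by (simp add: cochain_map_def linear_map_def)
  have \<iota>d: "cochain_map R D D (\<lambda>l. id)"
    using D idl by (simp add: cochain_map_def linear_map_def)
  have hom': "dif D (l - 1) (G l x) \<oplus>\<^bsub>obj D l\<^esub> G (l + 1) (dif D l x) = (\<alpha> l \<circ> \<beta> l) (id x) \<ominus>\<^bsub>obj D l\<^esub> x" if "x \<in> carrier (obj D l)" for l x
    using hom[OF that] by simp
  let ?T = "\<lambda>M. laurent_tensor R N M"
  let ?t = "\<lambda>M \<phi>. laurent_tensor_map R N M \<phi> id"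
  let ?v = "\<lambda>M k. laurent_tensor_map R N M id (\<lambda>p. laurent_var R k \<otimes>\<^bsub>laurent R N\<^esub> p)"
  let ?MD = "\<lambda>l. ?T (obj D l)" and ?MC = "\<lambda>l. ?T (obj C l)"
  let ?dD = "\<lambda>l. ?t (obj D (l + 1)) (dif D l)" and ?dC = "\<lambda>l. ?t (obj C (l + 1)) (dif C l)"
  let ?xD = "\<lambda>k l. ?v (obj D l) k" and ?xC = "\<lambda>k l. ?v (obj C l) k"
  let ?h = "\<lambda>k l. ?t (obj D l) (h k l)" and ?G = "\<lambda>l. ?t (obj D (l - 1)) (G l)"
  let ?a = "\<lambda>l. ?t (obj D l) (\<alpha> l)" and ?b = "\<lambda>l. ?t (obj C l) (\<beta> l)"
  let ?ab = "\<lambda>l. ?t (obj D l) (\<alpha> l \<circ> \<beta> l)" and ?id = "\<lambda>l. ?t (obj D l) id"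
  interpret Z: derived_data "laurent R N" N ?MD ?h ?G ?dD ?xD ?MC ?dC ?xC ?a ?b
    by (rule R.laurent_derived_data) (fact N D h hh Gl \<alpha> \<beta> hom)+
  \<comment> \<open>The same locale with D in both roles, \<alpha>\<beta> for a and the identity for
    b.\<close>
  interpret Y: derived_data "laurent R N" N ?MD ?h ?G ?dD ?xD ?MD ?dD ?xD ?ab ?id
    by (rule R.laurent_derived_data) (fact N D h hh Gl \<alpha>\<beta> \<iota>d hom')+
  let ?FZ = "laurent_cube R N (derived_cube C D \<alpha> \<beta> G h)"
  let ?FY = "laurent_cube R N (derived_cube D D (\<lambda>l. \<alpha> l \<circ> \<beta> l) (\<lambda>l. id) G h)"
  have eZ: "obj (base ?FZ) = ?MC" "dif (base ?FZ) = ?dC"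
    by (rule R.laurent_cube_entries[OF N D h hh Gl \<alpha> \<beta> hom]; assumption)+
  have eY: "obj (base ?FY) = ?MD" "dif (base ?FY) = ?dD"
    by (rule R.laurent_cube_entries[OF N D h hh Gl \<alpha>\<beta> \<iota>d hom']; assumption)+
  have edgeZ: "edge ?FZ k l y = ?b l (?h k l (?a l y)) \<ominus>\<^bsub>?MC l\<^esub> ?xC k l y" if "k \<in> N" "y \<in> carrier (?MC l)" for k l y
    by (rule R.laurent_cube_entries(3)) (fact N D h hh Gl \<alpha> \<beta> hom that)+
  have edgeY: "edge ?FY k l y = ?id l (?h k l (?ab l y)) \<ominus>\<^bsub>?MD l\<^esub> ?xD k l y" if "k \<in> N" "y \<in> carrier (?MD l)" for k l y
    by (rule R.laurent_cube_entries(3)) (fact N D h hh Gl \<alpha>\<beta> \<iota>d hom' that)+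
  have highZ: "higher ?FZ S l y = ?b (l + 1 - int (card S)) (alternating_zigzag ?MD ?h ?G S l (?a l y))"
    if "S \<subseteq> N" "card S \<ge> 2" "y \<in> carrier (?MC l)" for S l y
    by (rule R.laurent_cube_entries(4)) (fact N D h hh Gl \<alpha> \<beta> hom that)+
  have highY: "higher ?FY S l y = ?id (l + 1 - int (card S)) (alternating_zigzag ?MD ?h ?G S l (?ab l y))"
    if "S \<subseteq> N" "card S \<ge> 2" "y \<in> carrier (?MD l)" for S l y
    by (rule R.laurent_cube_entries(4)) (fact N D h hh Gl \<alpha>\<beta> \<iota>d hom' that)+
  have cZ: "cochain_complex (laurent R N) Z"
    unfolding Z_def mapping_torus_def by (rule Z.cochain_complex_totalisation) (fact eZ edgeZ highZ)+
  have cY: "cochain_complex (laurent R N) Y"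
    unfolding Y_def mapping_torus_def by (rule Y.cochain_complex_totalisation) (fact eY edgeY highY)+
  have dZ: "dif Z l v = Z.derived_differential l v" if "v \<in> carrier (total_module N ?MC l)" for l v
    unfolding Z_def mapping_torus_def by (rule Z.totalisation_dif) (fact eZ edgeZ highZ that)+
  have dY: "dif Y l v = Y.derived_differential l v" if "v \<in> carrier (total_module N ?MD l)" for l v
    unfolding Y_def mapping_torus_def by (rule Y.totalisation_dif) (fact eY edgeY highY that)+
  show oY: "obj Y l = total_module N ?MD l" for l
    unfolding Y_def mapping_torus_def totalisation_def using eY by simp
  show oZ: "obj Z l = total_module N ?MC l" for l
    unfolding Z_def mapping_torus_def totalisation_def using eZ by simp
  have id_eq: "?id l X = X" if X: "X \<in> carrier (?MD l)" for l X
    by (rule ext.tens_hom_eqI[OF mD linear_map_abelian_group_hom[OF ext.tensor_map_id(1)[OF idl]]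
          linear_map_abelian_group_hom[OF linear_map_ident[OF ext.right_module_tens[OF mD]]] _ X])
      (simp only: ext.tensor_map_id(2)[OF idl] id_apply)
  have J: "J l v = diagonal N ?b l v" if v: "v \<in> carrier (total_module N ?MD l)" for l v
    unfolding J_def diagonal_map_def matrix_map_def diagonal_def
  proof (rule restrict_ext)
    fix B assume B: "B \<in> Pow N"
    interpret K: right_module "laurent R N" "?MC (l - int (card B))" by (rule ext.right_module_tens[OF mC])
    have cl: "?b (l - int (card B)) (v B) \<in> carrier (?MC (l - int (card B)))"
      by (rule linear_map_closed[OF ext.tensor_map_id(1)[OF b] Z.M.total_component[OF v B]])
    have "finite (Pow N)" using N by simp
    from K.M.finsum_delta[OF this B, of "\<lambda>A. ?b (l - int (card B)) (v A)"] cl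
    show "(\<Oplus>\<^bsub>?MC (l - int (card B))\<^esub>A\<in>Pow N. if A = B then ?b (l - int (card B)) (v A) else \<zero>\<^bsub>?MC (l - int (card B))\<^esub>)
        = ?b (l - int (card B)) (v B)" by simp
  qed
  have Jlin: "linear_map (laurent R N) (total_module N ?MD l) (total_module N ?MC l) (J l)" for l
    by (rule linear_map_cong[OF Z.bT_linear]) (rule J[symmetric])
  have Jd: "J (l + 1) (dif Y l v) = dif Z l (J l v)" if v: "v \<in> carrier (total_module N ?MD l)" for l v
  proof -
    \<comment> \<open>The argument at which both sides evaluate P: once as \<alpha>\<beta> v, once
      as \<alpha> applied to J v.\<close>
    let ?w = "diagonal N ?a l (diagonal N ?b l v)"
    note bv = linear_map_closed[OF Z.bT_linear v]
    have "diagonal N ?ab l v = ?w"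
      unfolding diagonal_def
    proof (rule restrict_ext)
      fix B assume B: "B \<in> Pow N"
      show "?ab (l - int (card B)) (v B) = ?a (l - int (card B)) ((\<lambda>B\<in>Pow N. ?b (l - int (card B)) (v B)) B)"
        using ext.tensor_map_compose[OF b a Z.M.total_component[OF v B]] B by (simp add: comp_def)
    qed
    moreover have "diagonal N ?id (l + 1) u = u" if u: "u \<in> carrier (total_module N ?MD (l + 1))" for u
      by (rule direct_sum_eqI[OF linear_map_closed[OF Y.bT_linear u] u])
        (simp add: diagonal_def id_eq[OF Z.M.total_component[OF u]])
    moreover note P = linear_map_closed[OF Z.zigzag_operator_linear linear_map_closed[OF Z.aT_linear bv]]
    ultimately have "dif Y l v = Y.dS l v \<oplus>\<^bsub>total_module N ?MD (l + 1)\<^esub> Z.zigzag_operator l ?w"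
      unfolding dY[OF v] Y.derived_differential_def by simp
    moreover have dv: "Y.dS l v \<in> carrier (total_module N ?MD (l + 1))"
      by (rule linear_map_closed[OF Z.M.total_differential_linear v])
    ultimately have "J (l + 1) (dif Y l v) = J (l + 1) (Y.dS l v) \<oplus>\<^bsub>total_module N ?MC (l + 1)\<^esub> J (l + 1) (Z.zigzag_operator l ?w)"
      using linear_map_add[OF Jlin dv P] by simp
    also have "J (l + 1) (Y.dS l v) = Z.dS l (diagonal N ?b l v)"
      unfolding J[OF dv]
      by (rule diagonal_total_differential[where b = ?b, OF Z.M.multicomplex_axioms Z.K.multicomplex_axioms _ _ _ v])
        (rule Z.b_linear, erule Z.b_d, erule (1) Z.b_x)
    also have "J (l + 1) (Z.zigzag_operator l ?w) = diagonal N ?b (l + 1) (Z.zigzag_operator l ?w)" by (rule J[OF P])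
    finally show ?thesis unfolding J[OF v] dZ[OF bv] Z.derived_differential_def .
  qed
  show Jmap: "cochain_map (laurent R N) Y Z J"
    using cY cZ Jlin Jd unfolding cochain_map_def oY oZ linear_map_def by blast
  assume exact: "cone_exact D C \<beta>"
  show "cone_exact Y Z J"
  \<comment> \<open>The leading terms of both torus differentials are the original differentials
    tensored with L, so exactness for J reduces to exactness for \<beta> \<otimes> 1.\<close>
  proof (rule cone_exact_triangular[where M = ?MD and K = ?MC and d = ?dD and dK = ?dC and b = ?b, OF Jmap N oY oZ])
    show "linear_map (laurent R N) (?MD l) (?MD (l + 1)) (?dD l)" for l by (rule Z.M.d_linear)
    show "linear_map (laurent R N) (?MC l) (?MC (l + 1)) (?dC l)" for l by (rule Z.K.d_linear)
    show "linear_map (laurent R N) (?MD l) (?MC l) (?b l)" for l by (rule Z.b_linear)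
    show "J l v B = ?b (l - int (card B)) (v B)" if "v \<in> carrier (total_module N ?MD l)" "B \<in> Pow N" for l v B
      using J[OF that(1)] that(2) by (simp add: diagonal_def)
    show "cone_exact \<lparr>obj = ?MD, dif = ?dD\<rparr> \<lparr>obj = ?MC, dif = ?dC\<rparr> ?b"
      using R.cone_exact_laurent[OF \<beta> exact] unfolding laurent_complex_def .
    show "dif Y l v B = [((-1) ^ card B :: int)] \<cdot>\<^bsub>?MD (l + 1 - int (card B))\<^esub> ?dD (l - int (card B)) (v B)"
      if "v \<in> carrier (total_module N ?MD l)" "B \<in> Pow N" "\<And>A. A \<subset> B \<Longrightarrow> v A = \<zero>\<^bsub>?MD (l - int (card A))\<^esub>" for l v B
      unfolding dY[OF that(1)] by (rule Y.derived_differential_leading[OF that])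
    show "dif Z l v B = [((-1) ^ card B :: int)] \<cdot>\<^bsub>?MC (l + 1 - int (card B))\<^esub> ?dC (l - int (card B)) (v B)"
      if "v \<in> carrier (total_module N ?MC l)" "B \<in> Pow N" "\<And>A. A \<subset> B \<Longrightarrow> v A = \<zero>\<^bsub>?MC (l - int (card A))\<^esub>" for l v B
      unfolding dZ[OF that(1)] by (rule Z.derived_differential_leading[OF that])
  qed
qed

theorem mainTheorem5:
  fixes R :: "('r, 'x) ring_scheme"
    and n :: nat
    and C :: "('r, 'c) cochain" and D :: "('r, 'd) cochain"
    and h :: "nat \<Rightarrow> int \<Rightarrow> 'd \<Rightarrow> 'd"
    and \<alpha> :: "int \<Rightarrow> 'c \<Rightarrow> 'd" and \<beta> :: "int \<Rightarrow> 'd \<Rightarrow> 'c" and G :: "int \<Rightarrow> 'd \<Rightarrow> 'd"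
  defines "N \<equiv> {1..n}"
  defines "L \<equiv> laurent R N"
  defines "Y \<equiv> mapping_torus R N (derived_cube D D (\<lambda>l. \<alpha> l \<circ> \<beta> l) (\<lambda>l. id) G h)"
  defines "Z \<equiv> mapping_torus R N (derived_cube C D \<alpha> \<beta> G h)"
  defines "J \<equiv> diagonal_map R N C \<beta>"
  assumes "ring R"
    and "cochain_complex R D"
    and "\<And>k. k \<in> N \<Longrightarrow> cochain_map R D D (h k)"
    and "\<And>j k l x. \<lbrakk>j \<in> N; k \<in> N; x \<in> carrier (obj D l)\<rbrakk> \<Longrightarrow> h j l (h k l x) = h k l (h j l x)"
    and "cochain_complex R C"
    and "cochain_map R C D \<alpha>"
    and "cochain_map R D C \<beta>"
    and "cochain_homotopy R D D G (\<lambda>l. id) (\<lambda>l. \<alpha> l \<circ> \<beta> l)"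
  shows "cochain_map L Y Z J
    \<and> (quasi_isomorphism D C \<beta> \<longrightarrow> quasi_isomorphism Y Z J)
    \<and> (quasi_isomorphism D C \<beta>
        \<and> bounded_above C \<and> (\<forall>l. projective_module R (obj C l))
        \<and> bounded_above D \<and> (\<forall>l. projective_module R (obj D l))
        \<longrightarrow> homotopy_equivalence L Y Z J)"
proof -
  have N: "finite N" by (simp add: N_def)
  note D = assms(7) and h = assms(8) and hh = assms(9) and C = assms(10) and \<alpha> = assms(11)
    and \<beta> = assms(12) and G = assms(13)
  interpret R: ring R by fact
  interpret ext: scalar_extension R "laurent R N" "laurent_const R" by (rule R.scalar_extension_laurent)
  note mD = cochain_complexD(2)[OF D] and mC = cochain_complexD(2)[OF C]
  have J: "cochain_map (laurent R N) Y Z J"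
    unfolding Y_def Z_def J_def by (rule mapping_torus_comparison(1)) (fact N D h hh \<alpha> \<beta> G)+
  have exact: "cone_exact Y Z J" if "cone_exact D C \<beta>"
    unfolding Y_def Z_def J_def by (rule mapping_torus_comparison(2)) (fact N D h hh \<alpha> \<beta> G that)+
  have oY: "obj Y l = total_module N (\<lambda>l. laurent_tensor R N (obj D l)) l" for l
    unfolding Y_def by (rule mapping_torus_comparison(3)) (fact N D h hh \<alpha> \<beta> G)+
  have oZ: "obj Z l = total_module N (\<lambda>l. laurent_tensor R N (obj C l)) l" for l
    unfolding Z_def by (rule mapping_torus_comparison(4)) (fact N D h hh \<alpha> \<beta> G)+
  note qD = quasi_isomorphism_iff_cone_exact[OF \<beta>] and qY = quasi_isomorphism_iff_cone_exact[OF J]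
  have "homotopy_equivalence (laurent R N) Y Z J"
    if q: "quasi_isomorphism D C \<beta>" and bC: "bounded_above C" and pC: "\<And>l. projective_module R (obj C l)"
      and bD: "bounded_above D" and pD: "\<And>l. projective_module R (obj D l)"
  proof (rule homotopy_equivalence_of_cone_exact[OF J])
    show "cone_exact Y Z J" using q exact qD by blast
    show "bounded_above Y" by (rule bounded_above_laurent_total[OF D N bD oY])
    show "bounded_above Z" by (rule bounded_above_laurent_total[OF C N bC oZ])
    \<comment> \<open>In each degree Y and Z are finite sums of modules of the form Q \<otimes> L
      with Q projective over R, so lifts are found summand by summand.\<close>
    have fin: "finite (Pow N)" using N by simp
    show "lifts_along (laurent R N) (obj Y l) A W g" if "linear_map (laurent R N) A W g" for l A W g
      unfolding oY by (rule lifts_along_direct_sum[OF that fin])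
        (rule ext.right_module_tens[OF mD], rule ext.tens_lifts_along[OF pD that])
    show "lifts_along (laurent R N) (obj Z l) A W g" if "linear_map (laurent R N) A W g" for l A W g
      unfolding oZ by (rule lifts_along_direct_sum[OF that fin])
        (rule ext.right_module_tens[OF mC], rule ext.tens_lifts_along[OF pC that])
  qed
  then show ?thesis using J exact qD qY unfolding L_def by blast
qed

end
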